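(* Let $X=\mathrm{Bl}_4(\mathbb{P}^2)$ be the quintic del Pezzo surface obtained by blowing up $\mathbb{P}^2$ at $4$ general points. Among all partitions of the $10$ exceptional curves ($(-1)$-curves) of $X$ into two disjoint sets $S$ and $S^c$, the largest possible number of pairwise intersections, i.e. the maximum over all such partitions of $\sum_{U\in S,\,V\in S^c}U\cdot V$, is equal to $12$.
   Context: $U\cdot V$ denotes the intersection number of two curves on the surface. The quantity is the maximum cut of the graph whose vertices are the $10$ exceptional curves, with the weight of the pair $\{U,V\}$ of distinct curves equal to $U\cdot V$. *)

theory Defs
  imports "HOL-Analysis.Analysis" "HOL-Computational_Algebra.Polynomial"
begin

section \<open>Subvarieties of products of projective spaces\<close>

text \<open>
  A matrix of type \<open>'k^'n^'i\<close> with nonzero rows is a system of multihomogeneous coordinates of a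
  point of the product, over the index type \<open>'i\<close>, of copies of the projective space
  of dimension \<open>CARD('n) - 1\<close>. The point itself is the set of all its coordinate systems.
\<close>

type_synonym ('k, 'n, 'i) mpoint = "('k^'n^'i) set"

definition row_scale :: "('i::finite \<Rightarrow> 'k::field) \<Rightarrow> 'k^'n^'i \<Rightarrow> 'k^'n^'i" where
  "row_scale c v = (\<chi> i. c i *s v $ i)"

definition proj_class :: "'k::field^'n^'i::finite \<Rightarrow> ('k, 'n, 'i) mpoint" where
  "proj_class v = {row_scale c v |c. \<forall>i. c i \<noteq> 0}"

definition multiproj :: "('k::field, 'n::finite, 'i::finite) mpoint set" where
  "multiproj = {proj_class v |v. \<forall>i. v $ i \<noteq> 0}"

definition rep :: "('k, 'n::finite, 'i::finite) mpoint \<Rightarrow> 'k^'n^'i" where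
  "rep y = (SOME v. v \<in> y)"

inductive poly_fun :: "('k::field^'n^'i \<Rightarrow> 'k) \<Rightarrow> bool" where
  const: "poly_fun (\<lambda>v. c)"
| coord: "poly_fun (\<lambda>v. v $ i $ j)"
| add: "poly_fun P \<Longrightarrow> poly_fun Q \<Longrightarrow> poly_fun (\<lambda>v. P v + Q v)"
| mult: "poly_fun P \<Longrightarrow> poly_fun Q \<Longrightarrow> poly_fun (\<lambda>v. P v * Q v)"

text \<open>
  Multihomogeneous polynomials. Over an infinite field a polynomial is determined by its
  function and is multihomogeneous iff that function is. Hence the vanishing of a form at a
  point, and the ratio of two forms of equal multidegree, do not depend on the choice
  made in \<open>rep\<close>.
\<close>

definition form :: "('i::finite \<Rightarrow> nat) \<Rightarrow> ('k::field^'n^'i \<Rightarrow> 'k) \<Rightarrow> bool" where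
  "form d P \<longleftrightarrow> poly_fun P \<and> (\<forall>c v. P (row_scale c v) = (\<Prod>i\<in>UNIV. c i ^ d i) * P v)"

definition ratio ::
  "('k::field^'n^'i \<Rightarrow> 'k) \<Rightarrow> ('k^'n^'i \<Rightarrow> 'k) \<Rightarrow> ('k, 'n, 'i) mpoint \<Rightarrow> 'k" where
  "ratio P Q y = P (rep y) / Q (rep y)"

definition zclosed :: "('k::field, 'n::finite, 'i::finite) mpoint set \<Rightarrow> ('k, 'n, 'i) mpoint set \<Rightarrow> bool" where
  "zclosed V Z \<longleftrightarrow>
     (\<exists>F. (\<forall>P\<in>F. \<exists>d. form d P) \<and> Z = {y \<in> V. \<forall>P\<in>F. P (rep y) = 0})"

definition irreducible_closed ::
  "('k::field, 'n::finite, 'i::finite) mpoint set \<Rightarrow> ('k, 'n, 'i) mpoint set \<Rightarrow> bool" where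
  "irreducible_closed V Z \<longleftrightarrow> zclosed V Z \<and> Z \<noteq> {} \<and>
     (\<forall>A B. zclosed V A \<and> zclosed V B \<and> Z = A \<union> B \<longrightarrow> Z = A \<or> Z = B)"

text \<open>Curves are the irreducible closed subsets of Krull dimension one.\<close>

definition curve_on ::
  "('k::field, 'n::finite, 'i::finite) mpoint set \<Rightarrow> ('k, 'n, 'i) mpoint set \<Rightarrow> bool" where
  "curve_on V C \<longleftrightarrow> irreducible_closed V C \<and>
     (\<exists>Z. irreducible_closed V Z \<and> Z \<subset> C) \<and>
     \<not> (\<exists>Z\<^sub>1 Z\<^sub>2. irreducible_closed V Z\<^sub>1 \<and> irreducible_closed V Z\<^sub>2 \<and> Z\<^sub>1 \<subset> Z\<^sub>2 \<and> Z\<^sub>2 \<subset> C)"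


section \<open>Regular functions and morphisms\<close>

text \<open>
  The principal open sets given by forms are a basis of the Zariski topology, so \<open>near V x R\<close> says
  that \<open>R\<close> holds on an open neighbourhood of \<open>x\<close> in \<open>V\<close>.
\<close>

definition near ::
  "('k::field, 'n::finite, 'i::finite) mpoint set \<Rightarrow> ('k, 'n, 'i) mpoint \<Rightarrow>
   (('k, 'n, 'i) mpoint \<Rightarrow> bool) \<Rightarrow> bool" where
  "near V x R \<longleftrightarrow>
     (\<exists>d Q. form d Q \<and> Q (rep x) \<noteq> 0 \<and> (\<forall>y\<in>V. Q (rep y) \<noteq> 0 \<longrightarrow> R y))"

text \<open>
  Elements of the local ring at \<open>x\<close> are represented by total functions, of which only the values
  near \<open>x\<close> matter. All ideals below are closed under changing a function away from a
  neighbourhood of \<open>x\<close>.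
\<close>

definition local_ring ::
  "('k::field, 'n::finite, 'i::finite) mpoint set \<Rightarrow> ('k, 'n, 'i) mpoint \<Rightarrow>
   (('k, 'n, 'i) mpoint \<Rightarrow> 'k) set" where
  "local_ring V x = {f. \<exists>d P Q. form d P \<and> form d Q \<and> Q (rep x) \<noteq> 0 \<and>
     (\<forall>y\<in>V. Q (rep y) \<noteq> 0 \<longrightarrow> f y = ratio P Q y)}"

text \<open>
  Continuity of a morphism follows from this condition: pull back the regular function \<open>ratio Q Q'\<close>
  for a form \<open>Q'\<close> of the same multidegree as \<open>Q\<close> that does not vanish at \<open>\<phi> x\<close>;
  as \<open>ratio Q Q'\<close> is \<open>0\<close> where \<open>Q'\<close> vanishes, it is nonzero only where \<open>Q\<close> is.
\<close>

definition morphism ::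
  "('k::field, 'n::finite, 'i::finite) mpoint set \<Rightarrow> ('k, 'm::finite, 'j::finite) mpoint set \<Rightarrow>
   (('k, 'n, 'i) mpoint \<Rightarrow> ('k, 'm, 'j) mpoint) \<Rightarrow> bool" where
  "morphism V W \<phi> \<longleftrightarrow> (\<forall>x\<in>V. \<phi> x \<in> W \<and> (\<forall>f\<in>local_ring W (\<phi> x). f \<circ> \<phi> \<in> local_ring V x))"

definition isomorphic_varieties ::
  "('k::field, 'n::finite, 'i::finite) mpoint set \<Rightarrow> ('k, 'm::finite, 'j::finite) mpoint set \<Rightarrow> bool" where
  "isomorphic_varieties V W \<longleftrightarrow> (\<exists>\<phi> \<psi>. morphism V W \<phi> \<and> morphism W V \<psi> \<and>
     (\<forall>x\<in>V. \<psi> (\<phi> x) = x) \<and> (\<forall>y\<in>W. \<phi> (\<psi> y) = y))"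

definition projective_line :: "('k::field, 2, 1) mpoint set" where
  "projective_line = multiproj"


section \<open>Intersection numbers of curves on a smooth surface\<close>

definition curve_ideal ::
  "('k::field, 'n::finite, 'i::finite) mpoint set \<Rightarrow> ('k, 'n, 'i) mpoint set \<Rightarrow> ('k, 'n, 'i) mpoint \<Rightarrow>
   (('k, 'n, 'i) mpoint \<Rightarrow> 'k) set" where
  "curve_ideal V C x = {f \<in> local_ring V x. near V x (\<lambda>y. y \<in> C \<longrightarrow> f y = 0)}"

text \<open>
  The dimension over \<open>'k\<close> of the quotient of the local ring by the ideal \<open>J\<close>, as the least size
  of a family spanning it; meaningful only when this dimension is finite.
\<close>

definition colength ::
  "('k::field, 'n::finite, 'i::finite) mpoint set \<Rightarrow> ('k, 'n, 'i) mpoint \<Rightarrow>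
   (('k, 'n, 'i) mpoint \<Rightarrow> 'k) set \<Rightarrow> nat" where
  "colength V x J = (LEAST n. \<exists>B. finite B \<and> card B = n \<and> B \<subseteq> local_ring V x \<and>
     (\<forall>f\<in>local_ring V x. \<exists>c. (\<lambda>y. f y - (\<Sum>b\<in>B. c b * b y)) \<in> J))"

text \<open>
  On a smooth surface the two ideals are generated by local equations \<open>f\<close> and \<open>g\<close> of the curves, so
  this is the usual multiplicity, the dimension of the local ring modulo \<open>(f, g)\<close>.
\<close>

definition local_intersection ::
  "('k::field, 'n::finite, 'i::finite) mpoint set \<Rightarrow> ('k, 'n, 'i) mpoint set \<Rightarrow> ('k, 'n, 'i) mpoint set \<Rightarrow>
   ('k, 'n, 'i) mpoint \<Rightarrow> nat" where
  "local_intersection V C D x =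
     colength V x {\<lambda>y. f y + g y |f g. f \<in> curve_ideal V C x \<and> g \<in> curve_ideal V D x}"

text \<open>The intersection number of two distinct curves.\<close>

definition intersection_number ::
  "('k::field, 'n::finite, 'i::finite) mpoint set \<Rightarrow> ('k, 'n, 'i) mpoint set \<Rightarrow> ('k, 'n, 'i) mpoint set \<Rightarrow>
   nat" where
  "intersection_number V C D = (\<Sum>x\<in>C \<inter> D. local_intersection V C D x)"

text \<open>
  The self-intersection number of \<open>C\<close> is the degree of its normal bundle, that is,
  minus the degree of the conormal bundle, whose sheaf of sections is \<open>I / I\<^sup>2\<close> with \<open>I\<close> the
  ideal sheaf of \<open>C\<close>. A rational function \<open>ratio P Q\<close> that is a local equation of \<open>C\<close> at some
  point of \<open>C\<close> is a nonzero rational section of it. If \<open>f\<close> is a local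
  equation of \<open>C\<close> at \<open>x\<close> and \<open>ratio P Q = f * a / b\<close> with \<open>a\<close>, \<open>b\<close> not identically zero on \<open>C\<close>, the
  order of this section at \<open>x\<close> is the order of \<open>a / b\<close> on \<open>C\<close>.
\<close>

definition local_equation ::
  "('k::field, 'n::finite, 'i::finite) mpoint set \<Rightarrow> ('k, 'n, 'i) mpoint set \<Rightarrow> ('k, 'n, 'i) mpoint \<Rightarrow>
   (('k, 'n, 'i) mpoint \<Rightarrow> 'k) \<Rightarrow> bool" where
  "local_equation V C x f \<longleftrightarrow> f \<in> curve_ideal V C x \<and>
     (\<forall>g\<in>curve_ideal V C x. \<exists>r\<in>local_ring V x. near V x (\<lambda>y. g y = r y * f y))"

definition order_on_curve ::
  "('k::field, 'n::finite, 'i::finite) mpoint set \<Rightarrow> ('k, 'n, 'i) mpoint set \<Rightarrow> ('k, 'n, 'i) mpoint \<Rightarrow>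
   (('k, 'n, 'i) mpoint \<Rightarrow> 'k) \<Rightarrow> nat" where
  "order_on_curve V C x a =
     colength V x {\<lambda>y. g y + r y * a y |g r. g \<in> curve_ideal V C x \<and> r \<in> local_ring V x}"

definition conormal_section ::
  "('k::field, 'n::finite, 'i::finite) mpoint set \<Rightarrow> ('k, 'n, 'i) mpoint set \<Rightarrow>
   ('k^'n^'i \<Rightarrow> 'k) \<Rightarrow> ('k^'n^'i \<Rightarrow> 'k) \<Rightarrow> bool" where
  "conormal_section V C P Q \<longleftrightarrow> (\<exists>d. form d P \<and> form d Q) \<and>
     (\<exists>x\<in>C. Q (rep x) \<noteq> 0 \<and> local_equation V C x (ratio P Q))"

definition conormal_order ::
  "('k::field, 'n::finite, 'i::finite) mpoint set \<Rightarrow> ('k, 'n, 'i) mpoint set \<Rightarrow>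
   ('k^'n^'i \<Rightarrow> 'k) \<Rightarrow> ('k^'n^'i \<Rightarrow> 'k) \<Rightarrow> ('k, 'n, 'i) mpoint \<Rightarrow> int \<Rightarrow> bool" where
  "conormal_order V C P Q x n \<longleftrightarrow>
     (\<exists>f a b. local_equation V C x f \<and>
        a \<in> local_ring V x - curve_ideal V C x \<and> b \<in> local_ring V x - curve_ideal V C x \<and>
        near V x (\<lambda>y. Q (rep y) \<noteq> 0 \<longrightarrow> ratio P Q y * b y = f y * a y) \<and>
        n = int (order_on_curve V C x a) - int (order_on_curve V C x b))"

definition has_self_intersection ::
  "('k::field, 'n::finite, 'i::finite) mpoint set \<Rightarrow> ('k, 'n, 'i) mpoint set \<Rightarrow> int \<Rightarrow> bool" where
  "has_self_intersection V C m \<longleftrightarrow>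
     (\<exists>P Q n. conormal_section V C P Q \<and> (\<forall>x\<in>C. conormal_order V C P Q x (n x)) \<and>
        finite {x \<in> C. n x \<noteq> 0} \<and> m = - (\<Sum>x | x \<in> C \<and> n x \<noteq> 0. n x))"

text \<open>Smooth rational curves of self-intersection \<open>-1\<close>.\<close>

definition exceptional_curves ::
  "('k::field, 'n::finite, 'i::finite) mpoint set \<Rightarrow> ('k, 'n, 'i) mpoint set set" where
  "exceptional_curves V =
     {C. curve_on V C \<and> isomorphic_varieties projective_line C \<and> has_self_intersection V C (- 1)}"


section \<open>The blow-up of the plane at four points\<close>

text \<open>Lines of the plane are given by their dual coordinates.\<close>

definition on_line :: "'k::field^3 \<Rightarrow> 'k^3 \<Rightarrow> bool" where
  "on_line l x \<longleftrightarrow> (\<Sum>j\<in>UNIV. l $ j * x $ j) = 0"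

text \<open>
  No three of the four points are collinear. This forces all \<open>p i\<close> to be nonzero
  and to represent distinct points of the plane.
\<close>

definition general_points :: "(4 \<Rightarrow> 'k::field^3) \<Rightarrow> bool" where
  "general_points p \<longleftrightarrow>
     (\<forall>i j k. i \<noteq> j \<and> i \<noteq> k \<and> j \<noteq> k \<longrightarrow>
        \<not> (\<exists>l. l \<noteq> 0 \<and> on_line l (p i) \<and> on_line l (p j) \<and> on_line l (p k)))"

text \<open>
  The blow-up of the plane at a point \<open>p\<close> is the incidence variety of pairs of a point \<open>x\<close> of the
  plane and a line \<open>l\<close> through \<open>p\<close> and \<open>x\<close>. For several distinct points it is the fibre product over
  the plane of these. Here row \<open>None\<close> is the point \<open>x\<close> and row \<open>Some i\<close> is the line
  through \<open>p i\<close>.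
\<close>

definition blowup4 :: "(4 \<Rightarrow> 'k::field^3) \<Rightarrow> ('k, 3, 4 option) mpoint set" where
  "blowup4 p = {proj_class v |v. (\<forall>i. v $ i \<noteq> 0) \<and>
     (\<forall>i. on_line (v $ Some i) (p i) \<and> on_line (v $ Some i) (v $ None))}"

definition cut_value :: 
  "('k::field, 'n::finite, 'i::finite) mpoint set \<Rightarrow> ('k, 'n, 'i) mpoint set set \<Rightarrow> nat" where
  "cut_value X S = (\<Sum>U\<in>S. \<Sum>V\<in>exceptional_curves X - S. intersection_number X U V)"

end

theory Submission
  imports Defs
begin

text \<open>
The ten exceptional curves are the curves \<open>Ecurve p c\<close> over the four points and the strict
transforms \<open>Lcurve p a b\<close> of the six lines through two of the points. The graph of their
intersections is the Petersen graph: \<open>Ecurve p c\<close> meets the three lines through \<open>p c\<close>, and two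
lines meet on the surface iff they have no blown-up point in common. The Petersen graph has 15 edges
and its largest cut has 12 of them: six of its cycles of length five cover every edge twice, and a
cut contains at most four edges of each, so twice its size is at most 24; the four curves
\<open>Ecurve p c\<close> against the six lines attain this bound.

The geometric part has two halves.

That the ten curves are exceptional, with these intersection numbers, is a computation in
coordinates. A point of the surface is a point of the plane with a line through it and \<open>p i\<close> for
every \<open>i\<close>, and near every point of the surface two of these four lines, moving in the pencils
through \<open>p a\<close> and \<open>p b\<close>, are a system of local coordinates (\<open>chart_exists\<close>,
\<open>local_expansion\<close>). Every one of the ten curves is a component of a degenerate fibre
\<open>Ecurve p c + Lcurve p a c\<close> of the projection to the pencil at \<open>p a\<close>. The equation of this
fibre is a section of the conormal bundle of each component, and it vanishes to first order
exactly at the point common to both; hence the self-intersection is \<open>-1\<close>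
(\<open>EL_equation\<close>, \<open>self_intersection_EL\<close>).

That there are no others is the adjunction formula together with the inequality of Bezout. Let \<open>C\<close>
be an exceptional curve that is not one of the ten. It is parametrized by polynomials \<open>X\<close> for the
point of the plane and \<open>L i\<close> for the four lines. Let \<open>d\<close> be the degree of the plane curve, and write
\<open>p i \<times> X = M i * L i\<close> (cross product), so that the degree \<open>m i\<close> of \<open>M i\<close> is the
multiplicity at \<open>p i\<close>. The order of a conormal section \<open>P / Q\<close> at a parameter \<open>t\<close> is the order
at \<open>t\<close> of \<open>N j * (\<Prod>i. M i) / (K j * Q)\<close>, where \<open>N\<close> is the gradient of \<open>P\<close> along the plane curve and \<open>K = X \<times> X'\<close> its tangent line
(\<open>local_order\<close>). Here \<open>K\<close> has degree \<open>2 * d - 2\<close>, and \<open>N\<close> has degree at most that of \<open>Q\<close> minus \<open>d\<close>,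
so the sum \<open>1\<close> of all orders is at most \<open>2 - 3 * d + (\<Sum>i. m i)\<close> (\<open>degree_inequality\<close>).
On the other hand a line through two of the points meets the curve in \<open>d\<close> points, whence
\<open>m a + m b \<le> d\<close> (\<open>pair_inequality\<close>). These inequalities are contradictory.
\<close>

section \<open>Forms and local rings\<close>

lemma poly_fun_cmult: "poly_fun P \<Longrightarrow> poly_fun (\<lambda>v. c * P v)"
  by (rule poly_fun.mult[OF poly_fun.const])

lemma poly_fun_uminus: "poly_fun P \<Longrightarrow> poly_fun (\<lambda>v. - P v)"
  using poly_fun_cmult[of P "-1"] by simp

lemma poly_fun_diff: "poly_fun P \<Longrightarrow> poly_fun Q \<Longrightarrow> poly_fun (\<lambda>v. P v - Q v)"
  using poly_fun.add[OF _ poly_fun_uminus, of P Q] by simp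

lemma poly_fun_sum: "(\<And>a. a \<in> A \<Longrightarrow> poly_fun (P a)) \<Longrightarrow> poly_fun (\<lambda>v. \<Sum>a\<in>A. P a v)"
  by (induction A rule: infinite_finite_induct) (auto intro: poly_fun.intros)

lemma poly_fun_prod: "(\<And>a. a \<in> A \<Longrightarrow> poly_fun (P a)) \<Longrightarrow> poly_fun (\<lambda>v. \<Prod>a\<in>A. P a v)"
  by (induction A rule: infinite_finite_induct) (auto intro: poly_fun.intros)

lemma poly_fun_power: "poly_fun P \<Longrightarrow> poly_fun (\<lambda>v. P v ^ n)"
  by (induction n) (auto intro: poly_fun.intros)

lemmas poly_fun_intros = poly_fun.intros poly_fun_uminus poly_fun_diff poly_fun_sum poly_fun_prod
  poly_fun_power

lemma poly_fun_compose:
  assumes "poly_fun P" "\<And>i j. poly_fun (\<lambda>z. F z $ i $ j)"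
  shows "poly_fun (\<lambda>z. P (F z))"
  using assms(1) by induction (auto intro: poly_fun_intros assms(2))

lemma row_scale_nth [simp]: "row_scale c v $ i = c i *s v $ i"
  by (simp add: row_scale_def)

lemma row_scale_row_scale: "row_scale c (row_scale d v) = row_scale (\<lambda>i. c i * d i) v"
  by (simp add: vec_eq_iff mult.assoc)

lemma row_scale_1 [simp]: "row_scale (\<lambda>i. 1) v = v"
  by (simp add: vec_eq_iff)

lemma proj_class_self: "v \<in> proj_class v"
  unfolding proj_class_def by (rule CollectI, rule exI[of _ "\<lambda>_. 1"]) simp

lemma proj_class_row_scale:
  assumes "\<forall>i. c i \<noteq> 0"
  shows "proj_class (row_scale c v) = proj_class v"
proof (intro equalityI subsetI)
  fix w assume "w \<in> proj_class (row_scale c v)"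
  then obtain d where "\<forall>i. d i \<noteq> 0" "w = row_scale d (row_scale c v)"
    by (auto simp: proj_class_def)
  then show "w \<in> proj_class v"
    using assms unfolding proj_class_def row_scale_row_scale
    by (intro CollectI exI[of _ "\<lambda>i. d i * c i"]) simp
next
  fix w assume "w \<in> proj_class v"
  then obtain d where "\<forall>i. d i \<noteq> 0" "w = row_scale d v"
    by (auto simp: proj_class_def)
  then show "w \<in> proj_class (row_scale c v)"
    using assms unfolding proj_class_def row_scale_row_scale
    by (intro CollectI exI[of _ "\<lambda>i. d i / c i"]) simp
qed

lemma proj_class_eq_iff:
  "proj_class v = proj_class w \<longleftrightarrow> (\<exists>c. (\<forall>i. c i \<noteq> 0) \<and> w = row_scale c v)"
proof
  assume "proj_class v = proj_class w"
  with proj_class_self[of w] have "w \<in> proj_class v" by simp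
  then show "\<exists>c. (\<forall>i. c i \<noteq> 0) \<and> w = row_scale c v" by (auto simp: proj_class_def)
qed (auto simp: proj_class_row_scale)

lemma rep_proj_class: "\<exists>c. (\<forall>i. c i \<noteq> 0) \<and> rep (proj_class v) = row_scale c v"
proof -
  have "rep (proj_class v) \<in> proj_class v"
    unfolding rep_def by (rule someI) (rule proj_class_self)
  then show ?thesis by (auto simp: proj_class_def)
qed

lemma proj_class_rep [simp]: "proj_class (rep (proj_class v)) = proj_class v"
  using rep_proj_class[of v] proj_class_row_scale by metis

lemma form_poly_fun: "form d P \<Longrightarrow> poly_fun P"
  by (simp add: form_def)

lemma form_scale: "form d P \<Longrightarrow> P (row_scale c v) = (\<Prod>i\<in>UNIV. c i ^ d i) * P v"
  by (simp add: form_def)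

lemma form_zero: "form d (\<lambda>v. 0)"
  by (auto simp: form_def intro: poly_fun.intros)

lemma form_const: "form (\<lambda>_. 0) (\<lambda>v. c)"
  by (auto simp: form_def intro: poly_fun.intros)

lemma form_mult: "form d P \<Longrightarrow> form e Q \<Longrightarrow> form (\<lambda>i. d i + e i) (\<lambda>v. P v * Q v)"
  by (auto simp: form_def power_add prod.distrib intro: poly_fun.intros)

lemma form_add: "form d P \<Longrightarrow> form d Q \<Longrightarrow> form d (\<lambda>v. P v + Q v)"
  by (auto simp: form_def algebra_simps intro: poly_fun.intros)

lemma form_cmult: "form d P \<Longrightarrow> form d (\<lambda>v. c * P v)"
  by (auto simp: form_def algebra_simps intro: poly_fun.intros)

lemma form_diff: "form d P \<Longrightarrow> form d Q \<Longrightarrow> form d (\<lambda>v. P v - Q v)"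
  by (auto simp: form_def algebra_simps intro: poly_fun_intros)

lemma form_sum: "(\<And>a. a \<in> A \<Longrightarrow> form d (P a)) \<Longrightarrow> form d (\<lambda>v. \<Sum>a\<in>A. P a v)"
  by (induction A rule: infinite_finite_induct) (auto intro: form_zero form_add)

lemma form_prod:
  "finite A \<Longrightarrow> (\<And>a. a \<in> A \<Longrightarrow> form (d a) (P a)) \<Longrightarrow>
    form (\<lambda>i. \<Sum>a\<in>A. d a i) (\<lambda>v. \<Prod>a\<in>A. P a v)"
  by (induction A rule: finite_induct) (auto intro: form_const form_mult)

lemma form_power: "form d P \<Longrightarrow> form (\<lambda>i. n * d i) (\<lambda>v. P v ^ n)"
  by (induction n) (auto intro: form_const form_mult)

text \<open>
The multidegree of a coordinate of row \<open>i\<close>.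
\<close>

definition rowdeg :: "'i \<Rightarrow> 'i \<Rightarrow> nat" where
  "rowdeg i = (\<lambda>k. if k = i then 1 else 0)"

lemma prod_rowdeg: "(\<Prod>k\<in>UNIV. c k ^ rowdeg i k) = (c (i::'i::finite) :: 'k::field)"
proof -
  have "(\<Prod>k\<in>UNIV. c k ^ rowdeg i k) = (\<Prod>k\<in>UNIV. if k = i then c k else 1)"
    by (rule prod.cong) (auto simp: rowdeg_def)
  then show ?thesis by simp
qed

lemma form_coord: "form (rowdeg i) (\<lambda>v. v $ i $ j)"
  by (auto simp: form_def prod_rowdeg intro: poly_fun.intros)

lemma form_rep_eq_0: "form d P \<Longrightarrow> P (rep (proj_class v)) = 0 \<longleftrightarrow> P v = 0"
  using rep_proj_class[of v] by (auto simp: form_scale)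

lemma form_scale_eq_0: "form d P \<Longrightarrow> \<forall>i. c i \<noteq> 0 \<Longrightarrow> P (row_scale c v) = 0 \<longleftrightarrow> P v = 0"
  by (auto simp: form_scale)

lemma ratio_proj_class:
  assumes "form d P" "form d Q"
  shows "ratio P Q (proj_class v) = P v / Q v"
proof -
  obtain c where c: "\<forall>i. c i \<noteq> 0" "rep (proj_class v) = row_scale c v"
    using rep_proj_class by blast
  show ?thesis
    unfolding ratio_def c(2) form_scale[OF assms(1)] form_scale[OF assms(2)] using c(1) by simp
qed

lemma near_form: "form d Q \<Longrightarrow> Q (rep x) \<noteq> 0 \<Longrightarrow> near V x (\<lambda>y. Q (rep y) \<noteq> 0)"
  unfolding near_def by blast

lemma near_mono: "near V x R \<Longrightarrow> (\<And>y. y \<in> V \<Longrightarrow> R y \<Longrightarrow> R' y) \<Longrightarrow> near V x R'"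
  unfolding near_def by blast

lemma near_conj:
  assumes "near V x R" "near V x R'"
  shows "near V x (\<lambda>y. R y \<and> R' y)"
proof -
  obtain d Q d' Q' where "form d Q" "Q (rep x) \<noteq> 0" "\<forall>y\<in>V. Q (rep y) \<noteq> 0 \<longrightarrow> R y"
    "form d' Q'" "Q' (rep x) \<noteq> 0" "\<forall>y\<in>V. Q' (rep y) \<noteq> 0 \<longrightarrow> R' y"
    using assms unfolding near_def by blast
  then show ?thesis unfolding near_def
    by (intro exI[of _ "\<lambda>i. d i + d' i"] exI[of _ "\<lambda>v. Q v * Q' v"]) (auto intro: form_mult)
qed

lemma near_True: "(\<And>y. y \<in> V \<Longrightarrow> R y) \<Longrightarrow> near V x R"
  unfolding near_def by (intro exI[of _ "\<lambda>_. 0"] exI[of _ "\<lambda>_. 1"]) (auto intro: form_const)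

lemma near_self: "near V x R \<Longrightarrow> x \<in> V \<Longrightarrow> R x"
  unfolding near_def by blast

lemma local_ring_iff:
  "f \<in> local_ring V x \<longleftrightarrow>
    (\<exists>d P Q. form d P \<and> form d Q \<and> Q (rep x) \<noteq> 0 \<and> near V x (\<lambda>y. f y = ratio P Q y))"
proof
  assume "f \<in> local_ring V x"
  then show "\<exists>d P Q. form d P \<and> form d Q \<and> Q (rep x) \<noteq> 0 \<and> near V x (\<lambda>y. f y = ratio P Q y)"
    unfolding local_ring_def near_def by blast
next
  assume "\<exists>d P Q. form d P \<and> form d Q \<and> Q (rep x) \<noteq> 0 \<and> near V x (\<lambda>y. f y = ratio P Q y)"
  then obtain d P Q e S where *: "form d P" "form d Q" "Q (rep x) \<noteq> 0"
    "form e S" "S (rep x) \<noteq> 0" "\<forall>y\<in>V. S (rep y) \<noteq> 0 \<longrightarrow> f y = ratio P Q y"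
    unfolding near_def by blast
  show "f \<in> local_ring V x"
    unfolding local_ring_def using *
    by (intro CollectI exI[of _ "\<lambda>i. d i + e i"] exI[of _ "\<lambda>v. P v * S v"] exI[of _ "\<lambda>v. Q v * S v"])
      (auto intro: form_mult simp: ratio_def)
qed

lemma local_ringE:
  assumes "f \<in> local_ring V x"
  obtains d P Q where "form d P" "form d Q" "Q (rep x) \<noteq> 0"
    "\<And>y. y \<in> V \<Longrightarrow> Q (rep y) \<noteq> 0 \<Longrightarrow> f y = ratio P Q y"
  using assms unfolding local_ring_def by blast

lemma local_ring_cong:
  assumes "f \<in> local_ring V x" "near V x (\<lambda>y. g y = f y)"
  shows "g \<in> local_ring V x"
proof -
  obtain d P Q where *: "form d P" "form d Q" "Q (rep x) \<noteq> 0" "near V x (\<lambda>y. f y = ratio P Q y)"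
    using assms(1) unfolding local_ring_iff by blast
  have "near V x (\<lambda>y. g y = ratio P Q y)"
    by (rule near_mono[OF near_conj[OF assms(2) *(4)]]) simp
  with * show ?thesis unfolding local_ring_iff by blast
qed

lemma local_ring_ratio:
  "form d P \<Longrightarrow> form d Q \<Longrightarrow> Q (rep x) \<noteq> 0 \<Longrightarrow> ratio P Q \<in> local_ring V x"
  unfolding local_ring_def by blast

lemma local_ring_const: "(\<lambda>y. c) \<in> local_ring V x"
  unfolding local_ring_def
  by (intro CollectI exI[of _ "\<lambda>_. 0"] exI[of _ "\<lambda>_. c"] exI[of _ "\<lambda>_. 1"])
    (auto intro: form_const simp: ratio_def)

lemma local_ring_add:
  assumes "f \<in> local_ring V x" "g \<in> local_ring V x"
  shows "(\<lambda>y. f y + g y) \<in> local_ring V x"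
proof -
  from assms obtain d P Q where 1: "form d P" "form d Q" "Q (rep x) \<noteq> 0"
    "\<And>y. y \<in> V \<Longrightarrow> Q (rep y) \<noteq> 0 \<Longrightarrow> f y = ratio P Q y" by (auto elim: local_ringE)
  from assms obtain e P' Q' where 2: "form e P'" "form e Q'" "Q' (rep x) \<noteq> 0"
    "\<And>y. y \<in> V \<Longrightarrow> Q' (rep y) \<noteq> 0 \<Longrightarrow> g y = ratio P' Q' y" by (auto elim: local_ringE)
  have *: "form (\<lambda>i. d i + e i) (\<lambda>v. P v * Q' v + P' v * Q v)"
    using form_add[OF form_mult[OF 1(1) 2(2)] form_mult[OF 1(2) 2(1)]] by (simp add: mult.commute)
  have "f y + g y = ratio (\<lambda>v. P v * Q' v + P' v * Q v) (\<lambda>v. Q v * Q' v) y"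
    if "y \<in> V" "Q (rep y) * Q' (rep y) \<noteq> 0" for y
    using that 1(4)[of y] 2(4)[of y] by (simp add: ratio_def add_frac_eq)
  moreover have "Q (rep x) * Q' (rep x) \<noteq> 0" using 1 2 by simp
  ultimately show ?thesis
    unfolding local_ring_def using * form_mult[OF 1(2) 2(2)] by blast
qed

lemma local_ring_mult:
  assumes "f \<in> local_ring V x" "g \<in> local_ring V x"
  shows "(\<lambda>y. f y * g y) \<in> local_ring V x"
proof -
  from assms obtain d P Q where 1: "form d P" "form d Q" "Q (rep x) \<noteq> 0"
    "\<And>y. y \<in> V \<Longrightarrow> Q (rep y) \<noteq> 0 \<Longrightarrow> f y = ratio P Q y" by (auto elim: local_ringE)
  from assms obtain e P' Q' where 2: "form e P'" "form e Q'" "Q' (rep x) \<noteq> 0"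
    "\<And>y. y \<in> V \<Longrightarrow> Q' (rep y) \<noteq> 0 \<Longrightarrow> g y = ratio P' Q' y" by (auto elim: local_ringE)
  show ?thesis
    unfolding local_ring_def using 1 2
    by (intro CollectI exI[of _ "\<lambda>i. d i + e i"] exI[of _ "\<lambda>v. P v * P' v"]
         exI[of _ "\<lambda>v. Q v * Q' v"])
      (auto intro: form_mult simp: ratio_def)
qed

lemma local_ring_uminus: "f \<in> local_ring V x \<Longrightarrow> (\<lambda>y. - f y) \<in> local_ring V x"
  using local_ring_mult[OF local_ring_const[of "-1"], of f V x] by simp

lemma local_ring_diff:
  "f \<in> local_ring V x \<Longrightarrow> g \<in> local_ring V x \<Longrightarrow> (\<lambda>y. f y - g y) \<in> local_ring V x"
  using local_ring_add[OF _ local_ring_uminus, of f V x g] by simp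

lemma local_ring_sum:
  "(\<And>a. a \<in> A \<Longrightarrow> f a \<in> local_ring V x) \<Longrightarrow> (\<lambda>y. \<Sum>a\<in>A. f a y) \<in> local_ring V x"
  by (induction A rule: infinite_finite_induct) (auto intro: local_ring_const local_ring_add)

lemma local_ring_power: "f \<in> local_ring V x \<Longrightarrow> (\<lambda>y. f y ^ n) \<in> local_ring V x"
  by (induction n) (auto intro: local_ring_const local_ring_mult)

lemma near_nonzero:
  assumes "f \<in> local_ring V x" "x \<in> V" "f x \<noteq> 0"
  shows "near V x (\<lambda>y. f y \<noteq> 0)"
proof -
  from assms obtain d P Q where 1: "form d P" "form d Q" "Q (rep x) \<noteq> 0"
    "\<And>y. y \<in> V \<Longrightarrow> Q (rep y) \<noteq> 0 \<Longrightarrow> f y = ratio P Q y" by (auto elim: local_ringE)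
  have "P (rep x) \<noteq> 0" using 1(4)[OF assms(2) 1(3)] assms(3) by (auto simp: ratio_def)
  then show ?thesis unfolding near_def using 1
    by (intro exI[of _ "\<lambda>i. d i + d i"] exI[of _ "\<lambda>v. P v * Q v"])
      (auto intro: form_mult simp: ratio_def)
qed

lemma local_ring_inverse:
  assumes "f \<in> local_ring V x" "x \<in> V" "f x \<noteq> 0"
  shows "(\<lambda>y. 1 / f y) \<in> local_ring V x"
proof -
  from assms obtain d P Q where 1: "form d P" "form d Q" "Q (rep x) \<noteq> 0"
    "\<And>y. y \<in> V \<Longrightarrow> Q (rep y) \<noteq> 0 \<Longrightarrow> f y = ratio P Q y" by (auto elim: local_ringE)
  have "P (rep x) \<noteq> 0" using 1(4)[OF assms(2) 1(3)] assms(3) by (auto simp: ratio_def)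
  then show ?thesis unfolding local_ring_def using 1
    by (intro CollectI exI[of _ "\<lambda>i. d i + d i"] exI[of _ "\<lambda>v. Q v * Q v"] exI[of _ "\<lambda>v. P v * Q v"])
      (auto intro: form_mult simp: ratio_def)
qed

lemma local_ring_divide:
  assumes "g \<in> local_ring V x" "f \<in> local_ring V x" "x \<in> V" "f x \<noteq> 0"
  shows "(\<lambda>y. g y / f y) \<in> local_ring V x"
  using local_ring_mult[OF assms(1) local_ring_inverse[OF assms(2-4)]] by simp

lemmas local_ring_intros = local_ring_const local_ring_add local_ring_mult local_ring_uminus
  local_ring_diff local_ring_sum local_ring_power

lemma local_ring_poly: "f \<in> local_ring V x \<Longrightarrow> (\<lambda>y. poly p (f y)) \<in> local_ring V x"
  by (induction p) (auto intro!: local_ring_intros)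

lemma local_ring_poly_fun:
  assumes "poly_fun F" "\<And>i j. c i j \<in> local_ring V x"
  shows "(\<lambda>y. F (\<chi> i j. c i j y)) \<in> local_ring V x"
  using assms(1) by induction (auto intro!: local_ring_intros assms(2))

text \<open>
A subvariety carries the quotients of the same forms, so its regular functions extend locally to
the surface. This turns the parameter of an embedded line into a function on the surface.
\<close>

lemma local_ring_extend:
  assumes "f \<in> local_ring C x"
  obtains g where "g \<in> local_ring V x" "near C x (\<lambda>y. g y = f y)"
proof -
  from assms obtain d P Q where 1: "form d P" "form d Q" "Q (rep x) \<noteq> 0"
    "\<And>y. y \<in> C \<Longrightarrow> Q (rep y) \<noteq> 0 \<Longrightarrow> f y = ratio P Q y" by (auto elim: local_ringE)
  show thesis
  proof (rule that[of "ratio P Q"])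
    show "ratio P Q \<in> local_ring V x" using 1 by (auto intro: local_ring_ratio)
    show "near C x (\<lambda>y. ratio P Q y = f y)"
      unfolding near_def using 1 by metis
  qed
qed

lemma curve_ideal_mult:
  assumes "f \<in> local_ring V x" "g \<in> curve_ideal V C x"
  shows "(\<lambda>y. f y * g y) \<in> curve_ideal V C x"
proof -
  have "near V x (\<lambda>y. y \<in> C \<longrightarrow> f y * g y = 0)"
    by (rule near_mono[of V x "\<lambda>y. y \<in> C \<longrightarrow> g y = 0"])
      (use assms in \<open>auto simp: curve_ideal_def\<close>)
  then show ?thesis using assms unfolding curve_ideal_def by (auto intro: local_ring_mult)
qed

lemma curve_ideal_cong:
  assumes "f \<in> curve_ideal V C x" "near V x (\<lambda>y. g y = f y)"
  shows "g \<in> curve_ideal V C x"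
proof -
  have "near V x (\<lambda>y. y \<in> C \<longrightarrow> g y = 0)"
    by (rule near_mono[OF near_conj[of V x "\<lambda>y. y \<in> C \<longrightarrow> f y = 0" "\<lambda>y. g y = f y"]])
      (use assms in \<open>auto simp: curve_ideal_def\<close>)
  then show ?thesis using assms unfolding curve_ideal_def by (auto intro: local_ring_cong)
qed

lemma curve_ideal_self: "f \<in> curve_ideal V C x \<Longrightarrow> x \<in> C \<Longrightarrow> C \<subseteq> V \<Longrightarrow> f x = 0"
  unfolding curve_ideal_def by (auto dest!: near_self)

section \<open>Polynomial paths, derivatives and germs\<close>

lemma infinite_alg_closed: "infinite (UNIV :: 'k::alg_closed_field set)"
proof
  assume fin: "finite (UNIV :: 'k set)"
  define p :: "'k poly" where "p = (\<Prod>a\<in>UNIV. [:- a, 1:])"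
  have root: "poly p a = 0" for a
    unfolding p_def poly_prod using fin by (auto simp: prod_zero_iff)
  have "degree p = (\<Sum>a\<in>(UNIV::'k set). 1)"
    unfolding p_def by (subst degree_prod_sum_eq) auto
  then have deg: "degree p > 0" using fin by (simp add: card_gt_0_iff)
  have "degree (p + 1) = degree p" using deg by (simp add: degree_add_eq_left)
  with deg obtain x where "poly (p + 1) x = 0"
    using alg_closed_imp_poly_has_root[of "p + 1"] by auto
  with root show False by simp
qed

lemma cofinite_ex:
  fixes P :: "'k::alg_closed_field \<Rightarrow> bool"
  assumes "\<forall>\<^sub>\<infinity>t. P t"
  shows "\<exists>t. P t"
proof (rule ccontr)
  assume "\<not> (\<exists>t. P t)"
  then have "{t. \<not> P t} = UNIV" by auto
  with assms infinite_alg_closed[where 'k='k] show False by (simp add: eventually_cofinite)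
qed

lemma poly_nonzero_cofinite: "(p::'k::idom poly) \<noteq> 0 \<Longrightarrow> \<forall>\<^sub>\<infinity>t. poly p t \<noteq> 0"
  using poly_roots_finite[of p] by (simp add: eventually_cofinite)

lemma poly_eqI_cofinite:
  fixes p q :: "'k::alg_closed_field poly"
  assumes "\<forall>\<^sub>\<infinity>t. poly p t = poly q t"
  shows "p = q"
proof (rule ccontr)
  assume "p \<noteq> q"
  then have "\<forall>\<^sub>\<infinity>t. poly (p - q) t \<noteq> 0" by (intro poly_nonzero_cofinite) simp
  with assms have "\<forall>\<^sub>\<infinity>t::'k. False" by eventually_elim simp
  then show False using cofinite_ex[of "\<lambda>_. False"] by blast
qed

lemma poly_eqI_all: "(\<And>t. poly p t = poly q t) \<Longrightarrow> p = (q :: 'k::alg_closed_field poly)"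
  by (rule poly_eqI_cofinite) simp

lemma cofinite_shift:
  fixes P :: "'k::field \<Rightarrow> bool"
  assumes "\<forall>\<^sub>\<infinity>t. P t"
  shows "\<forall>\<^sub>\<infinity>t. P (a + t)"
  using MOST_inj[OF assms, of "\<lambda>t. a + t"] by (simp add: inj_def)

definition cev :: "'k::comm_semiring_0 poly^'n^'i \<Rightarrow> 'k \<Rightarrow> 'k^'n^'i" where
  "cev c t = (\<chi> i j. poly (c $ i $ j) t)"

lemma cev_nth [simp]: "cev c t $ i $ j = poly (c $ i $ j) t"
  by (simp add: cev_def)

text \<open>
Composition of a polynomial function with a polynomial path. As the field is infinite, the
polynomial is determined by its values; \<open>poly_plift\<close> shows that it exists.
\<close>

definition plift :: "('k::alg_closed_field^'n^'i \<Rightarrow> 'k) \<Rightarrow> 'k poly^'n^'i \<Rightarrow> 'k poly" where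
  "plift P c = (THE p. \<forall>t. poly p t = P (cev c t))"

lemma plift_ex: "poly_fun P \<Longrightarrow> \<exists>p. \<forall>t. poly p t = P (cev c t)"
proof (induction rule: poly_fun.induct)
  case (const k) then show ?case by (intro exI[of _ "[:k:]"]) simp
next
  case (coord i j) then show ?case by (intro exI[of _ "c $ i $ j"]) simp
next
  case (add P Q)
  then obtain p q where "\<forall>t. poly p t = P (cev c t)" "\<forall>t. poly q t = Q (cev c t)" by blast
  then show ?case by (intro exI[of _ "p + q"]) simp
next
  case (mult P Q)
  then obtain p q where "\<forall>t. poly p t = P (cev c t)" "\<forall>t. poly q t = Q (cev c t)" by blast
  then show ?case by (intro exI[of _ "p * q"]) simp
qed

lemma poly_plift [simp]:
  assumes "poly_fun P"
  shows "poly (plift P c) t = P (cev c t)"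
proof -
  obtain p where p: "\<forall>t. poly p t = P (cev c t)" using plift_ex[OF assms] by blast
  have "\<exists>!p. \<forall>t. poly p t = P (cev c t)"
    by (rule ex1I[of _ p]) (use p in \<open>auto intro: poly_eqI_all\<close>)
  from theI'[OF this] show ?thesis unfolding plift_def by blast
qed

lemma plift_eqI: "poly_fun P \<Longrightarrow> \<forall>\<^sub>\<infinity>t. P (cev c t) = poly p t \<Longrightarrow> plift P c = p"
  by (rule poly_eqI_cofinite) simp

lemma plift_nonzero_cofinite:
  fixes P :: "'k::alg_closed_field^'n^'i \<Rightarrow> 'k"
  assumes "poly_fun P" "P (cev c t0) \<noteq> 0"
  shows "\<forall>\<^sub>\<infinity>t. P (cev c t) \<noteq> 0"
proof -
  have "poly (plift P c) t0 \<noteq> 0" using assms by simp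
  then have "plift P c \<noteq> 0" by (metis poly_0)
  from poly_nonzero_cofinite[OF this] show ?thesis using assms by simp
qed

lemma grad_ex:
  fixes P :: "'k::alg_closed_field^'n::finite^'i::finite \<Rightarrow> 'k"
  assumes "poly_fun P"
  shows "\<exists>g. (\<forall>i j. poly_fun (g i j)) \<and>
    (\<forall>c. pderiv (plift P c) = (\<Sum>i\<in>UNIV. \<Sum>j\<in>UNIV. plift (g i j) c * pderiv (c $ i $ j)))"
  using assms
proof (induction rule: poly_fun.induct)
  case (const k)
  have 1: "plift (\<lambda>v. k) c = [:k:]" for c :: "'k poly^'n^'i"
    by (rule plift_eqI) (auto intro: poly_fun.intros)
  have 2: "plift (\<lambda>v. 0) c = 0" for c :: "'k poly^'n^'i"
    by (rule plift_eqI) (auto intro: poly_fun.intros)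
  show ?case by (rule exI[of _ "\<lambda>i j v. 0"]) (auto simp: 1 2 pderiv_pCons intro: poly_fun.intros)
next
  case (coord i j)
  have 1: "plift (\<lambda>v. v $ i $ j) c = c $ i $ j" for c :: "'k poly^'n^'i"
    by (rule plift_eqI) (auto intro: poly_fun.intros)
  have 2: "plift (\<lambda>v. (if i' = i \<and> j' = j then 1 else 0)) c = (if i' = i \<and> j' = j then 1 else 0)"
    for c :: "'k poly^'n^'i" and i' j'
    by (rule plift_eqI) (auto intro: poly_fun.intros)
  have 3: "(\<Sum>i'\<in>UNIV. \<Sum>j'\<in>UNIV. (if i' = i \<and> j' = j then 1 else 0) * F i' j') = F i j"
    for F :: "'i \<Rightarrow> 'n \<Rightarrow> 'k poly"
  proof -
    have "(\<Sum>i'\<in>UNIV. \<Sum>j'\<in>UNIV. (if i' = i \<and> j' = j then 1 else 0) * F i' j')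
      = (\<Sum>i'\<in>UNIV. if i' = i then (\<Sum>j'\<in>UNIV. if j' = j then F i' j' else 0) else 0)"
      by (intro sum.cong refl) (simp add: if_distrib[of "\<lambda>x. x * _"] cong: if_cong)
    then show ?thesis by simp
  qed
  show ?case
    by (rule exI[of _ "\<lambda>i' j' v. if i' = i \<and> j' = j then 1 else 0"])
      (auto simp: 1 2 3 intro: poly_fun.intros)
next
  case (add P Q)
  then obtain g h where g: "\<forall>i j. poly_fun (g i j)"
    "\<forall>c. pderiv (plift P c) = (\<Sum>i\<in>UNIV. \<Sum>j\<in>UNIV. plift (g i j) c * pderiv (c $ i $ j))"
    and h: "\<forall>i j. poly_fun (h i j)"
    "\<forall>c. pderiv (plift Q c) = (\<Sum>i\<in>UNIV. \<Sum>j\<in>UNIV. plift (h i j) c * pderiv (c $ i $ j))"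
    by blast
  have 1: "plift (\<lambda>v. P v + Q v) c = plift P c + plift Q c" for c :: "'k poly^'n^'i"
    using add by (intro plift_eqI) (auto intro: poly_fun.intros)
  have 2: "plift (\<lambda>v. g i j v + h i j v) c = plift (g i j) c + plift (h i j) c"
    for i j and c :: "'k poly^'n^'i"
    using g h by (intro plift_eqI) (auto intro: poly_fun.intros)
  show ?case
    by (rule exI[of _ "\<lambda>i j v. g i j v + h i j v"])
      (use g h in \<open>auto simp: 1 2 pderiv_add sum.distrib ring_distribs intro: poly_fun.intros\<close>)
next
  case (mult P Q)
  then obtain g h where g: "\<forall>i j. poly_fun (g i j)"
    "\<forall>c. pderiv (plift P c) = (\<Sum>i\<in>UNIV. \<Sum>j\<in>UNIV. plift (g i j) c * pderiv (c $ i $ j))"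
    and h: "\<forall>i j. poly_fun (h i j)"
    "\<forall>c. pderiv (plift Q c) = (\<Sum>i\<in>UNIV. \<Sum>j\<in>UNIV. plift (h i j) c * pderiv (c $ i $ j))"
    by blast
  have 1: "plift (\<lambda>v. P v * Q v) c = plift P c * plift Q c" for c :: "'k poly^'n^'i"
    using mult by (intro plift_eqI) (auto intro: poly_fun.intros)
  have 3: "poly_fun (\<lambda>v. P v * h i j v + Q v * g i j v)" for i j
    using g(1) h(1) mult.hyps by (intro poly_fun.add poly_fun.mult) auto
  have 2: "plift (\<lambda>v. P v * h i j v + Q v * g i j v) c =
     plift P c * plift (h i j) c + plift Q c * plift (g i j) c"
    for i j and c :: "'k poly^'n^'i"
    by (rule plift_eqI[OF 3]) (use g(1) h(1) mult.hyps in simp)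
  show ?case
    by (rule exI[of _ "\<lambda>i j v. P v * h i j v + Q v * g i j v"])
      (use g(2) h(2) in \<open>auto simp: 1 2 3 pderiv_mult sum.distrib ring_distribs sum_distrib_left mult.assoc\<close>)
qed

text \<open>
Partial derivatives of a polynomial function. Only the function is given, not a polynomial, so they
are chosen among all families that satisfy the chain rule along every polynomial path.
\<close>

definition grad ::
  "('k::alg_closed_field^'n::finite^'i::finite \<Rightarrow> 'k) \<Rightarrow> 'i \<Rightarrow> 'n \<Rightarrow> 'k^'n^'i \<Rightarrow> 'k" where
  "grad P = (SOME g. (\<forall>i j. poly_fun (g i j)) \<and>
    (\<forall>c. pderiv (plift P c) = (\<Sum>i\<in>UNIV. \<Sum>j\<in>UNIV. plift (g i j) c * pderiv (c $ i $ j))))"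

lemma
  assumes "poly_fun P"
  shows grad_poly_fun: "poly_fun (grad P i j)"
    and pderiv_plift: "pderiv (plift P c) = (\<Sum>i\<in>UNIV. \<Sum>j\<in>UNIV. plift (grad P i j) c * pderiv (c $ i $ j))"
  using someI_ex[OF grad_ex[OF assms]] unfolding grad_def[symmetric] by blast+

definition dird :: "('k::alg_closed_field^'n::finite^'i::finite \<Rightarrow> 'k) \<Rightarrow> 'k^'n^'i \<Rightarrow> 'k^'n^'i \<Rightarrow> 'k" where
  "dird P v w = (\<Sum>i\<in>UNIV. \<Sum>j\<in>UNIV. grad P i j v * w $ i $ j)"

lemma poly_pderiv_plift:
  assumes "poly_fun P"
  shows "poly (pderiv (plift P c)) t = dird P (cev c t) (\<chi> i j. poly (pderiv (c $ i $ j)) t)"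
  unfolding pderiv_plift[OF assms] dird_def
  by (simp add: poly_sum grad_poly_fun[OF assms])

lemma dird_eqI:
  fixes P :: "'k::alg_closed_field^'n::finite^'i::finite \<Rightarrow> 'k"
  assumes "poly_fun P" "\<forall>\<^sub>\<infinity>t. P (\<chi> i j. v $ i $ j + t * w $ i $ j) = poly p t"
  shows "dird P v w = poly (pderiv p) 0"
proof -
  define c where "c = (\<chi> i j. [:v $ i $ j, w $ i $ j:])"
  have ev: "cev c t = (\<chi> i j. v $ i $ j + t * w $ i $ j)" for t
    by (simp add: c_def vec_eq_iff)
  have "plift P c = p" using assms by (intro plift_eqI) (simp_all add: ev)
  with poly_pderiv_plift[OF assms(1), of c 0] show ?thesis
    by (simp add: ev) (simp add: c_def pderiv_pCons)
qed

lemma dird_ex: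
  fixes P :: "'k::alg_closed_field^'n::finite^'i::finite \<Rightarrow> 'k"
  assumes "poly_fun P"
  obtains p where "\<And>t. P (\<chi> i j. v $ i $ j + t * w $ i $ j) = poly p t"
    "poly (pderiv p) 0 = dird P v w" "poly p 0 = P v"
proof -
  define c where "c = (\<chi> i j. [:v $ i $ j, w $ i $ j:])"
  have ev: "cev c t = (\<chi> i j. v $ i $ j + t * w $ i $ j)" for t
    by (simp add: c_def vec_eq_iff)
  have 1: "P (\<chi> i j. v $ i $ j + t * w $ i $ j) = poly (plift P c) t" for t
    using assms by (simp add: ev)
  moreover have "poly (plift P c) 0 = P v" unfolding 1[symmetric] by (rule arg_cong[of _ _ P]) (simp add: vec_eq_iff)
  ultimately show thesis using dird_eqI[OF assms, of v w "plift P c"] that by auto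
qed

lemma dird_mult:
  assumes "poly_fun P" "poly_fun Q"
  shows "dird (\<lambda>v. P v * Q v) v w = dird P v w * Q v + P v * dird Q v w"
proof -
  obtain p where p: "\<And>t. P (\<chi> i j. v $ i $ j + t * w $ i $ j) = poly p t"
    "poly (pderiv p) 0 = dird P v w" "poly p 0 = P v" using dird_ex[OF assms(1)] by blast
  obtain q where q: "\<And>t. Q (\<chi> i j. v $ i $ j + t * w $ i $ j) = poly q t"
    "poly (pderiv q) 0 = dird Q v w" "poly q 0 = Q v" using dird_ex[OF assms(2)] by blast
  have "dird (\<lambda>v. P v * Q v) v w = poly (pderiv (p * q)) 0"
    using assms by (intro dird_eqI) (auto intro: poly_fun.intros simp: p(1) q(1))
  then show ?thesis using p q by (simp add: pderiv_mult algebra_simps)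
qed

text \<open>
The factor in Euler's identity \<open>dird_row_scale\<close>: it is \<open>\<Sum>i. d i * a i\<close>, left as a derivative so
that no case distinction on exponents is needed.
\<close>

definition euler :: "('i::finite \<Rightarrow> nat) \<Rightarrow> ('i \<Rightarrow> 'k::alg_closed_field) \<Rightarrow> 'k" where
  "euler d a = poly (pderiv (\<Prod>i\<in>UNIV. [:1, a i:] ^ d i)) 0"

lemma dird_row_scale:
  assumes "form d P"
  shows "dird P v (row_scale a v) = euler d a * P v"
proof -
  have "P (\<chi> i j. v $ i $ j + t * row_scale a v $ i $ j)
    = poly (smult (P v) (\<Prod>i\<in>UNIV. [:1, a i:] ^ d i)) t" for t
  proof -
    have "(\<chi> i j. v $ i $ j + t * row_scale a v $ i $ j) = row_scale (\<lambda>i. 1 + t * a i) v"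
      by (simp add: vec_eq_iff algebra_simps)
    then show ?thesis using form_scale[OF assms] by (simp add: poly_prod)
  qed
  then have "dird P v (row_scale a v) = poly (pderiv (smult (P v) (\<Prod>i\<in>UNIV. [:1, a i:] ^ d i))) 0"
    by (intro dird_eqI form_poly_fun[OF assms]) simp
  then show ?thesis by (simp add: euler_def pderiv_smult)
qed

text \<open>
The Taylor series at \<open>0\<close> of a function along a one-parameter family \<open>y\<close>. The function is required to
be a quotient of polynomials in the parameter for almost all values only: functions in a
local ring are prescribed only near a point, and \<open>near\<close> becomes "for almost all parameters" along
a path (\<open>near_path\<close>).
\<close>

definition germ :: "('k::alg_closed_field \<Rightarrow> 'a) \<Rightarrow> ('a \<Rightarrow> 'k) \<Rightarrow> 'k fps \<Rightarrow> bool" where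
  "germ y f h \<longleftrightarrow> (\<exists>p q. poly q 0 \<noteq> 0 \<and> (\<forall>\<^sub>\<infinity>t. f (y t) * poly q t = poly p t) \<and>
     h * fps_of_poly q = fps_of_poly p)"

lemma germI:
  assumes "poly q 0 \<noteq> 0" "\<forall>\<^sub>\<infinity>t. f (y t) * poly q t = poly p t" "h * fps_of_poly q = fps_of_poly p"
  shows "germ y f h"
  using assms unfolding germ_def by blast

lemma fps_of_poly_nonzero: "poly q 0 \<noteq> 0 \<Longrightarrow> fps_of_poly q \<noteq> (0 :: 'k::field fps)"
  by (metis fps_of_poly_0 fps_of_poly_eq_iff poly_0)

lemma germ_unique:
  assumes "germ y f h" "germ y f h'"
  shows "h = h'"
proof -
  obtain p q where 1: "poly q 0 \<noteq> 0" "\<forall>\<^sub>\<infinity>t. f (y t) * poly q t = poly p t"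
    "h * fps_of_poly q = fps_of_poly p" using assms unfolding germ_def by blast
  obtain p' q' where 2: "poly q' 0 \<noteq> 0" "\<forall>\<^sub>\<infinity>t. f (y t) * poly q' t = poly p' t"
    "h' * fps_of_poly q' = fps_of_poly p'" using assms unfolding germ_def by blast
  have "\<forall>\<^sub>\<infinity>t. poly (p * q') t = poly (p' * q) t"
    using 1(2) 2(2)
  proof eventually_elim
    case (elim t)
    show ?case unfolding poly_mult elim[symmetric] by (simp add: mult_ac)
  qed
  then have "p * q' = p' * q" by (rule poly_eqI_cofinite)
  then have "fps_of_poly p * fps_of_poly q' = fps_of_poly p' * fps_of_poly q"
    by (simp flip: fps_of_poly_mult)
  then have "h * (fps_of_poly q * fps_of_poly q') = h' * (fps_of_poly q * fps_of_poly q')"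
    unfolding 1(3)[symmetric] 2(3)[symmetric] by (simp add: mult_ac)
  then show ?thesis using fps_of_poly_nonzero[OF 1(1)] fps_of_poly_nonzero[OF 2(1)] by simp
qed

lemma germ_cong: "germ y f h \<Longrightarrow> \<forall>\<^sub>\<infinity>t. g (y t) = f (y t) \<Longrightarrow> germ y g h"
  unfolding germ_def
proof (elim exE conjE)
  fix p q
  assume "\<forall>\<^sub>\<infinity>t. g (y t) = f (y t)" "poly q 0 \<noteq> 0" "\<forall>\<^sub>\<infinity>t. f (y t) * poly q t = poly p t"
    "h * fps_of_poly q = fps_of_poly p"
  moreover from this have "\<forall>\<^sub>\<infinity>t. g (y t) * poly q t = poly p t"
    by (auto elim: eventually_elim2)
  ultimately show "\<exists>p q. poly q 0 \<noteq> 0 \<and> (\<forall>\<^sub>\<infinity>t. g (y t) * poly q t = poly p t) \<and>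
    h * fps_of_poly q = fps_of_poly p" by blast
qed

lemma germ_poly_fun:
  assumes "\<forall>\<^sub>\<infinity>t. f (y t) = poly p t"
  shows "germ y f (fps_of_poly p)"
  by (rule germI[of 1 _ _ p]) (use assms in auto)

lemma germ_const: "germ y (\<lambda>_. c) (fps_const c)"
  using germ_poly_fun[of "\<lambda>_. c" y "[:c:]"] by (simp add: fps_of_poly_const)

lemma germ_mult:
  assumes "germ y f h" "germ y g k"
  shows "germ y (\<lambda>z. f z * g z) (h * k)"
proof -
  obtain p q where 1: "poly q 0 \<noteq> 0" "\<forall>\<^sub>\<infinity>t. f (y t) * poly q t = poly p t"
    "h * fps_of_poly q = fps_of_poly p" using assms unfolding germ_def by blast
  obtain p' q' where 2: "poly q' 0 \<noteq> 0" "\<forall>\<^sub>\<infinity>t. g (y t) * poly q' t = poly p' t"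
    "k * fps_of_poly q' = fps_of_poly p'" using assms unfolding germ_def by blast
  show ?thesis
  proof (rule germI[of "q * q'" _ _ "p * p'"])
    show "\<forall>\<^sub>\<infinity>t. f (y t) * g (y t) * poly (q * q') t = poly (p * p') t"
      using 1(2) 2(2)
    proof eventually_elim
      case (elim t)
      have "f (y t) * g (y t) * poly (q * q') t = (f (y t) * poly q t) * (g (y t) * poly q' t)"
        by simp
      then show ?case unfolding elim by simp
    qed
    show "h * k * fps_of_poly (q * q') = fps_of_poly (p * p')"
      unfolding fps_of_poly_mult 1(3)[symmetric] 2(3)[symmetric] by (simp add: mult_ac)
  qed (use 1 2 in auto)
qed

lemma germ_add:
  assumes "germ y f h" "germ y g k"
  shows "germ y (\<lambda>z. f z + g z) (h + k)"
proof -
  obtain p q where 1: "poly q 0 \<noteq> 0" "\<forall>\<^sub>\<infinity>t. f (y t) * poly q t = poly p t"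
    "h * fps_of_poly q = fps_of_poly p" using assms unfolding germ_def by blast
  obtain p' q' where 2: "poly q' 0 \<noteq> 0" "\<forall>\<^sub>\<infinity>t. g (y t) * poly q' t = poly p' t"
    "k * fps_of_poly q' = fps_of_poly p'" using assms unfolding germ_def by blast
  show ?thesis
  proof (rule germI[of "q * q'" _ _ "p * q' + p' * q"])
    show "\<forall>\<^sub>\<infinity>t. (f (y t) + g (y t)) * poly (q * q') t = poly (p * q' + p' * q) t"
      using 1(2) 2(2)
    proof eventually_elim
      case (elim t)
      have "(f (y t) + g (y t)) * poly (q * q') t
        = (f (y t) * poly q t) * poly q' t + (g (y t) * poly q' t) * poly q t"
        by (simp add: algebra_simps)
      then show ?case unfolding elim by simp
    qed
    show "(h + k) * fps_of_poly (q * q') = fps_of_poly (p * q' + p' * q)"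
      unfolding fps_of_poly_mult fps_of_poly_add 1(3)[symmetric] 2(3)[symmetric]
      by (simp add: algebra_simps)
  qed (use 1 2 in auto)
qed

lemma germ_diff: "germ y f h \<Longrightarrow> germ y g k \<Longrightarrow> germ y (\<lambda>z. f z - g z) (h - k)"
  using germ_add[of y f h "\<lambda>z. (-1) * g z" "fps_const (-1) * k"] germ_mult[OF germ_const[of y "-1"], of g k]
  by (simp flip: fps_const_neg)

lemma germ_sum:
  "(\<And>a. a \<in> A \<Longrightarrow> germ y (f a) (h a)) \<Longrightarrow> germ y (\<lambda>z. \<Sum>a\<in>A. f a z) (\<Sum>a\<in>A. h a)"
  by (induction A rule: infinite_finite_induct) (use germ_const[of y 0] in \<open>auto intro: germ_add\<close>)

lemma germ_poly:
  assumes "germ y f h"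
  shows "germ y (\<lambda>z. poly A (f z)) (poly (map_poly fps_const A) h)"
proof (induction A)
  case 0
  then show ?case using germ_const[of y 0] by simp
next
  case (pCons a A)
  then show ?case using germ_add[OF germ_const germ_mult[OF assms pCons.IH]]
    by (simp add: map_poly_pCons)
qed

lemma fps_nth_poly_0: "fps_nth (poly (map_poly fps_const A) h) 0 = poly A (fps_nth h 0)"
  by (induction A) (simp_all add: map_poly_pCons fps_mult_nth_0)

lemma fps_mult_nth_1': "fps_nth (f * g) (Suc 0) = fps_nth f 0 * fps_nth g (Suc 0) + fps_nth f (Suc 0) * fps_nth g 0"
  by (simp add: fps_mult_nth)

lemma fps_nth_poly_1:
  fixes h :: "'k::field fps"
  shows "fps_nth (poly (map_poly fps_const A) h) (Suc 0) = poly (pderiv A) (fps_nth h 0) * fps_nth h (Suc 0)"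
  by (induction A)
    (simp_all add: map_poly_pCons fps_mult_nth_1' fps_nth_poly_0 pderiv_pCons algebra_simps)

definition path_at :: "('k::alg_closed_field, 'n::finite, 'i::finite) mpoint set \<Rightarrow>
   ('k \<Rightarrow> ('k, 'n, 'i) mpoint) \<Rightarrow> ('k, 'n, 'i) mpoint \<Rightarrow> bool" where
  "path_at V y x \<longleftrightarrow> (\<exists>c. x = proj_class (cev c 0) \<and> (\<forall>\<^sub>\<infinity>t. y t = proj_class (cev c t)) \<and>
     (\<forall>\<^sub>\<infinity>t. y t \<in> V) \<and> x \<in> V)"

lemma near_path:
  assumes "near V x R" "path_at V y x"
  shows "\<forall>\<^sub>\<infinity>t. R (y t)"
proof -
  obtain c where c: "x = proj_class (cev c 0)" "\<forall>\<^sub>\<infinity>t. y t = proj_class (cev c t)"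
    "\<forall>\<^sub>\<infinity>t. y t \<in> V" using assms(2) unfolding path_at_def by blast
  obtain d Q where Q: "form d Q" "Q (rep x) \<noteq> 0" "\<forall>y\<in>V. Q (rep y) \<noteq> 0 \<longrightarrow> R y"
    using assms(1) unfolding near_def by blast
  have "Q (cev c 0) \<noteq> 0" using Q(2) unfolding c(1) by (simp add: form_rep_eq_0[OF Q(1)])
  then have "\<forall>\<^sub>\<infinity>t. Q (cev c t) \<noteq> 0" by (rule plift_nonzero_cofinite[OF form_poly_fun[OF Q(1)]])
  then show ?thesis using c(2,3)
    by eventually_elim (use Q(3) in \<open>auto simp: form_rep_eq_0[OF Q(1)]\<close>)
qed

lemma germ_local_ring:
  assumes "f \<in> local_ring V x" "path_at V y x"
  shows "\<exists>h. germ y f h \<and> fps_nth h 0 = f x"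
proof -
  obtain c where c: "x = proj_class (cev c 0)" "\<forall>\<^sub>\<infinity>t. y t = proj_class (cev c t)"
    "\<forall>\<^sub>\<infinity>t. y t \<in> V" "x \<in> V" using assms(2) unfolding path_at_def by blast
  obtain d P Q where 1: "form d P" "form d Q" "Q (rep x) \<noteq> 0"
    "\<And>y. y \<in> V \<Longrightarrow> Q (rep y) \<noteq> 0 \<Longrightarrow> f y = ratio P Q y" using assms(1) by (rule local_ringE) blast
  note pf = form_poly_fun[OF 1(1)] form_poly_fun[OF 1(2)]
  have Q0: "Q (cev c 0) \<noteq> 0" using 1(3) unfolding c(1) by (simp add: form_rep_eq_0[OF 1(2)])
  define h where "h = fps_of_poly (plift P c) * inverse (fps_of_poly (plift Q c))"
  have nz: "fps_nth (fps_of_poly (plift Q c)) 0 \<noteq> 0"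
    using Q0 pf by (simp flip: poly_0_coeff_0)
  have h: "h * fps_of_poly (plift Q c) = fps_of_poly (plift P c)"
    unfolding h_def using inverse_mult_eq_1[OF nz] by (simp add: mult.assoc)
  have "\<forall>\<^sub>\<infinity>t. Q (cev c t) \<noteq> 0" by (rule plift_nonzero_cofinite[OF pf(2) Q0])
  then have "\<forall>\<^sub>\<infinity>t. f (y t) * poly (plift Q c) t = poly (plift P c) t"
    using c(2,3)
  proof eventually_elim
    case (elim t)
    then have "f (y t) = ratio P Q (y t)" using 1(4)[of "y t"] by (simp add: form_rep_eq_0[OF 1(2)])
    with elim show ?case using pf by (simp add: ratio_proj_class[OF 1(1,2)])
  qed
  then have "germ y f h" using Q0 pf h by (intro germI) auto
  moreover have "fps_nth h 0 = f x"
  proof -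
    have "f x = ratio P Q x" using 1(3,4) c(4) by blast
    also have "\<dots> = P (cev c 0) / Q (cev c 0)" unfolding c(1) by (rule ratio_proj_class[OF 1(1,2)])
    finally have "f x * Q (cev c 0) = P (cev c 0)" using Q0 by simp
    moreover have "fps_nth h 0 * Q (cev c 0) = P (cev c 0)"
      using arg_cong[OF h, of "\<lambda>h. fps_nth h 0"] pf
      by (simp add: fps_mult_nth_0 flip: poly_0_coeff_0)
    ultimately show ?thesis using Q0 by (metis mult_right_cancel)
  qed
  ultimately show ?thesis by blast
qed

section \<open>The projective line and its morphisms\<close>

definition lin :: "'k::comm_semiring_0^'n^'i \<Rightarrow> 'k^'n^'i \<Rightarrow> 'k poly^'n^'i" where
  "lin a b = (\<chi> i j. [:a $ i $ j, b $ i $ j:])"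

definition pl :: "'k::semiring_0^'n^'i \<Rightarrow> 'k^'n^'i \<Rightarrow> 'k \<Rightarrow> 'k^'n^'i" where
  "pl a b t = (\<chi> i j. a $ i $ j + t * b $ i $ j)"

lemma cev_lin [simp]: "cev (lin a b) t = pl a b (t::'k::comm_ring_1)"
  by (simp add: vec_eq_iff lin_def pl_def)

lemma pl_0 [simp]: "pl a b (0::'k::comm_ring_1) = a"
  by (simp add: vec_eq_iff pl_def)

definition det2 :: "'k::comm_ring_1^2^1 \<Rightarrow> 'k^2^1 \<Rightarrow> 'k" where
  "det2 a b = a $ 1 $ 1 * b $ 1 $ 2 - a $ 1 $ 2 * b $ 1 $ 1"

lemma det2_swap: "det2 b a = - det2 a b"
  by (simp add: det2_def algebra_simps)

lemma form1_scale: "form d P \<Longrightarrow> P (row_scale (\<lambda>_. c) v) = c ^ d (1::1) * P v"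
  by (simp add: form_scale UNIV_1)

lemma fun_num1_eqI: "f (1::1) = g 1 \<Longrightarrow> f = g"
  by (rule ext) (metis num1_eq1)

lemma pl_combination:
  fixes a b z :: "'k::field^2^1"
  assumes "det2 a b \<noteq> 0"
  shows "z = (\<chi> i j. (det2 z b / det2 a b) * a $ i $ j + (det2 a z / det2 a b) * b $ i $ j)"
proof -
  have "z $ 1 $ j * det2 a b = det2 z b * a $ 1 $ j + det2 a z * b $ 1 $ j" for j
    using exhaust_2[of j] by (auto simp: det2_def algebra_simps)
  then have "z $ 1 $ j = (det2 z b / det2 a b) * a $ 1 $ j + (det2 a z / det2 a b) * b $ 1 $ j" for j
    using assms by (simp add: field_simps)
  then show ?thesis by (simp add: vec_eq_iff forall_1)
qed

lemma pl_scale: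
  assumes "det2 a b \<noteq> 0" "det2 z b \<noteq> (0::'k::field)"
  shows "z = row_scale (\<lambda>_. det2 z b / det2 a b) (pl a b (det2 a z / det2 z b))"
  by (subst (1) pl_combination[OF assms(1), of z])
    (use assms in \<open>simp add: vec_eq_iff pl_def field_simps\<close>)

lemma pl_scale_inf:
  assumes "det2 a b \<noteq> 0" "det2 z b = (0::'k::field)"
  shows "z = row_scale (\<lambda>_. det2 a z / det2 a b) b"
  by (subst (1) pl_combination[OF assms(1), of z]) (use assms in \<open>simp add: vec_eq_iff\<close>)

lemma pl_nonzero: "det2 a b \<noteq> 0 \<Longrightarrow> pl a b t $ 1 \<noteq> (0 :: 'k::field^2)"
proof
  assume "det2 a b \<noteq> 0" "pl a b t $ 1 = 0"
  then have "a $ 1 $ 1 + t * b $ 1 $ 1 = 0" "a $ 1 $ 2 + t * b $ 1 $ 2 = 0"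
    by (simp_all add: vec_eq_iff pl_def forall_2)
  then have "a $ 1 $ 1 = - t * b $ 1 $ 1" "a $ 1 $ 2 = - t * b $ 1 $ 2"
    by (simp_all add: eq_neg_iff_add_eq_0)
  with \<open>det2 a b \<noteq> 0\<close> show False by (simp add: det2_def)
qed

lemma det2_nonzero: "det2 a b \<noteq> (0::'k::field) \<Longrightarrow> a $ 1 \<noteq> 0 \<and> b $ 1 \<noteq> 0"
  by (auto simp: det2_def)

lemma P1_cases:
  fixes a b z :: "'k::field^2^1"
  assumes "det2 a b \<noteq> 0" "z $ 1 \<noteq> 0"
  shows "proj_class z = proj_class b \<or> (\<exists>t. proj_class z = proj_class (pl a b t))"
proof (cases "det2 z b = 0")
  case True
  note z = pl_scale_inf[OF assms(1) True]
  have "det2 a z / det2 a b \<noteq> 0"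
  proof
    assume "det2 a z / det2 a b = 0"
    with z have "z = row_scale (\<lambda>_. 0) b" by metis
    with assms(2) show False by (simp add: vec_eq_iff)
  qed
  then show ?thesis using z proj_class_row_scale by metis
next
  case False
  then show ?thesis
    using pl_scale[OF assms(1) False] assms(1) proj_class_row_scale[of "\<lambda>_. det2 z b / det2 a b"]
    by (metis divide_eq_0_iff)
qed

lemma ex_independent:
  fixes b :: "'k::field^2^1"
  assumes "b $ 1 \<noteq> 0"
  obtains a where "det2 a b \<noteq> 0"
proof (cases "b $ 1 $ 2 = 0")
  case False
  then show thesis using that[of "\<chi> i j. if j = 1 then 1 else 0"] by (simp add: det2_def)
next
  case True
  then have "b $ 1 $ 1 \<noteq> 0" using assms by (auto simp: vec_eq_iff forall_2)
  then show thesis using that[of "\<chi> i j. if j = 2 then 1 else 0"] by (simp add: det2_def)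
qed

lemma form_zero_line:
  fixes P :: "'k::alg_closed_field^2^1 \<Rightarrow> 'k"
  assumes P: "form d P" and ab: "det2 a b \<noteq> 0" and z0: "\<forall>\<^sub>\<infinity>t. P (pl a b t) = 0"
  shows "P z = 0"
proof -
  have line: "P (pl v w t) = 0" if "\<forall>\<^sub>\<infinity>t. P (pl v w t) = 0" for v w t
  proof -
    have "plift P (lin v w) = 0" by (rule plift_eqI) (use that form_poly_fun[OF P] in auto)
    then show ?thesis using poly_plift[OF form_poly_fun[OF P], of "lin v w" t] by simp
  qed
  have 1: "P w = 0" if "det2 w b \<noteq> 0" for w
    by (subst pl_scale[OF ab that], subst form1_scale[OF P]) (simp add: line[OF z0])
  show ?thesis
  proof (cases "det2 z b = 0")
    case True
    have "det2 (pl z a t) b = det2 z b + t * det2 a b" for t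
      by (simp add: det2_def pl_def algebra_simps)
    then have "P (pl z a t) = 0" if "t \<noteq> 0" for t using that True ab by (intro 1) simp
    then have "\<forall>\<^sub>\<infinity>t. P (pl z a t) = 0"
      by (intro eventually_mono[OF MOST_neq(1)[of 0]]) auto
    from line[OF this, of 0] show ?thesis by simp
  qed (rule 1)
qed

lemma coeff_eq_reverse:
  fixes p q :: "'k::alg_closed_field poly"
  assumes "\<And>t. t \<noteq> 0 \<Longrightarrow> poly p t = t ^ e * poly q (1 / t)"
  shows "coeff p j = (if j \<le> e then coeff q (e - j) else 0)"
proof -
  define n where "n = max e (degree q)"
  define r where "r = (\<Sum>k\<le>degree q. monom (coeff q k) (n - k))"
  have "poly (monom 1 (n - e) * p) t = poly r t" if "t \<noteq> 0" for t
  proof -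
    have "poly (monom 1 (n - e) * p) t = t ^ (n - e) * (t ^ e * poly q (1 / t))"
      using assms[OF that] by (simp add: poly_monom)
    also have "\<dots> = t ^ n * poly q (1 / t)"
      by (simp add: n_def flip: mult.assoc power_add)
    also have "\<dots> = (\<Sum>k\<le>degree q. t ^ n * (coeff q k * (1 / t) ^ k))"
      by (simp add: poly_altdef sum_distrib_left)
    also have "\<dots> = (\<Sum>k\<le>degree q. coeff q k * t ^ (n - k))"
    proof (rule sum.cong[OF refl])
      fix k assume "k \<in> {..degree q}"
      then have "n = (n - k) + k" by (simp add: n_def)
      then have "t ^ n = t ^ (n - k) * t ^ k" by (metis power_add)
      then show "t ^ n * (coeff q k * (1 / t) ^ k) = coeff q k * t ^ (n - k)"
        using that by (simp add: power_one_over field_simps)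
    qed
    finally show ?thesis by (simp add: r_def poly_sum poly_monom)
  qed
  then have "\<forall>\<^sub>\<infinity>t. poly (monom 1 (n - e) * p) t = poly r t"
    by (intro eventually_mono[OF MOST_neq(1)[of 0]]) auto
  then have r: "monom 1 (n - e) * p = r" by (rule poly_eqI_cofinite)
  have "coeff p j = coeff (monom 1 (n - e) * p) (j + (n - e))" by (simp add: coeff_monom_mult)
  also have "\<dots> = coeff r (j + (n - e))" unfolding r ..
  also have "\<dots> = (\<Sum>k\<le>degree q. if n - k = j + (n - e) then coeff q k else 0)"
    by (simp add: r_def coeff_sum)
  also have "\<dots> = (\<Sum>k\<le>degree q. if j \<le> e \<and> k = e - j then coeff q k else 0)"
    by (rule sum.cong) (auto simp: n_def)
  also have "\<dots> = (if j \<le> e then coeff q (e - j) else 0)"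
    by (auto simp: coeff_eq_0)
  finally show ?thesis .
qed

text \<open>
Exchanging the two base points of the affine parametrization replaces the parameter \<open>t\<close> by
\<open>1 / t\<close>, so the coefficients of a form of degree \<open>e\<close> are reversed. This moves the point at infinity to
the origin.
\<close>

lemma form_line_reverse:
  fixes P :: "'k::alg_closed_field^2^1 \<Rightarrow> 'k"
  assumes P: "form (\<lambda>_. e) P"
  shows "coeff (plift P (lin a b)) j = (if j \<le> e then coeff (plift P (lin b a)) (e - j) else 0)"
proof (rule coeff_eq_reverse)
  fix t :: 'k assume "t \<noteq> 0"
  then have "pl a b t = row_scale (\<lambda>_. t) (pl b a (1 / t))"
    by (simp add: vec_eq_iff pl_def field_simps)
  then show "poly (plift P (lin a b)) t = t ^ e * poly (plift P (lin b a)) (1 / t)"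
    using form_poly_fun[OF P] form1_scale[OF P] by simp
qed

lemma form_line_degree:
  fixes P :: "'k::alg_closed_field^2^1 \<Rightarrow> 'k"
  assumes P: "form (\<lambda>_. e) P"
  shows "degree (plift P (lin a b)) \<le> e" "coeff (plift P (lin a b)) e = P b"
  using form_line_reverse[OF P, of a b] poly_plift[OF form_poly_fun[OF P], of "lin b a" 0]
  by (auto intro!: degree_le simp: poly_0_coeff_0)

text \<open>
Homogenization to degree \<open>e\<close>.
\<close>

definition hom :: "nat \<Rightarrow> 'k::field poly \<Rightarrow> 'k^2^1 \<Rightarrow> 'k" where
  "hom e A z = (\<Sum>k\<le>e. coeff A k * (z $ 1 $ 1 ^ (e - k) * z $ 1 $ 2 ^ k))"

lemma form_hom: fixes A :: "'k::field poly" shows "form (\<lambda>_. e) (hom e A)"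
proof -
  have 1: "form (\<lambda>i. (e - k) * rowdeg (1::1) i + k * rowdeg (1::1) i)
      (\<lambda>z::'k^2^1. z $ 1 $ 1 ^ (e - k) * z $ 1 $ 2 ^ k)" for k
    by (intro form_mult form_power form_coord)
  have 2: "(\<lambda>i. (e - k) * rowdeg (1::1) i + k * rowdeg (1::1) i) = (\<lambda>_. e)" if "k \<le> e" for k
    using that by (intro fun_num1_eqI) (simp add: rowdeg_def)
  have "form (\<lambda>_. e) (\<lambda>z::'k^2^1. z $ 1 $ 1 ^ (e - k) * z $ 1 $ 2 ^ k)" if "k \<le> e" for k
    using 1[of k] unfolding 2[OF that] .
  then show ?thesis unfolding hom_def[abs_def] by (intro form_sum form_cmult) auto
qed

lemma hom_affine:
  assumes "degree A \<le> e" "z $ 1 $ 1 \<noteq> 0"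
  shows "hom e A z = z $ 1 $ 1 ^ e * poly A (z $ 1 $ 2 / z $ 1 $ 1)"
proof -
  have "poly A x = (\<Sum>k\<le>e. coeff A k * x ^ k)" for x
    unfolding poly_altdef
    by (rule sum.mono_neutral_left) (use assms(1) in \<open>auto simp: coeff_eq_0\<close>)
  then have "z $ 1 $ 1 ^ e * poly A (z $ 1 $ 2 / z $ 1 $ 1)
     = (\<Sum>k\<le>e. z $ 1 $ 1 ^ e * (coeff A k * (z $ 1 $ 2 / z $ 1 $ 1) ^ k))"
    by (simp add: sum_distrib_left)
  also have "\<dots> = hom e A z" unfolding hom_def
  proof (rule sum.cong[OF refl])
    fix k assume "k \<in> {..e}"
    then have "z $ 1 $ 1 ^ e = z $ 1 $ 1 ^ (e - k) * z $ 1 $ 1 ^ k" by (simp flip: power_add)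
    then show "z $ 1 $ 1 ^ e * (coeff A k * (z $ 1 $ 2 / z $ 1 $ 1) ^ k) =
      coeff A k * (z $ 1 $ 1 ^ (e - k) * z $ 1 $ 2 ^ k)"
      using assms(2) by (simp add: power_divide)
  qed
  finally show ?thesis by simp
qed

lemma hom_infinity:
  assumes "z $ 1 $ 1 = 0"
  shows "hom e A z = coeff A e * z $ 1 $ 2 ^ e"
proof -
  have "hom e A z = (\<Sum>k\<le>e. if k = e then coeff A e * z $ 1 $ 2 ^ e else 0)"
    unfolding hom_def using assms by (intro sum.cong) (auto simp: power_0_left)
  then show ?thesis by simp
qed

lemma remove_common_roots:
  fixes A :: "'n \<Rightarrow> 'k::alg_closed_field poly"
  assumes "A j0 \<noteq> 0"
  shows "\<exists>B A'. B \<noteq> 0 \<and> (\<forall>j. A j = B * A' j) \<and> \<not> (\<exists>t. \<forall>j. poly (A' j) t = 0)"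
  using assms
proof (induction "degree (A j0)" arbitrary: A rule: less_induct)
  case less
  show ?case
  proof (cases "\<exists>t. \<forall>j. poly (A j) t = 0")
    case False
    then show ?thesis by (intro exI[of _ 1] exI[of _ A]) auto
  next
    case True
    then obtain t where "\<forall>j. [:- t, 1:] dvd A j" by (auto simp: poly_eq_0_iff_dvd)
    then obtain A1 where A1: "\<And>j. A j = [:- t, 1:] * A1 j" unfolding dvd_def by metis
    then have nz: "A1 j0 \<noteq> 0" using less.prems by auto
    have "degree (A j0) = degree [:- t, 1:] + degree (A1 j0)"
      unfolding A1 by (rule degree_mult_eq) (use nz in auto)
    then have "degree (A1 j0) < degree (A j0)" by simp
    from less.hyps[of A1, OF this nz] obtain B A' where
      *: "B \<noteq> 0" "\<forall>j. A1 j = B * A' j" "\<not> (\<exists>t. \<forall>j. poly (A' j) t = 0)" by blast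
    have "\<forall>j. A j = ([:- t, 1:] * B) * A' j" unfolding A1 using *(2) by (simp only: mult.assoc) simp
    moreover have "[:- t, 1:] * B \<noteq> 0" using *(1) by (simp del: mult_pCons_left)
    ultimately show ?thesis using *(3) by blast
  qed
qed

lemma proportional:
  fixes a b :: "'n \<Rightarrow> 'k::field"
  assumes "\<And>j k. a j * b k = a k * b j" "a j0 \<noteq> 0" "b j1 \<noteq> 0"
  shows "\<exists>c. c \<noteq> 0 \<and> (\<forall>j. b j = c * a j)"
proof (intro exI conjI allI)
  have "a j0 * b j1 \<noteq> 0" using assms by simp
  then have "b j0 \<noteq> 0" using assms(1)[of j0 j1] by auto
  then show "b j0 / a j0 \<noteq> 0" using assms by simp
  show "b j = b j0 / a j0 * a j" for j using assms(1)[of j0 j] assms(2) by (simp add: field_simps)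
qed

text \<open>
Morphisms from the line into a product of projective spaces are given globally by forms: \<open>Y\<close> has
forms of degree \<open>\<delta> i\<close> as entries of row \<open>i\<close>, without common zero.
\<close>

definition lift_of ::
  "(('k::field, 2, 1) mpoint \<Rightarrow> ('k, 'n::finite, 'i::finite) mpoint) \<Rightarrow> ('k^2^1 \<Rightarrow> 'k^'n^'i) \<Rightarrow>
   ('i \<Rightarrow> nat) \<Rightarrow> bool" where
  "lift_of \<phi> Y \<delta> \<longleftrightarrow> (\<forall>i j. form (\<lambda>_. \<delta> i) (\<lambda>z. Y z $ i $ j)) \<and>
     (\<forall>z. z $ 1 \<noteq> 0 \<longrightarrow> (\<forall>i. Y z $ i \<noteq> 0) \<and> \<phi> (proj_class z) = proj_class (Y z))"

lemma projective_line_iff: "y \<in> projective_line \<longleftrightarrow> (\<exists>z. z $ 1 \<noteq> 0 \<and> y = proj_class z)"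
  by (auto simp: projective_line_def multiproj_def forall_1)

lemma rep_nonzero: "y \<in> multiproj \<Longrightarrow> rep y $ i \<noteq> 0"
proof -
  assume "y \<in> multiproj"
  then obtain v where v: "y = proj_class v" "\<forall>i. v $ i \<noteq> 0" by (auto simp: multiproj_def)
  obtain c where "\<forall>i. c i \<noteq> 0" "rep y = row_scale c v" using rep_proj_class[of v] v(1) by blast
  with v(2) show ?thesis by (simp add: vector_mul_eq_0)
qed

lemma proj_class_in_line: "z $ 1 \<noteq> 0 \<Longrightarrow> proj_class z \<in> projective_line"
  by (auto simp: projective_line_iff)

lemma morphism_in: "morphism V W \<phi> \<Longrightarrow> x \<in> V \<Longrightarrow> \<phi> x \<in> W"
  by (simp add: morphism_def)

lemma morphism_comp: "morphism V W \<phi> \<Longrightarrow> x \<in> V \<Longrightarrow> f \<in> local_ring W (\<phi> x) \<Longrightarrow> f \<circ> \<phi> \<in> local_ring V x"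
  by (simp add: morphism_def)

text \<open>
The pullbacks of coordinate quotients are regular at \<open>z0\<close>; clearing their denominators gives
forms that describe one row of the morphism near \<open>z0\<close>.
\<close>

lemma morphism_local_form:
  fixes \<phi> :: "('k::alg_closed_field, 2, 1) mpoint \<Rightarrow> ('k, 'n::finite, 'i::finite) mpoint"
  assumes mor: "morphism projective_line W \<phi>" and W: "W \<subseteq> multiproj" and z0: "z0 $ 1 \<noteq> 0"
  shows "\<exists>e R d S. (\<forall>j::'n. form (\<lambda>_. e) (R j)) \<and> form d S \<and> S z0 \<noteq> 0 \<and>
    (\<forall>z. z $ 1 \<noteq> 0 \<longrightarrow> S z \<noteq> 0 \<longrightarrow> (\<exists>c. c \<noteq> 0 \<and> (\<forall>j. rep (\<phi> (proj_class z)) $ i $ j = c * R j z)))"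
proof -
  have phiW: "\<phi> (proj_class z) \<in> W" if "z $ 1 \<noteq> 0" for z
    using morphism_in[OF mor proj_class_in_line[OF that]] .
  let ?x = "proj_class z0"
  have xP: "?x \<in> projective_line" using z0 projective_line_iff by blast
  have "rep (\<phi> ?x) $ i \<noteq> 0" using rep_nonzero phiW[OF z0] W by blast
  then obtain j0 where j0: "rep (\<phi> ?x) $ i $ j0 \<noteq> 0" by (auto simp: vec_eq_iff)
  define f :: "'n \<Rightarrow> ('k, 'n, 'i) mpoint \<Rightarrow> 'k"
    where "f j = ratio (\<lambda>v. v $ i $ j) (\<lambda>v. v $ i $ j0)" for j
  have "f j \<in> local_ring W (\<phi> ?x)" for j
    unfolding f_def by (rule local_ring_ratio[OF form_coord form_coord j0])
  then have "\<exists>d P Q. form d P \<and> form d Q \<and> Q (rep ?x) \<noteq> 0 \<and>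
      (\<forall>y\<in>projective_line. Q (rep y) \<noteq> 0 \<longrightarrow> (f j \<circ> \<phi>) y = ratio P Q y)" for j
    using morphism_comp[OF mor xP, of "f j"] unfolding local_ring_def[of projective_line] by blast
  then obtain d P Q where PQ: "\<And>j. form (d j) (P j)" "\<And>j. form (d j) (Q j)" "\<And>j. Q j (rep ?x) \<noteq> 0"
    "\<And>j y. y \<in> projective_line \<Longrightarrow> Q j (rep y) \<noteq> 0 \<Longrightarrow> f j (\<phi> y) = ratio (P j) (Q j) y"
    unfolding comp_def by metis
  have Q0: "Q j z0 \<noteq> 0" for j using PQ(3) by (simp add: form_rep_eq_0[OF PQ(2)])
  have fPQ: "f j (\<phi> (proj_class z)) = P j z / Q j z" if "z $ 1 \<noteq> 0" "Q j z \<noteq> 0" for j z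
    using PQ(4)[of "proj_class z" j] that
    by (auto simp: projective_line_iff form_rep_eq_0[OF PQ(2)] ratio_proj_class[OF PQ(1,2)])
  define R where "R j z = P j z * (\<Prod>k\<in>UNIV - {j}. Q k z)" for j z
  define S where "S z = P j0 z * (\<Prod>k\<in>UNIV. Q k z)" for z
  have "form (\<lambda>i. d j i + (\<Sum>k\<in>UNIV - {j}. d k i)) (R j)" for j
    unfolding R_def by (intro form_mult form_prod PQ) auto
  moreover have *: "(\<lambda>i. d j i + (\<Sum>k\<in>UNIV - {j}. d k i)) = (\<lambda>_. \<Sum>k\<in>UNIV. d k 1)" for j
    by (rule fun_num1_eqI) (simp add: sum.remove[of UNIV j])
  ultimately have formR: "form (\<lambda>_. \<Sum>k\<in>UNIV. d k 1) (R j)" for j using * by simp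
  have formS: "form (\<lambda>i. d j0 i + (\<Sum>k\<in>UNIV. d k i)) S"
    unfolding S_def by (intro form_mult form_prod PQ) auto
  have "f j0 (\<phi> ?x) = 1" using j0 by (simp add: f_def ratio_def)
  then have "P j0 z0 \<noteq> 0" using fPQ[OF z0 Q0, of j0] by auto
  then have S0: "S z0 \<noteq> 0" using Q0 by (simp add: S_def)
  have "\<exists>c. c \<noteq> 0 \<and> (\<forall>j. rep (\<phi> (proj_class z)) $ i $ j = c * R j z)" if z: "z $ 1 \<noteq> 0" "S z \<noteq> 0" for z
  proof -
    let ?v = "rep (\<phi> (proj_class z)) $ i"
    have Qz: "Q k z \<noteq> 0" for k using z(2) by (auto simp: S_def)
    have Pz: "P j0 z \<noteq> 0" using z(2) by (auto simp: S_def)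
    have f: "?v $ j / ?v $ j0 = P j z / Q j z" for j
      using fPQ[OF z(1) Qz, of j] by (simp add: f_def ratio_def)
    have v0: "?v $ j0 \<noteq> 0" using f[of j0] Pz Qz[of j0] by auto
    define c where "c = ?v $ j0 / (\<Prod>k\<in>UNIV. Q k z)"
    have "?v $ j = c * R j z" for j
    proof -
      have "(\<Prod>k\<in>UNIV. Q k z) = Q j z * (\<Prod>k\<in>UNIV - {j}. Q k z)"
        by (simp add: prod.remove[of UNIV j])
      moreover have "(\<Prod>k\<in>UNIV - {j}. Q k z) \<noteq> 0" using Qz by simp
      ultimately have "c * R j z = ?v $ j0 * (P j z / Q j z)"
        using Qz by (simp add: c_def R_def)
      also have "\<dots> = ?v $ j" unfolding f[symmetric] using v0 by simp
      finally show ?thesis by simp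
    qed
    moreover have "c \<noteq> 0" using v0 Qz by (simp add: c_def)
    ultimately show ?thesis by blast
  qed
  then show ?thesis using formR formS S0 by blast
qed

text \<open>
The forms found near one point of the line, divided by their common factor, have no common zero.
They describe the morphism everywhere, since two local descriptions are proportional at
almost all points and hence at all.
\<close>

lemma morphism_row_lift:
  fixes \<phi> :: "('k::alg_closed_field, 2, 1) mpoint \<Rightarrow> ('k, 'n::finite, 'i::finite) mpoint"
  assumes mor: "morphism projective_line W \<phi>" and W: "W \<subseteq> multiproj"
  shows "\<exists>e Y. (\<forall>j::'n. form (\<lambda>_. e) (Y j)) \<and>
    (\<forall>z. z $ 1 \<noteq> 0 \<longrightarrow> (\<exists>c. c \<noteq> 0 \<and> (\<forall>j. rep (\<phi> (proj_class z)) $ i $ j = c * Y j z)))"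
proof -
  define e1 :: "'k^2^1" where "e1 = (\<chi> i j. if j = 1 then 1 else 0)"
  define e2 :: "'k^2^1" where "e2 = (\<chi> i j. if j = 2 then 1 else 0)"
  have ind: "det2 e1 e2 \<noteq> 0" by (simp add: det2_def e1_def e2_def)
  have pl12: "pl e1 e2 t $ 1 $ 1 = 1" "pl e1 e2 t $ 1 $ 2 = t" for t
    by (simp_all add: pl_def e1_def e2_def)
  have nz: "\<exists>j. rep (\<phi> (proj_class z)) $ i $ j \<noteq> 0" if "z $ 1 \<noteq> 0" for z
  proof -
    have "\<phi> (proj_class z) \<in> multiproj"
      using morphism_in[OF mor proj_class_in_line[OF that]] W by blast
    from rep_nonzero[OF this] show ?thesis by (auto simp: vec_eq_iff)
  qed
  obtain e R d S where R: "\<forall>j::'n. form (\<lambda>_. e) (R j)" "form d S" "S e1 \<noteq> 0"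
    "\<And>z. z $ 1 \<noteq> 0 \<Longrightarrow> S z \<noteq> 0 \<Longrightarrow> (\<exists>c. c \<noteq> 0 \<and> (\<forall>j. rep (\<phi> (proj_class z)) $ i $ j = c * R j z))"
    using morphism_local_form[OF mor W, of e1 i] det2_nonzero[OF ind] by metis
  have "\<exists>j0. R j0 e1 \<noteq> 0" using R(3) R(4)[of e1] nz[of e1] det2_nonzero[OF ind] by auto
  then obtain j0 where j0: "R j0 e1 \<noteq> 0" ..
  define A where "A j = plift (R j) (lin e1 e2)" for j
  have evA: "poly (A j) t = R j (pl e1 e2 t)" for j t
    unfolding A_def using poly_plift[OF form_poly_fun[OF R(1)[rule_format]]] by simp
  have "A j0 \<noteq> 0" using evA[of j0 0] j0 by auto
  from remove_common_roots[of A, OF this] obtain B A' where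
    A': "B \<noteq> 0" "\<And>j. A j = B * A' j" "\<not> (\<exists>t. \<forall>j. poly (A' j) t = 0)" by blast
  define m where "m = Max (range (\<lambda>j. degree (A' j)))"
  have degm: "degree (A' j) \<le> m" for j unfolding m_def by (rule Max_ge) auto
  have "m \<in> range (\<lambda>j. degree (A' j))" unfolding m_def by (rule Max_in) auto
  then obtain j1 where j1: "degree (A' j1) = m" by auto
  have lead: "\<exists>j. coeff (A' j) m \<noteq> 0"
  proof (cases "A' j1 = 0")
    case True
    then have "m = 0" using j1 by simp
    moreover obtain j where "A' j \<noteq> 0" using A'(3) by force
    moreover have "degree (A' j) = 0" using degm[of j] \<open>m = 0\<close> by simp
    ultimately show ?thesis by (metis leading_coeff_0_iff)
  next
    case False
    then show ?thesis using j1 by (metis leading_coeff_0_iff)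
  qed
  define Y where "Y j = hom m (A' j)" for j
  have formY: "form (\<lambda>_. m) (Y j)" for j unfolding Y_def by (rule form_hom)
  have Yaff: "Y j (pl e1 e2 t) = poly (A' j) t" for j t
    using hom_affine[OF degm, of "pl e1 e2 t"] by (simp add: Y_def pl12)
  have Ynz: "\<exists>j. Y j z \<noteq> 0" if z: "z $ 1 \<noteq> 0" for z
  proof (cases "z $ 1 $ 1 = 0")
    case True
    then have "z $ 1 $ 2 \<noteq> 0" using z by (auto simp: vec_eq_iff forall_2)
    with lead True show ?thesis by (auto simp: Y_def hom_infinity)
  next
    case False
    with A'(3) show ?thesis by (auto simp: Y_def hom_affine[OF degm])
  qed
  have "S (cev (lin e1 e2) 0) \<noteq> 0" using R(3) by simp
  then have Scof: "\<forall>\<^sub>\<infinity>t. S (pl e1 e2 t) \<noteq> 0"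
    using plift_nonzero_cofinite[OF form_poly_fun[OF R(2)], of "lin e1 e2" 0] by simp
  have gen: "\<forall>\<^sub>\<infinity>t. \<exists>c. c \<noteq> 0 \<and> (\<forall>j. rep (\<phi> (proj_class (pl e1 e2 t))) $ i $ j = c * Y j (pl e1 e2 t))"
    using Scof poly_nonzero_cofinite[OF A'(1)]
  proof eventually_elim
    case (elim t)
    obtain c where c: "c \<noteq> 0" "\<And>j. rep (\<phi> (proj_class (pl e1 e2 t))) $ i $ j = c * R j (pl e1 e2 t)"
      using R(4)[OF pl_nonzero[OF ind] elim(1)] by blast
    have "R j (pl e1 e2 t) = poly B t * Y j (pl e1 e2 t)" for j
      by (simp add: Yaff A'(2) flip: evA)
    then show ?case using c elim(2) by (intro exI[of _ "c * poly B t"]) auto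
  qed
  have "\<exists>c. c \<noteq> 0 \<and> (\<forall>j. rep (\<phi> (proj_class z)) $ i $ j = c * Y j z)" if z: "z $ 1 \<noteq> 0" for z
  proof -
    obtain e' R' d' S' where R': "\<And>j::'n. form (\<lambda>_. e') (R' j)" "form d' S'" "S' z \<noteq> 0"
      "\<And>z. z $ 1 \<noteq> 0 \<Longrightarrow> S' z \<noteq> 0 \<Longrightarrow> (\<exists>c. c \<noteq> 0 \<and> (\<forall>j. rep (\<phi> (proj_class z)) $ i $ j = c * R' j z))"
      using morphism_local_form[OF mor W z, of i] by metis
    have "\<not> (\<forall>\<^sub>\<infinity>t. S' (pl e1 e2 t) = 0)" using form_zero_line[OF R'(2) ind] R'(3) by blast
    then obtain t1 where "S' (pl e1 e2 t1) \<noteq> 0" by (metis (mono_tags, lifting) always_eventually)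
    then have S'cof: "\<forall>\<^sub>\<infinity>t. S' (pl e1 e2 t) \<noteq> 0"
      using plift_nonzero_cofinite[OF form_poly_fun[OF R'(2)], of "lin e1 e2" t1] by simp
    have cross: "Y j z * R' k z - Y k z * R' j z = 0" for j k
    proof (rule form_zero_line[where P = "\<lambda>z. Y j z * R' k z - Y k z * R' j z", OF _ ind])
      show "form (\<lambda>i. m + e') (\<lambda>z. Y j z * R' k z - Y k z * R' j z)"
        by (intro form_diff form_mult formY R')
      show "\<forall>\<^sub>\<infinity>t. Y j (pl e1 e2 t) * R' k (pl e1 e2 t) - Y k (pl e1 e2 t) * R' j (pl e1 e2 t) = 0"
        using gen S'cof
      proof eventually_elim
        case (elim t)
        from elim(1) obtain c where
          c: "c \<noteq> 0" "\<And>j. rep (\<phi> (proj_class (pl e1 e2 t))) $ i $ j = c * Y j (pl e1 e2 t)" by blast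
        from R'(4)[OF pl_nonzero[OF ind] elim(2)] obtain c' where
          c': "c' \<noteq> 0" "\<And>j. rep (\<phi> (proj_class (pl e1 e2 t))) $ i $ j = c' * R' j (pl e1 e2 t)" by blast
        have "Y j (pl e1 e2 t) = c' / c * R' j (pl e1 e2 t)" for j
          using c c' by (metis nonzero_mult_div_cancel_left times_divide_eq_left)
        then show ?case by simp
      qed
    qed
    from R'(4)[OF z R'(3)] obtain c where
      c: "c \<noteq> 0" "\<And>j. rep (\<phi> (proj_class z)) $ i $ j = c * R' j z" by blast
    obtain k where k: "rep (\<phi> (proj_class z)) $ i $ k \<noteq> 0" using nz[OF z] by blast
    obtain l where l: "Y l z \<noteq> 0" using Ynz[OF z] by blast
    show ?thesis
    proof (rule proportional[of "\<lambda>j. Y j z" "\<lambda>j. rep (\<phi> (proj_class z)) $ i $ j" l k, OF _ l k])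
      show "Y j z * rep (\<phi> (proj_class z)) $ i $ k = Y k z * rep (\<phi> (proj_class z)) $ i $ j" for j k
        using cross[of j k] by (simp add: c(2) mult_ac)
    qed
  qed
  then show ?thesis using formY by blast
qed

lemma lift_ex:
  fixes \<phi> :: "('k::alg_closed_field, 2, 1) mpoint \<Rightarrow> ('k, 'n::finite, 'i::finite) mpoint"
  assumes mor: "morphism projective_line W \<phi>" and W: "W \<subseteq> multiproj"
  shows "\<exists>Y \<delta>. lift_of \<phi> Y \<delta>"
proof -
  from morphism_row_lift[OF mor W] obtain \<delta> Y where
    Y: "\<And>i j. form (\<lambda>_. \<delta> i) (Y i j)"
    "\<And>i z. z $ 1 \<noteq> 0 \<Longrightarrow> \<exists>c. c \<noteq> 0 \<and> (\<forall>j. rep (\<phi> (proj_class z)) $ i $ j = c * Y i j z)"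
    by metis
  have "lift_of \<phi> (\<lambda>z. \<chi> i j. Y i j z) \<delta>"
    unfolding lift_of_def
  proof (intro conjI allI impI)
    show "form (\<lambda>_. \<delta> i) (\<lambda>z. (\<chi> i j. Y i j z) $ i $ j)" for i j using Y(1) by simp
    fix z :: "'k^2^1" assume z: "z $ 1 \<noteq> 0"
    have ph: "\<phi> (proj_class z) \<in> multiproj"
      using morphism_in[OF mor proj_class_in_line[OF z]] W by blast
    from Y(2)[OF z] obtain c where c: "\<And>i. c i \<noteq> 0"
      "\<And>i j. rep (\<phi> (proj_class z)) $ i $ j = c i * Y i j z" by metis
    then have eq: "rep (\<phi> (proj_class z)) = row_scale c (\<chi> i j. Y i j z)"
      by (simp add: vec_eq_iff)
    from ph obtain w where w: "\<phi> (proj_class z) = proj_class w" by (auto simp: multiproj_def)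
    show "\<phi> (proj_class z) = proj_class (\<chi> i j. Y i j z)"
      using proj_class_row_scale[of c "\<chi> i j. Y i j z"] c(1) w proj_class_rep[of w] eq by metis
    show "(\<chi> i j. Y i j z) $ i \<noteq> 0" for i
      using rep_nonzero[OF ph, of i] unfolding eq by auto
  qed
  then show ?thesis by blast
qed

section \<open>Points and lines of the plane\<close>

definition crs :: "'k::comm_ring_1^3 \<Rightarrow> 'k^3 \<Rightarrow> 'k^3" where
  "crs a b = (\<chi> i. if i = 1 then a $ 2 * b $ 3 - a $ 3 * b $ 2
     else if i = 2 then a $ 3 * b $ 1 - a $ 1 * b $ 3 else a $ 1 * b $ 2 - a $ 2 * b $ 1)"

definition dot :: "'k::comm_ring_1^3 \<Rightarrow> 'k^3 \<Rightarrow> 'k" where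
  "dot a b = a $ 1 * b $ 1 + a $ 2 * b $ 2 + a $ 3 * b $ 3"

lemma crs_nth:
  "crs a b $ 1 = a $ 2 * b $ 3 - a $ 3 * b $ 2"
  "crs a b $ 2 = a $ 3 * b $ 1 - a $ 1 * b $ 3"
  "crs a b $ 3 = a $ 1 * b $ 2 - a $ 2 * b $ 1"
  by (simp_all add: crs_def)

lemma on_line_dot: "on_line l x \<longleftrightarrow> dot l x = 0"
  by (simp add: on_line_def dot_def sum_3)

lemma dot_commute: "dot a b = dot b a"
  by (simp add: dot_def mult.commute)

lemma dot_smult [simp]: "dot (c *s a) b = c * dot a b" "dot a (c *s b) = c * dot a b"
  by (simp_all add: dot_def algebra_simps)

lemma dot_zero [simp]: "dot 0 b = 0" "dot a 0 = 0"
  by (simp_all add: dot_def)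

lemma dot_add: "dot (a + b) c = dot a c + dot b c" "dot c (a + b) = dot c a + dot c b"
  by (simp_all add: dot_def algebra_simps)

lemma dot_diff: "dot (a - b) c = dot a c - dot b c" "dot c (a - b) = dot c a - dot c b"
  by (simp_all add: dot_def algebra_simps)

lemma crs_smult [simp]: "crs (c *s a) b = c *s crs a b" "crs a (c *s b) = c *s crs a b"
  by (simp_all add: vec_eq_iff forall_3 crs_nth algebra_simps)

lemma crs_zero [simp]: "crs 0 b = 0" "crs a 0 = 0"
  by (simp_all add: vec_eq_iff forall_3 crs_nth)

lemma crs_add: "crs (a + b) c = crs a c + crs b c" "crs c (a + b) = crs c a + crs c b"
  by (simp_all add: vec_eq_iff forall_3 crs_nth algebra_simps)

lemma crs_self [simp]: "crs a a = 0"
  by (simp add: vec_eq_iff forall_3 crs_nth)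

lemma crs_swap: "crs b a = - crs a b"
  by (simp add: vec_eq_iff forall_3 crs_nth)

lemma dot_crs [simp]: "dot (crs a b) a = 0" "dot (crs a b) b = 0" "dot a (crs a b) = 0" "dot b (crs a b) = 0"
  by (simp_all add: dot_def crs_nth algebra_simps)

lemma crs_crs: "crs p (crs l m) = dot p m *s l - dot p l *s m"
  by (simp add: vec_eq_iff forall_3 crs_nth dot_def algebra_simps)

lemma smult_eq_0 [simp]: "c *s v = (0::'k::field^'n) \<longleftrightarrow> c = 0 \<or> v = 0"
  by (auto simp: vec_eq_iff)

text \<open>
Two vectors with zero cross product represent the same point or line.
\<close>

lemma crs_eq_0:
  fixes a b :: "'k::field^3"
  assumes "crs a b = 0" "a \<noteq> 0"
  obtains c where "b = c *s a"
proof -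
  have e: "a $ 2 * b $ 3 = a $ 3 * b $ 2" "a $ 3 * b $ 1 = a $ 1 * b $ 3" "a $ 1 * b $ 2 = a $ 2 * b $ 1"
    using assms(1) by (simp_all add: vec_eq_iff forall_3 crs_nth)
  from assms(2) obtain k where k: "a $ k \<noteq> 0" by (auto simp: vec_eq_iff)
  have "b = (b $ k / a $ k) *s a"
    using exhaust_3[of k] k e by (auto simp: vec_eq_iff forall_3 field_simps)
  then show thesis by (rule that)
qed

text \<open>
Two lines through \<open>p\<close> meet in \<open>p\<close>, unless they are equal.
\<close>

lemma pencil:
  fixes l m p :: "'k::field^3"
  assumes "dot l p = 0" "dot m p = 0" "p \<noteq> 0"
  obtains c where "crs l m = c *s p"
proof -
  have "crs p (crs l m) = 0" using assms by (simp add: crs_crs dot_commute[of p])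
  then show thesis using crs_eq_0[OF _ assms(3)] that by blast
qed

definition det3 :: "'k::comm_ring_1^3 \<Rightarrow> 'k^3 \<Rightarrow> 'k^3 \<Rightarrow> 'k" where
  "det3 a b c = dot (crs a b) c"

lemma dot_crs_det: "dot (crs a b) c = det3 a b c" "dot a (crs b c) = det3 a b c"
  by (simp_all add: det3_def dot_def crs_nth algebra_simps)

lemma det3_perm: "det3 b a c = - det3 a b c" "det3 a c b = - det3 a b c" "det3 b c a = det3 a b c"
  by (simp_all add: det3_def dot_def crs_nth algebra_simps)

lemma cramer_line:
  assumes "dot l a = 0"
  shows "det3 a s q *s l = dot l q *s crs a s - dot l s *s crs a q"
proof -
  have "det3 a s q *s l = dot l q *s crs a s - dot l s *s crs a q + dot l a *s crs s q"
    by (simp add: vec_eq_iff forall_3 det3_def crs_nth dot_def algebra_simps)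
  then show ?thesis using assms by simp
qed

lemma det3_nonzero: "det3 a b c \<noteq> 0 \<Longrightarrow> a \<noteq> 0 \<and> b \<noteq> 0 \<and> c \<noteq> 0 \<and> crs a b \<noteq> 0 \<and> crs b c \<noteq> 0 \<and> crs a c \<noteq> 0"
  using dot_crs_det(1)[of a b c] dot_crs_det(2)[of a b c] dot_crs_det(1)[of a c b] det3_perm(2)[of a b c]
  by auto

lemma exists_nonzero_dot: "(l::'k::field^3) \<noteq> 0 \<Longrightarrow> \<exists>q. dot l q \<noteq> 0"
proof -
  assume "l \<noteq> 0"
  then obtain k where k: "l $ k \<noteq> 0" by (auto simp: vec_eq_iff)
  have "dot l (\<chi> i. if i = k then 1 else 0) = l $ k"
    using exhaust_3[of k] by (auto simp: dot_def)
  with k show ?thesis by metis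
qed

lemma exists_coords:
  fixes l a :: "'k::field^3"
  assumes "dot l a = 0" "l \<noteq> 0" "a \<noteq> 0"
  obtains s q where "dot l s = 0" "dot l q \<noteq> 0" "det3 a s q \<noteq> 0"
proof -
  obtain q where q: "dot l q \<noteq> 0" using exists_nonzero_dot[OF assms(2)] by blast
  obtain r where r: "dot a r \<noteq> 0" using exists_nonzero_dot[OF assms(3)] by blast
  define s where "s = crs l r"
  have "crs a s = dot a r *s l - dot a l *s r" by (simp add: s_def crs_crs)
  then have "crs a s = dot a r *s l" using assms(1) by (simp add: dot_commute)
  then have "det3 a s q \<noteq> 0" using q r by (simp add: det3_def)
  moreover have "dot l s = 0" by (simp add: s_def)
  ultimately show thesis using that q by blast
qed

lemma exists_perp: "\<exists>l. l \<noteq> 0 \<and> dot l a = 0 \<and> dot l b = (0::'k::field)"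
proof -
  have one: "\<exists>l. l \<noteq> 0 \<and> dot l a = 0" for a :: "'k^3"
  proof (cases "a = 0")
    case True
    then show ?thesis by (intro exI[of _ "\<chi> i. 1"]) (auto simp: vec_eq_iff dot_def)
  next
    case False
    have "\<exists>r. crs a r \<noteq> 0"
    proof (rule ccontr)
      assume "\<not> ?thesis"
      then have *: "crs a (\<chi> i. if i = k then 1 else 0) $ m = 0" for k m by simp
      have "a = 0" using *[of 2 3] *[of 3 1] *[of 1 2] *[of 1 3] *[of 2 1]
        by (simp add: vec_eq_iff forall_3 crs_nth)
      with False show False by simp
    qed
    then show ?thesis by (metis dot_crs(1))
  qed
  show ?thesis
  proof (cases "crs a b = 0")
    case False
    then show ?thesis by (metis dot_crs(1,2))
  next
    case True
    show ?thesis
    proof (cases "a = 0")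
      case True
      then show ?thesis using one[of b] by simp
    next
      case False
      then obtain c where "b = c *s a" using crs_eq_0[OF True] by blast
      then show ?thesis using one[of a] by auto
    qed
  qed
qed

lemma gp_det:
  fixes p :: "4 \<Rightarrow> 'k::field^3"
  assumes gp: "general_points p" and ijk: "i \<noteq> j" "i \<noteq> k" "j \<noteq> k"
  shows "det3 (p i) (p j) (p k) \<noteq> 0"
proof
  assume d: "det3 (p i) (p j) (p k) = 0"
  have no: "l = 0" if "dot l (p i) = 0" "dot l (p j) = 0" "dot l (p k) = 0" for l
    using gp ijk that unfolding general_points_def on_line_dot by blast
  have c: "crs (p i) (p j) = 0" using d by (intro no) (simp_all add: dot_crs_det)
  show False
  proof (cases "p i = 0")
    case False
    then obtain e where "p j = e *s p i" using crs_eq_0[OF c] by blast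
    then show False using exists_perp[of "p i" "p k"] no by auto
  next
    case True
    then show False using exists_perp[of "p j" "p k"] no by auto
  qed
qed

lemma exists_other_indices:
  fixes i :: 4
  obtains j k where "i \<noteq> j" "i \<noteq> k" "j \<noteq> k"
  using exhaust_4[of i]
proof (elim disjE)
  assume "i = 1" then show thesis by (intro that[of 2 3]) simp_all
next
  assume "i = 2" then show thesis by (intro that[of 1 3]) simp_all
next
  assume "i = 3" then show thesis by (intro that[of 1 2]) simp_all
next
  assume "i = 4" then show thesis by (intro that[of 1 2]) simp_all
qed

lemma gp_nonzero:
  assumes "general_points p"
  shows "p i \<noteq> (0::'k::field^3)"
proof -
  obtain j k where "i \<noteq> j" "i \<noteq> k" "j \<noteq> k" using exists_other_indices .
  from gp_det[OF assms this] show ?thesis using det3_nonzero by blast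
qed

section \<open>Charts of the blow-up given by two pencils of lines\<close>

lemma form_value:
  assumes "form d P" "form d Q" "y = proj_class v"
  shows "Q (rep y) = 0 \<longleftrightarrow> Q v = 0" "ratio P Q y = P v / Q v"
  unfolding assms(3) using form_rep_eq_0[OF assms(2)] ratio_proj_class[OF assms(1,2)] by blast+

text \<open>
The multihomogeneous coordinates of the points of the blow-up.
\<close>

definition cone :: "(4 \<Rightarrow> 'k::field^3) \<Rightarrow> 'k^3^(4 option) \<Rightarrow> bool" where
  "cone p v \<longleftrightarrow> (\<forall>i. v $ i \<noteq> 0) \<and>
     (\<forall>i. dot (v $ Some i) (p i) = 0 \<and> dot (v $ Some i) (v $ None) = 0)"

lemma blowup4_cone: "blowup4 p = {proj_class v |v. cone p v}"
  by (simp add: blowup4_def cone_def on_line_dot)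

lemma coneD:
  assumes "cone p v"
  shows "v $ i \<noteq> 0" "dot (v $ Some c) (p c) = 0" "dot (v $ Some c) (v $ None) = 0"
    "dot (p c) (v $ Some c) = 0" "dot (v $ None) (v $ Some c) = 0"
  using assms by (auto simp: cone_def dot_commute)

lemma cone_row_scale: "\<forall>i. c i \<noteq> 0 \<Longrightarrow> cone p v \<Longrightarrow> cone p (row_scale c v)"
  by (simp add: cone_def)

lemma blowup4I: "cone p v \<Longrightarrow> proj_class v \<in> blowup4 p"
  by (auto simp: blowup4_cone)

lemma cone_rep: "y \<in> blowup4 p \<Longrightarrow> cone p (rep y)"
  using rep_proj_class cone_row_scale unfolding blowup4_cone by (smt (verit) mem_Collect_eq)

lemma blowup4_rep: "y \<in> blowup4 p \<Longrightarrow> proj_class (rep y) = y"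
  unfolding blowup4_cone by auto

lemma blowup4_multiproj: "blowup4 p \<subseteq> multiproj"
  by (auto simp: blowup4_def multiproj_def)

text \<open>
The lines \<open>v $ Some a\<close> and \<open>v $ Some b\<close> are distinct, so they meet in the point \<open>v $ None\<close> alone;
this point is none of the other two \<open>p c\<close>, so it determines the other two lines as well. On this
open set the lines through \<open>p a\<close> and \<open>p b\<close> therefore determine the point of the blow-up, by \<open>Phi\<close>.
\<close>

definition chart :: "(4 \<Rightarrow> 'k::field^3) \<Rightarrow> 4 \<Rightarrow> 4 \<Rightarrow> 'k^3^(4 option) \<Rightarrow> bool" where
  "chart p a b v \<longleftrightarrow> a \<noteq> b \<and> crs (v $ Some a) (v $ Some b) \<noteq> 0 \<and>
     (\<forall>c. c \<noteq> a \<longrightarrow> c \<noteq> b \<longrightarrow> crs (p c) (v $ None) \<noteq> 0)"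

lemma chart_swap: "chart p a b v \<longleftrightarrow> chart p b a v"
  by (auto simp: chart_def crs_swap[of "v $ Some a" "v $ Some b"])

lemma chart_row_scale: "\<forall>i. c i \<noteq> 0 \<Longrightarrow> chart p a b (row_scale c v) \<longleftrightarrow> chart p a b v"
  by (auto simp: chart_def)

definition Phi :: "(4 \<Rightarrow> 'k::comm_ring_1^3) \<Rightarrow> 4 \<Rightarrow> 4 \<Rightarrow> 'k^3 \<Rightarrow> 'k^3 \<Rightarrow> 'k^3^(4 option)" where
  "Phi p a b l m = (\<chi> i. case i of None \<Rightarrow> crs l m
     | Some c \<Rightarrow> if c = a then l else if c = b then m else crs (p c) (crs l m))"

lemma Phi_nth [simp]:
  "Phi p a b l m $ None = crs l m"
  "Phi p a b l m $ Some a = l"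
  "a \<noteq> b \<Longrightarrow> Phi p a b l m $ Some b = m"
  "c \<noteq> a \<Longrightarrow> c \<noteq> b \<Longrightarrow> Phi p a b l m $ Some c = crs (p c) (crs l m)"
  by (simp_all add: Phi_def)

lemma cone_Phi:
  assumes "chart p a b (Phi p a b l m)" "dot l (p a) = 0" "dot m (p b) = 0"
  shows "cone p (Phi p a b l m)"
proof -
  have ab: "a \<noteq> b" and lm: "crs l m \<noteq> 0" and c: "\<And>c. c \<noteq> a \<Longrightarrow> c \<noteq> b \<Longrightarrow> crs (p c) (crs l m) \<noteq> 0"
    using assms(1) by (auto simp: chart_def)
  have nz: "l \<noteq> 0" "m \<noteq> 0" using lm by auto
  show ?thesis
    unfolding cone_def
  proof (intro conjI allI)
    show "Phi p a b l m $ i \<noteq> 0" for i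
      using ab lm c nz by (cases i) (auto simp: Phi_def)
    show "dot (Phi p a b l m $ Some i) (p i) = 0" "dot (Phi p a b l m $ Some i) (Phi p a b l m $ None) = 0" for i
      using assms(2,3) ab by (auto simp: Phi_def)
  qed
qed

lemma row_scale_eqI: "(\<And>i. \<exists>c. c \<noteq> 0 \<and> w $ i = c *s v $ i) \<Longrightarrow> proj_class v = proj_class w"
proof -
  assume "\<And>i. \<exists>c. c \<noteq> 0 \<and> w $ i = c *s v $ i"
  then obtain c where "\<forall>i. c i \<noteq> 0 \<and> w $ i = c i *s v $ i" by metis
  then show ?thesis unfolding proj_class_eq_iff by (intro exI[of _ c]) (simp add: vec_eq_iff)
qed

lemma chart_Phi:
  assumes v: "cone p v" and ch: "chart p a b v"
  shows "proj_class v = proj_class (Phi p a b (v $ Some a) (v $ Some b))"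
proof (rule row_scale_eqI)
  fix i
  let ?l = "v $ Some a" and ?m = "v $ Some b" and ?x = "v $ None"
  have ab: "a \<noteq> b" and lm: "crs ?l ?m \<noteq> 0" using ch by (auto simp: chart_def)
  obtain k where k: "crs ?l ?m = k *s ?x"
    using pencil[of ?l ?x ?m] coneD[OF v] by blast
  have k0: "k \<noteq> 0" using lm k by auto
  show "\<exists>c. c \<noteq> 0 \<and> Phi p a b ?l ?m $ i = c *s v $ i"
  proof (cases i)
    case None
    with k k0 show ?thesis by auto
  next
    case (Some c)
    show ?thesis
    proof (cases "c = a \<or> c = b")
      case True
      then show ?thesis using ab Some by (intro exI[of _ 1]) auto
    next
      case False
      obtain k' where k': "crs (p c) ?x = k' *s v $ Some c"
        using pencil[of "p c" "v $ Some c" ?x] coneD[OF v] by blast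
      have "crs (p c) ?x \<noteq> 0" using ch False by (auto simp: chart_def)
      then have "k' \<noteq> 0" using k' by auto
      then show ?thesis using Some False k k' k0
        by (intro exI[of _ "k * k'"]) (simp add: vector_smult_assoc)
    qed
  qed
qed

text \<open>
If the point of the plane is \<open>p c\<close>, take \<open>c\<close> as one index: the lines from the other points \<open>p i\<close>
to \<open>p c\<close> are pairwise distinct, so at most one of them is the given line through \<open>p c\<close>. If it is no
\<open>p i\<close>, the four lines cannot all coincide, as no line contains four of the points.
\<close>

lemma chart_exists:
  fixes p :: "4 \<Rightarrow> 'k::field^3"
  assumes gp: "general_points p" and v: "cone p v"
  obtains a b where "chart p a b v"
proof -
  let ?x = "v $ None"
  have par: "dot (v $ Some i) (p j) = 0" if "crs (v $ Some i) (v $ Some j) = 0" for i j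
  proof -
    have "crs (v $ Some j) (v $ Some i) = 0" by (subst crs_swap) (simp add: that)
    then obtain c where "v $ Some i = c *s v $ Some j"
      using crs_eq_0[OF _ coneD(1)[OF v]] by blast
    then show ?thesis using coneD(2)[OF v, of j] by simp
  qed
  have ex: "\<exists>b. b \<noteq> a \<and> crs (v $ Some a) (v $ Some b) \<noteq> 0" for a
  proof (rule ccontr)
    assume "\<not> ?thesis"
    then have d: "dot (v $ Some a) (p b) = 0" for b
      using par[of a b] coneD(2)[OF v] by (cases "b = a") auto
    obtain j k where jk: "a \<noteq> j" "a \<noteq> k" "j \<noteq> k" using exists_other_indices .
    have "det3 (p a) (p j) (p k) *s v $ Some a = 0"
      using cramer_line[of "v $ Some a" "p a" "p j" "p k"] d by simp
    then show False using gp_det[OF gp jk] coneD(1)[OF v] by auto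
  qed
  show thesis
  proof (cases "\<exists>c. crs (p c) ?x = 0")
    case False
    moreover obtain b where "b \<noteq> 1" "crs (v $ Some 1) (v $ Some b) \<noteq> 0" using ex[of 1] by blast
    ultimately show ?thesis by (intro that[of 1 b]) (auto simp: chart_def)
  next
    case True
    then obtain c where c: "crs (p c) ?x = 0" by blast
    obtain k where k: "?x = k *s p c" using crs_eq_0[OF c gp_nonzero[OF gp]] by blast
    have k0: "k \<noteq> 0" using k coneD(1)[OF v, of None] by auto
    have "crs (p i) ?x \<noteq> 0" if "i \<noteq> c" for i
    proof
      obtain j where j: "j \<noteq> i" "j \<noteq> c" using exists_other_indices[of i] by metis
      assume "crs (p i) ?x = 0"
      then have "crs (p i) (p c) = 0" using k k0 by simp
      then show False using gp_det[OF gp that j(1)[symmetric] j(2)[symmetric]] det3_nonzero by blast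
    qed
    moreover obtain b where "b \<noteq> c" "crs (v $ Some c) (v $ Some b) \<noteq> 0" using ex[of c] by blast
    ultimately show ?thesis by (intro that[of c b]) (auto simp: chart_def)
  qed
qed

lemma form_dot: "form (rowdeg i) (\<lambda>v. dot (v $ i) (s::'k::field^3))"
  unfolding dot_def
  using form_add[OF form_add[OF form_cmult[OF form_coord[of i 1], of "s $ 1"]
     form_cmult[OF form_coord[of i 2], of "s $ 2"]] form_cmult[OF form_coord[of i 3], of "s $ 3"]]
  by (simp add: mult.commute)

lemma form_crs_const: "form (rowdeg i) (\<lambda>v. crs a (v $ i) $ j)"
  using exhaust_3[of j] by (elim disjE) (simp_all add: crs_nth form_diff form_cmult form_coord)

lemma form_crs: "form (\<lambda>k. rowdeg i k + rowdeg i' k) (\<lambda>v. crs (v $ i) (v $ i') $ j)"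
  using exhaust_3[of j] by (elim disjE) (simp_all add: crs_nth form_diff form_mult form_coord)

lemma poly_fun_crs:
  assumes "\<And>j. poly_fun (\<lambda>z. F z $ j)" "\<And>j. poly_fun (\<lambda>z. G z $ j)"
  shows "poly_fun (\<lambda>z. crs (F z) (G z) $ j)"
  using exhaust_3[of j] by (elim disjE) (simp_all add: crs_nth poly_fun_diff poly_fun.mult assms)

lemma poly_fun_Phi:
  assumes "\<And>j. poly_fun (\<lambda>z. F z $ j)" "\<And>j. poly_fun (\<lambda>z. G z $ j)"
  shows "poly_fun (\<lambda>z. Phi p a b (F z) (G z) $ i $ j)"
proof (cases i)
  case None
  then show ?thesis using assms by (simp add: poly_fun_crs)
next
  case (Some c)
  have "poly_fun (\<lambda>z. crs (p c) (crs (F z) (G z)) $ j)"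
    by (intro poly_fun_crs assms poly_fun.const)
  then show ?thesis using assms Some by (cases "c = a"; cases "c = b") (simp_all add: Phi_def)
qed

lemma near_all: "finite A \<Longrightarrow> (\<And>c. c \<in> A \<Longrightarrow> near V x (R c)) \<Longrightarrow> near V x (\<lambda>y. \<forall>c\<in>A. R c y)"
proof (induction A rule: finite_induct)
  case empty
  then show ?case by (intro near_True) simp
next
  case (insert c A)
  show ?case
    by (rule near_mono[OF near_conj[of V x "R c" "\<lambda>y. \<forall>c\<in>A. R c y"]]) (use insert in auto)
qed

lemma near_chart:
  assumes "chart p a b (rep x)"
  shows "near V x (\<lambda>y. chart p a b (rep y))"
proof -
  have ab: "a \<noteq> b" and lm: "crs (rep x $ Some a) (rep x $ Some b) \<noteq> 0"
    and c: "\<And>c. c \<noteq> a \<Longrightarrow> c \<noteq> b \<Longrightarrow> crs (p c) (rep x $ None) \<noteq> 0"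
    using assms by (auto simp: chart_def)
  from lm obtain j where j: "crs (rep x $ Some a) (rep x $ Some b) $ j \<noteq> 0" by (auto simp: vec_eq_iff)
  have 1: "near V x (\<lambda>y. crs (rep y $ Some a) (rep y $ Some b) \<noteq> 0)"
    by (rule near_mono[OF near_form[OF form_crs j]]) auto
  have this': "near V x (\<lambda>y. \<forall>c\<in>UNIV - {a, b}. crs (p c) (rep y $ None) \<noteq> 0)"
  proof (rule near_all)
    fix c assume "c \<in> UNIV - {a, b}"
    then obtain j where j: "crs (p c) (rep x $ None) $ j \<noteq> 0" using c[of c] by (auto simp: vec_eq_iff)
    show "near V x (\<lambda>y. crs (p c) (rep y $ None) \<noteq> 0)"
      by (rule near_mono[OF near_form[OF form_crs_const j]]) auto
  qed simp
  show ?thesis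
    by (rule near_mono[OF near_conj[OF 1 this']]) (use ab in \<open>auto simp: chart_def\<close>)
qed

definition coord0 :: "2 \<Rightarrow> 'k::zero^2^1 \<Rightarrow> 'k^2^1" where
  "coord0 j z = (\<chi> i k. if k = j then 0 else z $ i $ k)"

lemma poly_fun_coord0: "poly_fun P \<Longrightarrow> poly_fun (\<lambda>z. P (coord0 j z))"
proof (rule poly_fun_compose)
  show "poly_fun (\<lambda>z. coord0 j z $ i $ k)" for i k
    by (cases "k = j") (simp_all add: coord0_def poly_fun.intros)
qed

text \<open>
Division by a coordinate with remainder in the other one: the source of all statements that an ideal
of the local ring is generated by the chart coordinates.
\<close>

lemma poly_fun_divide_coord:
  fixes A :: "'k::field^2^1 \<Rightarrow> 'k"
  assumes "poly_fun A"
  shows "\<exists>A1. poly_fun A1 \<and> (\<forall>z. A z = A (coord0 j z) + z $ 1 $ j * A1 z)"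
  using assms
proof (induction rule: poly_fun.induct)
  case (const c)
  show ?case by (rule exI[of _ "\<lambda>z. 0"]) (auto intro: poly_fun.intros)
next
  case (coord i k)
  have i: "i = 1" by (rule num1_eq1)
  show ?case unfolding i
    by (intro exI[of _ "\<lambda>z. if k = j then 1 else 0"]) (auto simp: coord0_def intro: poly_fun.const)
next
  case (add P Q)
  then obtain P1 Q1 where *: "poly_fun P1" "\<And>z. P z = P (coord0 j z) + z $ 1 $ j * P1 z"
     "poly_fun Q1" "\<And>z. Q z = Q (coord0 j z) + z $ 1 $ j * Q1 z" by blast
  show ?case
  proof (intro exI[of _ "\<lambda>z. P1 z + Q1 z"] conjI allI)
    show "P z + Q z = P (coord0 j z) + Q (coord0 j z) + z $ 1 $ j * (P1 z + Q1 z)" for z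
      by (subst *(2), subst *(4)) (simp add: algebra_simps)
  qed (intro poly_fun.intros *)
next
  case (mult P Q)
  then obtain P1 Q1 where *: "poly_fun P1" "\<And>z. P z = P (coord0 j z) + z $ 1 $ j * P1 z"
     "poly_fun Q1" "\<And>z. Q z = Q (coord0 j z) + z $ 1 $ j * Q1 z" by blast
  show ?case
  proof (intro exI[of _ "\<lambda>z. P (coord0 j z) * Q1 z + P1 z * Q (coord0 j z) + z $ 1 $ j * (P1 z * Q1 z)"]
      conjI allI)
    show "P z * Q z = P (coord0 j z) * Q (coord0 j z) + z $ 1 $ j *
      (P (coord0 j z) * Q1 z + P1 z * Q (coord0 j z) + z $ 1 $ j * (P1 z * Q1 z))" for z
      by (subst *(2), subst *(4)) (simp add: algebra_simps)
  qed (intro poly_fun.add poly_fun.mult poly_fun_coord0 poly_fun.coord * mult.hyps)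
qed

text \<open>
A chart centred at \<open>y0\<close>. The pencil at \<open>p a\<close> gets an affine coordinate \<open>u\<close> by evaluating a line at a
point \<open>s\<close> of the line belonging to \<open>y0\<close>, divided by its value at \<open>q\<close> off that line; similarly \<open>w\<close> for
the pencil at \<open>p b\<close>. Both vanish at \<open>y0\<close>, and \<open>l\<close>, \<open>m\<close> are the lines with given coordinates. The
freedom in choosing \<open>s\<close> is used below to make \<open>u\<close> vanish on prescribed curves.
\<close>

locale blowup_chart =
  fixes p :: "4 \<Rightarrow> 'k::alg_closed_field^3" and y0 :: "('k, 3, 4 option) mpoint"
    and a b :: 4 and s q s' q' :: "'k^3"
  assumes y0: "y0 \<in> blowup4 p" and ch: "chart p a b (rep y0)"
    and las: "dot (rep y0 $ Some a) s = 0" and laq: "dot (rep y0 $ Some a) q \<noteq> 0"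
    and da: "det3 (p a) s q \<noteq> 0"
    and lbs: "dot (rep y0 $ Some b) s' = 0" and lbq: "dot (rep y0 $ Some b) q' \<noteq> 0"
    and db: "det3 (p b) s' q' \<noteq> 0"
begin

abbreviation "X \<equiv> blowup4 p"

definition u :: "('k, 3, 4 option) mpoint \<Rightarrow> 'k" where
  "u = ratio (\<lambda>v. dot (v $ Some a) s) (\<lambda>v. dot (v $ Some a) q)"

definition w :: "('k, 3, 4 option) mpoint \<Rightarrow> 'k" where
  "w = ratio (\<lambda>v. dot (v $ Some b) s') (\<lambda>v. dot (v $ Some b) q')"

definition l :: "'k \<Rightarrow> 'k^3" where
  "l t = (1 / det3 (p a) s q) *s (crs (p a) s - t *s crs (p a) q)"

definition m :: "'k \<Rightarrow> 'k^3" where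
  "m t = (1 / det3 (p b) s' q') *s (crs (p b) s' - t *s crs (p b) q')"

definition pt :: "'k \<Rightarrow> 'k \<Rightarrow> 'k^3^(4 option)" where
  "pt x y = Phi p a b (l x) (m y)"

definition uw :: "('k, 3, 4 option) mpoint \<Rightarrow> 'k^2^1" where
  "uw y = (\<chi> i j. if j = 1 then u y else w y)"

lemma ab: "a \<noteq> b" using ch by (simp add: chart_def)

lemma u_local: "u \<in> local_ring X y0"
  unfolding u_def by (rule local_ring_ratio[OF form_dot form_dot laq])

lemma w_local: "w \<in> local_ring X y0"
  unfolding w_def by (rule local_ring_ratio[OF form_dot form_dot lbq])

lemma u0: "u y0 = 0" and w0: "w y0 = 0"
  by (simp_all add: u_def w_def ratio_def las lbs)

lemma l_dot: "dot (l t) (p a) = 0" "dot (l t) s = t" "dot (l t) q = 1"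
  using da det3_perm(2)[of "p a" s q] by (simp_all add: l_def dot_diff dot_crs_det field_simps)

lemma m_dot: "dot (m t) (p b) = 0" "dot (m t) s' = t" "dot (m t) q' = 1"
  using db det3_perm(2)[of "p b" s' q'] by (simp_all add: m_def dot_diff dot_crs_det field_simps)

lemma near_pt: "near X y0 (\<lambda>y. y = proj_class (pt (u y) (w y)))"
proof (rule near_mono[OF near_conj[OF near_chart[OF ch] near_conj[OF near_form[OF form_dot laq] near_form[OF form_dot lbq]]]])
  fix y assume y: "y \<in> X" and *: "chart p a b (rep y) \<and> dot (rep y $ Some a) q \<noteq> 0 \<and> dot (rep y $ Some b) q' \<noteq> 0"
  let ?v = "rep y"
  note cn = cone_rep[OF y]
  have la: "?v $ Some a = dot (?v $ Some a) q *s l (u y)"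
    using cramer_line[OF coneD(2)[OF cn, of a], of s q] da *
    by (simp add: l_def u_def ratio_def vec_eq_iff field_simps)
  have mb: "?v $ Some b = dot (?v $ Some b) q' *s m (w y)"
    using cramer_line[OF coneD(2)[OF cn, of b], of s' q'] db *
    by (simp add: m_def w_def ratio_def vec_eq_iff field_simps)
  have "y = proj_class (Phi p a b (?v $ Some a) (?v $ Some b))"
    using chart_Phi[OF cn] * blowup4_rep[OF y] by metis
  also have "\<dots> = proj_class (pt (u y) (w y))"
  proof (rule row_scale_eqI[symmetric])
    fix i
    define k where "k = dot (?v $ Some a) q"
    define k' where "k' = dot (?v $ Some b) q'"
    have kk: "k \<noteq> 0" "k' \<noteq> 0" using * by (auto simp: k_def k'_def)
    have "Phi p a b (k *s l (u y)) (k' *s m (w y)) $ i =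
      (case i of None \<Rightarrow> k * k' | Some c \<Rightarrow> if c = a then k else if c = b then k' else k * k') *s pt (u y) (w y) $ i"
      by (cases i) (auto simp: pt_def Phi_def vec_eq_iff)
    moreover have "Phi p a b (?v $ Some a) (?v $ Some b) = Phi p a b (k *s l (u y)) (k' *s m (w y))"
      using arg_cong2[OF la mb, of "Phi p a b"] unfolding k_def k'_def .
    moreover have "(case i of None \<Rightarrow> k * k' | Some c \<Rightarrow> if c = a then k else if c = b then k' else k * k') \<noteq> 0"
      using kk by (simp split: option.split)
    ultimately show "\<exists>c. c \<noteq> 0 \<and> Phi p a b (?v $ Some a) (?v $ Some b) $ i = c *s pt (u y) (w y) $ i"
      by auto
  qed
  finally show "y = proj_class (pt (u y) (w y))" .
qed

lemma y0_pt: "y0 = proj_class (pt 0 0)"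
  using near_self[OF near_pt y0] by (simp add: u0 w0)

lemma poly_fun_l: "poly_fun F \<Longrightarrow> poly_fun (\<lambda>z. l (F z) $ j)"
  unfolding l_def vector_smult_component vector_minus_component
  by (intro poly_fun_cmult poly_fun_diff poly_fun.const poly_fun.mult)

lemma poly_fun_m: "poly_fun F \<Longrightarrow> poly_fun (\<lambda>z. m (F z) $ j)"
  unfolding m_def vector_smult_component vector_minus_component
  by (intro poly_fun_cmult poly_fun_diff poly_fun.const poly_fun.mult)

lemma poly_fun_pt: "poly_fun F \<Longrightarrow> poly_fun G \<Longrightarrow> poly_fun (\<lambda>z. pt (F z) (G z) $ i $ j)"
  unfolding pt_def by (intro poly_fun_Phi poly_fun_l poly_fun_m)

lemma chart_pt0: "chart p a b (pt 0 0)"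
proof -
  obtain c where "\<forall>i. c i \<noteq> 0" "rep y0 = row_scale c (pt 0 0)"
    using rep_proj_class[of "pt 0 0"] y0_pt by auto
  then show ?thesis using ch chart_row_scale[of c p a b "pt 0 0"] by simp
qed

text \<open>
A regular function is a quotient of forms, and pulling the forms back by \<open>Phi\<close> makes it a
rational function of \<open>u\<close> and \<open>w\<close>. So the local ring is that of the affine plane at the origin.
\<close>

lemma local_expansion:
  assumes "f \<in> local_ring X y0"
  obtains A B where "poly_fun A" "poly_fun B" "B 0 \<noteq> 0"
    "near X y0 (\<lambda>y. f y = A (uw y) / B (uw y) \<and> B (uw y) \<noteq> 0)"
proof -
  from assms obtain d P Q where 1: "form d P" "form d Q" "Q (rep y0) \<noteq> 0"
    "\<And>y. y \<in> X \<Longrightarrow> Q (rep y) \<noteq> 0 \<Longrightarrow> f y = ratio P Q y" by (rule local_ringE) blast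
  define F where "F z = pt (z $ 1 $ 1) (z $ 1 $ 2)" for z :: "'k^2^1"
  have F: "F (uw y) = pt (u y) (w y)" for y by (simp add: F_def uw_def)
  have pf: "poly_fun (\<lambda>z. P (F z))" "poly_fun (\<lambda>z. Q (F z))"
    unfolding F_def by (intro poly_fun_compose[OF form_poly_fun[OF 1(1)]] poly_fun_compose[OF form_poly_fun[OF 1(2)]]
       poly_fun_pt poly_fun.coord)+
  have "Q (pt 0 0) \<noteq> 0" using 1(3) form_value(1)[OF 1(1,2) y0_pt] by simp
  moreover have "F 0 = pt 0 0" by (simp add: F_def)
  moreover have "near X y0 (\<lambda>y. f y = P (F (uw y)) / Q (F (uw y)) \<and> Q (F (uw y)) \<noteq> 0)"
  proof (rule near_mono[OF near_conj[OF near_pt near_form[OF 1(2,3)]]])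
    fix y assume y: "y \<in> X" "y = proj_class (pt (u y) (w y)) \<and> Q (rep y) \<noteq> 0"
    note yz = y(2)[THEN conjunct1]
    show "f y = P (F (uw y)) / Q (F (uw y)) \<and> Q (F (uw y)) \<noteq> 0"
      using 1(4)[OF y(1)] y(2) form_value[OF 1(1,2) yz] unfolding F by simp
  qed
  ultimately show thesis using that[OF pf] by simp
qed

lemma local_ring_uw:
  assumes "poly_fun A"
  shows "(\<lambda>y. A (uw y)) \<in> local_ring X y0"
proof -
  have "(\<lambda>y. A (\<chi> i j. (if j = 1 then u else w) y)) \<in> local_ring X y0"
    by (rule local_ring_poly_fun[OF assms]) (simp add: u_local w_local)
  moreover have "(\<chi> i j. (if j = 1 then u else w) y) = uw y" for y
    by (simp add: uw_def vec_eq_iff)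
  ultimately show ?thesis by simp
qed

lemma uw0: "uw y0 = 0"
  by (simp add: uw_def vec_eq_iff u0 w0)

text \<open>
The maximal ideal is generated by \<open>u\<close> and \<open>w\<close>.
\<close>

lemma vanishing_at_point:
  assumes f: "f \<in> local_ring X y0" "f y0 = 0"
  obtains r1 r2 where "r1 \<in> local_ring X y0" "r2 \<in> local_ring X y0"
    "near X y0 (\<lambda>y. f y = r1 y * u y + r2 y * w y)"
proof -
  obtain A B where AB: "poly_fun A" "poly_fun B" "B 0 \<noteq> 0"
    "near X y0 (\<lambda>y. f y = A (uw y) / B (uw y) \<and> B (uw y) \<noteq> 0)" using local_expansion[OF f(1)] .
  have A0: "A 0 = 0" using near_self[OF AB(4) y0] f(2) AB(3) by (simp add: uw0)
  obtain A1 where A1: "poly_fun A1" "\<And>z. A z = A (coord0 1 z) + z $ 1 $ 1 * A1 z"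
    using poly_fun_divide_coord[OF AB(1), of 1] by blast
  obtain A2 where A2: "poly_fun A2" "\<And>z. A z = A (coord0 2 z) + z $ 1 $ 2 * A2 z"
    using poly_fun_divide_coord[OF AB(1), of 2] by blast
  have "coord0 2 (coord0 1 z) = (0 :: 'k^2^1)" for z
    by (simp add: coord0_def vec_eq_iff forall_2)
  then have A: "A z = z $ 1 $ 1 * A1 z + z $ 1 $ 2 * A2 (coord0 1 z)" for z
    using A1(2)[of z] A2(2)[of "coord0 1 z"] A0 by (simp add: coord0_def)
  have B: "(\<lambda>y. 1 / B (uw y)) \<in> local_ring X y0"
    by (rule local_ring_inverse[OF local_ring_uw[OF AB(2)] y0]) (simp add: uw0 AB(3))
  show thesis
  proof (rule that[of "\<lambda>y. A1 (uw y) * (1 / B (uw y))" "\<lambda>y. A2 (coord0 1 (uw y)) * (1 / B (uw y))"])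
    show "near X y0 (\<lambda>y. f y = A1 (uw y) * (1 / B (uw y)) * u y + A2 (coord0 1 (uw y)) * (1 / B (uw y)) * w y)"
    proof (rule near_mono[OF AB(4)])
      fix y assume "f y = A (uw y) / B (uw y) \<and> B (uw y) \<noteq> 0"
      then show "f y = A1 (uw y) * (1 / B (uw y)) * u y + A2 (coord0 1 (uw y)) * (1 / B (uw y)) * w y"
        by (simp add: A[of "uw y"] field_simps) (simp add: uw_def)
    qed
  qed (intro local_ring_mult B local_ring_uw[OF A1(1)] local_ring_uw[OF poly_fun_coord0[OF A2(1)]])+
qed

lemma chart_cone_pt: "chart p a b (pt x y) \<Longrightarrow> cone p (pt x y)"
  unfolding pt_def by (rule cone_Phi) (simp_all add: l_dot m_dot)

lemma path_w: "path_at X (\<lambda>t. proj_class (pt 0 t)) y0"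
proof -
  define c where "c = (\<chi> i j. plift (\<lambda>z. pt 0 (z $ 1 $ 2) $ i $ j) (\<chi> i j. if j = (2::2) then [:0, 1:] else 0 :: 'k poly^2^1))"
  have pf: "poly_fun (\<lambda>z::'k^2^1. pt 0 (z $ 1 $ 2) $ i $ j)" for i j
    by (intro poly_fun_pt poly_fun.intros)
  have cev: "cev c t = pt 0 t" for t
    by (simp add: vec_eq_iff c_def poly_plift[OF pf])
  have chc: "\<forall>\<^sub>\<infinity>t. chart p a b (pt 0 t)"
  proof -
    have nz: "\<forall>\<^sub>\<infinity>t. F (cev c t) \<noteq> 0" if "form d F" "F (pt 0 0) \<noteq> 0" for d F
      by (rule plift_nonzero_cofinite[OF form_poly_fun[OF that(1)], of c 0]) (simp add: cev that)
    note ch0 = chart_pt0[unfolded chart_def]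
    from ch0 obtain j where "crs (pt 0 0 $ Some a) (pt 0 0 $ Some b) $ j \<noteq> 0" by (auto simp: vec_eq_iff)
    from nz[OF form_crs this] have 1: "\<forall>\<^sub>\<infinity>t. crs (pt 0 t $ Some a) (pt 0 t $ Some b) $ j \<noteq> 0"
      by (simp add: cev)
    have "\<forall>\<^sub>\<infinity>t. \<forall>c\<in>UNIV - {a, b}. crs (p c) (pt 0 t $ None) \<noteq> 0"
    proof (rule eventually_ball_finite, simp, rule ballI)
      fix c assume "c \<in> UNIV - {a, b}"
      then obtain j where "crs (p c) (pt 0 0 $ None) $ j \<noteq> 0" using ch0 by (auto simp: vec_eq_iff)
      from nz[OF form_crs_const this] show "\<forall>\<^sub>\<infinity>t. crs (p c) (pt 0 t $ None) \<noteq> 0"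
        by (auto simp: cev elim!: eventually_mono)
    qed
    with 1 show ?thesis by eventually_elim (use ab in \<open>auto simp: chart_def\<close>)
  qed
  show ?thesis
    unfolding path_at_def
  proof (intro exI[of _ c] conjI)
    show "\<forall>\<^sub>\<infinity>t. proj_class (pt 0 t) \<in> X"
      using chc by eventually_elim (intro blowup4I chart_cone_pt)
  qed (use y0 y0_pt in \<open>simp_all add: cev\<close>)
qed

lemma uw_pt: "u (proj_class (pt x y)) = x" "w (proj_class (pt x y)) = y"
  unfolding u_def w_def ratio_proj_class[OF form_dot form_dot]
  using ab by (simp_all add: pt_def l_dot m_dot)

text \<open>
The numerator, divided with remainder by \<open>u\<close>, leaves a polynomial in \<open>w\<close> alone. It vanishes on the
axis \<open>u = 0\<close> near \<open>y0\<close>, that is for almost all values of \<open>w\<close>, and hence identically.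
\<close>

lemma vanishing_on_curve:
  assumes C: "near X y0 (\<lambda>y. y \<in> C \<longleftrightarrow> u y = 0)" and f: "f \<in> curve_ideal X C y0"
  obtains r where "r \<in> local_ring X y0" "near X y0 (\<lambda>y. f y = r y * u y)"
proof -
  have fl: "f \<in> local_ring X y0" and f0: "near X y0 (\<lambda>y. y \<in> C \<longrightarrow> f y = 0)"
    using f by (auto simp: curve_ideal_def)
  obtain A B where AB: "poly_fun A" "poly_fun B" "B 0 \<noteq> 0"
    "near X y0 (\<lambda>y. f y = A (uw y) / B (uw y) \<and> B (uw y) \<noteq> 0)" using local_expansion[OF fl] .
  obtain A1 where A1: "poly_fun A1" "\<And>z. A z = A (coord0 1 z) + z $ 1 $ 1 * A1 z"
    using poly_fun_divide_coord[OF AB(1), of 1] by blast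
  define c where "c = (\<chi> i j. if j = (2::2) then [:0, 1:] else 0 :: 'k poly^2^1)"
  have ev: "\<forall>\<^sub>\<infinity>t. A (cev c t) = 0"
    using near_path[OF near_conj[OF near_conj[OF C f0] AB(4)] path_w]
  proof eventually_elim
    case (elim t)
    have e: "uw (proj_class (pt 0 t)) = cev c t"
      by (simp add: uw_def uw_pt vec_eq_iff c_def forall_2)
    have c: "proj_class (pt 0 t) \<in> C" using elim uw_pt(1)[of 0 t] by simp
    have "f (proj_class (pt 0 t)) = 0" using elim c by blast
    moreover have "f (proj_class (pt 0 t)) = A (cev c t) / B (cev c t)" "B (cev c t) \<noteq> 0"
      using elim unfolding e by simp_all
    ultimately show ?case by simp
  qed
  have "plift A c = 0" by (rule plift_eqI[OF AB(1)]) (use ev in simp)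
  then have A0: "A (cev c t) = 0" for t using poly_plift[OF AB(1), of c t] by simp
  have "coord0 1 z = cev c (z $ 1 $ 2)" for z
    by (simp add: coord0_def c_def vec_eq_iff forall_2 forall_1)
  then have A: "A z = z $ 1 $ 1 * A1 z" for z using A1(2)[of z] A0 by simp
  have B: "(\<lambda>y. 1 / B (uw y)) \<in> local_ring X y0"
    by (rule local_ring_inverse[OF local_ring_uw[OF AB(2)] y0]) (simp add: uw0 AB(3))
  show thesis
  proof (rule that[of "\<lambda>y. A1 (uw y) * (1 / B (uw y))"])
    show "near X y0 (\<lambda>y. f y = A1 (uw y) * (1 / B (uw y)) * u y)"
    proof (rule near_mono[OF AB(4)])
      fix y assume "f y = A (uw y) / B (uw y) \<and> B (uw y) \<noteq> 0"
      then show "f y = A1 (uw y) * (1 / B (uw y)) * u y"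
        by (simp add: A[of "uw y"]) (simp add: uw_def)
    qed
  qed (intro local_ring_mult B local_ring_uw[OF A1(1)])
qed

lemma u_curve_ideal:
  "near X y0 (\<lambda>y. y \<in> C \<longleftrightarrow> u y = 0) \<Longrightarrow> u \<in> curve_ideal X C y0"
  unfolding curve_ideal_def
  by (intro CollectI conjI u_local, elim near_mono) auto

lemma local_equation_u:
  "near X y0 (\<lambda>y. y \<in> C \<longleftrightarrow> u y = 0) \<Longrightarrow> local_equation X C y0 u"
  unfolding local_equation_def using u_curve_ideal[of C] by (blast elim: vanishing_on_curve[of C])

end

text \<open>
The quotient by the maximal ideal is the field of constants.
\<close>

lemma colength_1:
  assumes "\<And>f. f \<in> J \<Longrightarrow> f x = 0"
    and "\<And>f. f \<in> local_ring V x \<Longrightarrow> f x = 0 \<Longrightarrow> f \<in> J"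
  shows "colength V x J = (1 :: nat)"
  unfolding colength_def
proof (rule Least_equality)
  show "\<exists>B. finite B \<and> card B = 1 \<and> B \<subseteq> local_ring V x \<and>
    (\<forall>f\<in>local_ring V x. \<exists>c. (\<lambda>y. f y - (\<Sum>b\<in>B. c b * b y)) \<in> J)"
  proof (intro exI[of _ "{\<lambda>_. 1}"] conjI ballI)
    fix f assume f: "f \<in> local_ring V x"
    show "\<exists>c. (\<lambda>y. f y - (\<Sum>b\<in>{\<lambda>_. 1}. c b * b y)) \<in> J"
      by (intro exI[of _ "\<lambda>_. f x"] assms(2)) (auto intro!: local_ring_intros f)
  qed (auto intro: local_ring_const)
  fix n assume "\<exists>B. finite B \<and> card B = n \<and> B \<subseteq> local_ring V x \<and>
    (\<forall>f\<in>local_ring V x. \<exists>c. (\<lambda>y. f y - (\<Sum>b\<in>B. c b * b y)) \<in> J)"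
  then obtain B where B: "finite B" "card B = n"
    "\<forall>f\<in>local_ring V x. \<exists>c. (\<lambda>y. f y - (\<Sum>b\<in>B. c b * b y)) \<in> J" by blast
  show "1 \<le> n"
  proof (rule ccontr)
    assume "\<not> 1 \<le> n"
    then have "card B = 0" using B(2) by simp
    then have "B = {}" using B(1) by simp
    with B(3) have "(\<lambda>y. 1) \<in> J" using local_ring_const[of 1 V x] by fastforce
    then show False using assms(1) by fastforce
  qed
qed

lemma colength_0:
  assumes "\<And>f. f \<in> local_ring V x \<Longrightarrow> f \<in> J"
  shows "colength V x J = 0"
  unfolding colength_def
  by (rule Least_equality) (auto intro!: exI[of _ "{}"] assms)

lemma order_on_curve_unit:
  assumes "a \<in> local_ring V x" "a x \<noteq> 0" "x \<in> V"
  shows "order_on_curve V C x a = 0"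
  unfolding order_on_curve_def
proof (rule colength_0, rule CollectI)
  fix f assume f: "f \<in> local_ring V x"
  let ?r = "\<lambda>y. f y / a y"
  have r: "?r \<in> local_ring V x" by (rule local_ring_divide[OF f assms(1,3,2)])
  have 1: "(\<lambda>y. f y - ?r y * a y) \<in> local_ring V x"
    by (intro local_ring_diff local_ring_mult f r assms(1))
  have 2: "near V x (\<lambda>y. y \<in> C \<longrightarrow> f y - ?r y * a y = 0)"
    by (rule near_mono[OF near_nonzero[OF assms(1,3,2)]]) simp
  have "(\<lambda>y. f y - ?r y * a y) \<in> curve_ideal V C x"
    unfolding curve_ideal_def using 1 2 by blast
  with r show "\<exists>g r. f = (\<lambda>y. g y + r y * a y) \<and> g \<in> curve_ideal V C x \<and> r \<in> local_ring V x"
    by (intro exI[of _ "\<lambda>y. f y - ?r y * a y"] exI[of _ ?r]) auto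
qed

context blowup_chart begin

lemma order_on_curve_w:
  assumes C: "near X y0 (\<lambda>y. y \<in> C \<longleftrightarrow> u y = 0)" "y0 \<in> C" "C \<subseteq> X"
    and e: "e \<in> local_ring X y0" "e y0 \<noteq> 0"
  shows "order_on_curve X C y0 (\<lambda>y. e y * w y) = 1"
  unfolding order_on_curve_def
proof (rule colength_1)
  fix f assume "f \<in> {\<lambda>y. g y + r y * (e y * w y) |g r. g \<in> curve_ideal X C y0 \<and> r \<in> local_ring X y0}"
  then show "f y0 = 0" using curve_ideal_self[OF _ C(2,3)] by (auto simp: w0)
next
  fix f assume f: "f \<in> local_ring X y0" "f y0 = 0"
  obtain r1 r2 where r: "r1 \<in> local_ring X y0" "r2 \<in> local_ring X y0"
    "near X y0 (\<lambda>y. f y = r1 y * u y + r2 y * w y)" using vanishing_at_point[OF f] .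
  let ?r = "\<lambda>y. r2 y / e y"
  have r': "?r \<in> local_ring X y0" by (rule local_ring_divide[OF r(2) e(1) y0 e(2)])
  have "near X y0 (\<lambda>y. f y - ?r y * (e y * w y) = r1 y * u y)"
    by (rule near_mono[OF near_conj[OF r(3) near_nonzero[OF e(1) y0 e(2)]]]) auto
  from curve_ideal_cong[OF curve_ideal_mult[OF r(1) u_curve_ideal[OF C(1)]] this]
  have "(\<lambda>y. f y - ?r y * (e y * w y)) \<in> curve_ideal X C y0" .
  with r' show "f \<in> {\<lambda>y. g y + r y * (e y * w y) |g r. g \<in> curve_ideal X C y0 \<and> r \<in> local_ring X y0}"
    by (intro CollectI exI[of _ "\<lambda>y. f y - ?r y * (e y * w y)"] exI[of _ ?r]) auto
qed

lemma local_intersection_uw: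
  assumes C: "near X y0 (\<lambda>y. y \<in> C \<longleftrightarrow> u y = 0)" "y0 \<in> C" "C \<subseteq> X"
    and D: "near X y0 (\<lambda>y. y \<in> D \<longleftrightarrow> w y = 0)" "y0 \<in> D" "D \<subseteq> X"
  shows "local_intersection X C D y0 = 1"
  unfolding local_intersection_def
proof (rule colength_1)
  fix h assume "h \<in> {\<lambda>y. f y + g y |f g. f \<in> curve_ideal X C y0 \<and> g \<in> curve_ideal X D y0}"
  then obtain f g where "h = (\<lambda>y. f y + g y)" "f \<in> curve_ideal X C y0" "g \<in> curve_ideal X D y0"
    by blast
  then show "h y0 = 0" using curve_ideal_self[of f X C y0] curve_ideal_self[of g X D y0] C(2,3) D(2,3) by simp
next
  fix f assume f: "f \<in> local_ring X y0" "f y0 = 0"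
  obtain r1 r2 where r: "r1 \<in> local_ring X y0" "r2 \<in> local_ring X y0"
    "near X y0 (\<lambda>y. f y = r1 y * u y + r2 y * w y)" using vanishing_at_point[OF f] .
  have wD: "w \<in> curve_ideal X D y0"
    unfolding curve_ideal_def
    by (intro CollectI conjI w_local near_mono[OF D(1)]) auto
  have 1: "(\<lambda>y. r2 y * w y) \<in> curve_ideal X D y0" by (rule curve_ideal_mult[OF r(2) wD])
  have "near X y0 (\<lambda>y. f y - r2 y * w y = r1 y * u y)"
    by (rule near_mono[OF r(3)]) auto
  from curve_ideal_cong[OF curve_ideal_mult[OF r(1) u_curve_ideal[OF C(1)]] this]
  have 2: "(\<lambda>y. f y - r2 y * w y) \<in> curve_ideal X C y0" .
  show "f \<in> {\<lambda>y. f y + g y |f g. f \<in> curve_ideal X C y0 \<and> g \<in> curve_ideal X D y0}"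
    by (intro CollectI exI[of _ "\<lambda>y. f y - r2 y * w y"] exI[of _ "\<lambda>y. r2 y * w y"] conjI 1 2) auto
qed

end

section \<open>Exceptional curves over the points and strict transforms of lines\<close>

text \<open>
The exceptional curve over the point \<open>p c\<close>.
\<close>

definition Ecurve :: "(4 \<Rightarrow> 'k::field^3) \<Rightarrow> 4 \<Rightarrow> ('k, 3, 4 option) mpoint set" where
  "Ecurve p c = {y \<in> blowup4 p. crs (p c) (rep y $ None) = 0}"

text \<open>
The strict transform of the line joining \<open>p a\<close> and \<open>p c\<close>. Away from the two points the condition says
that the point lies on this line; on the exceptional curves over \<open>p a\<close> and \<open>p c\<close> it selects the
direction of the line.
\<close>

definition Lcurve :: "(4 \<Rightarrow> 'k::field^3) \<Rightarrow> 4 \<Rightarrow> 4 \<Rightarrow> ('k, 3, 4 option) mpoint set" where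
  "Lcurve p a c = {y \<in> blowup4 p. dot (rep y $ Some a) (p c) = 0 \<and> dot (rep y $ Some c) (p a) = 0}"

lemma Lcurve_commute: "Lcurve p a c = Lcurve p c a"
  by (auto simp: Lcurve_def)

lemma Ecurve_subset: "Ecurve p c \<subseteq> blowup4 p"
  by (auto simp: Ecurve_def)

lemma Lcurve_subset: "Lcurve p a c \<subseteq> blowup4 p"
  by (auto simp: Lcurve_def)

lemma proj_class_in_Ecurve: "cone p v \<Longrightarrow> proj_class v \<in> Ecurve p c \<longleftrightarrow> crs (p c) (v $ None) = 0"
  using rep_proj_class[of v] blowup4I[of p v] by (auto simp: Ecurve_def)

lemma proj_class_in_Lcurve:
  "cone p v \<Longrightarrow> proj_class v \<in> Lcurve p a c \<longleftrightarrow> dot (v $ Some a) (p c) = 0 \<and> dot (v $ Some c) (p a) = 0"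
  using rep_proj_class[of v] blowup4I[of p v] by (auto simp: Lcurve_def)

lemma det3_eq_0_if_perp:
  assumes "l \<noteq> (0::'k::field^3)" "dot l a = 0" "dot l b = 0" "dot l c = 0"
  shows "det3 a b c = 0"
  using cramer_line[OF assms(2), of b c] assms by simp

lemma parallel_to_cross:
  fixes l a b :: "'k::field^3"
  assumes "dot l a = 0" "dot l b = 0" "l \<noteq> 0" "crs a b \<noteq> 0"
  obtains k where "k \<noteq> 0" "crs a b = k *s l"
  using pencil[of a l b] assms by (metis dot_commute smult_eq_0)

lemma cone_row_cross:
  assumes "cone p v" "crs (p c) (v $ None) \<noteq> (0::'k::field^3)"
  obtains k where "k \<noteq> 0" "crs (p c) (v $ None) = k *s v $ Some c"
  using parallel_to_cross[of "v $ Some c" "p c" "v $ None"] coneD[OF assms(1)] assms(2) by metis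

text \<open>
For the line joining \<open>p a\<close> and \<open>p c\<close> the two defining conditions agree off \<open>Ecurve p c\<close>.
\<close>

lemma chart_Lcurve_iff:
  fixes p :: "4 \<Rightarrow> 'k::field^3"
  assumes y: "y \<in> blowup4 p" and ch: "chart p a b (rep y)" and c: "c \<noteq> a" "c \<noteq> b"
  shows "y \<in> Lcurve p a c \<longleftrightarrow> dot (rep y $ Some a) (p c) = 0"
proof
  assume d: "dot (rep y $ Some a) (p c) = 0"
  note cn = cone_rep[OF y]
  have "crs (p c) (rep y $ None) \<noteq> 0" using ch c by (auto simp: chart_def)
  then obtain k where k: "k \<noteq> 0" "crs (p c) (rep y $ None) = k *s rep y $ Some c"
    using cone_row_cross[OF cn] by metis
  have "det3 (p c) (rep y $ None) (p a) = 0"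
    by (rule det3_eq_0_if_perp[of "rep y $ Some a"]) (use coneD[OF cn] d in auto)
  then have "dot (k *s rep y $ Some c) (p a) = 0" unfolding k(2)[symmetric] by (simp add: det3_def)
  with k(1) d y show "y \<in> Lcurve p a c" by (simp add: Lcurve_def)
qed (simp add: Lcurve_def)

lemma chart_Ecurve_iff:
  fixes p :: "4 \<Rightarrow> 'k::field^3"
  assumes gp: "general_points p" and y: "y \<in> blowup4 p" and ch: "chart p a b (rep y)"
  shows "y \<in> Ecurve p b \<longleftrightarrow> dot (rep y $ Some a) (p b) = 0"
proof
  note cn = cone_rep[OF y]
  assume "y \<in> Ecurve p b"
  then have "crs (p b) (rep y $ None) = 0" by (simp add: Ecurve_def)
  then obtain k where k: "rep y $ None = k *s p b" using crs_eq_0 gp_nonzero[OF gp] by metis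
  then have "k \<noteq> 0" using coneD(1)[OF cn, of None] by auto
  then show "dot (rep y $ Some a) (p b) = 0" using coneD(3)[OF cn, of a] k by simp
next
  note cn = cone_rep[OF y]
  assume d: "dot (rep y $ Some a) (p b) = 0"
  have ne: "crs (rep y $ Some a) (rep y $ Some b) \<noteq> 0" using ch by (simp add: chart_def)
  obtain k where k: "k \<noteq> 0" "crs (rep y $ Some a) (rep y $ Some b) = k *s p b"
    using parallel_to_cross[of "p b" "rep y $ Some a" "rep y $ Some b"] ne d gp_nonzero[OF gp] coneD[OF cn]
    by (metis dot_commute)
  obtain k' where k': "k' \<noteq> 0" "crs (rep y $ Some a) (rep y $ Some b) = k' *s rep y $ None"
    using parallel_to_cross[of "rep y $ None" "rep y $ Some a" "rep y $ Some b"] ne coneD[OF cn]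
    by metis
  have "k' *s crs (p b) (rep y $ None) = crs (p b) (k *s p b)"
    using k(2) k'(2) by (metis crs_smult(2))
  then have "crs (p b) (rep y $ None) = 0" using k'(1) by simp
  then show "y \<in> Ecurve p b" using y by (simp add: Ecurve_def)
qed

lemma gp_crs: "general_points p \<Longrightarrow> i \<noteq> j \<Longrightarrow> crs (p i) (p j) \<noteq> (0::'k::field^3)"
proof -
  assume gp: "general_points p" and ij: "i \<noteq> j"
  obtain k where "k \<noteq> i" "k \<noteq> j"
    using exists_other_indices[of i] by metis
  with gp_det[OF gp ij, of k] det3_nonzero show ?thesis by blast
qed

lemma crs_gp_eq_0:
  fixes p :: "4 \<Rightarrow> 'k::field^3"
  assumes gp: "general_points p" and "crs (p c) x = 0" "x \<noteq> 0"
  obtains k where "k \<noteq> 0" "x = k *s p c"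
  using crs_eq_0[OF assms(2) gp_nonzero[OF gp]] assms(3) by (metis smult_eq_0)

text \<open>
Together with \<open>Ecurve_chart\<close> and \<open>EL_chart\<close> this provides, at every point of the fibre
\<open>Ecurve p c + Lcurve p a c\<close>, a chart in which the components through that point are coordinate axes.
\<close>

lemma Lcurve_chart:
  fixes p :: "4 \<Rightarrow> 'k::field^3"
  assumes gp: "general_points p" and y: "y \<in> Lcurve p a c" and nE: "y \<notin> Ecurve p c"
    and abc: "a \<noteq> c" "b \<noteq> a" "b \<noteq> c"
  shows "chart p a b (rep y)"
proof -
  have yX: "y \<in> blowup4 p" and d: "dot (rep y $ Some a) (p c) = 0" "dot (rep y $ Some c) (p a) = 0"
    using y by (auto simp: Lcurve_def)
  note cn = cone_rep[OF yX]
  have no: "dot (rep y $ Some a) (p e) \<noteq> 0" if "e \<noteq> a" "e \<noteq> c" for e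
    using det3_eq_0_if_perp[OF coneD(1)[OF cn, of "Some a"], of "p a" "p c" "p e"]
      gp_det[OF gp abc(1), of e] that d coneD[OF cn] by metis
  show ?thesis unfolding chart_def
  proof (intro conjI allI impI)
    show "a \<noteq> b" using abc by simp
    show "crs (rep y $ Some a) (rep y $ Some b) \<noteq> 0"
    proof
      assume "crs (rep y $ Some a) (rep y $ Some b) = 0"
      then have "crs (rep y $ Some b) (rep y $ Some a) = 0" by (subst crs_swap) simp
      then obtain k where "rep y $ Some a = k *s rep y $ Some b" using crs_eq_0 coneD(1)[OF cn] by blast
      then have "dot (rep y $ Some a) (p b) = 0" using coneD(2)[OF cn, of b] by simp
      with no[of b] abc show False by simp
    qed
    fix e assume e: "e \<noteq> a" "e \<noteq> b"
    show "crs (p e) (rep y $ None) \<noteq> 0"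
    proof (cases "e = c")
      case True
      then show ?thesis using nE yX by (simp add: Ecurve_def)
    next
      case False
      show ?thesis
      proof
        assume "crs (p e) (rep y $ None) = 0"
        then obtain k where "k \<noteq> 0" "rep y $ None = k *s p e"
          using crs_gp_eq_0[OF gp] coneD(1)[OF cn] by metis
        then have "dot (rep y $ Some a) (p e) = 0" using coneD(3)[OF cn, of a] by simp
        with no[of e] False e show False by simp
      qed
    qed
  qed
qed

lemma Ecurve_not_other:
  fixes p :: "4 \<Rightarrow> 'k::field^3"
  assumes gp: "general_points p" and y: "y \<in> Ecurve p c" and e: "e \<noteq> c"
  shows "crs (p e) (rep y $ None) \<noteq> 0"
proof
  have yX: "y \<in> blowup4 p" and "crs (p c) (rep y $ None) = 0" using y by (auto simp: Ecurve_def)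
  then obtain k where k: "k \<noteq> 0" "rep y $ None = k *s p c"
    using crs_gp_eq_0[OF gp] coneD(1)[OF cone_rep[OF yX]] by metis
  assume "crs (p e) (rep y $ None) = 0"
  with k have "crs (p e) (p c) = 0" by simp
  with gp_crs[OF gp e] show False by simp
qed

lemma Ecurve_dot:
  fixes p :: "4 \<Rightarrow> 'k::field^3"
  assumes gp: "general_points p" and y: "y \<in> Ecurve p c"
  shows "dot (rep y $ Some a) (p c) = 0"
proof -
  have yX: "y \<in> blowup4 p" and "crs (p c) (rep y $ None) = 0" using y by (auto simp: Ecurve_def)
  then obtain k where k: "k \<noteq> 0" "rep y $ None = k *s p c"
    using crs_gp_eq_0[OF gp] coneD(1)[OF cone_rep[OF yX]] by metis
  then show ?thesis using coneD(3)[OF cone_rep[OF yX], of a] by simp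
qed

lemma Ecurve_chart:
  fixes p :: "4 \<Rightarrow> 'k::field^3"
  assumes gp: "general_points p" and y: "y \<in> Ecurve p c" and nL: "y \<notin> Lcurve p a c" and ac: "a \<noteq> c"
  shows "chart p a c (rep y)"
proof -
  have yX: "y \<in> blowup4 p" using y by (auto simp: Ecurve_def)
  note cn = cone_rep[OF yX]
  have "crs (rep y $ Some a) (rep y $ Some c) \<noteq> 0"
  proof
    assume "crs (rep y $ Some a) (rep y $ Some c) = 0"
    then obtain k where "rep y $ Some c = k *s rep y $ Some a" using crs_eq_0 coneD(1)[OF cn] by blast
    then have "dot (rep y $ Some c) (p a) = 0" using coneD(2)[OF cn, of a] by simp
    then show False using nL yX Ecurve_dot[OF gp y, of a] by (simp add: Lcurve_def)
  qed
  then show ?thesis using ac Ecurve_not_other[OF gp y] by (auto simp: chart_def)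
qed

lemma EL_chart:
  fixes p :: "4 \<Rightarrow> 'k::field^3"
  assumes gp: "general_points p" and y: "y \<in> Ecurve p c" "y \<in> Lcurve p a c"
    and abc: "a \<noteq> c" "b \<noteq> a" "b \<noteq> c"
  shows "chart p c b (rep y)"
proof (rule Lcurve_chart[OF gp])
  show "y \<in> Lcurve p c a" using y(2) by (simp add: Lcurve_commute)
  show "y \<notin> Ecurve p a" using Ecurve_not_other[OF gp y(1) abc(1)] by (auto simp: Ecurve_def)
qed (use abc in auto)

lemma row_dot_nonzero:
  fixes p :: "4 \<Rightarrow> 'k::field^3"
  assumes y: "y \<in> blowup4 p" and d: "dot (rep y $ Some a) (p c) = 0" and q: "det3 (p a) (p c) q \<noteq> 0"
  shows "dot (rep y $ Some a) q \<noteq> 0"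
  using det3_eq_0_if_perp[OF coneD(1)[OF cone_rep[OF y], of "Some a"], of "p a" "p c" q] d q
    coneD(2)[OF cone_rep[OF y], of a] by blast

lemma blowup_chartI:
  fixes p :: "4 \<Rightarrow> 'k::alg_closed_field^3"
  assumes gp: "general_points p" and y: "y \<in> blowup4 p" and ch: "chart p a b (rep y)"
    and d: "dot (rep y $ Some a) (p c) = 0" and q: "det3 (p a) (p c) q \<noteq> 0"
  obtains s' q' where "blowup_chart p y a b (p c) q s' q'"
proof -
  note cn = cone_rep[OF y]
  obtain s' q' where *: "dot (rep y $ Some b) s' = 0" "dot (rep y $ Some b) q' \<noteq> 0" "det3 (p b) s' q' \<noteq> 0"
    using exists_coords[OF coneD(2)[OF cn, of b] coneD(1)[OF cn] gp_nonzero[OF gp]] by blast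
  show thesis
    by (rule that[of s' q']) (unfold_locales, use assms * row_dot_nonzero[OF y d q] in auto)
qed

context blowup_chart begin

lemma near_chart_q: "near X y0 (\<lambda>y. y \<in> X \<and> chart p a b (rep y) \<and> dot (rep y $ Some a) q \<noteq> 0 \<and> dot (rep y $ Some b) q' \<noteq> 0)"
  by (rule near_mono[OF near_conj[OF near_chart[OF ch] near_conj[OF near_form[OF form_dot laq] near_form[OF form_dot lbq]]]])
    auto

lemma u_eq_0: "dot (rep y $ Some a) q \<noteq> 0 \<Longrightarrow> u y = 0 \<longleftrightarrow> dot (rep y $ Some a) s = 0"
  and w_eq_0: "dot (rep y $ Some b) q' \<noteq> 0 \<Longrightarrow> w y = 0 \<longleftrightarrow> dot (rep y $ Some b) s' = 0"
  by (simp_all add: u_def w_def ratio_def)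

lemma near_Lcurve_u:
  assumes "s = p c" "c \<noteq> a" "c \<noteq> b"
  shows "near X y0 (\<lambda>y. y \<in> Lcurve p a c \<longleftrightarrow> u y = 0)"
proof (rule near_mono[OF near_chart_q])
  fix y assume "y \<in> X \<and> chart p a b (rep y) \<and> dot (rep y $ Some a) q \<noteq> 0 \<and> dot (rep y $ Some b) q' \<noteq> 0"
  then show "y \<in> Lcurve p a c \<longleftrightarrow> u y = 0"
    using chart_Lcurve_iff[OF _ _ assms(2,3), of y p] u_eq_0[of y] unfolding assms(1)[symmetric] by blast
qed

lemma near_Lcurve_w:
  assumes "s' = p c" "c \<noteq> a" "c \<noteq> b"
  shows "near X y0 (\<lambda>y. y \<in> Lcurve p b c \<longleftrightarrow> w y = 0)"
proof (rule near_mono[OF near_chart_q])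
  fix y assume "y \<in> X \<and> chart p a b (rep y) \<and> dot (rep y $ Some a) q \<noteq> 0 \<and> dot (rep y $ Some b) q' \<noteq> 0"
  then show "y \<in> Lcurve p b c \<longleftrightarrow> w y = 0"
    using chart_Lcurve_iff[OF _ _ assms(3,2), of y p] w_eq_0[of y] chart_swap[of p b a "rep y"] unfolding assms(1)[symmetric] by blast
qed

lemma near_Ecurve_u:
  assumes "general_points p" "s = p b"
  shows "near X y0 (\<lambda>y. y \<in> Ecurve p b \<longleftrightarrow> u y = 0)"
proof (rule near_mono[OF near_chart_q])
  fix y assume "y \<in> X \<and> chart p a b (rep y) \<and> dot (rep y $ Some a) q \<noteq> 0 \<and> dot (rep y $ Some b) q' \<noteq> 0"
  then show "y \<in> Ecurve p b \<longleftrightarrow> u y = 0"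
    using chart_Ecurve_iff[OF assms(1), of y a b] u_eq_0[of y] unfolding assms(2)[symmetric] by blast
qed

lemma w_not_curve_ideal:
  assumes C: "near X y0 (\<lambda>y. y \<in> C \<longleftrightarrow> u y = 0)" and e: "e \<in> local_ring X y0" "e y0 \<noteq> 0"
  shows "(\<lambda>y. e y * w y) \<notin> curve_ideal X C y0"
proof
  assume "(\<lambda>y. e y * w y) \<in> curve_ideal X C y0"
  from vanishing_on_curve[OF C this] obtain r where r: "near X y0 (\<lambda>y. e y * w y = r y * u y)" by blast
  have "\<forall>\<^sub>\<infinity>t::'k. False"
    using near_path[OF near_conj[OF r near_nonzero[OF e(1) y0 e(2)]] path_w] MOST_neq(1)[of 0]
    by eventually_elim (simp add: uw_pt)
  then show False using cofinite_ex[of "\<lambda>_. False"] by blast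
qed

end

lemma unit_not_curve_ideal:
  assumes "f x \<noteq> 0" "x \<in> C" "C \<subseteq> V"
  shows "f \<notin> curve_ideal V C x"
  using curve_ideal_self[of f V C x] assms by blast

definition formP :: "(4 \<Rightarrow> 'k::field^3) \<Rightarrow> 4 \<Rightarrow> 'k^3 \<Rightarrow> 'k^3^(4 option) \<Rightarrow> 'k" where
  "formP p a s = (\<lambda>v. dot (v $ Some a) s)"

lemma conormal_order_regular:
  assumes "local_equation V C x (ratio P Q)" "x \<in> C" "C \<subseteq> V"
  shows "conormal_order V C P Q x 0"
  unfolding conormal_order_def
  by (rule exI[of _ "ratio P Q"], rule exI[of _ "\<lambda>_. 1"], rule exI[of _ "\<lambda>_. 1"])
    (use assms unit_not_curve_ideal[of "\<lambda>_. 1" x C V] in \<open>auto intro!: local_ring_const near_True\<close>)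

lemma conormal_order_transversal:
  fixes p :: "4 \<Rightarrow> 'k::alg_closed_field^3"
  assumes "blowup_chart p y0 a b s q s' q'"
    and C: "near (blowup4 p) y0 (\<lambda>y. y \<in> C \<longleftrightarrow> blowup_chart.u a s q y = 0)" "y0 \<in> C" "C \<subseteq> blowup4 p"
    and e: "e \<in> local_ring (blowup4 p) y0" "e y0 \<noteq> 0"
    and eq: "near (blowup4 p) y0 (\<lambda>y. Q (rep y) \<noteq> 0 \<longrightarrow>
       ratio P Q y * e y = blowup_chart.u a s q y * ((-1) * blowup_chart.w b s' q' y))"
  shows "conormal_order (blowup4 p) C P Q y0 1"
proof -
  interpret blowup_chart p y0 a b s q s' q' by fact
  have 1: "order_on_curve X C y0 (\<lambda>y. (-1) * w y) = 1"
    by (rule order_on_curve_w[OF C]) (auto intro: local_ring_const)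
  have 2: "(\<lambda>y. (-1) * w y) \<in> local_ring X y0 - curve_ideal X C y0"
    using w_not_curve_ideal[OF C(1), of "\<lambda>_. -1"] by (auto intro!: local_ring_intros w_local)
  have 3: "e \<in> local_ring X y0 - curve_ideal X C y0"
    using e unit_not_curve_ideal[of e y0 C X] C(2,3) by blast
  have 4: "order_on_curve X C y0 e = 0" by (rule order_on_curve_unit[OF e y0])
  show ?thesis
    unfolding conormal_order_def
    by (rule exI[of _ u], rule exI[of _ "\<lambda>y. (-1) * w y"], rule exI[of _ e])
      (use 1 2 3 4 eq local_equation_u[OF C(1)] in auto)
qed

text \<open>
At the common point of \<open>Ecurve p c\<close> and \<open>Lcurve p a c\<close> the line through \<open>p a\<close> is not a chart
coordinate. Expressing it by the lines through \<open>p c\<close> and \<open>p b\<close> shows that the equation of the fibre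
is minus the product of the two chart coordinates, whose zeros are the two components, divided by
the unit \<open>1 - \<dots>\<close>.
\<close>

lemma EL_equation:
  fixes p :: "4 \<Rightarrow> 'k::field^3"
  assumes y: "y \<in> blowup4 p" and ch: "chart p c b (rep y)" and ab: "a \<noteq> b" "a \<noteq> c"
    and lq: "dot (rep y $ Some c) q \<noteq> 0" and lb: "dot (rep y $ Some b) (p a) \<noteq> 0"
    and Q: "dot (rep y $ Some a) q \<noteq> 0"
  shows "ratio (formP p a (p c)) (formP p a q) y *
     (1 - ratio (formP p b q) (formP p b (p a)) y * ratio (formP p c (p a)) (formP p c q) y) =
     - (ratio (formP p c (p a)) (formP p c q) y * ratio (formP p b (p c)) (formP p b (p a)) y)"
proof -
  note cn = cone_rep[OF y]
  define la lb' lc where "la = rep y $ Some a" and "lb' = rep y $ Some b" and "lc = rep y $ Some c"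
  have "crs (p a) (rep y $ None) \<noteq> 0" using ch ab by (auto simp: chart_def)
  then obtain k where k: "k \<noteq> 0" "crs (p a) (rep y $ None) = k *s la"
    using cone_row_cross[OF cn] unfolding la_def by metis
  have ne: "crs lc lb' \<noteq> 0" using ch by (simp add: chart_def lc_def lb'_def)
  obtain k' where k': "k' \<noteq> 0" "crs lc lb' = k' *s rep y $ None"
    using parallel_to_cross[of "rep y $ None" lc lb'] ne coneD[OF cn] unfolding lc_def lb'_def by metis
  define K where "K = k' * k"
  have K: "K *s la = dot (p a) lb' *s lc - dot (p a) lc *s lb'"
    using k k' by (metis K_def crs_crs crs_smult(2) vector_smult_assoc)
  have lcc: "dot lc (p c) = 0" using coneD[OF cn] by (simp add: lc_def)
  have 1: "K * dot la (p c) = - dot lc (p a) * dot lb' (p c)"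
    using arg_cong[OF K, of "\<lambda>v. dot v (p c)"] by (simp add: dot_diff lcc dot_commute)
  have 2: "K * dot la q = dot lb' (p a) * dot lc q - dot lc (p a) * dot lb' q"
    using arg_cong[OF K, of "\<lambda>v. dot v q"] by (simp add: dot_diff dot_commute)
  have nz: "dot lc q \<noteq> 0" "dot lb' (p a) \<noteq> 0" "dot la q \<noteq> 0" "K \<noteq> 0"
    using lq lb Q k k' by (simp_all add: la_def lb'_def lc_def K_def)
  have "dot la (p c) / dot la q * (1 - dot lb' q / dot lb' (p a) * (dot lc (p a) / dot lc q))
    = (K * dot la (p c)) / (K * dot la q) * ((dot lb' (p a) * dot lc q - dot lc (p a) * dot lb' q) / (dot lb' (p a) * dot lc q))"
    using nz by (simp add: field_simps)
  also have "\<dots> = (K * dot la (p c)) / (dot lb' (p a) * dot lc q)"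
    unfolding 2[symmetric] using nz by simp
  also have "\<dots> = - (dot lc (p a) / dot lc q * (dot lb' (p c) / dot lb' (p a)))"
    unfolding 1 using nz by (simp add: field_simps)
  finally show ?thesis
    by (simp add: ratio_def formP_def la_def lb'_def lc_def)
qed

text \<open>
Coordinates of the point of \<open>Ecurve p c\<close> in the direction of the line \<open>l\<close> through \<open>p c\<close>.
\<close>

definition Evec :: "(4 \<Rightarrow> 'k::field^3) \<Rightarrow> 4 \<Rightarrow> 'k^3 \<Rightarrow> 'k^3^(4 option)" where
  "Evec p c l = (\<chi> i. case i of None \<Rightarrow> p c | Some d \<Rightarrow> if d = c then l else crs (p d) (p c))"

lemma Evec_nth [simp]:
  "Evec p c l $ None = p c" "Evec p c l $ Some c = l" "d \<noteq> c \<Longrightarrow> Evec p c l $ Some d = crs (p d) (p c)"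
  by (simp_all add: Evec_def)

lemma cone_Evec:
  assumes gp: "general_points p" and l: "l \<noteq> 0" "dot l (p c) = 0"
  shows "cone p (Evec p c l)"
  unfolding cone_def
proof (intro conjI allI)
  show "Evec p c l $ i \<noteq> 0" for i
    using l gp_nonzero[OF gp] gp_crs[OF gp] by (cases i) (auto simp: Evec_def)
  show "dot (Evec p c l $ Some i) (p i) = 0" "dot (Evec p c l $ Some i) (Evec p c l $ None) = 0" for i
    using l by (auto simp: Evec_def)
qed

definition ELpoint :: "(4 \<Rightarrow> 'k::field^3) \<Rightarrow> 4 \<Rightarrow> 4 \<Rightarrow> ('k, 3, 4 option) mpoint" where
  "ELpoint p a c = proj_class (Evec p c (crs (p a) (p c)))"

lemma Ecurve_Lcurve_Int:
  fixes p :: "4 \<Rightarrow> 'k::field^3"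
  assumes gp: "general_points p" and ac: "a \<noteq> c"
  shows "Ecurve p c \<inter> Lcurve p a c = {ELpoint p a c}"
proof (intro equalityI subsetI)
  have cn: "cone p (Evec p c (crs (p a) (p c)))"
    by (rule cone_Evec[OF gp]) (use gp_crs[OF gp ac] in simp_all)
  fix y assume "y \<in> {ELpoint p a c}"
  then show "y \<in> Ecurve p c \<inter> Lcurve p a c"
    using ac by (simp add: ELpoint_def proj_class_in_Ecurve[OF cn] proj_class_in_Lcurve[OF cn])
next
  fix y assume y: "y \<in> Ecurve p c \<inter> Lcurve p a c"
  then have yX: "y \<in> blowup4 p" and d: "dot (rep y $ Some c) (p a) = 0" and x: "crs (p c) (rep y $ None) = 0"
    by (auto simp: Lcurve_def Ecurve_def)
  note cn = cone_rep[OF yX]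
  obtain k where k: "k \<noteq> 0" "rep y $ None = k *s p c" using crs_gp_eq_0[OF gp x coneD(1)[OF cn]] .
  have "proj_class (rep y) = proj_class (Evec p c (crs (p a) (p c)))"
  proof (rule row_scale_eqI)
    fix i
    show "\<exists>e. e \<noteq> 0 \<and> Evec p c (crs (p a) (p c)) $ i = e *s rep y $ i"
    proof (cases i)
      case None
      then show ?thesis using k by (intro exI[of _ "1 / k"]) (simp add: vector_smult_assoc)
    next
      case (Some e)
      show ?thesis
      proof (cases "e = c")
        case True
        obtain k where "k \<noteq> 0" "crs (p a) (p c) = k *s rep y $ Some c"
          using parallel_to_cross[OF d coneD(2)[OF cn, of c] coneD(1)[OF cn] gp_crs[OF gp ac]] .
        then show ?thesis using Some True by auto
      next
        case False
        have "crs (p e) (rep y $ None) \<noteq> 0" using Ecurve_not_other[OF gp _ False] y by blast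
        then obtain k' where k': "k' \<noteq> 0" "crs (p e) (rep y $ None) = k' *s rep y $ Some e"
          using cone_row_cross[OF cn] by metis
        have "k *s crs (p e) (p c) = k' *s rep y $ Some e" using k'(2) k(2) by simp
        then have "(1 / k) *s (k *s crs (p e) (p c)) = (1 / k) *s (k' *s rep y $ Some e)" by simp
        then have "crs (p e) (p c) = (k' / k) *s rep y $ Some e" using k by (simp add: vector_smult_assoc)
        then show ?thesis using Some False k k' by (intro exI[of _ "k' / k"]) simp
      qed
    qed
  qed
  then show "y \<in> {ELpoint p a c}" using blowup4_rep[OF yX] by (simp add: ELpoint_def)
qed

text \<open>
The section is the equation of the fibre of the projection to the pencil at \<open>p a\<close> over the line
through \<open>p c\<close>. It is a local equation of the component \<open>C\<close> except at the point \<open>y1\<close> on the other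
component, so the degree of the conormal bundle is \<open>1\<close>.
\<close>

lemma self_intersection_EL:
  fixes p :: "4 \<Rightarrow> 'k::alg_closed_field^3"
  assumes C: "C \<subseteq> blowup4 p" and q: "det3 (p a) (p c) q \<noteq> 0"
    and d: "\<And>y. y \<in> C \<Longrightarrow> dot (rep y $ Some a) (p c) = 0"
    and y1: "y1 \<in> C" "conormal_order (blowup4 p) C (formP p a (p c)) (formP p a q) y1 1"
    and reg: "\<And>y. y \<in> C \<Longrightarrow> y \<noteq> y1 \<Longrightarrow> local_equation (blowup4 p) C y (ratio (formP p a (p c)) (formP p a q))"
    and y2: "y2 \<in> C" "y2 \<noteq> y1"
  shows "has_self_intersection (blowup4 p) C (- 1)"
proof -
  define n :: "('k, 3, 4 option) mpoint \<Rightarrow> int" where "n x = (if x = y1 then 1 else 0)" for x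
  have Q: "formP p a q (rep y) \<noteq> 0" if "y \<in> C" for y
    unfolding formP_def using row_dot_nonzero[of y p a c q] C d[OF that] q that by blast
  have forms: "form (rowdeg (Some a)) (formP p a (p c))" "form (rowdeg (Some a)) (formP p a q)"
    unfolding formP_def by (rule form_dot)+
  have "conormal_section (blowup4 p) C (formP p a (p c)) (formP p a q)"
    unfolding conormal_section_def using forms Q[OF y2(1)] reg[OF y2] y2 by blast
  moreover have "conormal_order (blowup4 p) C (formP p a (p c)) (formP p a q) x (n x)" if "x \<in> C" for x
    using y1 conormal_order_regular[OF reg that C] that by (auto simp: n_def)
  moreover have "{x \<in> C. n x \<noteq> 0} = {y1}" using y1 by (auto simp: n_def)
  ultimately show ?thesis unfolding has_self_intersection_def
    by (intro exI[of _ "formP p a (p c)"] exI[of _ "formP p a q"] exI[of _ n]) (auto simp: n_def)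
qed

context
  fixes p :: "4 \<Rightarrow> 'k::alg_closed_field^3" and a c :: 4
  assumes gp: "general_points p" and ac: "a \<noteq> c"
begin

lemma ELpoint_in: "ELpoint p a c \<in> Ecurve p c" "ELpoint p a c \<in> Lcurve p a c"
  using Ecurve_Lcurve_Int[OF gp ac] by auto

lemma EL_blowup_chart:
  assumes b: "b \<noteq> a" "b \<noteq> c" and q: "det3 (p a) (p c) q \<noteq> 0"
  shows "blowup_chart p (ELpoint p a c) c b (p a) q (p c) (p a)"
    "blowup_chart p (ELpoint p a c) b c (p c) (p a) (p a) q"
proof -
  note y = ELpoint_in
  have yX: "ELpoint p a c \<in> blowup4 p" using y(1) Ecurve_subset by blast
  have ch: "chart p c b (rep (ELpoint p a c))" by (rule EL_chart[OF gp y ac b])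
  have d: "dot (rep (ELpoint p a c) $ Some c) (p a) = 0" using y(2) by (simp add: Lcurve_def)
  have d': "dot (rep (ELpoint p a c) $ Some b) (p c) = 0" by (rule Ecurve_dot[OF gp y(1)])
  have q': "det3 (p c) (p a) q \<noteq> 0" using q det3_perm(1)[of "p c" "p a" q] by simp
  have D: "det3 (p b) (p c) (p a) \<noteq> 0" using gp_det[OF gp] b ac by metis
  note row_dot_nonzero[OF yX d q'] row_dot_nonzero[OF yX d' D]
  with yX ch d d' q' D chart_swap[of p c b]
  show "blowup_chart p (ELpoint p a c) c b (p a) q (p c) (p a)"
    "blowup_chart p (ELpoint p a c) b c (p c) (p a) (p a) q"
    by (unfold_locales; simp)+
qed

lemma EL_order:
  assumes b: "b \<noteq> a" "b \<noteq> c" and q: "det3 (p a) (p c) q \<noteq> 0"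
  shows "conormal_order (blowup4 p) (Lcurve p a c) (formP p a (p c)) (formP p a q) (ELpoint p a c) 1"
    "conormal_order (blowup4 p) (Ecurve p c) (formP p a (p c)) (formP p a q) (ELpoint p a c) 1"
    "local_intersection (blowup4 p) (Ecurve p c) (Lcurve p a c) (ELpoint p a c) = 1"
proof -
  interpret A: blowup_chart p "ELpoint p a c" c b "p a" q "p c" "p a" by (rule EL_blowup_chart[OF b q])
  interpret B: blowup_chart p "ELpoint p a c" b c "p c" "p a" "p a" q by (rule EL_blowup_chart[OF b q])
  have wu: "A.w = B.u" "A.u = B.w"
    by (simp_all add: A.w_def B.u_def A.u_def B.w_def)
  define e where "e = (\<lambda>y. 1 - ratio (formP p b q) (formP p b (p a)) y * A.u y)"
  have bpa: "formP p b (p a) (rep (ELpoint p a c)) \<noteq> 0" using A.lbq by (simp add: formP_def)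
  have k: "ratio (formP p b q) (formP p b (p a)) \<in> local_ring (blowup4 p) (ELpoint p a c)"
    by (rule local_ring_ratio[where d = "rowdeg (Some b)"]) (use bpa in \<open>auto simp: formP_def form_dot\<close>)
  have e1: "e \<in> local_ring (blowup4 p) (ELpoint p a c)"
    unfolding e_def by (intro local_ring_diff local_ring_mult local_ring_const A.u_local k)
  have e2: "e (ELpoint p a c) \<noteq> 0" by (simp add: e_def A.u0)
  have eq: "near (blowup4 p) (ELpoint p a c) (\<lambda>y. formP p a q (rep y) \<noteq> 0 \<longrightarrow>
       ratio (formP p a (p c)) (formP p a q) y * e y = - (A.u y * A.w y))"
  proof (rule near_mono[OF A.near_chart_q], rule impI)
    fix y assume *: "y \<in> blowup4 p \<and> chart p c b (rep y) \<and> dot (rep y $ Some c) q \<noteq> 0 \<and> dot (rep y $ Some b) (p a) \<noteq> 0"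
      "formP p a q (rep y) \<noteq> 0"
    have "ratio (formP p a (p c)) (formP p a q) y *
     (1 - ratio (formP p b q) (formP p b (p a)) y * ratio (formP p c (p a)) (formP p c q) y) =
     - (ratio (formP p c (p a)) (formP p c q) y * ratio (formP p b (p c)) (formP p b (p a)) y)"
      by (rule EL_equation) (use * b ac in \<open>auto simp: formP_def\<close>)
    then show "ratio (formP p a (p c)) (formP p a q) y * e y = - (A.u y * A.w y)"
      by (simp add: e_def A.u_def A.w_def formP_def)
  qed
  have nL: "near (blowup4 p) (ELpoint p a c) (\<lambda>y. y \<in> Lcurve p a c \<longleftrightarrow> A.u y = 0)"
    unfolding Lcurve_commute[of p a c] by (rule A.near_Lcurve_u) (use b ac in auto)
  have nE: "near (blowup4 p) (ELpoint p a c) (\<lambda>y. y \<in> Ecurve p c \<longleftrightarrow> B.u y = 0)"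
    by (rule B.near_Ecurve_u[OF gp]) simp
  show "conormal_order (blowup4 p) (Lcurve p a c) (formP p a (p c)) (formP p a q) (ELpoint p a c) 1"
    by (rule conormal_order_transversal[OF A.blowup_chart_axioms nL ELpoint_in(2) Lcurve_subset e1 e2])
      (use eq in simp)
  show "conormal_order (blowup4 p) (Ecurve p c) (formP p a (p c)) (formP p a q) (ELpoint p a c) 1"
    by (rule conormal_order_transversal[OF B.blowup_chart_axioms nE ELpoint_in(1) Ecurve_subset e1 e2])
      (use eq in \<open>simp add: wu mult.commute\<close>)
  show "local_intersection (blowup4 p) (Ecurve p c) (Lcurve p a c) (ELpoint p a c) = 1"
    by (rule B.local_intersection_uw[OF nE ELpoint_in(1) Ecurve_subset _ ELpoint_in(2) Lcurve_subset])
      (use nL wu in simp)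
qed

lemma exists_third:
  obtains b where "b \<noteq> a" "b \<noteq> c"
  using exists_other_indices[of a] by metis

lemma exists_q: obtains q where "det3 (p a) (p c) q \<noteq> 0"
  using exists_nonzero_dot[OF gp_crs[OF gp ac]] by (auto simp: det3_def)

lemma Lcurve_self_intersection: "has_self_intersection (blowup4 p) (Lcurve p a c) (- 1)"
proof -
  obtain q where q: "det3 (p a) (p c) q \<noteq> 0" using exists_q .
  obtain b where b: "b \<noteq> a" "b \<noteq> c" using exists_third .
  have cn: "cone p (Evec p a (crs (p a) (p c)))"
    by (rule cone_Evec[OF gp]) (use gp_crs[OF gp ac] in simp_all)
  have y2: "proj_class (Evec p a (crs (p a) (p c))) \<in> Lcurve p a c"
    using ac by (simp add: proj_class_in_Lcurve[OF cn])
  have y2': "proj_class (Evec p a (crs (p a) (p c))) \<notin> Ecurve p c"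
    using gp_crs[OF gp, of c a] ac by (simp add: proj_class_in_Ecurve[OF cn])
  show ?thesis
  proof (rule self_intersection_EL[OF Lcurve_subset q _ ELpoint_in(2) EL_order(1)[OF b q] _ y2])
    fix y assume y: "y \<in> Lcurve p a c"
    then show d: "dot (rep y $ Some a) (p c) = 0" by (simp add: Lcurve_def)
    assume "y \<noteq> ELpoint p a c"
    then have nE: "y \<notin> Ecurve p c" using y Ecurve_Lcurve_Int[OF gp ac] by blast
    have yX: "y \<in> blowup4 p" using y Lcurve_subset by blast
    obtain s' q' where "blowup_chart p y a b (p c) q s' q'"
      using blowup_chartI[OF gp yX Lcurve_chart[OF gp y nE ac b] d q] .
    then interpret A: blowup_chart p y a b "p c" q s' q' .
    have "local_equation (blowup4 p) (Lcurve p a c) y A.u"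
      by (rule A.local_equation_u[OF A.near_Lcurve_u]) (use b ac in auto)
    then show "local_equation (blowup4 p) (Lcurve p a c) y (ratio (formP p a (p c)) (formP p a q))"
      by (simp add: A.u_def formP_def)
  next
    show "proj_class (Evec p a (crs (p a) (p c))) \<noteq> ELpoint p a c" using y2' ELpoint_in(1) by metis
  qed
qed

lemma Ecurve_self_intersection: "has_self_intersection (blowup4 p) (Ecurve p c) (- 1)"
proof -
  obtain q where q: "det3 (p a) (p c) q \<noteq> 0" using exists_q .
  obtain b where b: "b \<noteq> a" "b \<noteq> c" using exists_third .
  have cn: "cone p (Evec p c (crs (p b) (p c)))"
    by (rule cone_Evec[OF gp]) (use gp_crs[OF gp b(2)] in simp_all)
  have y2: "proj_class (Evec p c (crs (p b) (p c))) \<in> Ecurve p c"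
    by (simp add: proj_class_in_Ecurve[OF cn])
  have y2': "proj_class (Evec p c (crs (p b) (p c))) \<notin> Lcurve p a c"
    using gp_det[OF gp, of b c a] b ac by (simp add: proj_class_in_Lcurve[OF cn] dot_crs_det)
  show ?thesis
  proof (rule self_intersection_EL[OF Ecurve_subset q _ ELpoint_in(1) EL_order(2)[OF b q] _ y2])
    fix y assume y: "y \<in> Ecurve p c"
    then show d: "dot (rep y $ Some a) (p c) = 0" by (rule Ecurve_dot[OF gp])
    assume "y \<noteq> ELpoint p a c"
    then have nL: "y \<notin> Lcurve p a c" using y Ecurve_Lcurve_Int[OF gp ac] by blast
    have yX: "y \<in> blowup4 p" using y Ecurve_subset by blast
    obtain s' q' where "blowup_chart p y a c (p c) q s' q'"
      using blowup_chartI[OF gp yX Ecurve_chart[OF gp y nL ac] d q] .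
    then interpret A: blowup_chart p y a c "p c" q s' q' .
    have "local_equation (blowup4 p) (Ecurve p c) y A.u"
      by (rule A.local_equation_u[OF A.near_Ecurve_u[OF gp]]) simp
    then show "local_equation (blowup4 p) (Ecurve p c) y (ratio (formP p a (p c)) (formP p a q))"
      by (simp add: A.u_def formP_def)
  next
    show "proj_class (Evec p c (crs (p b) (p c))) \<noteq> ELpoint p a c" using y2' ELpoint_in(2) by metis
  qed
qed

lemma intersection_number_EL: "intersection_number (blowup4 p) (Ecurve p c) (Lcurve p a c) = 1"
proof -
  obtain q where q: "det3 (p a) (p c) q \<noteq> 0" using exists_q .
  obtain b where b: "b \<noteq> a" "b \<noteq> c" using exists_third .
  show ?thesis using EL_order(3)[OF b q] by (simp add: intersection_number_def Ecurve_Lcurve_Int[OF gp ac])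
qed

end

lemma intersection_number_commute: "intersection_number V C D = intersection_number V D C"
proof -
  have "{\<lambda>y. f y + g y |f g. f \<in> curve_ideal V C x \<and> g \<in> curve_ideal V D x} =
    {\<lambda>y. f y + g y |f g. f \<in> curve_ideal V D x \<and> g \<in> curve_ideal V C x}" for x
    by (auto; metis add.commute)
  then show ?thesis by (simp add: intersection_number_def local_intersection_def Int_commute)
qed

lemma intersection_number_disjoint: "C \<inter> D = {} \<Longrightarrow> intersection_number V C D = 0"
  by (simp add: intersection_number_def)

lemma Ecurve_disjoint: "general_points p \<Longrightarrow> c \<noteq> e \<Longrightarrow> Ecurve p c \<inter> Ecurve p e = {}"
  using Ecurve_not_other[of p _ c e] by (auto simp: Ecurve_def)

lemma Ecurve_Lcurve_disjoint:
  assumes gp: "general_points p" and "a \<noteq> b" "a \<noteq> c" "b \<noteq> c"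
  shows "Ecurve p c \<inter> Lcurve p a b = {}"
proof (rule ccontr)
  assume "\<not> ?thesis"
  then obtain y where y: "y \<in> Ecurve p c" "y \<in> Lcurve p a b" by blast
  have yX: "y \<in> blowup4 p" using y Ecurve_subset by blast
  have "det3 (p a) (p b) (p c) = 0"
    by (rule det3_eq_0_if_perp[OF coneD(1)[OF cone_rep[OF yX], of "Some a"]])
      (use y coneD(2)[OF cone_rep[OF yX], of a] Ecurve_dot[OF gp y(1), of a] in \<open>auto simp: Lcurve_def\<close>)
  with gp_det[OF gp] assms show False by blast
qed

lemma Lcurve_disjoint:
  assumes gp: "general_points p" and "a \<noteq> b" "a \<noteq> c" "b \<noteq> c"
  shows "Lcurve p a b \<inter> Lcurve p a c = {}"
proof (rule ccontr)
  assume "\<not> ?thesis"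
  then obtain y where y: "y \<in> Lcurve p a b" "y \<in> Lcurve p a c" by blast
  have yX: "y \<in> blowup4 p" using y Lcurve_subset by blast
  have "det3 (p a) (p b) (p c) = 0"
    by (rule det3_eq_0_if_perp[OF coneD(1)[OF cone_rep[OF yX], of "Some a"]])
      (use y coneD(2)[OF cone_rep[OF yX], of a] in \<open>auto simp: Lcurve_def\<close>)
  with gp_det[OF gp] assms show False by blast
qed

text \<open>
The two lines meet in the point \<open>x\<close> of the plane that is on no exceptional curve; there the lines
through \<open>p a\<close> and \<open>p c\<close> are chart coordinates, and the two curves are their zero sets.
\<close>

lemma intersection_number_LL:
  fixes p :: "4 \<Rightarrow> 'k::alg_closed_field^3"
  assumes gp: "general_points p" and D: "a \<noteq> b" "a \<noteq> c" "a \<noteq> d" "b \<noteq> c" "b \<noteq> d" "c \<noteq> d"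
  shows "intersection_number (blowup4 p) (Lcurve p a b) (Lcurve p c d) = 1"
proof -
  have all: "e = a \<or> e = b \<or> e = c \<or> e = d" for e
    using D exhaust_4[of a] exhaust_4[of b] exhaust_4[of c] exhaust_4[of d] exhaust_4[of e] by metis
  let ?x = "crs (crs (p a) (p b)) (crs (p c) (p d))"
  have xcd: "?x = det3 (p a) (p b) (p d) *s p c - det3 (p a) (p b) (p c) *s p d"
    by (simp add: crs_crs det3_def)
  have x0: "?x \<noteq> 0"
  proof
    assume "?x = 0"
    then have "crs (p c) ?x = 0" by simp
    moreover have "crs (p c) ?x = (- det3 (p a) (p b) (p c)) *s crs (p c) (p d)"
      unfolding xcd by (simp add: vec_eq_iff forall_3 crs_nth algebra_simps)
    ultimately show False using gp_det[OF gp D(1,2,4)] gp_crs[OF gp D(6)] by simp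
  qed
  define v :: "'k^3^(4 option)" where
    "v = (\<chi> i. case i of None \<Rightarrow> ?x | Some e \<Rightarrow> if e = a \<or> e = b then crs (p a) (p b) else crs (p c) (p d))"
  have v: "v $ None = ?x" "v $ Some a = crs (p a) (p b)" "v $ Some b = crs (p a) (p b)"
    "v $ Some c = crs (p c) (p d)" "v $ Some d = crs (p c) (p d)"
    using D by (simp_all add: v_def)
  have cn: "cone p v"
    unfolding cone_def
  proof (intro conjI allI)
    show "v $ i \<noteq> 0" for i
      using x0 gp_crs[OF gp] D by (cases i) (simp_all add: v_def)
    show "dot (v $ Some i) (p i) = 0" "dot (v $ Some i) (v $ None) = 0" for i
      using all[of i] by (auto simp: v)
  qed
  have y1: "proj_class v \<in> Lcurve p a b" "proj_class v \<in> Lcurve p c d"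
    by (simp_all add: proj_class_in_Lcurve[OF cn] v)
  have uniq: "y = proj_class v" if y: "y \<in> Lcurve p a b" "y \<in> Lcurve p c d" for y
  proof -
    have yX: "y \<in> blowup4 p" using y Lcurve_subset by blast
    note cy = cone_rep[OF yX]
    have dd: "dot (rep y $ Some a) (p b) = 0" "dot (rep y $ Some b) (p a) = 0"
      "dot (rep y $ Some c) (p d) = 0" "dot (rep y $ Some d) (p c) = 0"
      using y by (auto simp: Lcurve_def)
    have 1: "\<exists>k. k \<noteq> 0 \<and> crs (p a) (p b) = k *s rep y $ Some a"
      using parallel_to_cross[OF coneD(2)[OF cy] dd(1) coneD(1)[OF cy] gp_crs[OF gp D(1)]] by metis
    have 2: "\<exists>k. k \<noteq> 0 \<and> crs (p a) (p b) = k *s rep y $ Some b"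
      using parallel_to_cross[OF dd(2) coneD(2)[OF cy] coneD(1)[OF cy] gp_crs[OF gp D(1)]] by metis
    have 3: "\<exists>k. k \<noteq> 0 \<and> crs (p c) (p d) = k *s rep y $ Some c"
      using parallel_to_cross[OF coneD(2)[OF cy] dd(3) coneD(1)[OF cy] gp_crs[OF gp D(6)]] by metis
    have 4: "\<exists>k. k \<noteq> 0 \<and> crs (p c) (p d) = k *s rep y $ Some d"
      using parallel_to_cross[OF dd(4) coneD(2)[OF cy] coneD(1)[OF cy] gp_crs[OF gp D(6)]] by metis
    have "dot (rep y $ None) (crs (p a) (p b)) = 0" "dot (rep y $ None) (crs (p c) (p d)) = 0"
      using 1 3 coneD(5)[OF cy] by auto
    then have 5: "\<exists>k. k \<noteq> 0 \<and> ?x = k *s rep y $ None"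
      using parallel_to_cross[OF _ _ coneD(1)[OF cy] x0] by metis
    have "proj_class (rep y) = proj_class v"
    proof (rule row_scale_eqI)
      show "\<exists>k. k \<noteq> 0 \<and> v $ i = k *s rep y $ i" for i
      proof (cases i)
        case None
        then show ?thesis using 5 v by simp
      next
        case (Some e)
        then show ?thesis using all[of e] 1 2 3 4 v by auto
      qed
    qed
    then show ?thesis using blowup4_rep[OF yX] by simp
  qed
  have int: "Lcurve p a b \<inter> Lcurve p c d = {proj_class v}" using uniq y1 by blast
  have yX: "proj_class v \<in> blowup4 p" by (rule blowup4I[OF cn])
  have "proj_class v \<notin> Ecurve p b"
    using Ecurve_Lcurve_disjoint[OF gp D(6), of b] D y1 by auto
  then have "chart p a c (rep (proj_class v))"
    by (rule Lcurve_chart[OF gp y1(1) _ D(1)]) (use D in auto)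
  moreover obtain q where q: "det3 (p a) (p b) q \<noteq> 0" using exists_q[OF gp D(1)] .
  moreover obtain q' where q': "det3 (p c) (p d) q' \<noteq> 0" using exists_q[OF gp D(6)] .
  moreover have d1: "dot (rep (proj_class v) $ Some a) (p b) = 0" "dot (rep (proj_class v) $ Some c) (p d) = 0"
    using y1 by (auto simp: Lcurve_def)
  ultimately have "blowup_chart p (proj_class v) a c (p b) q (p d) q'"
    using yX row_dot_nonzero[OF yX d1(1) q] row_dot_nonzero[OF yX d1(2) q'] by unfold_locales auto
  then interpret A: blowup_chart p "proj_class v" a c "p b" q "p d" q' .
  have "local_intersection (blowup4 p) (Lcurve p a b) (Lcurve p c d) (proj_class v) = 1"
    by (rule A.local_intersection_uw[OF A.near_Lcurve_u y1(1) Lcurve_subset A.near_Lcurve_w y1(2) Lcurve_subset])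
      (use D in auto)
  then show ?thesis by (simp add: intersection_number_def int)
qed

section \<open>Rational curves\<close>

lemma forms_row_scale:
  assumes "\<And>j k. form (D j) (\<lambda>v. F v $ j $ k)"
  shows "F (row_scale c v) = row_scale (\<lambda>j. \<Prod>i\<in>UNIV. c i ^ D j i) (F v)"
  using form_scale[OF assms] by (simp add: vec_eq_iff)

lemma form_compose:
  fixes F :: "'k::field^'n^'i::finite \<Rightarrow> 'k^'m^'j::finite"
  assumes F: "\<And>j k. form (D j) (\<lambda>v. F v $ j $ k)" and P: "form d P"
  shows "form (\<lambda>i. \<Sum>j\<in>UNIV. d j * D j i) (\<lambda>v. P (F v))"
  unfolding form_def
proof (intro conjI allI)
  show "poly_fun (\<lambda>v. P (F v))"
    by (rule poly_fun_compose[OF form_poly_fun[OF P] form_poly_fun[OF F]])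
  fix c :: "'i \<Rightarrow> 'k" and v
  have "(\<Prod>j\<in>UNIV. (\<Prod>i\<in>UNIV. c i ^ D j i) ^ d j) = (\<Prod>j\<in>UNIV. \<Prod>i\<in>UNIV. c i ^ (d j * D j i))"
    by (simp add: prod_power_distrib mult.commute[of "d _"] power_mult)
  also have "\<dots> = (\<Prod>i\<in>UNIV. \<Prod>j\<in>UNIV. c i ^ (d j * D j i))" by (rule prod.swap)
  also have "\<dots> = (\<Prod>i\<in>UNIV. c i ^ (\<Sum>j\<in>UNIV. d j * D j i))"
    by (simp add: power_sum)
  finally show "P (F (row_scale c v)) = (\<Prod>i\<in>UNIV. c i ^ (\<Sum>j\<in>UNIV. d j * D j i)) * P (F v)"
    using form_scale[OF P] by (simp add: forms_row_scale[where F = F, OF F])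
qed

lemma proj_class_forms:
  assumes F: "\<And>j k. form (D j) (\<lambda>v. F v $ j $ k)" and "proj_class v = proj_class w"
  shows "proj_class (F v) = proj_class (F w)"
proof -
  obtain c where c: "\<forall>i. c i \<noteq> 0" "w = row_scale c v" using assms(2) unfolding proj_class_eq_iff by blast
  then show ?thesis unfolding c(2) forms_row_scale[where F = F, OF F]
    by (subst proj_class_row_scale) auto
qed

lemma morphism_forms:
  assumes F: "\<And>j k. form (D j) (\<lambda>v. F v $ j $ k)"
    and W: "\<And>y. y \<in> V \<Longrightarrow> proj_class (F (rep y)) \<in> W"
  shows "morphism V W (\<lambda>y. proj_class (F (rep y)))"
  unfolding morphism_def
proof (intro ballI conjI)
  fix x assume x: "x \<in> V"
  then show "proj_class (F (rep x)) \<in> W" by (rule W)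
  fix f assume "f \<in> local_ring W (proj_class (F (rep x)))"
  then obtain d P Q where 1: "form d P" "form d Q" "Q (rep (proj_class (F (rep x)))) \<noteq> 0"
    "\<And>y. y \<in> W \<Longrightarrow> Q (rep y) \<noteq> 0 \<Longrightarrow> f y = ratio P Q y" by (rule local_ringE) blast
  note forms = form_compose[where F = F, OF F 1(1)] form_compose[where F = F, OF F 1(2)]
  show "f \<circ> (\<lambda>y. proj_class (F (rep y))) \<in> local_ring V x"
    unfolding local_ring_def
  proof (rule CollectI, intro exI conjI ballI impI)
    show "form (\<lambda>i. \<Sum>j\<in>UNIV. d j * D j i) (\<lambda>v. P (F v))"
      "form (\<lambda>i. \<Sum>j\<in>UNIV. d j * D j i) (\<lambda>v. Q (F v))" by (rule forms)+
    show "Q (F (rep x)) \<noteq> 0" using 1(3) form_rep_eq_0[OF 1(2)] by simp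
    fix y assume y: "y \<in> V" "Q (F (rep y)) \<noteq> 0"
    then have "f (proj_class (F (rep y))) = ratio P Q (proj_class (F (rep y)))"
      by (intro 1(4) W) (simp_all add: form_rep_eq_0[OF 1(2)])
    then show "(f \<circ> (\<lambda>y. proj_class (F (rep y)))) y = ratio (\<lambda>v. P (F v)) (\<lambda>v. Q (F v)) y"
      using ratio_proj_class[OF 1(1,2), of "F (rep y)"]
      by (simp add: ratio_def[of "\<lambda>v. P (F v)"])
  qed
qed

lemma zclosed_empty: "zclosed V {}"
  unfolding zclosed_def
  by (rule exI[of _ "{\<lambda>_. 1}"]) (auto intro: form_const)

lemma zclosed_Un:
  assumes "zclosed V A" "zclosed V B"
  shows "zclosed V (A \<union> B)"
proof -
  obtain F G where F: "\<forall>P\<in>F. \<exists>d. form d P" "A = {y \<in> V. \<forall>P\<in>F. P (rep y) = 0}"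
    and G: "\<forall>P\<in>G. \<exists>d. form d P" "B = {y \<in> V. \<forall>P\<in>G. P (rep y) = 0}"
    using assms unfolding zclosed_def by blast
  let ?S = "(\<lambda>(P, Q) v. P v * Q v) ` (F \<times> G)"
  have "\<exists>d. form d R" if "R \<in> ?S" for R
  proof -
    from that obtain P Q where R: "R = (\<lambda>v. P v * Q v)" "P \<in> F" "Q \<in> G" by auto
    then obtain d e where "form d P" "form e Q" using F(1) G(1) by blast
    then show "\<exists>d. form d R" unfolding R(1) using form_mult by blast
  qed
  moreover have "A \<union> B = {y \<in> V. \<forall>R\<in>?S. R (rep y) = 0}"
  proof -
    have "(\<forall>R\<in>?S. R (rep y) = 0) \<longleftrightarrow> (\<forall>P\<in>F. P (rep y) = 0) \<or> (\<forall>Q\<in>G. Q (rep y) = 0)" for y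
      by auto
    then show ?thesis unfolding F(2) G(2) by blast
  qed
  ultimately show ?thesis unfolding zclosed_def by blast
qed

lemma zclosed_point:
  assumes V: "V \<subseteq> multiproj" and y: "y \<in> V"
  shows "zclosed V {y}"
proof -
  define w where "w = rep y"
  let ?F = "(\<lambda>(i, j, k) v. v $ i $ j * w $ i $ k - v $ i $ k * w $ i $ j) ` UNIV"
  have "\<forall>P\<in>?F. \<exists>d. form d P"
  proof
    fix P assume "P \<in> ?F"
    then obtain i j k where P: "P = (\<lambda>v. v $ i $ j * w $ i $ k - v $ i $ k * w $ i $ j)" by auto
    have "form (rowdeg i) (\<lambda>v. w $ i $ k * v $ i $ j - w $ i $ j * v $ i $ k)"
      by (intro form_diff form_cmult form_coord)
    then show "\<exists>d. form d P" unfolding P by (auto simp: mult.commute)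
  qed
  moreover have "{y} = {y' \<in> V. \<forall>P\<in>?F. P (rep y') = 0}"
  proof (intro equalityI subsetI)
    fix y' assume "y' \<in> {y' \<in> V. \<forall>P\<in>?F. P (rep y') = 0}"
    then have y': "y' \<in> V" and eq: "rep y' $ i $ j * w $ i $ k = rep y' $ i $ k * w $ i $ j" for i j k
      by auto
    have cl: "proj_class (rep z) = z" if "z \<in> V" for z
      using that V by (auto simp: multiproj_def)
    have "proj_class (rep y') = proj_class w"
    proof (rule row_scale_eqI)
      fix i
      obtain j where j: "rep y' $ i $ j \<noteq> 0" using rep_nonzero[of y' i] y' V by (auto simp: vec_eq_iff)
      obtain k where k: "w $ i $ k \<noteq> 0" using rep_nonzero[of y i] y V by (auto simp: vec_eq_iff w_def)
      from proportional[of "\<lambda>j. rep y' $ i $ j" "\<lambda>j. w $ i $ j" j k, OF eq j k]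
      show "\<exists>c. c \<noteq> 0 \<and> w $ i = c *s rep y' $ i" by (simp add: vec_eq_iff)
    qed
    then show "y' \<in> {y}" using cl[OF y'] cl[OF y] by (simp add: w_def)
  qed (use y in \<open>auto simp: w_def\<close>)
  ultimately show ?thesis unfolding zclosed_def by blast
qed

lemma zclosed_finite: "finite Z \<Longrightarrow> V \<subseteq> multiproj \<Longrightarrow> Z \<subseteq> V \<Longrightarrow> zclosed V Z"
proof (induction Z rule: finite_induct)
  case empty
  then show ?case by (simp add: zclosed_empty)
next
  case (insert y Z)
  then show ?case using zclosed_Un[of V "{y}" Z] zclosed_point[of V y] by simp
qed

lemma zclosed_subset: "zclosed V Z \<Longrightarrow> Z \<subseteq> V"
  unfolding zclosed_def by blast

lemma irreducible_point: "V \<subseteq> multiproj \<Longrightarrow> y \<in> V \<Longrightarrow> irreducible_closed V {y}"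
  unfolding irreducible_closed_def using zclosed_point by blast

lemma irreducible_closedD:
  assumes "irreducible_closed V Z"
  shows "zclosed V Z" "Z \<noteq> {}" "zclosed V A \<Longrightarrow> zclosed V B \<Longrightarrow> Z = A \<union> B \<Longrightarrow> Z = A \<or> Z = B"
  using assms by (simp_all add: irreducible_closed_def)

text \<open>
If the proper closed subsets of an infinite closed set are finite, then it is irreducible, and its proper
irreducible closed subsets are the points.
\<close>

lemma curve_onI:
  assumes V: "V \<subseteq> multiproj" and C: "zclosed V C" "infinite C"
    and fin: "\<And>Z. zclosed V Z \<Longrightarrow> Z \<subseteq> C \<Longrightarrow> Z \<noteq> C \<Longrightarrow> finite Z"
  shows "curve_on V C"
proof -
  have "C \<noteq> {}" using C(2) by auto
  then obtain y where y: "y \<in> C" by blast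
  have "irreducible_closed V C"
    unfolding irreducible_closed_def
  proof (intro conjI allI impI C(1) \<open>C \<noteq> {}\<close>)
    fix A B assume AB: "zclosed V A \<and> zclosed V B \<and> C = A \<union> B"
    show "C = A \<or> C = B"
    proof (rule ccontr)
      assume "\<not> ?thesis"
      then have "finite A" "finite B" by (intro fin; use AB in blast)+
      then have "finite C" using AB by simp
      with C(2) show False by simp
    qed
  qed
  moreover have "\<exists>Z. irreducible_closed V Z \<and> Z \<subset> C"
  proof (intro exI conjI)
    show "irreducible_closed V {y}"
      by (rule irreducible_point[OF V]) (use zclosed_subset[OF C(1)] y in blast)
    have "{y} \<noteq> C" using C(2) by auto
    then show "{y} \<subset> C" using y by blast
  qed
  moreover have "\<not> (\<exists>Z\<^sub>1 Z\<^sub>2. irreducible_closed V Z\<^sub>1 \<and> irreducible_closed V Z\<^sub>2 \<and> Z\<^sub>1 \<subset> Z\<^sub>2 \<and> Z\<^sub>2 \<subset> C)"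
  proof
    assume "\<exists>Z\<^sub>1 Z\<^sub>2. irreducible_closed V Z\<^sub>1 \<and> irreducible_closed V Z\<^sub>2 \<and> Z\<^sub>1 \<subset> Z\<^sub>2 \<and> Z\<^sub>2 \<subset> C"
    then obtain Z1 Z2 where Z: "irreducible_closed V Z1" "irreducible_closed V Z2" "Z1 \<subset> Z2" "Z2 \<subset> C" by blast
    have f: "finite Z2"
      by (rule fin[OF irreducible_closedD(1)[OF Z(2)]]) (use Z(4) in auto)
    obtain x where x: "x \<in> Z1" using irreducible_closedD(2)[OF Z(1)] by blast
    have sub: "Z2 \<subseteq> V" by (rule zclosed_subset[OF irreducible_closedD(1)[OF Z(2)]])
    have cl: "zclosed V {x}" "zclosed V (Z2 - {x})"
      by (intro zclosed_finite V finite_Diff f finite.intros; use sub x Z(3) in blast)+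
    have "Z2 = {x} \<union> (Z2 - {x})" using x Z(3) by blast
    then have "Z2 = {x} \<or> Z2 = Z2 - {x}" by (rule irreducible_closedD(3)[OF Z(2) cl])
    then show False
    proof
      assume "Z2 = {x}"
      then show False using x Z(3) by blast
    next
      assume "Z2 = Z2 - {x}"
      then show False using x Z(3) by blast
    qed
  qed
  ultimately show ?thesis unfolding curve_on_def by (intro conjI)
qed

text \<open>
Here \<open>Y\<close> parametrizes \<open>C\<close> and the forms \<open>G\<close> recover the parameter. A closed proper subset of \<open>C\<close> is
finite, because some form vanishing on it becomes a nonzero form on the line.
\<close>

lemma rational_curve:
  fixes Y :: "'k::alg_closed_field^2^1 \<Rightarrow> 'k^'n::finite^'i::finite"
  assumes V: "V \<subseteq> multiproj"
    and Y: "\<And>i j. form (D i) (\<lambda>z. Y z $ i $ j)" and G: "\<And>i j. form (E i) (\<lambda>v. G v $ i $ j)"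
    and GY: "\<And>z. z $ 1 \<noteq> 0 \<Longrightarrow> \<exists>k. k \<noteq> 0 \<and> G (Y z) = row_scale (\<lambda>_. k) z"
    and C: "C = {proj_class (Y z) |z. z $ 1 \<noteq> 0}" "zclosed V C"
  shows "curve_on V C" "isomorphic_varieties projective_line C"
proof -
  define \<phi> where "\<phi> z = proj_class (Y (rep z))" for z
  define \<psi> where "\<psi> y = proj_class (G (rep y))" for y
  have phi: "\<phi> (proj_class z) = proj_class (Y z)" for z
    unfolding \<phi>_def by (rule proj_class_forms[where F = Y, OF Y]) simp
  have psi: "\<psi> (proj_class v) = proj_class (G v)" for v
    unfolding \<psi>_def by (rule proj_class_forms[where F = G, OF G]) simp
  have inv: "\<psi> (\<phi> (proj_class z)) = proj_class z" if "z $ 1 \<noteq> 0" for z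
  proof -
    obtain k where "k \<noteq> 0" "G (Y z) = row_scale (\<lambda>_. k) z" using GY[OF \<open>z $ 1 \<noteq> 0\<close>] by blast
    then show ?thesis by (simp add: phi psi proj_class_row_scale)
  qed
  have Cphi: "y \<in> C \<longleftrightarrow> (\<exists>z. z $ 1 \<noteq> 0 \<and> y = \<phi> (proj_class z))" for y
    unfolding C(1) phi by blast
  have m1: "morphism projective_line C \<phi>"
    unfolding \<phi>_def[abs_def]
  proof (rule morphism_forms[where F = Y, OF Y])
    fix y :: "('k, 2, 1) mpoint" assume "y \<in> projective_line"
    then obtain z where "z $ 1 \<noteq> 0" "y = proj_class z" by (auto simp: projective_line_iff)
    then have "\<phi> y \<in> C" using Cphi by blast
    then show "proj_class (Y (rep y)) \<in> C" by (simp only: \<phi>_def)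
  qed
  have m2: "morphism C projective_line \<psi>"
    unfolding \<psi>_def[abs_def]
  proof (rule morphism_forms[where F = G, OF G])
    fix y assume "y \<in> C"
    then obtain z where z: "z $ 1 \<noteq> 0" "y = \<phi> (proj_class z)" using Cphi by blast
    then have "\<psi> y \<in> projective_line" using inv[OF z(1)] proj_class_in_line[OF z(1)] by (simp only:)
    then show "proj_class (G (rep y)) \<in> projective_line" by (simp only: \<psi>_def)
  qed
  show "isomorphic_varieties projective_line C"
    unfolding isomorphic_varieties_def
  proof (rule exI[of _ \<phi>], rule exI[of _ \<psi>], intro conjI ballI m1 m2)
    fix x :: "('k, 2, 1) mpoint" assume "x \<in> projective_line"
    then obtain z where z: "z $ 1 \<noteq> 0" "x = proj_class z" unfolding projective_line_iff by blast
    show "\<psi> (\<phi> x) = x" unfolding z(2) by (rule inv[OF z(1)])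
  next
    fix y assume "y \<in> C"
    then obtain z where z: "z $ 1 \<noteq> 0" "y = \<phi> (proj_class z)" using Cphi by blast
    show "\<phi> (\<psi> y) = y" unfolding z(2) inv[OF z(1)] ..
  qed
  define e1 :: "'k^2^1" where "e1 = (\<chi> i j. if j = 1 then 1 else 0)"
  define e2 :: "'k^2^1" where "e2 = (\<chi> i j. if j = 2 then 1 else 0)"
  have ind: "det2 e1 e2 \<noteq> 0" by (simp add: det2_def e1_def e2_def)
  show "curve_on V C"
  proof (rule curve_onI[OF V C(2)])
    have inj: "inj (\<lambda>t. \<phi> (proj_class (pl e1 e2 t)))"
    proof (rule injI)
      fix s t assume "\<phi> (proj_class (pl e1 e2 s)) = \<phi> (proj_class (pl e1 e2 t))"
      then have "\<psi> (\<phi> (proj_class (pl e1 e2 s))) = \<psi> (\<phi> (proj_class (pl e1 e2 t)))" by (rule arg_cong)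
      then have "proj_class (pl e1 e2 s) = proj_class (pl e1 e2 t)"
        unfolding inv[OF pl_nonzero[OF ind]] .
      then obtain c where c: "pl e1 e2 t = row_scale c (pl e1 e2 s)" unfolding proj_class_eq_iff by blast
      have "pl e1 e2 t $ 1 $ 1 = c 1 * pl e1 e2 s $ 1 $ 1" "pl e1 e2 t $ 1 $ 2 = c 1 * pl e1 e2 s $ 1 $ 2"
        unfolding c by simp_all
      moreover have "pl e1 e2 r $ 1 $ 1 = 1" "pl e1 e2 r $ 1 $ 2 = r" for r
        by (simp_all add: pl_def e1_def e2_def)
      ultimately show "s = t" by simp
    qed
    have "infinite (range (\<lambda>t. \<phi> (proj_class (pl e1 e2 t))))"
    proof
      assume "finite (range (\<lambda>t. \<phi> (proj_class (pl e1 e2 t))))"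
      from finite_imageD[OF this inj] show False by (rule notE[OF infinite_alg_closed])
    qed
    moreover have "range (\<lambda>t. \<phi> (proj_class (pl e1 e2 t))) \<subseteq> C"
    proof (rule image_subsetI)
      show "\<phi> (proj_class (pl e1 e2 t)) \<in> C" for t
        unfolding Cphi by (rule exI[of _ "pl e1 e2 t"]) (simp add: pl_nonzero[OF ind])
    qed
    ultimately show "infinite C" using finite_subset by blast
    fix Z assume Z: "zclosed V Z" "Z \<subseteq> C" "Z \<noteq> C"
    obtain F where F: "\<forall>P\<in>F. \<exists>d. form d P" "Z = {y \<in> V. \<forall>P\<in>F. P (rep y) = 0}"
      using Z(1) unfolding zclosed_def by blast
    obtain y0 where y0: "y0 \<in> C" "y0 \<notin> Z" using Z(2,3) by blast
    obtain z0 where z0: "z0 $ 1 \<noteq> 0" "y0 = proj_class (Y z0)" using y0(1) unfolding C(1) by blast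
    have "proj_class (Y z0) \<in> V" using zclosed_subset[OF C(2)] y0(1) z0(2) by blast
    then obtain P where P: "P \<in> F" "P (rep (proj_class (Y z0))) \<noteq> 0" using y0(2) z0(2) F(2) by blast
    obtain d where d: "form d P" using F(1) P(1) by blast
    have P0: "P (Y z0) \<noteq> 0" using P(2) by (simp add: form_rep_eq_0[OF d])
    have PY: "form (\<lambda>i. \<Sum>j\<in>UNIV. d j * D j i) (\<lambda>z. P (Y z))" by (rule form_compose[where F = Y, OF Y d])
    have "plift (\<lambda>z. P (Y z)) (lin e1 e2) \<noteq> 0"
    proof
      assume "plift (\<lambda>z. P (Y z)) (lin e1 e2) = 0"
      then have "P (Y (pl e1 e2 t)) = 0" for t
        using poly_plift[OF form_poly_fun[OF PY], of "lin e1 e2" t] by simp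
      then show False using form_zero_line[OF PY ind, of z0] P0 by simp
    qed
    from poly_roots_finite[OF this] have fin: "finite {t. P (Y (pl e1 e2 t)) = 0}"
      by (simp add: poly_plift[OF form_poly_fun[OF PY]])
    have "Z \<subseteq> insert (\<phi> (proj_class e2)) ((\<lambda>t. \<phi> (proj_class (pl e1 e2 t))) ` {t. P (Y (pl e1 e2 t)) = 0})"
    proof
      fix y assume y: "y \<in> Z"
      then have "y \<in> C" using Z(2) by blast
      then obtain z where z: "z $ 1 \<noteq> 0" "y = \<phi> (proj_class z)" unfolding Cphi by blast
      have "P (rep y) = 0" using y P(1) F(2) by blast
      show "y \<in> insert (\<phi> (proj_class e2)) ((\<lambda>t. \<phi> (proj_class (pl e1 e2 t))) ` {t. P (Y (pl e1 e2 t)) = 0})"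
        using P1_cases[OF ind z(1)]
      proof
        assume "proj_class z = proj_class e2"
        then show ?thesis using z(2) by simp
      next
        assume "\<exists>t. proj_class z = proj_class (pl e1 e2 t)"
        then obtain t where t: "y = \<phi> (proj_class (pl e1 e2 t))" using z(2) by auto
        then have "P (Y (pl e1 e2 t)) = 0" using \<open>P (rep y) = 0\<close> by (simp add: phi form_rep_eq_0[OF d])
        then show ?thesis using t by blast
      qed
    qed
    then show "finite Z" using fin by (meson finite_imageI finite_insert finite_subset)
  qed
qed

lemma zclosed_Ecurve: "zclosed (blowup4 p) (Ecurve p c)"
  unfolding zclosed_def
proof (intro exI conjI)
  show "\<forall>P\<in>range (\<lambda>j v. crs (p c) (v $ None) $ j). \<exists>d. form d P"
    using form_crs_const by blast
  show "Ecurve p c = {y \<in> blowup4 p. \<forall>P\<in>range (\<lambda>j v. crs (p c) (v $ None) $ j). P (rep y) = 0}"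
    by (auto simp: Ecurve_def vec_eq_iff)
qed

lemma zclosed_Lcurve: "zclosed (blowup4 p) (Lcurve p a c)"
  unfolding zclosed_def
proof (intro exI conjI)
  show "\<forall>P\<in>{\<lambda>v. dot (v $ Some a) (p c), \<lambda>v. dot (v $ Some c) (p a)}. \<exists>d. form d P"
    using form_dot by blast
  show "Lcurve p a c = {y \<in> blowup4 p. \<forall>P\<in>{\<lambda>v. dot (v $ Some a) (p c), \<lambda>v. dot (v $ Some c) (p a)}. P (rep y) = 0}"
    by (auto simp: Lcurve_def)
qed

lemma form1_coord: "form (\<lambda>_. 1) (\<lambda>z::'k::field^2^1. z $ 1 $ j)"
proof -
  have *: "rowdeg (1::1) = (\<lambda>_. 1)" by (rule fun_num1_eqI) (simp add: rowdeg_def)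
  show ?thesis using form_coord[of "1::1" j] unfolding * .
qed

lemma Ecurve_rational:
  fixes p :: "4 \<Rightarrow> 'k::alg_closed_field^3"
  assumes gp: "general_points p"
  shows "curve_on (blowup4 p) (Ecurve p c)" "isomorphic_varieties projective_line (Ecurve p c)"
proof -
  obtain s q where sq: "det3 (p c) s q \<noteq> 0"
    using exists_perp[of "p c" 0] exists_coords[OF _ _ gp_nonzero[OF gp]] by (metis dot_commute)
  define \<Delta> where "\<Delta> = det3 (p c) s q"
  define L where "L z = z $ 1 $ 1 *s crs (p c) s - z $ 1 $ 2 *s crs (p c) q" for z :: "'k^2^1"
  define Y where "Y z = Evec p c (L z)" for z
  define G :: "'k^3^(4 option) \<Rightarrow> 'k^2^1" where
    "G v = (\<chi> i j. dot (v $ Some c) (if j = 1 then q else s))" for v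
  have L: "dot (L z) (p c) = 0" "dot (L z) q = z $ 1 $ 1 * \<Delta>" "dot (L z) s = z $ 1 $ 2 * \<Delta>" for z
    using det3_perm(2)[of "p c" s q] by (simp_all add: L_def \<Delta>_def dot_diff dot_crs_det)
  have GY: "G (Y z) = row_scale (\<lambda>_. \<Delta>) z" for z
    by (simp add: G_def Y_def vec_eq_iff forall_2 forall_1 L mult.commute)
  have L0: "L z \<noteq> 0" if "z $ 1 \<noteq> 0" for z
  proof
    assume "L z = 0"
    then have "z $ 1 $ 1 * \<Delta> = 0" "z $ 1 $ 2 * \<Delta> = 0" using L(2,3)[of z] by simp_all
    then show False using that sq by (simp add: vec_eq_iff forall_2 \<Delta>_def)
  qed
  define D :: "4 option \<Rightarrow> 1 \<Rightarrow> nat" where "D i = (\<lambda>_. if i = Some c then 1 else 0)" for i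
  have formY: "form (D i) (\<lambda>z. Y z $ i $ j)" for i j
  proof (cases "i = Some c")
    case True
    have "form (\<lambda>_. 1) (\<lambda>z::'k^2^1. crs (p c) s $ j * z $ 1 $ 1 - crs (p c) q $ j * z $ 1 $ 2)"
      by (intro form_diff form_cmult form1_coord)
    with True show ?thesis by (simp add: D_def Y_def L_def mult.commute)
  next
    case False
    then show ?thesis by (cases i) (auto simp: D_def Y_def Evec_def form_const)
  qed
  have formG: "form (rowdeg (Some c)) (\<lambda>v. G v $ i $ j)" for i j
    by (simp add: G_def form_dot)
  have C: "Ecurve p c = {proj_class (Y z) |z. z $ 1 \<noteq> 0}"
  proof (intro equalityI subsetI)
    fix y assume "y \<in> {proj_class (Y z) |z. z $ 1 \<noteq> 0}"
    then obtain z where z: "z $ 1 \<noteq> 0" "y = proj_class (Y z)" by blast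
    have "cone p (Y z)" unfolding Y_def by (rule cone_Evec[OF gp L0[OF z(1)] L(1)])
    then show "y \<in> Ecurve p c" unfolding z(2) by (simp add: proj_class_in_Ecurve) (simp add: Y_def)
  next
    fix y assume y: "y \<in> Ecurve p c"
    then have yX: "y \<in> blowup4 p" and x: "crs (p c) (rep y $ None) = 0" by (auto simp: Ecurve_def)
    note cn = cone_rep[OF yX]
    obtain k where k: "k \<noteq> 0" "rep y $ None = k *s p c" using crs_gp_eq_0[OF gp x coneD(1)[OF cn]] .
    define z where "z = G (rep y)"
    have Lz: "L z = \<Delta> *s rep y $ Some c"
      using cramer_line[OF coneD(2)[OF cn, of c], of s q] by (simp add: z_def G_def L_def \<Delta>_def)
    have "z $ 1 \<noteq> 0"
    proof
      assume "z $ 1 = 0"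
      then have "L z = 0" by (simp add: L_def)
      then show False using Lz sq coneD(1)[OF cn] by (simp add: \<Delta>_def)
    qed
    moreover have "proj_class (rep y) = proj_class (Y z)"
    proof (rule row_scale_eqI)
      fix i
      show "\<exists>e. e \<noteq> 0 \<and> Y z $ i = e *s rep y $ i"
      proof (cases i)
        case None
        then show ?thesis using k by (intro exI[of _ "1 / k"]) (simp add: Y_def vector_smult_assoc)
      next
        case (Some e)
        show ?thesis
        proof (cases "e = c")
          case True
          then show ?thesis using Some Lz sq by (auto simp: Y_def \<Delta>_def)
        next
          case False
          obtain k' where k': "k' \<noteq> 0" "crs (p e) (rep y $ None) = k' *s rep y $ Some e"
            using cone_row_cross[OF cn Ecurve_not_other[OF gp y False]] by metis
          have "k *s crs (p e) (p c) = k' *s rep y $ Some e" using k'(2) k(2) by simp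
          then have "(1 / k) *s (k *s crs (p e) (p c)) = (1 / k) *s (k' *s rep y $ Some e)" by simp
          then have "crs (p e) (p c) = (k' / k) *s rep y $ Some e" using k by (simp add: vector_smult_assoc)
          then show ?thesis using Some False k k' by (intro exI[of _ "k' / k"]) (simp add: Y_def)
        qed
      qed
    qed
    ultimately show "y \<in> {proj_class (Y z) |z. z $ 1 \<noteq> 0}" using blowup4_rep[OF yX] by auto
  qed
  have GY': "\<exists>k. k \<noteq> 0 \<and> G (Y z) = row_scale (\<lambda>_. k) z" for z
    using GY sq unfolding \<Delta>_def by blast
  show "curve_on (blowup4 p) (Ecurve p c)" "isomorphic_varieties projective_line (Ecurve p c)"
    using rational_curve[where Y = Y and G = G, OF blowup4_multiproj formY formG GY' C zclosed_Ecurve] by blast+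
qed

lemma plane_combination:
  "det3 a c q *s x = dot x (crs c q) *s a + dot x (crs q a) *s c + dot x (crs a c) *s (q::'k::comm_ring_1^3)"
  by (simp add: vec_eq_iff forall_3 det3_def crs_nth dot_def algebra_simps)

lemma Lcurve_rational:
  fixes p :: "4 \<Rightarrow> 'k::alg_closed_field^3"
  assumes gp: "general_points p" and ac: "a \<noteq> c"
  shows "curve_on (blowup4 p) (Lcurve p a c)" "isomorphic_varieties projective_line (Lcurve p a c)"
proof -
  obtain q where q: "det3 (p a) (p c) q \<noteq> 0" using exists_q[OF gp ac] .
  define \<Delta> where "\<Delta> = det3 (p a) (p c) q"
  define x where "x z = z $ 1 $ 1 *s p a + z $ 1 $ 2 *s p c" for z :: "'k^2^1"
  define Y :: "'k^2^1 \<Rightarrow> 'k^3^(4 option)" where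
    "Y z = (\<chi> i. case i of None \<Rightarrow> x z | Some b \<Rightarrow> if b = a \<or> b = c then crs (p a) (p c) else crs (p b) (x z))" for z
  define G :: "'k^3^(4 option) \<Rightarrow> 'k^2^1" where
    "G v = (\<chi> i j. dot (v $ None) (if j = 1 then crs (p c) q else crs q (p a)))" for v
  have YN: "Y z $ None = x z" for z by (simp add: Y_def)
  have "dot (x z) (crs (p c) q) = \<Delta> * z $ 1 $ 1" "dot (x z) (crs q (p a)) = \<Delta> * z $ 1 $ 2" for z
    by (simp_all add: x_def \<Delta>_def det3_def dot_def crs_nth algebra_simps)
  then have GY: "G (Y z) = row_scale (\<lambda>_. \<Delta>) z" for z
    by (simp add: G_def YN vec_eq_iff forall_2 forall_1)
  have x0: "x z \<noteq> 0" if "z $ 1 \<noteq> 0" for z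
  proof
    assume "x z = 0"
    then have "G (Y z) = (\<chi> i j. 0)" by (simp add: G_def YN cong: if_cong)
    then have "G (Y z) = 0" by (simp add: vec_eq_iff)
    then have "row_scale (\<lambda>_. \<Delta>) z $ 1 = 0" using GY by simp
    then show False using that q by (simp add: \<Delta>_def)
  qed
  have bx: "crs (p b) (x z) \<noteq> 0" if zb: "z $ 1 \<noteq> 0" "b \<noteq> a" "b \<noteq> c" for b z
  proof
    assume "crs (p b) (x z) = 0"
    then obtain k where k: "k \<noteq> 0" "x z = k *s p b" using x0[OF zb(1)] by (rule crs_gp_eq_0[OF gp])
    have "dot (crs (p a) (p c)) (x z) = 0" by (simp add: x_def dot_add)
    then have "det3 (p a) (p c) (p b) = 0" using k by (simp add: det3_def)
    with gp_det[OF gp ac, of b] zb show False by simp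
  qed
  define D :: "4 option \<Rightarrow> 1 \<Rightarrow> nat" where "D i = (\<lambda>_. if i = Some a \<or> i = Some c then 0 else 1)" for i
  have formx: "form (\<lambda>_. 1) (\<lambda>z. x z $ j)" for j
  proof -
    have "form (\<lambda>_. 1) (\<lambda>z::'k^2^1. p a $ j * z $ 1 $ 1 + p c $ j * z $ 1 $ 2)"
      by (intro form_add form_cmult form1_coord)
    then show ?thesis by (simp add: x_def mult.commute)
  qed
  have formbx: "form (\<lambda>_. 1) (\<lambda>z. crs (p b) (x z) $ j)" for b j
    using exhaust_3[of j] by (elim disjE) (simp_all only: crs_nth, (intro form_diff form_cmult formx)+)
  have formY: "form (D i) (\<lambda>z. Y z $ i $ j)" for i j
  proof (cases i)
    case None
    then show ?thesis using formx by (simp add: D_def Y_def)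
  next
    case (Some b)
    then show ?thesis using formbx by (cases "b = a \<or> b = c") (auto simp: D_def Y_def form_const)
  qed
  have formG: "form (rowdeg None) (\<lambda>v. G v $ i $ j)" for i j
    by (simp add: G_def form_dot)
  have C: "Lcurve p a c = {proj_class (Y z) |z. z $ 1 \<noteq> 0}"
  proof (intro equalityI subsetI)
    fix y assume "y \<in> {proj_class (Y z) |z. z $ 1 \<noteq> 0}"
    then obtain z where z: "z $ 1 \<noteq> 0" "y = proj_class (Y z)" by blast
    have dx: "dot (crs (p a) (p c)) (x z) = 0" by (simp add: x_def dot_add)
    have "cone p (Y z)" unfolding cone_def
    proof (intro conjI allI)
      show "Y z $ i \<noteq> 0" for i
        using x0[OF z(1)] bx[OF z(1)] gp_crs[OF gp ac] by (cases i) (auto simp: Y_def)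
      show "dot (Y z $ Some i) (p i) = 0" "dot (Y z $ Some i) (Y z $ None) = 0" for i
        by (auto simp: Y_def dx)
    qed
    then show "y \<in> Lcurve p a c" unfolding z(2) by (simp add: proj_class_in_Lcurve) (simp add: Y_def)
  next
    fix y assume y: "y \<in> Lcurve p a c"
    then have yX: "y \<in> blowup4 p" and d: "dot (rep y $ Some a) (p c) = 0" "dot (rep y $ Some c) (p a) = 0"
      by (auto simp: Lcurve_def)
    note cn = cone_rep[OF yX]
    obtain k where k: "k \<noteq> 0" "crs (p a) (p c) = k *s rep y $ Some a"
      using parallel_to_cross[OF coneD(2)[OF cn] d(1) coneD(1)[OF cn] gp_crs[OF gp ac]] by metis
    obtain k' where k': "k' \<noteq> 0" "crs (p a) (p c) = k' *s rep y $ Some c"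
      using parallel_to_cross[OF d(2) coneD(2)[OF cn] coneD(1)[OF cn] gp_crs[OF gp ac]] by metis
    define z where "z = G (rep y)"
    have xz: "x z = \<Delta> *s rep y $ None"
      using plane_combination[of "p a" "p c" q "rep y $ None"] k(2) coneD(5)[OF cn, of a]
      by (simp add: z_def G_def x_def \<Delta>_def)
    have \<Delta>: "\<Delta> \<noteq> 0" using q by (simp add: \<Delta>_def)
    have z0: "z $ 1 \<noteq> 0"
    proof
      assume "z $ 1 = 0"
      then have "x z = 0" by (simp add: x_def)
      then show False using xz \<Delta> coneD(1)[OF cn, of None] by simp
    qed
    moreover have "proj_class (rep y) = proj_class (Y z)"
    proof (rule row_scale_eqI)
      fix i
      show "\<exists>e. e \<noteq> 0 \<and> Y z $ i = e *s rep y $ i"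
      proof (cases i)
        case None
        then show ?thesis using xz \<Delta> by (auto simp: Y_def)
      next
        case (Some b)
        consider "b = a" | "b = c" | "b \<noteq> a" "b \<noteq> c" by blast
        then show ?thesis
        proof cases
          case 3
          have "crs (p b) (rep y $ None) \<noteq> 0" using bx[OF z0 3] xz by auto
          then obtain k'' where k'': "k'' \<noteq> 0" "crs (p b) (rep y $ None) = k'' *s rep y $ Some b"
            using cone_row_cross[OF cn] by metis
          then show ?thesis using Some 3 xz \<Delta>
            by (intro exI[of _ "\<Delta> * k''"]) (simp add: Y_def vector_smult_assoc)
        qed (use Some k k' in \<open>auto simp: Y_def\<close>)
      qed
    qed
    ultimately show "y \<in> {proj_class (Y z) |z. z $ 1 \<noteq> 0}" using blowup4_rep[OF yX] by auto
  qed
  have GY': "\<exists>k. k \<noteq> 0 \<and> G (Y z) = row_scale (\<lambda>_. k) z" for z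
    using GY q unfolding \<Delta>_def by blast
  show "curve_on (blowup4 p) (Lcurve p a c)" "isomorphic_varieties projective_line (Lcurve p a c)"
    using rational_curve[where Y = Y and G = G, OF blowup4_multiproj formY formG GY' C zclosed_Lcurve] by blast+
qed

lemma Ecurve_exceptional: "general_points p \<Longrightarrow> Ecurve p c \<in> exceptional_curves (blowup4 (p :: 4 \<Rightarrow> 'k::alg_closed_field^3))"
proof -
  assume gp: "general_points p"
  obtain a where "a \<noteq> c" using exists_other_indices[of c] by metis
  then show ?thesis unfolding exceptional_curves_def
    using Ecurve_rational[OF gp] Ecurve_self_intersection[OF gp] by blast
qed

lemma Lcurve_exceptional: "general_points p \<Longrightarrow> a \<noteq> c \<Longrightarrow>
    Lcurve p a c \<in> exceptional_curves (blowup4 (p :: 4 \<Rightarrow> 'k::alg_closed_field^3))"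
  unfolding exceptional_curves_def using Lcurve_rational Lcurve_self_intersection by blast

section \<open>Orders along a parametrized curve\<close>

lemma fps_coeffs_dvd:
  fixes p q :: "'k::field poly"
  assumes h: "h * fps_of_poly q = fps_of_poly p" and 0: "\<And>k. k < n \<Longrightarrow> fps_nth h k = 0"
  obtains p' where "p = monom 1 n * p'" "poly p' 0 = fps_nth h n * poly q 0"
proof -
  have c: "coeff p k = (\<Sum>i=0..k. fps_nth h i * coeff q (k - i))" for k
    using arg_cong[OF h, of "\<lambda>f. fps_nth f k"] by (simp add: fps_mult_nth)
  have "coeff p k = 0" if "k < n" for k
    unfolding c by (rule sum.neutral) (use that 0 in auto)
  then have "monom 1 n dvd p" by (simp add: monom_1_dvd_iff')
  then obtain p' where p': "p = monom 1 n * p'" by (auto simp: dvd_def)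
  have "poly p' 0 = coeff p n" by (simp add: p' poly_0_coeff_0 coeff_monom_mult)
  also have "\<dots> = (\<Sum>i=0..n. if i = n then fps_nth h n * coeff q 0 else 0)"
    unfolding c by (rule sum.cong) (use 0 in auto)
  also have "\<dots> = fps_nth h n * poly q 0" by (simp add: poly_0_coeff_0)
  finally show thesis using that p' by blast
qed

text \<open>
Linear algebra for the lower bound of a colength: series whose combinations realize all
monomials \<open>1, x, \<dots>, x^(n-1)\<close> modulo \<open>x^n\<close> are at least \<open>n\<close> in number.
\<close>

lemma spanning_truncations:
  fixes H :: "'b \<Rightarrow> 'k::field fps"
  assumes B: "finite B"
    and span: "\<And>k. k < n \<Longrightarrow> \<exists>c. \<forall>j<n. (\<Sum>b\<in>B. c b * fps_nth (H b) j) = (if j = k then 1 else 0)"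
  shows "n \<le> card B"
proof -
  interpret vs: vector_space "smult :: 'k \<Rightarrow> 'k poly \<Rightarrow> 'k poly"
    by unfold_locales (simp_all add: smult_add_right smult_add_left)
  define tr where "tr b = (\<Sum>j<n. monom (fps_nth (H b) j) j)" for b
  have tr: "coeff (tr b) j = (if j < n then fps_nth (H b) j else 0)" for b j
    by (simp add: tr_def coeff_sum)
  let ?M = "(\<lambda>k. monom (1::'k) k) ` {..<n}"
  have inj: "inj_on (\<lambda>k. monom (1::'k) k) {..<n}"
    by (rule inj_onI) (metis coeff_monom zero_neq_one)
  have indep: "vs.independent ?M"
  proof
    assume "vs.dependent ?M"
    then obtain u v where u: "v \<in> ?M" "u v \<noteq> 0" "(\<Sum>v\<in>?M. smult (u v) v) = 0"
      by (subst (asm) vs.dependent_finite) auto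
    have "(\<Sum>k<n. smult (u (monom 1 k)) (monom 1 k)) = 0"
      using u(3) by (subst (asm) sum.reindex[OF inj]) simp
    then have eq: "(\<Sum>k<n. monom (u (monom 1 k)) k) = 0" by (simp add: smult_monom)
    have "u (monom 1 k) = 0" if "k < n" for k
      using arg_cong[OF eq, of "\<lambda>p. coeff p k"] that by (simp add: coeff_sum)
    with u(1,2) show False by auto
  qed
  have "?M \<subseteq> vs.span (tr ` B)"
  proof
    fix v assume "v \<in> ?M"
    then obtain k where k: "k < n" "v = monom 1 k" by auto
    obtain c where c: "\<And>j. j < n \<Longrightarrow> (\<Sum>b\<in>B. c b * fps_nth (H b) j) = (if j = k then 1 else 0)"
      using span[OF k(1)] by blast
    have "v = (\<Sum>b\<in>B. smult (c b) (tr b))"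
      unfolding k(2)
    proof (rule poly_eqI)
      fix j
      show "coeff (monom 1 k) j = coeff (\<Sum>b\<in>B. smult (c b) (tr b)) j"
        using c[of j] k(1) by (cases "j < n") (auto simp: coeff_sum tr)
    qed
    also have "\<dots> \<in> vs.span (tr ` B)"
      by (intro vs.span_sum vs.span_scale vs.span_base imageI)
    finally show "v \<in> vs.span (tr ` B)" .
  qed
  then have "card ?M \<le> card (tr ` B)" using vs.independent_span_bound[OF _ indep] B by blast
  also have "\<dots> \<le> card B" by (rule card_image_le[OF B])
  finally show ?thesis using card_image[OF inj] by simp
qed

text \<open>
A curve \<open>C\<close> isomorphic to the projective line by \<open>\<phi>\<close> and \<open>\<psi>\<close>, with a lift \<open>Y\<close> of \<open>\<phi>\<close> to coordinates. The
independent vectors \<open>al\<close> and \<open>be\<close> choose an affine parameter \<open>t\<close> on the line; \<open>be\<close> is the point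
at infinity, and \<open>gam\<close> is the resulting parametrization of the affine part of \<open>C\<close>.
\<close>

locale embedded_line =
  fixes V C :: "('k::alg_closed_field, 'n::finite, 'i::finite) mpoint set"
    and \<phi> :: "('k, 2, 1) mpoint \<Rightarrow> ('k, 'n, 'i) mpoint" and \<psi> :: "('k, 'n, 'i) mpoint \<Rightarrow> ('k, 2, 1) mpoint"
    and Y :: "'k^2^1 \<Rightarrow> 'k^'n^'i" and \<delta> :: "'i \<Rightarrow> nat" and al be :: "'k^2^1"
  assumes V: "V \<subseteq> multiproj" and CV: "C \<subseteq> V"
    and mor1: "morphism projective_line C \<phi>" and mor2: "morphism C projective_line \<psi>"
    and inv1: "\<And>z. z \<in> projective_line \<Longrightarrow> \<psi> (\<phi> z) = z"
    and inv2: "\<And>y. y \<in> C \<Longrightarrow> \<phi> (\<psi> y) = y"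
    and lift: "lift_of \<phi> Y \<delta>" and ind: "det2 al be \<noteq> 0"
begin

definition gam :: "'k \<Rightarrow> ('k, 'n, 'i) mpoint" where
  "gam t = \<phi> (proj_class (pl al be t))"

definition Yc :: "'k poly^'n^'i" where
  "Yc = (\<chi> i j. plift (\<lambda>z. Y z $ i $ j) (lin al be))"

lemma formY: "form (\<lambda>_. \<delta> i) (\<lambda>z. Y z $ i $ j)"
  using lift unfolding lift_of_def by blast

lemma phi_Y: "z $ 1 \<noteq> 0 \<Longrightarrow> \<phi> (proj_class z) = proj_class (Y z)"
  using lift unfolding lift_of_def by blast

lemma cev_Yc: "cev Yc t = Y (pl al be t)"
  by (simp add: vec_eq_iff Yc_def poly_plift[OF form_poly_fun[OF formY]])

lemma gam_Yc: "gam t = proj_class (cev Yc t)"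
  by (simp add: gam_def cev_Yc phi_Y[OF pl_nonzero[OF ind]])

lemma phi_in: "z $ 1 \<noteq> 0 \<Longrightarrow> \<phi> (proj_class z) \<in> C"
  by (rule morphism_in[OF mor1 proj_class_in_line])

lemma gam_in: "gam t \<in> C"
  unfolding gam_def by (rule phi_in[OF pl_nonzero[OF ind]])

lemma gam_inV: "gam t \<in> V"
  using gam_in CV by blast

lemma C_cases:
  assumes "y \<in> C"
  obtains z where "z $ 1 \<noteq> 0" "y = \<phi> (proj_class z)"
proof -
  obtain z where z: "z $ 1 \<noteq> 0" "\<psi> y = proj_class z"
    using morphism_in[OF mor2 assms] unfolding projective_line_iff by blast
  have "y = \<phi> (proj_class z)" unfolding z(2)[symmetric] by (rule inv2[OF assms, symmetric])
  then show thesis using that z by blast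
qed

lemma C_gam: "y \<in> C \<Longrightarrow> y = \<phi> (proj_class be) \<or> (\<exists>t. y = gam t)"
proof -
  assume "y \<in> C"
  then obtain z where z: "z $ 1 \<noteq> 0" "y = \<phi> (proj_class z)" by (rule C_cases)
  show ?thesis using P1_cases[OF ind z(1)]
  proof
    assume "proj_class z = proj_class be"
    then show ?thesis using z(2) by simp
  next
    assume "\<exists>t. proj_class z = proj_class (pl al be t)"
    then obtain t where "proj_class z = proj_class (pl al be t)" by blast
    then show ?thesis using z(2) by (auto simp: gam_def)
  qed
qed

lemma psi_gam: "\<psi> (gam t) = proj_class (pl al be t)"
  unfolding gam_def by (rule inv1[OF proj_class_in_line[OF pl_nonzero[OF ind]]])

text \<open>
The affine parameter as a function on the projective line.
\<close>

definition tf :: "('k, 2, 1) mpoint \<Rightarrow> 'k" where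
  "tf = ratio (\<lambda>z. det2 al z) (\<lambda>z. det2 z be)"

lemma form_det2: "form (rowdeg 1) (\<lambda>z. det2 al z)" "form (rowdeg 1) (\<lambda>z. det2 z be)"
proof -
  have "form (rowdeg 1) (\<lambda>z. be $ 1 $ 2 * z $ 1 $ 1 - be $ 1 $ 1 * z $ 1 $ 2)"
    by (intro form_diff form_cmult form_coord)
  then show "form (rowdeg 1) (\<lambda>z. det2 z be)" by (simp add: det2_def mult.commute)
  show "form (rowdeg 1) (\<lambda>z. det2 al z)" unfolding det2_def
    by (intro form_diff form_cmult form_coord)
qed

lemma det2_pl: "det2 al (pl al be t) = t * det2 al be" "det2 (pl al be t) be = det2 al be"
  by (simp_all add: det2_def pl_def algebra_simps)

lemma tf_pl: "tf (proj_class (pl al be t)) = t"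
  unfolding tf_def ratio_proj_class[OF form_det2] det2_pl using ind by simp

lemma gam_inj: "gam s = gam t \<Longrightarrow> s = t"
  using psi_gam[of s] psi_gam[of t] tf_pl[of s] tf_pl[of t] by metis

lemma path_gam: "path_at V (\<lambda>e. gam (t0 + e)) (gam t0)" "path_at C (\<lambda>e. gam (t0 + e)) (gam t0)"
proof -
  define c where "c = (\<chi> i j. pcompose (Yc $ i $ j) [:t0, 1:])"
  have c: "cev c e = cev Yc (t0 + e)" for e
    by (simp add: c_def vec_eq_iff poly_pcompose add.commute)
  show "path_at V (\<lambda>e. gam (t0 + e)) (gam t0)" "path_at C (\<lambda>e. gam (t0 + e)) (gam t0)"
    unfolding path_at_def by (rule exI[of _ c]; simp add: c gam_Yc[symmetric] gam_in gam_inV)+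
qed

lemma form_YP: "form d P \<Longrightarrow> form (\<lambda>i. \<Sum>j\<in>UNIV. d j * \<delta> j) (\<lambda>z. P (Y z))"
  by (rule form_compose[where F = Y and D = "\<lambda>j _. \<delta> j", OF formY])

lemma vanishing_on_C:
  assumes P: "form d P" and 0: "\<forall>\<^sub>\<infinity>t. P (cev Yc t) = 0" and y: "y \<in> C"
  shows "P (rep y) = 0"
proof -
  obtain z where z: "z $ 1 \<noteq> 0" "y = \<phi> (proj_class z)" using C_cases[OF y] .
  have "P (Y z) = 0" by (rule form_zero_line[OF form_YP[OF P] ind]) (use 0 in \<open>simp add: cev_Yc\<close>)
  then show ?thesis unfolding z(2) phi_Y[OF z(1)] by (simp add: form_rep_eq_0[OF P])
qed

lemma cofinite_gam_shift:
  "(\<forall>\<^sub>\<infinity>e. R (t0 + e)) \<longleftrightarrow> (\<forall>\<^sub>\<infinity>t::'k. R t)"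
proof
  assume "\<forall>\<^sub>\<infinity>e. R (t0 + e)"
  from cofinite_shift[OF this, of "- t0"] show "\<forall>\<^sub>\<infinity>t. R t" by simp
qed (rule cofinite_shift)

text \<open>
Since \<open>\<psi>\<close> is a morphism, the parameter is a regular function on \<open>C\<close>, and it extends to the surface near
any given point. It makes the parametrization immersed and computes orders on \<open>C\<close>.
\<close>

lemma parameter_ex:
  obtains T where "T \<in> local_ring V (gam t0)" "\<forall>\<^sub>\<infinity>t. T (gam t) = t" "T (gam t0) = t0"
proof -
  have "det2 (rep (\<psi> (gam t0))) be \<noteq> 0"
    unfolding psi_gam form_rep_eq_0[OF form_det2(2)] det2_pl by (rule ind)
  then have "tf \<in> local_ring projective_line (\<psi> (gam t0))"
    unfolding tf_def by (rule local_ring_ratio[OF form_det2])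
  from morphism_comp[OF mor2 gam_in this] have "tf \<circ> \<psi> \<in> local_ring C (gam t0)" .
  then obtain T where T: "T \<in> local_ring V (gam t0)" "near C (gam t0) (\<lambda>y. T y = (tf \<circ> \<psi>) y)"
    by (rule local_ring_extend)
  have "\<forall>\<^sub>\<infinity>e. T (gam (t0 + e)) = t0 + e"
    using near_path[OF T(2) path_gam(2)] by (simp add: psi_gam tf_pl)
  then have "\<forall>\<^sub>\<infinity>t. T (gam t) = t" by (simp add: cofinite_gam_shift[of "\<lambda>t. T (gam t) = t"])
  moreover have "T (gam t0) = t0" using near_self[OF T(2) gam_in] by (simp add: psi_gam tf_pl)
  ultimately show thesis using that T(1) by blast
qed

lemma curve_ideal_iff:
  assumes f: "f \<in> local_ring V (gam t0)"
  shows "f \<in> curve_ideal V C (gam t0) \<longleftrightarrow> (\<forall>\<^sub>\<infinity>t. f (gam t) = 0)"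
proof
  assume "f \<in> curve_ideal V C (gam t0)"
  then have "near V (gam t0) (\<lambda>y. y \<in> C \<longrightarrow> f y = 0)" by (simp add: curve_ideal_def)
  from near_path[OF this path_gam(1)] have "\<forall>\<^sub>\<infinity>e. f (gam (t0 + e)) = 0" using gam_in by simp
  then show "\<forall>\<^sub>\<infinity>t. f (gam t) = 0" by (simp add: cofinite_gam_shift[of "\<lambda>t. f (gam t) = 0"])
next
  assume 0: "\<forall>\<^sub>\<infinity>t. f (gam t) = 0"
  obtain d P Q where 1: "form d P" "form d Q" "Q (rep (gam t0)) \<noteq> 0"
    "\<And>y. y \<in> V \<Longrightarrow> Q (rep y) \<noteq> 0 \<Longrightarrow> f y = ratio P Q y" using f by (rule local_ringE) blast
  have "Q (cev Yc t0) \<noteq> 0" using 1(3) by (simp add: gam_Yc form_rep_eq_0[OF 1(2)])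
  then have "\<forall>\<^sub>\<infinity>t. Q (cev Yc t) \<noteq> 0" by (rule plift_nonzero_cofinite[OF form_poly_fun[OF 1(2)]])
  then have "\<forall>\<^sub>\<infinity>t. P (cev Yc t) = 0" using 0
  proof eventually_elim
    case (elim t)
    have "Q (rep (gam t)) \<noteq> 0" using elim(1) by (simp add: gam_Yc form_rep_eq_0[OF 1(2)])
    then have "f (gam t) = ratio P Q (gam t)" by (rule 1(4)[OF gam_inV])
    also have "\<dots> = P (cev Yc t) / Q (cev Yc t)" unfolding gam_Yc by (rule ratio_proj_class[OF 1(1,2)])
    finally show ?case using elim by simp
  qed
  then have P0: "P (rep y) = 0" if "y \<in> C" for y by (rule vanishing_on_C[OF 1(1) _ that])
  have "near V (gam t0) (\<lambda>y. y \<in> C \<longrightarrow> f y = 0)"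
  proof (rule near_mono[OF near_form[OF 1(2,3)]], rule impI)
    fix y assume y: "y \<in> V" "Q (rep y) \<noteq> 0" "y \<in> C"
    show "f y = 0" using 1(4)[OF y(1,2)] P0[OF y(3)] by (simp add: ratio_def)
  qed
  with f show "f \<in> curve_ideal V C (gam t0)" by (simp add: curve_ideal_def)
qed

abbreviation "germ0 t0 \<equiv> germ (\<lambda>e. gam (t0 + e))"

lemma germ0_ex: "f \<in> local_ring V (gam t0) \<Longrightarrow> \<exists>h. germ0 t0 f h \<and> fps_nth h 0 = f (gam t0)"
  by (rule germ_local_ring[OF _ path_gam(1)])

lemma germ0_zero_iff:
  assumes f: "f \<in> local_ring V (gam t0)" and h: "germ0 t0 f h"
  shows "h = 0 \<longleftrightarrow> f \<in> curve_ideal V C (gam t0)"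
proof -
  have "f \<in> curve_ideal V C (gam t0) \<longleftrightarrow> (\<forall>\<^sub>\<infinity>e. f (gam (t0 + e)) = 0)"
    unfolding curve_ideal_iff[OF f] by (simp add: cofinite_gam_shift[of "\<lambda>t. f (gam t) = 0"])
  also have "\<dots> \<longleftrightarrow> h = 0"
  proof
    assume "\<forall>\<^sub>\<infinity>e. f (gam (t0 + e)) = 0"
    then have "germ0 t0 f (fps_of_poly 0)" by (intro germ_poly_fun) simp
    then show "h = 0" using germ_unique[OF h] by simp
  next
    assume "h = 0"
    with h obtain p q where pq: "poly q 0 \<noteq> 0" "\<forall>\<^sub>\<infinity>e. f (gam (t0 + e)) * poly q e = poly p e"
      "0 = fps_of_poly p" unfolding germ_def by auto
    have "p = 0" using pq(3) by (metis fps_of_poly_0 fps_of_poly_eq_iff)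
    have "q \<noteq> 0" using pq(1) by auto
    from poly_nonzero_cofinite[OF this] pq(2) show "\<forall>\<^sub>\<infinity>e. f (gam (t0 + e)) = 0"
      by eventually_elim (simp add: \<open>p = 0\<close>)
  qed
  finally show ?thesis by simp
qed

text \<open>
If \<open>f\<close> vanishes on \<open>C\<close> to at least the order of \<open>a\<close>, the quotient of their Taylor series is that of a
rational function of the parameter without pole at \<open>t0\<close>, so \<open>T\<close> makes it a regular function.
\<close>

lemma high_order_in_ideal:
  assumes T: "T \<in> local_ring V (gam t0)" "\<forall>\<^sub>\<infinity>t. T (gam t) = t" "T (gam t0) = t0"
    and a: "a \<in> local_ring V (gam t0)" "germ0 t0 a h" "h \<noteq> 0"
    and f: "f \<in> local_ring V (gam t0)" "germ0 t0 f k" "\<And>i. i < subdegree h \<Longrightarrow> fps_nth k i = 0"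
  obtains g r where "f = (\<lambda>y. g y + r y * a y)" "g \<in> curve_ideal V C (gam t0)" "r \<in> local_ring V (gam t0)"
proof -
  obtain pa qa where A: "poly qa 0 \<noteq> 0" "\<forall>\<^sub>\<infinity>e. a (gam (t0 + e)) * poly qa e = poly pa e"
    "h * fps_of_poly qa = fps_of_poly pa" using a(2) unfolding germ_def by blast
  obtain pf qf where F: "poly qf 0 \<noteq> 0" "\<forall>\<^sub>\<infinity>e. f (gam (t0 + e)) * poly qf e = poly pf e"
    "k * fps_of_poly qf = fps_of_poly pf" using f(2) unfolding germ_def by blast
  obtain pa' where pa': "pa = monom 1 (subdegree h) * pa'" "poly pa' 0 = fps_nth h (subdegree h) * poly qa 0"
    using fps_coeffs_dvd[OF A(3) nth_less_subdegree_zero] by metis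
  obtain pf' where pf': "pf = monom 1 (subdegree h) * pf'"
    using fps_coeffs_dvd[OF F(3) f(3)] by metis
  have pa0: "poly pa' 0 \<noteq> 0" using pa'(2) A(1) a(3) by simp
  define S where "S y = T y - t0" for y
  have S: "S \<in> local_ring V (gam t0)" unfolding S_def[abs_def] by (intro local_ring_diff T local_ring_const)
  have S0: "S (gam t0) = 0" by (simp add: S_def T)
  define r where "r y = poly (pf' * qa) (S y) / poly (qf * pa') (S y)" for y
  have r: "r \<in> local_ring V (gam t0)"
    unfolding r_def[abs_def]
    by (rule local_ring_divide[OF local_ring_poly[OF S] local_ring_poly[OF S] gam_inV]) (use S0 F(1) pa0 in simp)
  have ev: "\<forall>\<^sub>\<infinity>e. f (gam (t0 + e)) - r (gam (t0 + e)) * a (gam (t0 + e)) = 0"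
  proof -
    have nz: "\<forall>\<^sub>\<infinity>e. poly q e \<noteq> 0" if "poly q 0 \<noteq> 0" for q :: "'k poly"
      using that by (intro poly_nonzero_cofinite) auto
    have "\<forall>\<^sub>\<infinity>e. T (gam (t0 + e)) = t0 + e" by (rule cofinite_shift[OF T(2)])
    then show ?thesis using A(2) F(2) nz[OF A(1)] nz[OF F(1)] nz[OF pa0]
    proof eventually_elim
      case (elim e)
      define m where "m = poly (monom 1 (subdegree h)) e"
      have Se: "S (gam (t0 + e)) = e" using elim(1) by (simp add: S_def)
      have a_eq: "a (gam (t0 + e)) = m * poly pa' e / poly qa e"
        using elim(2,4) by (simp add: pa'(1) m_def field_simps)
      have f_eq: "f (gam (t0 + e)) = m * poly pf' e / poly qf e"
        using elim(3,5) by (simp add: pf' m_def field_simps)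
      show ?case
        unfolding r_def Se a_eq f_eq using elim by (simp add: field_simps)
    qed
  qed
  have "(\<lambda>y. f y - r y * a y) \<in> curve_ideal V C (gam t0)"
  proof (subst curve_ideal_iff)
    show "(\<lambda>y. f y - r y * a y) \<in> local_ring V (gam t0)" by (intro local_ring_diff local_ring_mult f a r)
    show "\<forall>\<^sub>\<infinity>t. f (gam t) - r (gam t) * a (gam t) = 0"
      using ev unfolding cofinite_gam_shift[of "\<lambda>t. f (gam t) - r (gam t) * a (gam t) = 0"] .
  qed
  then show thesis using r by (intro that[of "\<lambda>y. f y - r y * a y" r]) auto
qed

text \<open>
The order of \<open>a\<close> on \<open>C\<close> is the order of vanishing of its Taylor series: the powers \<open>1, \<dots>, T^(n-1)\<close> span
the quotient by \<open>high_order_in_ideal\<close>, and \<open>spanning_truncations\<close> shows that fewer functions do not.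
\<close>

lemma order_on_curve_germ:
  assumes a: "a \<in> local_ring V (gam t0)" "germ0 t0 a h" "h \<noteq> 0"
  shows "order_on_curve V C (gam t0) a = subdegree h"
proof -
  let ?n = "subdegree h" and ?O = "local_ring V (gam t0)"
  let ?J = "{\<lambda>y. g y + r y * a y |g r. g \<in> curve_ideal V C (gam t0) \<and> r \<in> ?O}"
  obtain T where T: "T \<in> ?O" "\<forall>\<^sub>\<infinity>t. T (gam t) = t" "T (gam t0) = t0" using parameter_ex .
  define S where "S k y = (T y - t0) ^ k" for k :: nat and y
  have S: "S k \<in> ?O" for k
    unfolding S_def[abs_def] by (intro local_ring_power local_ring_diff T local_ring_const)
  have gS: "germ0 t0 (S k) (fps_X ^ k)" for k
  proof -
    have "\<forall>\<^sub>\<infinity>e. S k (gam (t0 + e)) = poly (monom 1 k) e"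
      using cofinite_shift[OF T(2), of t0] by eventually_elim (simp add: S_def poly_monom)
    from germ_poly_fun[where y = "\<lambda>e. gam (t0 + e)", OF this] show ?thesis by (simp add: fps_of_poly_monom')
  qed
  have inj: "inj_on S {..<?n}"
  proof (rule inj_onI)
    fix i j assume "S i = S j"
    then have "fps_X ^ i = (fps_X ^ j :: 'k fps)" using germ_unique[OF gS[of i]] gS[of j] by simp
    then have "subdegree (fps_X ^ i :: 'k fps) = subdegree (fps_X ^ j :: 'k fps)" by simp
    then show "i = j" by (simp add: fps_X_power_subdegree)
  qed
  show ?thesis unfolding order_on_curve_def colength_def
  proof (rule Least_equality)
    show "\<exists>B. finite B \<and> card B = ?n \<and> B \<subseteq> ?O \<and> (\<forall>f\<in>?O. \<exists>c. (\<lambda>y. f y - (\<Sum>b\<in>B. c b * b y)) \<in> ?J)"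
    proof (rule exI[of _ "S ` {..<?n}"], intro conjI ballI)
      fix f assume f: "f \<in> ?O"
      obtain k where k: "germ0 t0 f k" using germ0_ex[OF f] by blast
      define c where "c b = fps_nth k (the_inv_into {..<?n} S b)" for b
      have sum: "(\<Sum>b\<in>S ` {..<?n}. c b * b y) = (\<Sum>i<?n. fps_nth k i * S i y)" for y
        by (subst sum.reindex[OF inj]) (simp add: c_def the_inv_into_f_f[OF inj])
      let ?f = "\<lambda>y. f y - (\<Sum>i<?n. fps_nth k i * S i y)"
      have f': "?f \<in> ?O" by (intro local_ring_diff f local_ring_sum local_ring_mult local_ring_const S)
      have g': "germ0 t0 ?f (k - (\<Sum>i<?n. fps_const (fps_nth k i) * fps_X ^ i))"
        by (intro germ_diff k germ_sum germ_mult germ_const gS)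
      have "fps_nth (k - (\<Sum>i<?n. fps_const (fps_nth k i) * fps_X ^ i)) j = 0" if "j < ?n" for j
        using that by (simp add: fps_sum_nth fps_X_power_nth if_distrib cong: if_cong)
      from high_order_in_ideal[OF T a f' g' this] obtain g r where
        "?f = (\<lambda>y. g y + r y * a y)" "g \<in> curve_ideal V C (gam t0)" "r \<in> ?O" .
      then show "\<exists>c. (\<lambda>y. f y - (\<Sum>b\<in>S ` {..<?n}. c b * b y)) \<in> ?J"
        unfolding sum[symmetric] by blast
    qed (use S card_image[OF inj] in auto)
    fix m assume "\<exists>B. finite B \<and> card B = m \<and> B \<subseteq> ?O \<and> (\<forall>f\<in>?O. \<exists>c. (\<lambda>y. f y - (\<Sum>b\<in>B. c b * b y)) \<in> ?J)"
    then obtain B where B: "finite B" "card B = m" "B \<subseteq> ?O"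
      "\<forall>f\<in>?O. \<exists>c. (\<lambda>y. f y - (\<Sum>b\<in>B. c b * b y)) \<in> ?J" by blast
    have "\<exists>h. germ0 t0 b h" if "b \<in> B" for b using germ0_ex[of b t0] that B(3) by blast
    then obtain H where H: "\<And>b. b \<in> B \<Longrightarrow> germ0 t0 b (H b)" by metis
    have "?n \<le> card B"
    proof (rule spanning_truncations[OF B(1), of ?n H])
      fix k assume "k < ?n"
      obtain c where "(\<lambda>y. S k y - (\<Sum>b\<in>B. c b * b y)) \<in> ?J" using B(4) S[of k] by blast
      then obtain g r where gr: "(\<lambda>y. S k y - (\<Sum>b\<in>B. c b * b y)) = (\<lambda>y. g y + r y * a y)"
        "g \<in> curve_ideal V C (gam t0)" "r \<in> ?O" by blast
      obtain hr where hr: "germ0 t0 r hr" using germ0_ex[OF gr(3)] by blast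
      have gO: "g \<in> ?O" using gr(2) by (simp add: curve_ideal_def)
      obtain hg where hg: "germ0 t0 g hg" using germ0_ex[OF gO] by blast
      have "hg = 0" using germ0_zero_iff[OF gO hg] gr(2) by simp
      then have 1: "germ0 t0 (\<lambda>y. g y + r y * a y) (hr * h)"
        using germ_add[OF hg germ_mult[OF hr a(2)]] by simp
      have 2: "germ0 t0 (\<lambda>y. S k y - (\<Sum>b\<in>B. c b * b y)) (fps_X ^ k - (\<Sum>b\<in>B. fps_const (c b) * H b))"
        by (intro germ_diff gS germ_sum germ_mult germ_const H)
      have eq: "fps_X ^ k - (\<Sum>b\<in>B. fps_const (c b) * H b) = hr * h"
        by (rule germ_unique[OF 2[unfolded gr(1)] 1])
      show "\<exists>c. \<forall>j<?n. (\<Sum>b\<in>B. c b * fps_nth (H b) j) = (if j = k then 1 else 0)"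
      proof (intro exI[of _ c] allI impI)
        fix j assume j: "j < ?n"
        have "fps_nth (hr * h) j = 0"
          unfolding fps_mult_nth
        proof (rule sum.neutral, rule ballI)
          fix i assume "i \<in> {0..j}"
          then have "j - i < subdegree h" using j by simp
          then have "fps_nth h (j - i) = 0" by (rule nth_less_subdegree_zero)
          then show "fps_nth hr i * fps_nth h (j - i) = 0" by simp
        qed
        then have "fps_nth (fps_X ^ k - (\<Sum>b\<in>B. fps_const (c b) * H b)) j = 0" unfolding eq .
        then show "(\<Sum>b\<in>B. c b * fps_nth (H b) j) = (if j = k then 1 else 0)"
          by (simp add: fps_sum_nth fps_X_power_nth)
      qed
    qed
    then show "?n \<le> m" by (simp add: B(2))
  qed
qed

text \<open>
A parametrized embedded line is immersed. If the derivative of the coordinates were proportional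
row by row to the coordinates, the derivative of every regular function along \<open>C\<close> would vanish
by Euler's identity, in contradiction to \<open>parameter_ex\<close>.
\<close>

lemma embedding_derivative:
  assumes c: "gam t0 = proj_class (cev c 0)" "\<forall>\<^sub>\<infinity>e. gam (t0 + e) = proj_class (cev c e)"
    and k: "\<And>i j. poly (pderiv (c $ i $ j)) 0 = k i * poly (c $ i $ j) 0"
  shows False
proof -
  obtain T where T: "T \<in> local_ring V (gam t0)" "\<forall>\<^sub>\<infinity>t. T (gam t) = t" "T (gam t0) = t0" using parameter_ex .
  obtain d P Q where 1: "form d P" "form d Q" "Q (rep (gam t0)) \<noteq> 0"
    "\<And>y. y \<in> V \<Longrightarrow> Q (rep y) \<noteq> 0 \<Longrightarrow> T y = ratio P Q y" using T(1) by (rule local_ringE) blast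
  note pf = form_poly_fun[OF 1(1)] form_poly_fun[OF 1(2)]
  let ?v = "cev c 0"
  have Q0: "Q ?v \<noteq> 0" using 1(3) by (simp add: c(1) form_rep_eq_0[OF 1(2)])
  then have "\<forall>\<^sub>\<infinity>e. Q (cev c e) \<noteq> 0" by (rule plift_nonzero_cofinite[OF pf(2)])
  then have "\<forall>\<^sub>\<infinity>e. poly (plift P c) e = poly ([:t0, 1:] * plift Q c) e"
    using c(2) cofinite_shift[OF T(2), of t0]
  proof eventually_elim
    case (elim e)
    have "Q (rep (gam (t0 + e))) \<noteq> 0" using elim(1,2) by (simp add: form_rep_eq_0[OF 1(2)])
    then have "T (gam (t0 + e)) = ratio P Q (gam (t0 + e))" by (rule 1(4)[OF gam_inV])
    also have "\<dots> = P (cev c e) / Q (cev c e)" unfolding elim(2) by (rule ratio_proj_class[OF 1(1,2)])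
    finally have "P (cev c e) = (t0 + e) * Q (cev c e)" using elim by (simp add: field_simps)
    then show ?case using pf by (simp add: algebra_simps)
  qed
  then have eq: "plift P c = [:t0, 1:] * plift Q c" by (rule poly_eqI_cofinite)
  have w: "(\<chi> i j. poly (pderiv (c $ i $ j)) 0) = row_scale k ?v"
    by (simp add: vec_eq_iff k)
  have P0: "P ?v = t0 * Q ?v" using arg_cong[OF eq, of "\<lambda>p. poly p 0"] pf by simp
  have "poly (pderiv (plift P c)) 0 = poly (pderiv ([:t0, 1:] * plift Q c)) 0" using eq by simp
  also have "\<dots> = t0 * poly (pderiv (plift Q c)) 0 + Q ?v"
    unfolding pderiv_mult using pf by (simp add: pderiv_pCons)
  finally have "euler d k * P ?v = t0 * (euler d k * Q ?v) + Q ?v"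
    unfolding poly_pderiv_plift[OF pf(1)] poly_pderiv_plift[OF pf(2)] w
      dird_row_scale[OF 1(1)] dird_row_scale[OF 1(2)] .
  then show False using Q0 by (simp add: P0 algebra_simps)
qed

end

section \<open>Parametrized curves on the blow-up\<close>

text \<open>
Vectors of polynomials: evaluation \<open>ev\<close>, constant vectors \<open>kc\<close>, and the derivative \<open>dv\<close>.
\<close>

definition ev :: "'k::comm_ring_1 poly^3 \<Rightarrow> 'k \<Rightarrow> 'k^3" where
  "ev A t = (\<chi> j. poly (A $ j) t)"

definition kc :: "'k::comm_ring_1^3 \<Rightarrow> 'k poly^3" where
  "kc v = (\<chi> j. [:v $ j:])"

definition dv :: "'k::alg_closed_field poly^3 \<Rightarrow> 'k poly^3" where
  "dv A = (\<chi> j. pderiv (A $ j))"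

lemma ev_nth [simp]: "ev A t $ j = poly (A $ j) t" by (simp add: ev_def)
lemma kc_nth [simp]: "kc v $ j = [:v $ j:]" by (simp add: kc_def)
lemma dv_nth [simp]: "dv A $ j = pderiv (A $ j)" by (simp add: dv_def)

lemma ev_kc [simp]: "ev (kc v) t = v" by (simp add: vec_eq_iff)
lemma ev_crs [simp]: "ev (crs A B) t = crs (ev A t) (ev B t)"
  by (simp add: vec_eq_iff forall_3 crs_nth)
lemma poly_dot [simp]: "poly (dot A B) t = dot (ev A t) (ev B t)"
  by (simp add: dot_def)
lemma ev_smult [simp]: "ev (c *s A) t = poly c t *s ev A t"
  by (simp add: vec_eq_iff)
lemma ev_add [simp]: "ev (A + B) t = ev A t + ev B t"
  by (simp add: vec_eq_iff)
lemma ev_zero [simp]: "ev 0 t = 0"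
  by (simp add: vec_eq_iff)

lemma ev_eqI: "(\<And>t. ev A t = ev B t) \<Longrightarrow> A = (B :: 'k::alg_closed_field poly^3)"
  by (simp add: vec_eq_iff) (blast intro: poly_eqI_all)

lemma dv_crs: "dv (crs A B) = crs (dv A) B + crs A (dv B)"
  by (simp add: vec_eq_iff forall_3 crs_nth pderiv_diff pderiv_mult algebra_simps)

lemma dv_kc [simp]: "dv (kc v) = 0"
  by (simp add: vec_eq_iff pderiv_pCons)

lemma dv_smult: "dv (c *s A) = pderiv c *s A + c *s dv A"
  by (simp add: vec_eq_iff pderiv_mult algebra_simps)

lemma pderiv_dot_kc: "pderiv (dot A (kc v)) = dot (dv A) (kc v)"
  by (simp add: dot_def pderiv_add pderiv_smult)

text \<open>
Polynomials in one variable without common zero generate the unit ideal.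
\<close>

lemma bezout_vector:
  fixes A :: "'k::alg_closed_field poly^3"
  assumes "\<And>t. ev A t \<noteq> 0"
  obtains s where "dot s A = 1"
proof -
  have "A \<noteq> 0" using assms[of 0] by auto
  define I where "I = {h. h \<noteq> 0 \<and> (\<exists>s. h = dot s A)}"
  have "I \<noteq> {}"
  proof -
    obtain j where j: "A $ j \<noteq> 0" using \<open>A \<noteq> 0\<close> by (auto simp: vec_eq_iff)
    have "dot (\<chi> i. if i = j then 1 else 0) A = A $ j"
      using exhaust_3[of j] by (auto simp: dot_def)
    then have "A $ j \<in> I" using j unfolding I_def by (intro CollectI conjI exI) (rule j, rule sym)
    then show ?thesis by blast
  qed
  then obtain h where h: "h \<in> I" "\<And>g. g \<in> I \<Longrightarrow> degree h \<le> degree g"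
    using ex_has_least_nat[of "\<lambda>h. h \<in> I" _ degree] by blast
  obtain s where s: "h = dot s A" and h0: "h \<noteq> 0" using h(1) unfolding I_def by blast
  have dvd: "h dvd A $ j" for j
  proof -
    define q where "q = A $ j div h"
    define r where "r = A $ j mod h"
    have r: "r = A $ j - q * h" by (simp add: q_def r_def minus_div_mult_eq_mod)
    have "r = dot ((\<chi> i. if i = j then 1 else 0) - q *s s) A"
      using exhaust_3[of j] unfolding r dot_diff dot_smult s[symmetric] by (auto simp: dot_def)
    then have "r \<noteq> 0 \<Longrightarrow> r \<in> I" unfolding I_def by blast
    moreover have "r = 0 \<or> degree r < degree h"
      using degree_mod_less[OF h0, of "A $ j"] unfolding r_def .
    ultimately have "r = 0" using h(2)[of r] by fastforce
    then show ?thesis unfolding r_def by (simp add: dvd_eq_mod_eq_0)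
  qed
  have "degree h = 0"
  proof (rule ccontr)
    assume "degree h \<noteq> 0"
    then obtain t where "poly h t = 0" using alg_closed_imp_poly_has_root[of h] by blast
    then have "poly (A $ j) t = 0" for j using dvd[of j] by (auto elim!: dvdE)
    then have "ev A t = 0" by (simp add: vec_eq_iff)
    then show False using assms by blast
  qed
  then obtain c where c: "h = [:c:]" by (rule degree_eq_zeroE)
  have "c \<noteq> 0" using h0 c by simp
  have "dot ([:1 / c:] *s s) A = [:1 / c:] * h" by (simp only: dot_smult s)
  also have "\<dots> = 1" using \<open>c \<noteq> 0\<close> by (simp add: c)
  finally show thesis by (rule that)
qed

text \<open>
If \<open>s\<close> satisfies \<open>dot s B = 1\<close>, then \<open>M = dot s A\<close> is the factor.
\<close>

lemma multiple_of_coprime: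
  fixes A B :: "'k::alg_closed_field poly^3"
  assumes B: "\<And>t. ev B t \<noteq> 0" and par: "crs A B = 0"
  obtains M where "A = M *s B"
proof -
  obtain s where s: "dot s B = 1" using bezout_vector[OF B] .
  have "crs s (crs A B) = dot s B *s A - dot s A *s B" by (rule crs_crs)
  then have "A = dot s A *s B" unfolding par s by simp
  then show thesis by (rule that)
qed

lemma cev_Phi:
  "cev (Phi (\<lambda>i. kc (p i)) a b A B) t = Phi p a b (ev A t) (ev B t)"
proof -
  have "cev (Phi (\<lambda>i. kc (p i)) a b A B) t $ i = Phi p a b (ev A t) (ev B t) $ i" for i
  proof -
    have "cev (Phi (\<lambda>i. kc (p i)) a b A B) t $ i = ev (Phi (\<lambda>i. kc (p i)) a b A B $ i) t"
      by (simp add: vec_eq_iff)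
    also have "\<dots> = Phi p a b (ev A t) (ev B t) $ i"
      by (cases i) (simp_all add: Phi_def)
    finally show ?thesis .
  qed
  then show ?thesis by (simp add: vec_eq_iff)
qed

lemma chart_cofinite:
  fixes c :: "'k::alg_closed_field poly^3^(4 option)"
  assumes "chart p a b (cev c t0)"
  shows "\<forall>\<^sub>\<infinity>t. chart p a b (cev c t)"
proof -
  have ab: "a \<noteq> b" using assms by (simp add: chart_def)
  note ch0 = assms[unfolded chart_def]
  from ch0 obtain j where "crs (cev c t0 $ Some a) (cev c t0 $ Some b) $ j \<noteq> 0" by (auto simp: vec_eq_iff)
  from plift_nonzero_cofinite[OF form_poly_fun[OF form_crs] this]
  have 1: "\<forall>\<^sub>\<infinity>t. crs (cev c t $ Some a) (cev c t $ Some b) $ j \<noteq> 0" .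
  have "\<forall>\<^sub>\<infinity>t. \<forall>e\<in>UNIV - {a, b}. crs (p e) (cev c t $ None) \<noteq> 0"
  proof (rule eventually_ball_finite, simp, rule ballI)
    fix e assume "e \<in> UNIV - {a, b}"
    then obtain j where "crs (p e) (cev c t0 $ None) $ j \<noteq> 0" using ch0 by (auto simp: vec_eq_iff)
    from plift_nonzero_cofinite[OF form_poly_fun[OF form_crs_const] this]
    show "\<forall>\<^sub>\<infinity>t. crs (p e) (cev c t $ None) \<noteq> 0" by (rule eventually_mono) auto
  qed
  with 1 show ?thesis by eventually_elim (use ab in \<open>auto simp: chart_def\<close>)
qed

lemma local_ring_crs:
  assumes "\<And>k. A k \<in> local_ring V x" "\<And>k. B k \<in> local_ring V x"
  shows "(\<lambda>y. crs (\<chi> k. A k y) (\<chi> k. B k y) $ j) \<in> local_ring V x"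
  using exhaust_3[of j]
  by (elim disjE) (simp_all add: crs_nth local_ring_diff local_ring_mult assms)

lemma germ_crs:
  assumes "\<And>k. germ y (A k) (H k)" "\<And>k. germ y (B k) (H' k)"
  shows "germ y (\<lambda>y. crs (\<chi> k. A k y) (\<chi> k. B k y) $ j) (crs (\<chi> k. H k) (\<chi> k. H' k) $ j)"
  using exhaust_3[of j]
  by (elim disjE) (simp_all add: crs_nth germ_diff germ_mult assms)

definition fnth :: "'k::zero fps^3 \<Rightarrow> nat \<Rightarrow> 'k^3" where
  "fnth H n = (\<chi> j. fps_nth (H $ j) n)"

lemma fps_nth_crs_1: "fps_nth (crs H H' $ j) (Suc 0) =
    crs (fnth H 0) (fnth H' (Suc 0)) $ j + crs (fnth H (Suc 0)) (fnth H' 0) $ j"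
  using exhaust_3[of j]
  by (elim disjE) (simp_all add: crs_nth fnth_def fps_mult_nth_1' algebra_simps)

lemma germ_quotient:
  assumes "poly q 0 \<noteq> 0" "\<forall>\<^sub>\<infinity>e. f (y e) * poly q e = poly p e"
  shows "\<exists>h. germ y f h \<and> h * fps_of_poly q = fps_of_poly p"
proof -
  have nz: "fps_nth (fps_of_poly q) 0 \<noteq> 0" using assms(1) by (simp flip: poly_0_coeff_0)
  define h where "h = fps_of_poly p * inverse (fps_of_poly q)"
  have h: "h * fps_of_poly q = fps_of_poly p"
    unfolding h_def mult.assoc inverse_mult_eq_1[OF nz] by (rule mult_1_right)
  from assms h have "germ y f h" by (rule germI)
  with h show ?thesis by blast
qed

text \<open>
A smooth rational curve on the blow-up. Its point of the plane is \<open>X\<close>, and \<open>L i\<close> is its line through \<open>p i\<close>;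
none of these vectors of polynomials has a zero.
\<close>

locale blowup_line = embedded_line "blowup4 p" C \<phi> \<psi> Y \<delta> al be
  for p :: "4 \<Rightarrow> 'k::alg_closed_field^3" and C \<phi> \<psi> Y \<delta> al be +
  assumes gp: "general_points p"
begin

definition X :: "'k poly^3" where "X = Yc $ None"
definition L :: "4 \<Rightarrow> 'k poly^3" where "L i = Yc $ Some i"

lemma cev_rows: "cev Yc t $ None = ev X t" "cev Yc t $ Some i = ev (L i) t"
  by (simp_all add: vec_eq_iff X_def L_def)

lemma cone_Yc: "cone p (cev Yc t)"
proof -
  obtain c where c: "\<forall>i. c i \<noteq> 0" "rep (gam t) = row_scale c (cev Yc t)"
    using rep_proj_class[of "cev Yc t"] by (auto simp: gam_Yc)
  have "cone p (row_scale (\<lambda>i. 1 / c i) (rep (gam t)))"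
    by (rule cone_row_scale[OF _ cone_rep[OF gam_inV]]) (use c in simp)
  moreover have "row_scale (\<lambda>i. 1 / c i) (rep (gam t)) = cev Yc t"
    unfolding c(2) row_scale_row_scale using c(1) by simp
  ultimately show ?thesis by simp
qed

lemma X_nonzero: "ev X t \<noteq> 0" and L_nonzero: "ev (L i) t \<noteq> 0"
  using coneD(1)[OF cone_Yc, of t None] coneD(1)[OF cone_Yc, of t "Some i"] by (simp_all add: cev_rows)

lemma L_dot: "dot (ev (L i) t) (p i) = 0" "dot (ev (L i) t) (ev X t) = 0"
  using coneD(2,3)[OF cone_Yc, of t i] by (simp_all add: cev_rows)

lemma L_dot_poly: "dot (L i) (kc (p i)) = 0" "dot (L i) X = 0"
  by (rule poly_eqI_all; simp add: L_dot)+

lemma chart_path: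
  assumes ch: "chart p a b (Phi p a b l lb)" and l: "dot l (p a) = 0" "dot m (p a) = 0" "dot lb (p b) = 0"
  shows "path_at (blowup4 p) (\<lambda>e. proj_class (Phi p a b (l + e *s m) lb)) (proj_class (Phi p a b l lb))"
    "\<forall>\<^sub>\<infinity>e. cone p (Phi p a b (l + e *s m) lb)"
proof -
  define c where "c = Phi (\<lambda>i. kc (p i)) a b (kc l + [:0, 1:] *s kc m) (kc lb)"
  have c: "cev c e = Phi p a b (l + e *s m) lb" for e
    unfolding c_def cev_Phi by simp
  have "\<forall>\<^sub>\<infinity>e. chart p a b (cev c e)" by (rule chart_cofinite[of p a b c 0]) (simp add: c ch)
  then have cn: "\<forall>\<^sub>\<infinity>e. cone p (Phi p a b (l + e *s m) lb)"
    by (rule eventually_mono) (auto simp: c dot_add l intro!: cone_Phi)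
  then show "\<forall>\<^sub>\<infinity>e. cone p (Phi p a b (l + e *s m) lb)" .
  show "path_at (blowup4 p) (\<lambda>e. proj_class (Phi p a b (l + e *s m) lb)) (proj_class (Phi p a b l lb))"
    unfolding path_at_def
  proof (intro exI[of _ c] conjI)
    show "\<forall>\<^sub>\<infinity>e. proj_class (Phi p a b (l + e *s m) lb) \<in> blowup4 p"
      using cn by (rule eventually_mono) (rule blowup4I)
    show "proj_class (Phi p a b l lb) \<in> blowup4 p"
      by (rule blowup4I[OF cone_Phi[OF ch l(1,3)]])
  qed (simp_all add: c)
qed

lemma gam_Phi:
  assumes "chart p a b (cev Yc t)"
  shows "gam t = proj_class (Phi p a b (ev (L a) t) (ev (L b) t))"
  using chart_Phi[OF cone_Yc assms] by (simp add: gam_Yc cev_rows)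

lemma chart_Phi_Yc:
  assumes "chart p a b (cev Yc t)"
  shows "chart p a b (Phi p a b (ev (L a) t) (ev (L b) t))"
proof -
  have "proj_class (cev Yc t) = proj_class (Phi p a b (ev (L a) t) (ev (L b) t))"
    using chart_Phi[OF cone_Yc assms] by (simp add: cev_rows)
  then obtain c where c: "\<forall>i. c i \<noteq> 0" "Phi p a b (ev (L a) t) (ev (L b) t) = row_scale c (cev Yc t)"
    unfolding proj_class_eq_iff by blast
  show ?thesis unfolding c(2) using chart_row_scale[OF c(1)] assms by blast
qed

lemma row_ratio_gam:
  "ratio (\<lambda>v. v $ Some i $ k) (\<lambda>v. v $ Some i $ k0) (gam t) = poly (L i $ k) t / poly (L i $ k0) t"
  unfolding gam_Yc ratio_proj_class[OF form_coord form_coord] by (simp add: L_def)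

lemma row_ratio_local:
  assumes "poly (L i $ k0) t0 \<noteq> 0"
  shows "ratio (\<lambda>v. v $ Some i $ k) (\<lambda>v. v $ Some i $ k0) \<in> local_ring (blowup4 p) (gam t0)"
proof (rule local_ring_ratio[OF form_coord form_coord])
  show "rep (gam t0) $ Some i $ k0 \<noteq> 0"
    unfolding gam_Yc form_rep_eq_0[OF form_coord] using assms by (simp add: L_def)
qed

text \<open>
On the curve the row \<open>i\<close> of a point is \<open>L i\<close> at its parameter, so the cross product of the two is a
function in the ideal of the curve. These functions suffice to test transversality.
\<close>

lemma row_comparison_in_ideal:
  assumes T: "T \<in> local_ring (blowup4 p) (gam t0)" "\<forall>\<^sub>\<infinity>t. T (gam t) = t" and k0: "poly (L i $ k0) t0 \<noteq> 0"
  shows "(\<lambda>y. crs (\<chi> k. ratio (\<lambda>v. v $ Some i $ k) (\<lambda>v. v $ Some i $ k0) y) (\<chi> k. poly (L i $ k) (T y)) $ j)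
    \<in> curve_ideal (blowup4 p) C (gam t0)"
proof (subst curve_ideal_iff)
  show "(\<lambda>y. crs (\<chi> k. ratio (\<lambda>v. v $ Some i $ k) (\<lambda>v. v $ Some i $ k0) y) (\<chi> k. poly (L i $ k) (T y)) $ j)
    \<in> local_ring (blowup4 p) (gam t0)"
    by (rule local_ring_crs[OF row_ratio_local[OF k0] local_ring_poly[OF T(1)]])
  show "\<forall>\<^sub>\<infinity>t. crs (\<chi> k. ratio (\<lambda>v. v $ Some i $ k) (\<lambda>v. v $ Some i $ k0) (gam t)) (\<chi> k. poly (L i $ k) (T (gam t))) $ j = 0"
    using T(2)
  proof eventually_elim
    case (elim t)
    have "(\<chi> k. ratio (\<lambda>v. v $ Some i $ k) (\<lambda>v. v $ Some i $ k0) (gam t)) = (1 / poly (L i $ k0) t) *s ev (L i) t"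
      by (simp add: vec_eq_iff row_ratio_gam)
    moreover have "(\<chi> k. poly (L i $ k) (T (gam t))) = ev (L i) t" by (simp add: vec_eq_iff elim)
    ultimately show ?case by simp
  qed
qed

text \<open>
The path moves the line through \<open>p a\<close> and keeps the line through \<open>p b\<close>, while along the curve the latter
moves. If \<open>f\<close> vanished to second order along the path, so would every function of the ideal,
which \<open>f\<close> generates. For the comparison function of row \<open>b\<close> this means that the parameter \<open>T\<close> has
derivative zero along the path; then the comparison function of row \<open>a\<close> shows that row \<open>a\<close> does
not move, a contradiction.
\<close>

lemma transversal:
  assumes ch: "chart p a b (cev Yc t0)" and m: "dot m (p a) = 0" "crs m (ev (L a) t0) \<noteq> 0"
    and W: "crs (ev (L b) t0) (ev (dv (L b)) t0) \<noteq> 0"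
    and f: "local_equation (blowup4 p) C (gam t0) f"
    and h: "germ (\<lambda>e. proj_class (Phi p a b (ev (L a) t0 + e *s m) (ev (L b) t0))) f h"
  shows "fps_nth h (Suc 0) \<noteq> 0"
proof
  assume h1: "fps_nth h (Suc 0) = 0"
  let ?V = "blowup4 p" and ?x = "gam t0"
  define la where "la = ev (L a) t0"
  define lb where "lb = ev (L b) t0"
  define y where "y = (\<lambda>e. proj_class (Phi p a b (la + e *s m) lb))"
  have ab: "a \<noteq> b" using ch by (simp add: chart_def)
  have path: "path_at ?V y ?x"
    using chart_path(1)[OF chart_Phi_Yc[OF ch] L_dot(1) m(1) L_dot(1)]
    unfolding y_def la_def lb_def gam_Phi[OF ch] .
  note h = h[folded la_def lb_def, folded y_def]
  have fI: "f \<in> curve_ideal ?V C ?x" using f unfolding local_equation_def by (rule conjunct1)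
  then have fl: "f \<in> local_ring ?V ?x" unfolding curve_ideal_def by blast
  have f0: "f ?x = 0" by (rule curve_ideal_self[OF fI gam_in CV])
  have h0: "fps_nth h 0 = 0"
  proof -
    obtain h' where "germ y f h'" "fps_nth h' 0 = f ?x" using germ_local_ring[OF fl path] by blast
    then show ?thesis using germ_unique[OF h, of h'] f0 by simp
  qed
  have tangent: "fps_nth k (Suc 0) = 0" if g: "g \<in> curve_ideal ?V C ?x" "germ y g k" for g k
  proof -
    obtain r where r: "r \<in> local_ring ?V ?x" "near ?V ?x (\<lambda>y. g y = r y * f y)"
      using f g(1) unfolding local_equation_def by blast
    obtain hr where hr: "germ y r hr" using germ_local_ring[OF r(1) path] by blast
    have "germ y g (hr * h)" by (rule germ_cong[OF germ_mult[OF hr h] near_path[OF r(2) path]])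
    then have "k = hr * h" by (rule germ_unique[OF g(2)])
    then show ?thesis by (simp add: fps_mult_nth_1' h0 h1)
  qed
  obtain T where T: "T \<in> local_ring ?V ?x" "\<forall>\<^sub>\<infinity>t. T (gam t) = t" "T ?x = t0" using parameter_ex .
  obtain hT where hT: "germ y T hT" "fps_nth hT 0 = t0"
    using germ_local_ring[OF T(1) path] unfolding T(3) by blast
  define HT where "HT i = (\<chi> k. poly (map_poly fps_const (L i $ k)) hT)" for i
  have HT: "germ y (\<lambda>z. poly (L i $ k) (T z)) (HT i $ k)" for i k
    unfolding HT_def by (simp add: germ_poly[OF hT(1)])
  have HT0: "fnth (HT i) 0 = ev (L i) t0" for i
    by (simp add: vec_eq_iff fnth_def HT_def fps_nth_poly_0 hT(2))
  have HT1: "fnth (HT i) (Suc 0) = fps_nth hT (Suc 0) *s ev (dv (L i)) t0" for i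
    by (simp add: vec_eq_iff fnth_def HT_def fps_nth_poly_1 hT(2) mult.commute)
  \<comment> \<open>first the row that is constant along the path\<close>
  obtain j where j: "crs lb (ev (dv (L b)) t0) $ j \<noteq> 0" using W by (auto simp: vec_eq_iff lb_def)
  obtain k0 where k0: "lb $ k0 \<noteq> 0" using L_nonzero[of b t0] by (auto simp: vec_eq_iff lb_def)
  then have k0': "poly (L b $ k0) t0 \<noteq> 0" by (simp add: lb_def)
  define H where "H = (\<chi> k. fps_const (lb $ k / lb $ k0))"
  have H: "germ y (ratio (\<lambda>v. v $ Some b $ k) (\<lambda>v. v $ Some b $ k0)) (H $ k)" for k
  proof -
    have "germ y (ratio (\<lambda>v. v $ Some b $ k) (\<lambda>v. v $ Some b $ k0)) (fps_of_poly [:lb $ k / lb $ k0:])"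
      by (rule germ_poly_fun) (use ab in \<open>simp add: y_def ratio_proj_class[OF form_coord form_coord]\<close>)
    then show ?thesis by (simp add: H_def fps_of_poly_const)
  qed
  have "fps_nth (crs (\<chi> k. H $ k) (\<chi> k. HT b $ k) $ j) (Suc 0) = 0"
    by (rule tangent[OF row_comparison_in_ideal[OF T(1,2) k0'] germ_crs[OF H HT]])
  then have "fps_nth (crs H (HT b) $ j) (Suc 0) = 0" by simp
  moreover have "fnth H 0 = (1 / lb $ k0) *s lb" "fnth H (Suc 0) = 0"
    by (simp_all add: vec_eq_iff fnth_def H_def)
  ultimately have hT1: "fps_nth hT (Suc 0) = 0"
    using j k0 by (simp add: fps_nth_crs_1 HT1)
  \<comment> \<open>then the moving row\<close>
  obtain j where j: "crs m la $ j \<noteq> 0" using m(2) by (auto simp: vec_eq_iff la_def)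
  obtain k0 where k0: "la $ k0 \<noteq> 0" using L_nonzero[of a t0] by (auto simp: vec_eq_iff la_def)
  then have k0': "poly (L a $ k0) t0 \<noteq> 0" by (simp add: la_def)
  have "\<exists>h. germ y (ratio (\<lambda>v. v $ Some a $ k) (\<lambda>v. v $ Some a $ k0)) h \<and>
      h * fps_of_poly [:la $ k0, m $ k0:] = fps_of_poly [:la $ k, m $ k:]" for k
  proof -
    have nz: "\<forall>\<^sub>\<infinity>e. poly [:la $ k0, m $ k0:] e \<noteq> 0" using k0 by (intro poly_nonzero_cofinite) simp
    have "\<forall>\<^sub>\<infinity>e. ratio (\<lambda>v. v $ Some a $ k) (\<lambda>v. v $ Some a $ k0) (y e) * poly [:la $ k0, m $ k0:] e = poly [:la $ k, m $ k:] e"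
      using nz by eventually_elim (simp add: y_def ratio_proj_class[OF form_coord form_coord])
    moreover have "poly [:la $ k0, m $ k0:] 0 \<noteq> 0" using k0 by simp
    ultimately show ?thesis by (intro germ_quotient)
  qed
  then obtain H where H: "\<And>k. germ y (ratio (\<lambda>v. v $ Some a $ k) (\<lambda>v. v $ Some a $ k0)) (H k)"
    "\<And>k. H k * fps_of_poly [:la $ k0, m $ k0:] = fps_of_poly [:la $ k, m $ k:]" by metis
  have "fps_nth (crs (\<chi> k. H k) (\<chi> k. HT a $ k) $ j) (Suc 0) = 0"
    by (rule tangent[OF row_comparison_in_ideal[OF T(1,2) k0'] germ_crs[OF H(1) HT]])
  then have "fps_nth (crs (\<chi> k. H k) (HT a) $ j) (Suc 0) = 0" by simp
  moreover have H0: "fnth (\<chi> k. H k) 0 = (1 / la $ k0) *s la"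
  proof -
    have "fps_nth (H k) 0 * la $ k0 = la $ k" for k
      using arg_cong[OF H(2), of "\<lambda>f. fps_nth f 0" k] by (simp add: fps_mult_nth_0)
    then show ?thesis using k0 by (simp add: vec_eq_iff fnth_def field_simps)
  qed
  moreover have H1: "fnth (\<chi> k. H k) (Suc 0) = (1 / la $ k0) *s m - (m $ k0 / (la $ k0 * la $ k0)) *s la"
  proof -
    have "fps_nth (H k) 0 * m $ k0 + fps_nth (H k) (Suc 0) * la $ k0 = m $ k" for k
      using arg_cong[OF H(2), of "\<lambda>f. fps_nth f (Suc 0)" k] by (simp add: fps_mult_nth_1')
    moreover have "fps_nth (H k) 0 = la $ k / la $ k0" for k
      using arg_cong[OF H0, of "\<lambda>v. v $ k"] by (simp add: fnth_def)
    ultimately have "la $ k / la $ k0 * m $ k0 + fps_nth (H k) (Suc 0) * la $ k0 = m $ k" for k by simp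
    then have "fps_nth (H k) (Suc 0) = (m $ k - la $ k / la $ k0 * m $ k0) / la $ k0" for k
      using k0 by (simp add: eq_divide_eq add.commute eq_diff_eq)
    then show ?thesis using k0 by (simp add: vec_eq_iff fnth_def diff_divide_distrib mult.commute)
  qed
  ultimately have "crs ((1 / la $ k0) *s m - (m $ k0 / (la $ k0 * la $ k0)) *s la) la $ j = 0"
    by (simp add: fps_nth_crs_1 HT1 HT0 hT1 la_def[symmetric])
  moreover have "crs ((1 / la $ k0) *s m - (m $ k0 / (la $ k0 * la $ k0)) *s la) la $ j = (1 / la $ k0) * crs m la $ j"
    using exhaust_3[of j] by (elim disjE) (simp_all add: crs_nth algebra_simps)
  ultimately show False using j k0 by simp
qed

end

section \<open>The plane curve and conormal sections\<close>

text \<open>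
The inverse of the blow-down, given by linear forms: the line through \<open>p i\<close> and \<open>x\<close> is \<open>p i \<times> x\<close>. Forms
on the blow-up thus become plane forms, of degree the sum of all degrees. The index type of
the rows of the argument is a singleton, since plane forms are forms in one row.
\<close>

definition hat :: "(4 \<Rightarrow> 'k::comm_ring_1^3) \<Rightarrow> 'k^3^1 \<Rightarrow> 'k^3^(4 option)" where
  "hat p z = (\<chi> i. case i of None \<Rightarrow> z $ 1 | Some c \<Rightarrow> crs (p c) (z $ 1))"

definition v1 :: "'k^3 \<Rightarrow> 'k^3^1" where "v1 x = (\<chi> i. x)"

lemma v1_nth [simp]: "v1 x $ i = x" by (simp add: v1_def)

lemma form_hat: "form (rowdeg 1) (\<lambda>z. hat p z $ i $ j)"
  by (cases i) (simp_all add: hat_def form_coord form_crs_const)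

lemma form_Ph: "form d P \<Longrightarrow> form (\<lambda>_. \<Sum>j\<in>UNIV. d j) (\<lambda>z. P (hat p z))"
proof -
  assume P: "form d P"
  have "form (\<lambda>i. \<Sum>j\<in>UNIV. d j * rowdeg (1::1) i) (\<lambda>z. P (hat p z))"
    by (rule form_compose[where F = "hat p" and D = "\<lambda>_. rowdeg 1", OF form_hat P])
  moreover have "(\<lambda>i. \<Sum>j\<in>UNIV. d j * rowdeg (1::1) i) = (\<lambda>_. \<Sum>j\<in>UNIV. d j)"
    by (rule fun_num1_eqI) (simp add: rowdeg_def)
  ultimately show ?thesis by simp
qed

lemma hat_chart:
  assumes "dot l (p a) = 0" "dot lb (p b) = 0" "a \<noteq> b"
  shows "hat p (v1 (crs l lb)) = row_scale
    (\<lambda>i. if i = Some a then dot (p a) lb else if i = Some b then - dot (p b) l else 1) (Phi p a b l lb)"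
proof -
  have "crs (p a) (crs l lb) = dot (p a) lb *s l" "crs (p b) (crs l lb) = (- dot (p b) l) *s lb"
    using assms by (simp_all add: crs_crs dot_commute vec_eq_iff)
  then have "hat p (v1 (crs l lb)) $ i = row_scale
    (\<lambda>i. if i = Some a then dot (p a) lb else if i = Some b then - dot (p b) l else 1) (Phi p a b l lb) $ i" for i
    using assms(3) by (cases i) (simp_all add: hat_def Phi_def)
  then show ?thesis by (simp add: vec_eq_iff)
qed

lemma form_hat_chart:
  assumes P: "form d P" and "dot l (p a) = 0" "dot lb (p b) = 0" "a \<noteq> b"
  shows "P (hat p (v1 (crs l lb))) =
    dot (p a) lb ^ d (Some a) * (- dot (p b) l) ^ d (Some b) * P (Phi p a b l lb)"
proof -
  let ?k = "\<lambda>i. if i = Some a then dot (p a) lb else if i = Some b then - dot (p b) l else 1"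
  have "(\<Prod>i\<in>UNIV. ?k i ^ d i) = (\<Prod>i\<in>{Some a, Some b}. ?k i ^ d i)"
    by (rule prod.mono_neutral_right) auto
  also have "\<dots> = dot (p a) lb ^ d (Some a) * (- dot (p b) l) ^ d (Some b)"
    using assms(4) by simp
  finally show ?thesis unfolding hat_chart[OF assms(2-4)] form_scale[OF P] by simp
qed

text \<open>
\<open>Phi p a b l lb\<close> is affine in \<open>l\<close>; this is its derivative in the direction \<open>m\<close>.
\<close>

definition Zv :: "(4 \<Rightarrow> 'k::comm_ring_1^3) \<Rightarrow> 4 \<Rightarrow> 4 \<Rightarrow> 'k^3 \<Rightarrow> 'k^3 \<Rightarrow> 'k^3^(4 option)" where
  "Zv p a b m lb = (\<chi> i. case i of None \<Rightarrow> crs m lb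
     | Some c \<Rightarrow> if c = a then m else if c = b then 0 else crs (p c) (crs m lb))"

lemma Phi_line:
  "Phi p a b (l + e *s m) lb = (\<chi> i j. Phi p a b l lb $ i $ j + e * Zv p a b m lb $ i $ j)"
proof -
  have "Phi p a b (l + e *s m) lb $ i = Phi p a b l lb $ i + e *s Zv p a b m lb $ i" for i
    by (cases i) (simp_all add: Phi_def Zv_def crs_add)
  then show ?thesis by (simp add: vec_eq_iff)
qed

lemma cev_Zv:
  "cev (Zv (\<lambda>i. kc (p i)) a b A B) t = Zv p a b (ev A t) (ev B t)"
proof -
  have "cev (Zv (\<lambda>i. kc (p i)) a b A B) t $ i = Zv p a b (ev A t) (ev B t) $ i" for i
  proof -
    have "cev (Zv (\<lambda>i. kc (p i)) a b A B) t $ i = ev (Zv (\<lambda>i. kc (p i)) a b A B $ i) t"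
      by (simp add: vec_eq_iff)
    also have "\<dots> = Zv p a b (ev A t) (ev B t) $ i"
      by (cases i) (simp_all add: Zv_def)
    finally show ?thesis .
  qed
  then show ?thesis by (simp add: vec_eq_iff)
qed

lemma dird_v1:
  fixes x z :: "'k::alg_closed_field^3"
  shows "dird F (v1 x) (v1 z) = dot (\<chi> j. grad F 1 j (v1 x)) z"
  by (simp add: dird_def UNIV_1 sum_3 dot_def)

lemma order_pcompose_shift:
  fixes q :: "'k::field poly"
  assumes "q \<noteq> 0"
  shows "order 0 (pcompose q [:t, 1:]) = order t q"
proof -
  obtain r where r: "q = [:- t, 1:] ^ order t q * r" "\<not> [:- t, 1:] dvd r" using order_decomp[OF assms] by blast
  have pw: "pcompose ([:- t, 1:] ^ n) [:t, 1:] = [:- 0, 1:] ^ n" for n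
  proof (induction n)
    case (Suc n)
    show ?case unfolding power_Suc pcompose_mult Suc.IH by (simp add: pcompose_pCons)
  qed (simp add: pcompose_1)
  have "pcompose q [:t, 1:] = pcompose ([:- t, 1:] ^ order t q * r) [:t, 1:]" using r(1) by simp
  also have "\<dots> = [:- 0, 1:] ^ order t q * pcompose r [:t, 1:]"
    by (simp only: pcompose_mult pw)
  finally have eq: "pcompose q [:t, 1:] = [:- 0, 1:] ^ order t q * pcompose r [:t, 1:]" .
  have r0: "poly (pcompose r [:t, 1:]) 0 \<noteq> 0" using r(2) by (simp add: poly_pcompose poly_eq_0_iff_dvd)
  have "order 0 (pcompose q [:t, 1:]) = order 0 ([:- 0, 1:] ^ order t q :: 'k poly) + order 0 (pcompose r [:t, 1:])"
    unfolding eq by (rule Polynomial.order_mult) (use r0 in auto)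
  also have "order 0 (pcompose r [:t, 1:]) = 0" by (rule order_0I[OF r0])
  also have "order 0 ([:- 0, 1:] ^ order t q :: 'k poly) = order t q" by (rule order_power_n_n)
  finally show ?thesis by simp
qed

context blowup_line begin

text \<open>
The curve in the coordinates of a chart. It agrees with \<open>Yc\<close> up to factors in the rows, which are
invertible near the parameters where the chart is defined.
\<close>

definition vt :: "4 \<Rightarrow> 4 \<Rightarrow> 'k poly^3^(4 option)" where
  "vt a b = Phi (\<lambda>i. kc (p i)) a b (L a) (L b)"

lemma cev_vt: "cev (vt a b) t = Phi p a b (ev (L a) t) (ev (L b) t)"
  unfolding vt_def by (rule cev_Phi)

lemma gam_vt: "chart p a b (cev Yc t) \<Longrightarrow> gam t = proj_class (cev (vt a b) t)"
  unfolding cev_vt by (rule gam_Phi)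

lemma order_on_curve_vt:
  assumes ch: "chart p a b (cev Yc t0)"
    and A: "A \<in> local_ring (blowup4 p) (gam t0) - curve_ideal (blowup4 p) C (gam t0)"
    and PQ: "form d P" "form d Q" "Q (rep (gam t0)) \<noteq> 0"
      "\<And>y. y \<in> blowup4 p \<Longrightarrow> Q (rep y) \<noteq> 0 \<Longrightarrow> A y = ratio P Q y"
  shows "plift P (vt a b) \<noteq> 0" "order_on_curve (blowup4 p) C (gam t0) A = order t0 (plift P (vt a b))"
    "poly (plift Q (vt a b)) t0 \<noteq> 0"
proof -
  note pf = form_poly_fun[OF PQ(1)] form_poly_fun[OF PQ(2)]
  have Q0: "Q (cev (vt a b) t0) \<noteq> 0" using PQ(3) by (simp add: gam_vt[OF ch] form_rep_eq_0[OF PQ(2)])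
  then show "poly (plift Q (vt a b)) t0 \<noteq> 0" by (simp add: poly_plift[OF pf(2)])
  have AL: "A \<in> local_ring (blowup4 p) (gam t0)" using A by simp
  obtain h where h: "germ0 t0 A h" using germ0_ex[OF AL] by blast
  have h0: "h \<noteq> 0" using germ0_zero_iff[OF AL h] A by simp
  have "\<forall>\<^sub>\<infinity>t. A (gam t) * Q (cev (vt a b) t) = P (cev (vt a b) t)"
    using plift_nonzero_cofinite[OF pf(2) Q0] chart_cofinite[OF ch]
  proof eventually_elim
    case (elim t)
    note g = gam_vt[OF elim(2)]
    have "A (gam t) = ratio P Q (gam t)"
      by (rule PQ(4)[OF gam_inV]) (simp add: g form_rep_eq_0[OF PQ(2)] elim)
    also have "\<dots> = P (cev (vt a b) t) / Q (cev (vt a b) t)" unfolding g by (rule ratio_proj_class[OF PQ(1,2)])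
    finally show ?case using elim by simp
  qed
  from cofinite_shift[OF this, of t0]
  have "\<forall>\<^sub>\<infinity>e. A (gam (t0 + e)) * poly (pcompose (plift Q (vt a b)) [:t0, 1:]) e = poly (pcompose (plift P (vt a b)) [:t0, 1:]) e"
    by (simp add: poly_pcompose poly_plift[OF pf(1)] poly_plift[OF pf(2)] add.commute)
  moreover have q0: "poly (pcompose (plift Q (vt a b)) [:t0, 1:]) 0 \<noteq> 0"
    using Q0 by (simp add: poly_pcompose poly_plift[OF pf(2)])
  ultimately obtain h' where h': "germ0 t0 A h'"
    "h' * fps_of_poly (pcompose (plift Q (vt a b)) [:t0, 1:]) = fps_of_poly (pcompose (plift P (vt a b)) [:t0, 1:])"
    using germ_quotient[of "pcompose (plift Q (vt a b)) [:t0, 1:]" A "\<lambda>e. gam (t0 + e)" "pcompose (plift P (vt a b)) [:t0, 1:]"] by blast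
  have hh: "h' = h" by (rule germ_unique[OF h'(1) h])
  let ?q = "fps_of_poly (pcompose (plift Q (vt a b)) [:t0, 1:])" and ?p = "pcompose (plift P (vt a b)) [:t0, 1:]"
  have qn: "?q \<noteq> 0" by (rule fps_of_poly_nonzero[OF q0])
  have p0: "?p \<noteq> 0" using h'(2) qn h0 hh by auto
  then show P0: "plift P (vt a b) \<noteq> 0" by auto
  have "subdegree ?q = 0" using q0 by (simp add: subdegree_eq_0_iff poly_0_coeff_0)
  then have "subdegree h = subdegree (h * ?q)" using h0 qn by simp
  also have "\<dots> = order 0 ?p" unfolding h'(2)[unfolded hh] by (rule subdegree_fps_of_poly[OF p0])
  also have "\<dots> = order t0 (plift P (vt a b))" by (rule order_pcompose_shift[OF P0])
  finally show "order_on_curve (blowup4 p) C (gam t0) A = order t0 (plift P (vt a b))"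
    using order_on_curve_germ[OF AL h h0] by simp
qed

text \<open>
The derivative of \<open>F\<close> along the curve in the transversal direction that moves the line through \<open>p a\<close> by \<open>m\<close>.
\<close>

definition dirp :: "('k^3^(4 option) \<Rightarrow> 'k) \<Rightarrow> 4 \<Rightarrow> 4 \<Rightarrow> 'k^3 \<Rightarrow> 'k poly" where
  "dirp F a b m = (\<Sum>i\<in>UNIV. \<Sum>j\<in>UNIV. plift (grad F i j) (vt a b) * Zv (\<lambda>i. kc (p i)) a b (kc m) (L b) $ i $ j)"

lemma poly_dirp:
  assumes "poly_fun F"
  shows "poly (dirp F a b m) t = dird F (cev (vt a b) t) (Zv p a b m (ev (L b) t))"
proof -
  have "poly (Zv (\<lambda>i. kc (p i)) a b (kc m) (L b) $ i $ j) t = Zv p a b m (ev (L b) t) $ i $ j" for i j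
    using cev_Zv[of p a b "kc m" "L b" t] by (metis cev_nth ev_kc)
  then show ?thesis
    by (simp add: dirp_def dird_def poly_sum poly_plift[OF grad_poly_fun[OF assms]])
qed

text \<open>
The product rule on the curve, where \<open>F\<close> and \<open>F'\<close> vanish and the terms with the derivatives of
\<open>G\<close> and \<open>G'\<close> drop out. The outer quantifier is over points of the curve, the inner one over the
transversal path through such a point.
\<close>

lemma dirp_eq:
  assumes F: "poly_fun F" "poly_fun G" "poly_fun F'" "poly_fun G'"
    and eq: "\<forall>\<^sub>\<infinity>t. \<forall>\<^sub>\<infinity>e. F (Phi p a b (ev (L a) t + e *s m) (ev (L b) t)) * G (Phi p a b (ev (L a) t + e *s m) (ev (L b) t))
       = F' (Phi p a b (ev (L a) t + e *s m) (ev (L b) t)) * G' (Phi p a b (ev (L a) t + e *s m) (ev (L b) t))"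
    and 0: "\<forall>\<^sub>\<infinity>t. F (cev (vt a b) t) = 0" "\<forall>\<^sub>\<infinity>t. F' (cev (vt a b) t) = 0"
  shows "dirp F a b m * plift G (vt a b) = dirp F' a b m * plift G' (vt a b)"
proof (rule poly_eqI_cofinite)
  show "\<forall>\<^sub>\<infinity>t. poly (dirp F a b m * plift G (vt a b)) t = poly (dirp F' a b m * plift G' (vt a b)) t"
    using eq 0
  proof eventually_elim
    case (elim t)
    let ?v = "cev (vt a b) t" and ?w = "Zv p a b m (ev (L b) t)"
    note pf = poly_fun.mult[OF F(1,2)] poly_fun.mult[OF F(3,4)]
    obtain q where q: "\<And>e. F' (\<chi> i j. ?v $ i $ j + e * ?w $ i $ j) * G' (\<chi> i j. ?v $ i $ j + e * ?w $ i $ j) = poly q e"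
      "poly (pderiv q) 0 = dird (\<lambda>v. F' v * G' v) ?v ?w" "poly q 0 = F' ?v * G' ?v" by (rule dird_ex[OF pf(2), of ?v ?w]) blast
    have "dird (\<lambda>v. F v * G v) ?v ?w = poly (pderiv q) 0"
      by (rule dird_eqI[OF pf(1)]) (use elim(1) in \<open>simp only: Phi_line cev_vt q(1)[unfolded cev_vt]\<close>)
    then have "dird (\<lambda>v. F v * G v) ?v ?w = dird (\<lambda>v. F' v * G' v) ?v ?w" using q(2) by simp
    then show ?case
      unfolding dird_mult[OF F(1,2)] dird_mult[OF F(3,4)] elim(2,3)
      by (simp add: poly_dirp[OF F(1)] poly_dirp[OF F(3)] poly_plift[OF F(2)] poly_plift[OF F(4)])
  qed
qed

text \<open>
If neither line moved at \<open>t0\<close>, the whole point of the blow-up would be stationary, since \<open>Phi\<close> computes it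
from the two lines; this contradicts \<open>embedding_derivative\<close>.
\<close>

lemma chart_derivative:
  assumes ch: "chart p a b (cev Yc t0)"
  shows "crs (ev (L a) t0) (ev (dv (L a)) t0) \<noteq> 0 \<or> crs (ev (L b) t0) (ev (dv (L b)) t0) \<noteq> 0"
proof (rule ccontr)
  assume "\<not> ?thesis"
  then have z: "crs (ev (L a) t0) (ev (dv (L a)) t0) = 0" "crs (ev (L b) t0) (ev (dv (L b)) t0) = 0" by auto
  obtain ka where ka: "ev (dv (L a)) t0 = ka *s ev (L a) t0" using crs_eq_0[OF z(1) L_nonzero] .
  obtain kb where kb: "ev (dv (L b)) t0 = kb *s ev (L b) t0" using crs_eq_0[OF z(2) L_nonzero] .
  have ab: "a \<noteq> b" using ch by (simp add: chart_def)
  define c where "c = (\<chi> i j. pcompose (vt a b $ i $ j) [:t0, 1:])"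
  have c: "cev c e = cev (vt a b) (t0 + e)" for e
    by (simp add: c_def vec_eq_iff poly_pcompose add.commute)
  define k where "k i = (case i of None \<Rightarrow> ka + kb | Some e \<Rightarrow> if e = a then ka else if e = b then kb else ka + kb)" for i
  have "ev (dv (vt a b $ i)) t0 = k i *s ev (vt a b $ i) t0" for i
  proof (cases i)
    case None
    then show ?thesis by (simp add: vt_def k_def dv_crs ka kb vec_eq_iff algebra_simps)
  next
    case (Some e)
    consider "e = a" | "e = b" | "e \<noteq> a" "e \<noteq> b" by blast
    then show ?thesis
    proof cases
      case 3
      then show ?thesis using Some
        by (simp add: vt_def k_def dv_crs ka kb crs_add vec_eq_iff algebra_simps)
    qed (use Some ab ka kb in \<open>simp_all add: vt_def k_def\<close>)
  qed
  then have *: "poly (pderiv (vt a b $ i $ j)) t0 = k i * poly (vt a b $ i $ j) t0" for i j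
    by (metis dv_nth ev_nth vector_smult_component)
  show False
  proof (rule embedding_derivative[of t0 c k])
    show "gam t0 = proj_class (cev c 0)" by (simp add: c gam_vt[OF ch])
    show "\<forall>\<^sub>\<infinity>e. gam (t0 + e) = proj_class (cev c e)"
      unfolding c by (rule cofinite_shift, rule eventually_mono[OF chart_cofinite[OF ch]]) (rule gam_vt)
    show "poly (pderiv (c $ i $ j)) 0 = k i * poly (c $ i $ j) 0" for i j
      by (simp add: c_def pderiv_pcompose poly_pcompose pderiv_pCons *)
  qed
qed

definition Xc :: "'k poly^3^1" where "Xc = (\<chi> i. X)"

lemma cev_Xc: "cev Xc t = v1 (ev X t)"
  by (simp add: vec_eq_iff Xc_def)

text \<open>
The gradient of the plane form of \<open>P\<close> along the plane curve.
\<close>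

definition Nv :: "('k^3^(4 option) \<Rightarrow> 'k) \<Rightarrow> 'k poly^3" where
  "Nv P = (\<chi> j. plift (grad (\<lambda>z. P (hat p z)) 1 j) Xc)"

lemma dot_Nv:
  assumes "form d P"
  shows "dot (ev (Nv P) t) z = dird (\<lambda>z. P (hat p z)) (v1 (ev X t)) (v1 z)"
proof -
  have "ev (Nv P) t = (\<chi> j. grad (\<lambda>z. P (hat p z)) 1 j (v1 (ev X t)))"
    by (simp add: vec_eq_iff Nv_def poly_plift[OF grad_poly_fun[OF form_poly_fun[OF form_Ph[OF assms]]]] cev_Xc)
  then show ?thesis by (simp add: dird_v1)
qed

text \<open>
The tangent line of the plane curve.
\<close>

definition K :: "'k poly^3" where "K = crs X (dv X)"

text \<open>
The form vanishes along the curve, so its gradient annihilates the tangent direction; it annihilates the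
point itself by Euler's identity.
\<close>

lemma Nv_perp:
  assumes P: "form d P" and 0: "\<And>t. P (hat p (v1 (ev X t))) = 0"
  shows "dot (Nv P) X = 0" "dot (Nv P) (dv X) = 0"
proof -
  let ?F = "\<lambda>z. P (hat p z)"
  note fF = form_Ph[OF P, of p]
  have "dot (ev (Nv P) t) (ev X t) = 0" for t
  proof -
    have "v1 (ev X t) = row_scale (\<lambda>_. 1) (v1 (ev X t))" by (simp add: vec_eq_iff)
    then have "dird ?F (v1 (ev X t)) (v1 (ev X t)) = euler (\<lambda>_::1. \<Sum>j\<in>UNIV. d j) (\<lambda>_. 1) * ?F (v1 (ev X t))"
      using dird_row_scale[OF fF, of "v1 (ev X t)" "\<lambda>_. 1"] by simp
    then show ?thesis unfolding dot_Nv[OF P] 0 by simp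
  qed
  then show "dot (Nv P) X = 0" by (intro poly_eqI_all) simp
  have "plift ?F Xc = 0" by (rule plift_eqI[OF form_poly_fun[OF fF]]) (simp add: cev_Xc 0)
  then have "pderiv (plift ?F Xc) = 0" by simp
  then show "dot (Nv P) (dv X) = 0"
    unfolding pderiv_plift[OF form_poly_fun[OF fF]]
    by (simp add: UNIV_1 sum_3 dot_def Nv_def Xc_def)
qed

text \<open>
By \<open>Nv_perp\<close> the gradient is proportional to \<open>K\<close>. The equation is free of denominators, so it gives
orders at points where \<open>K\<close> vanishes too.
\<close>

lemma Nv_cross:
  assumes P: "form d P" and 0: "\<And>t. P (hat p (v1 (ev X t))) = 0"
  shows "dot (Nv P) z * K $ j = Nv P $ j * dot K z"
proof -
  have "crs (Nv P) K = 0" unfolding K_def crs_crs Nv_perp[OF assms] by simp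
  then have "crs z (crs (Nv P) K) $ j = 0" by simp
  then show ?thesis unfolding crs_crs by (simp add: dot_commute mult.commute)
qed

lemma triple_identity:
  fixes A B A' B' m :: "'a::comm_ring_1^3"
  shows "dot (crs (crs A B) (crs A' B + crs A B')) (crs m B) = dot A (crs B B') * dot (crs A m) B"
proof -
  have 1: "dot (crs (crs A B) (crs A' B)) (crs m B) = 0"
  proof -
    have "crs (crs A B) (crs A' B) = det3 A A' B *s B"
      by (simp add: vec_eq_iff forall_3 crs_nth det3_def dot_def algebra_simps)
    then show ?thesis by simp
  qed
  have e: "crs (crs A B) (crs A B') = dot A (crs B B') *s A"
    by (simp add: vec_eq_iff forall_3 crs_nth dot_def algebra_simps)
  have 2: "dot (crs (crs A B) (crs A B')) (crs m B) = dot A (crs B B') * dot (crs A m) B"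
    unfolding e dot_smult by (simp only: dot_crs_det)
  show ?thesis unfolding crs_add dot_add 1 2 by simp
qed

end

section \<open>Local equations and conormal orders\<close>

lemma order_mult_nonzero_left: "poly q t \<noteq> 0 \<Longrightarrow> p \<noteq> 0 \<Longrightarrow> order t (p * q) = order t (p :: 'k::field poly)"
proof -
  assume q: "poly q t \<noteq> 0" and p: "p \<noteq> 0"
  have "q \<noteq> 0" using q by auto
  then have "order t (p * q) = order t p + order t q" using p by (intro Polynomial.order_mult) simp
  then show ?thesis by (simp add: order_0I[OF q])
qed

context blowup_line begin

text \<open>
Differentiating \<open>P / Q * B = f * A\<close> across the curve gives \<open>dP * B = Q * df * A\<close> on it. The derivative of the local
equation \<open>f\<close> does not vanish at \<open>t0\<close>, so the order of the section is that of \<open>dP / Q\<close>.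
\<close>

lemma conormal_identity:
  assumes ch: "chart p a b (cev Yc t0)" and m: "dot m (p a) = 0"
    and P: "form d P" "form d Q" and QV: "plift Q (vt a b) \<noteq> 0"
    and P0: "\<And>t. P (cev Yc t) = 0"
    and f: "local_equation (blowup4 p) C (gam t0) f"
    and AB: "A \<in> local_ring (blowup4 p) (gam t0) - curve_ideal (blowup4 p) C (gam t0)"
      "B \<in> local_ring (blowup4 p) (gam t0) - curve_ideal (blowup4 p) C (gam t0)"
    and eq: "near (blowup4 p) (gam t0) (\<lambda>y. Q (rep y) \<noteq> 0 \<longrightarrow> ratio P Q y * B y = f y * A y)"
    and dP: "form dd Pf" "form dd Qf" "Qf (rep (gam t0)) \<noteq> 0"
      "\<And>y. y \<in> blowup4 p \<Longrightarrow> Qf (rep y) \<noteq> 0 \<Longrightarrow> f y = ratio Pf Qf y"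
    and F1: "poly (dirp Pf a b m) t0 \<noteq> 0"
  shows "dirp P a b m \<noteq> 0"
    "int (order t0 (dirp P a b m)) = int (order_on_curve (blowup4 p) C (gam t0) A)
      - int (order_on_curve (blowup4 p) C (gam t0) B) + int (order t0 (plift Q (vt a b)))"
proof -
  let ?V = "blowup4 p" and ?x = "gam t0" and ?v = "vt a b"
  have ab: "a \<noteq> b" using ch by (simp add: chart_def)
  obtain da PA QA where A: "form da PA" "form da QA" "QA (rep ?x) \<noteq> 0"
    "\<And>y. y \<in> ?V \<Longrightarrow> QA (rep y) \<noteq> 0 \<Longrightarrow> A y = ratio PA QA y" using AB(1) by (auto elim: local_ringE)
  obtain db PB QB where B: "form db PB" "form db QB" "QB (rep ?x) \<noteq> 0"
    "\<And>y. y \<in> ?V \<Longrightarrow> QB (rep y) \<noteq> 0 \<Longrightarrow> B y = ratio PB QB y" using AB(2) by (auto elim: local_ringE)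
  note oA = order_on_curve_vt[OF ch AB(1) A]
  note oB = order_on_curve_vt[OF ch AB(2) B]
  obtain ds S where S: "form ds S" "S (rep ?x) \<noteq> 0"
    "\<forall>y\<in>?V. S (rep y) \<noteq> 0 \<longrightarrow> Q (rep y) \<noteq> 0 \<longrightarrow> ratio P Q y * B y = f y * A y"
    using eq unfolding near_def by blast
  note pf = form_poly_fun[OF P(1)] form_poly_fun[OF P(2)] form_poly_fun[OF A(1)] form_poly_fun[OF A(2)]
    form_poly_fun[OF B(1)] form_poly_fun[OF B(2)] form_poly_fun[OF dP(1)] form_poly_fun[OF dP(2)] form_poly_fun[OF S(1)]
  have QF0: "poly (plift Qf ?v) t0 \<noteq> 0"
    using dP(3) by (simp add: gam_vt[OF ch] form_rep_eq_0[OF dP(2)] poly_plift[OF pf(8)])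
  \<comment> \<open>the product of all denominators is nonzero at almost all points of the curve\<close>
  define R where "R v = S v * (Q v * (QA v * (QB v * Qf v)))" for v
  have R: "form (\<lambda>i. ds i + (d i + (da i + (db i + dd i)))) R"
    unfolding R_def[abs_def] by (intro form_mult S P A B dP)
  have "S (cev ?v t0) \<noteq> 0" using S(2) by (simp add: gam_vt[OF ch] form_rep_eq_0[OF S(1)])
  then have "plift S ?v \<noteq> 0" using poly_plift[OF pf(9), of ?v t0] by auto
  moreover have "plift QA ?v \<noteq> 0" "plift QB ?v \<noteq> 0" "plift Qf ?v \<noteq> 0" using oA(3) oB(3) QF0 by auto
  ultimately have "plift S ?v * (plift Q ?v * (plift QA ?v * (plift QB ?v * plift Qf ?v))) \<noteq> 0" using QV by simp
  from poly_nonzero_cofinite[OF this] have Rcof: "\<forall>\<^sub>\<infinity>t. R (cev ?v t) \<noteq> 0"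
    by (simp add: R_def poly_plift[OF pf(2)] poly_plift[OF pf(4)] poly_plift[OF pf(6)] poly_plift[OF pf(8)] poly_plift[OF pf(9)])
  have cross: "P v * (PB v * (Qf v * QA v)) = Pf v * (PA v * (Q v * QB v))"
    if v: "cone p v" "R v \<noteq> 0" for v
  proof -
    have nz: "S v \<noteq> 0" "Q v \<noteq> 0" "QA v \<noteq> 0" "QB v \<noteq> 0" "Qf v \<noteq> 0" using v(2) by (auto simp: R_def)
    let ?y = "proj_class v"
    have y: "?y \<in> ?V" by (rule blowup4I[OF v(1)])
    have "ratio P Q ?y * B ?y = f ?y * A ?y"
      using S(3) y nz by (simp add: form_rep_eq_0[OF S(1)] form_rep_eq_0[OF P(2)])
    moreover have "ratio P Q ?y = P v / Q v" by (rule ratio_proj_class[OF P])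
    moreover have "A ?y = PA v / QA v"
      using A(4)[OF y] nz ratio_proj_class[OF A(1,2)] by (simp add: form_rep_eq_0[OF A(2)])
    moreover have "B ?y = PB v / QB v"
      using B(4)[OF y] nz ratio_proj_class[OF B(1,2)] by (simp add: form_rep_eq_0[OF B(2)])
    moreover have "f ?y = Pf v / Qf v"
      using dP(4)[OF y] nz ratio_proj_class[OF dP(1,2)] by (simp add: form_rep_eq_0[OF dP(2)])
    ultimately have "P v / Q v * (PB v / QB v) = Pf v / Qf v * (PA v / QA v)" by simp
    then show ?thesis using nz by (simp add: frac_eq_eq mult_ac)
  qed
  have main: "dirp P a b m * plift (\<lambda>v. PB v * (Qf v * QA v)) ?v = dirp Pf a b m * plift (\<lambda>v. PA v * (Q v * QB v)) ?v"
  proof (rule dirp_eq[OF pf(1) _ pf(7)])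
    show "poly_fun (\<lambda>v. PB v * (Qf v * QA v))" "poly_fun (\<lambda>v. PA v * (Q v * QB v))"
      by (intro poly_fun.mult pf)+
    show "\<forall>\<^sub>\<infinity>t. P (cev ?v t) = 0"
      using chart_cofinite[OF ch]
    proof eventually_elim
      case (elim t)
      have "proj_class (cev ?v t) = proj_class (cev Yc t)" using gam_vt[OF elim] gam_Yc[of t] by simp
      then show ?case using P0[of t] form_rep_eq_0[OF P(1)] by metis
    qed
    have "f \<in> curve_ideal ?V C ?x" using f unfolding local_equation_def by (rule conjunct1)
    then have "\<forall>\<^sub>\<infinity>t. f (gam t) = 0" using curve_ideal_iff[of f t0] unfolding curve_ideal_def by blast
    then show "\<forall>\<^sub>\<infinity>t. Pf (cev ?v t) = 0"
      using chart_cofinite[OF ch] Rcof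
    proof eventually_elim
      case (elim t)
      note g = gam_vt[OF elim(2)]
      have nz: "Qf (cev ?v t) \<noteq> 0" using elim(3) by (auto simp: R_def)
      have "f (gam t) = ratio Pf Qf (gam t)"
        by (rule dP(4)[OF gam_inV]) (simp add: g form_rep_eq_0[OF dP(2)] nz)
      also have "\<dots> = Pf (cev ?v t) / Qf (cev ?v t)" unfolding g by (rule ratio_proj_class[OF dP(1,2)])
      finally show ?case using elim(1) nz by simp
    qed
    show "\<forall>\<^sub>\<infinity>t. \<forall>\<^sub>\<infinity>e. P (Phi p a b (ev (L a) t + e *s m) (ev (L b) t)) *
        (PB (Phi p a b (ev (L a) t + e *s m) (ev (L b) t)) * (Qf (Phi p a b (ev (L a) t + e *s m) (ev (L b) t)) *
         QA (Phi p a b (ev (L a) t + e *s m) (ev (L b) t)))) =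
      Pf (Phi p a b (ev (L a) t + e *s m) (ev (L b) t)) *
        (PA (Phi p a b (ev (L a) t + e *s m) (ev (L b) t)) * (Q (Phi p a b (ev (L a) t + e *s m) (ev (L b) t)) *
         QB (Phi p a b (ev (L a) t + e *s m) (ev (L b) t))))"
      using chart_cofinite[OF ch] Rcof
    proof eventually_elim
      case (elim t)
      note cp = chart_path[OF chart_Phi_Yc[OF elim(1)] L_dot(1) m L_dot(1)]
      have "R (rep (proj_class (Phi p a b (ev (L a) t) (ev (L b) t)))) \<noteq> 0"
        using elim(2) by (simp add: form_rep_eq_0[OF R] cev_vt)
      from near_path[OF near_form[OF R this] cp(1)]
      have "\<forall>\<^sub>\<infinity>e. R (Phi p a b (ev (L a) t + e *s m) (ev (L b) t)) \<noteq> 0"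
        by (simp add: form_rep_eq_0[OF R])
      with cp(2) show ?case by eventually_elim (rule cross)
    qed
  qed
  have pl: "plift (\<lambda>v. PB v * (Qf v * QA v)) ?v = plift PB ?v * (plift Qf ?v * plift QA ?v)"
    "plift (\<lambda>v. PA v * (Q v * QB v)) ?v = (plift PA ?v * plift Q ?v) * plift QB ?v"
    by (rule poly_eqI_all, simp add: poly_plift[OF poly_fun.mult[OF pf(5) poly_fun.mult[OF pf(8,4)]]]
        poly_plift[OF pf(5)] poly_plift[OF pf(8)] poly_plift[OF pf(4)])
     (rule poly_eqI_all, simp add: poly_plift[OF poly_fun.mult[OF pf(3) poly_fun.mult[OF pf(2,6)]]]
        poly_plift[OF pf(3)] poly_plift[OF pf(2)] poly_plift[OF pf(6)])
  have main': "(dirp P a b m * plift PB ?v) * (plift Qf ?v * plift QA ?v)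
      = (plift PA ?v * plift Q ?v) * (plift QB ?v * dirp Pf a b m)"
    using main unfolding pl by (simp only: mult_ac)
  have F1n: "dirp Pf a b m \<noteq> 0" using F1 by auto
  have rhs: "(plift PA ?v * plift Q ?v) * (plift QB ?v * dirp Pf a b m) \<noteq> 0"
    using oA(1) QV oB(3) F1n by auto
  then have lhs: "dirp P a b m * plift PB ?v \<noteq> 0" using main' by auto
  then show D: "dirp P a b m \<noteq> 0" by auto
  have "order t0 (dirp P a b m) + order t0 (plift PB ?v) = order t0 (dirp P a b m * plift PB ?v)"
    by (rule Polynomial.order_mult[OF lhs, symmetric])
  also have "\<dots> = order t0 ((dirp P a b m * plift PB ?v) * (plift Qf ?v * plift QA ?v))"
    by (rule order_mult_nonzero_left[symmetric]) (use oA(3) QF0 lhs in auto)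
  also have "\<dots> = order t0 (plift PA ?v * plift Q ?v)"
    unfolding main' by (rule order_mult_nonzero_left) (use oB(3) F1 rhs in auto)
  also have "\<dots> = order t0 (plift PA ?v) + order t0 (plift Q ?v)"
    by (rule Polynomial.order_mult) (use rhs in auto)
  finally show "int (order t0 (dirp P a b m)) = int (order_on_curve ?V C ?x A)
      - int (order_on_curve ?V C ?x B) + int (order t0 (plift Q ?v))"
    using oA(2) oB(2) by simp
qed

text \<open>
Here \<open>transversal\<close> is translated from the Taylor coefficient of \<open>f\<close> to the numerator of \<open>f\<close>.
\<close>

lemma local_equation_derivative:
  assumes ch: "chart p a b (cev Yc t0)" and m: "dot m (p a) = 0" "crs m (ev (L a) t0) \<noteq> 0"
    and W: "crs (ev (L b) t0) (ev (dv (L b)) t0) \<noteq> 0"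
    and f: "local_equation (blowup4 p) C (gam t0) f"
    and dP: "form dd Pf" "form dd Qf" "Qf (rep (gam t0)) \<noteq> 0"
      "\<And>y. y \<in> blowup4 p \<Longrightarrow> Qf (rep y) \<noteq> 0 \<Longrightarrow> f y = ratio Pf Qf y"
  shows "poly (dirp Pf a b m) t0 \<noteq> 0"
proof -
  let ?v = "cev (vt a b) t0" and ?w = "Zv p a b m (ev (L b) t0)"
  let ?y = "\<lambda>e. Phi p a b (ev (L a) t0 + e *s m) (ev (L b) t0)"
  note pf = form_poly_fun[OF dP(1)] form_poly_fun[OF dP(2)]
  have line: "?y e = (\<chi> i j. ?v $ i $ j + e * ?w $ i $ j)" for e unfolding Phi_line cev_vt ..
  obtain pp where pp: "\<And>e. Pf (\<chi> i j. ?v $ i $ j + e * ?w $ i $ j) = poly pp e"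
    "poly (pderiv pp) 0 = dird Pf ?v ?w" "poly pp 0 = Pf ?v" by (rule dird_ex[OF pf(1), of ?v ?w]) blast
  obtain qq where qq: "\<And>e. Qf (\<chi> i j. ?v $ i $ j + e * ?w $ i $ j) = poly qq e"
    "poly (pderiv qq) 0 = dird Qf ?v ?w" "poly qq 0 = Qf ?v" by (rule dird_ex[OF pf(2), of ?v ?w]) blast
  have Q0: "Qf ?v \<noteq> 0" using dP(3) by (simp add: gam_vt[OF ch] form_rep_eq_0[OF dP(2)])
  have fI: "f \<in> curve_ideal (blowup4 p) C (gam t0)" using f unfolding local_equation_def by (rule conjunct1)
  have f0: "f (gam t0) = 0" by (rule curve_ideal_self[OF fI gam_in CV])
  have "f (gam t0) = Pf ?v / Qf ?v"
    using dP(4)[OF gam_inV dP(3)] ratio_proj_class[OF dP(1,2), of ?v] by (simp add: gam_vt[OF ch])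
  then have P0: "Pf ?v = 0" using f0 Q0 by simp
  note cp = chart_path[OF chart_Phi_Yc[OF ch] L_dot(1) m(1) L_dot(1)]
  have q0: "poly qq 0 \<noteq> 0" using Q0 qq(3) by simp
  have "qq \<noteq> 0" using q0 by auto
  have "\<forall>\<^sub>\<infinity>e. f (proj_class (?y e)) * poly qq e = poly pp e"
    using cp(2) poly_nonzero_cofinite[OF \<open>qq \<noteq> 0\<close>]
  proof eventually_elim
    case (elim e)
    have nz: "Qf (?y e) \<noteq> 0" using elim(2) unfolding line qq(1) .
    have "f (proj_class (?y e)) = ratio Pf Qf (proj_class (?y e))"
      by (rule dP(4)[OF blowup4I[OF elim(1)]]) (simp add: form_rep_eq_0[OF dP(2)] nz)
    also have "\<dots> = Pf (?y e) / Qf (?y e)" by (rule ratio_proj_class[OF dP(1,2)])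
    finally show ?case using nz unfolding line pp(1) qq(1) by simp
  qed
  from germ_quotient[where f = f and y = "\<lambda>e. proj_class (?y e)", OF q0 this] obtain h where h: "germ (\<lambda>e. proj_class (?y e)) f h"
    "h * fps_of_poly qq = fps_of_poly pp" by blast
  have h1: "fps_nth h (Suc 0) \<noteq> 0" by (rule transversal[OF ch m W f h(1)])
  have h0: "fps_nth h 0 * poly qq 0 = poly pp 0"
    using arg_cong[OF h(2), of "\<lambda>f. fps_nth f 0"] by (simp add: fps_mult_nth_0 poly_0_coeff_0)
  then have h0: "fps_nth h 0 = 0" using P0 pp(3) q0 by simp
  have "fps_nth h (Suc 0) * coeff qq 0 = coeff pp (Suc 0)"
    using arg_cong[OF h(2), of "\<lambda>f. fps_nth f (Suc 0)"] h0 by (simp add: fps_mult_nth_1')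
  moreover have "poly (pderiv pp) 0 = coeff pp (Suc 0)" by (simp add: poly_0_coeff_0 coeff_pderiv)
  ultimately have "poly (pderiv pp) 0 \<noteq> 0" using h1 q0 by (auto simp: poly_0_coeff_0)
  then show ?thesis unfolding poly_dirp[OF pf(1)] pp(2) .
qed

text \<open>
The joining line of \<open>p i\<close> and \<open>X\<close> is \<open>L i\<close> wherever the two points differ, so \<open>p i \<times> X\<close> is a multiple of \<open>L i\<close>.
The factor vanishes where the plane curve passes through \<open>p i\<close>, to the order in which the curve on
the surface meets \<open>Ecurve p i\<close>.
\<close>

definition M :: "4 \<Rightarrow> 'k poly" where
  "M i = (SOME M. crs (kc (p i)) X = M *s L i)"

lemma M: "crs (kc (p i)) X = M i *s L i"
proof -
  have "crs (crs (kc (p i)) X) (L i) = 0"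
    using crs_crs[of "L i" "kc (p i)" X] L_dot_poly[of i] crs_swap[of "L i" "crs (kc (p i)) X"] by simp
  then obtain M where "crs (kc (p i)) X = M *s L i" using multiple_of_coprime[OF L_nonzero] by metis
  then show ?thesis unfolding M_def by (rule someI)
qed

lemma Xlines: "a \<noteq> b \<Longrightarrow> \<exists>R. crs (L a) (L b) = R *s X"
proof -
  have "crs X (crs (L a) (L b)) = 0"
    using crs_crs[of X "L a" "L b"] L_dot_poly by (simp add: dot_commute)
  then have "crs (crs (L a) (L b)) X = 0" using crs_swap[of "crs (L a) (L b)" X] by simp
  then show ?thesis using multiple_of_coprime[OF X_nonzero] by metis
qed

lemma smult_cancel_L: "c *s L i = e *s L i \<Longrightarrow> c = e"
proof -
  have *: "c = e" if "c *s A = e *s A" "\<And>t. ev A t \<noteq> 0" for c e :: "'k poly" and A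
  proof -
    have "A \<noteq> 0" using that(2)[of 0] by auto
    then obtain j where "A $ j \<noteq> 0" by (auto simp: vec_eq_iff)
    moreover have "c * A $ j = e * A $ j" using arg_cong[OF that(1), of "\<lambda>v. v $ j"] by simp
    ultimately show ?thesis by simp
  qed
  show "c *s L i = e *s L i \<Longrightarrow> c = e" using *[of c "L i" e] L_nonzero by blast
qed

end

section \<open>The local adjunction formula\<close>

lemma dird_scale:
  assumes F: "form (\<lambda>_::1. e) (F :: 'k::alg_closed_field^'n::finite^1 \<Rightarrow> 'k)"
  shows "c * dird F (row_scale (\<lambda>_. c) v) w = c ^ e * dird F v w"
proof -
  note pf = form_poly_fun[OF F]
  obtain q where q: "\<And>t. F (\<chi> i j. v $ i $ j + t * w $ i $ j) = poly q t"
    "poly (pderiv q) 0 = dird F v w" "poly q 0 = F v" by (rule dird_ex[OF pf, of v w]) blast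
  have "dird F (row_scale (\<lambda>_. c) v) (row_scale (\<lambda>_. c) w) = poly (pderiv (smult (c ^ e) q)) 0"
  proof (rule dird_eqI[OF pf], rule always_eventually, rule allI)
    fix t
    have "(\<chi> i j. row_scale (\<lambda>_. c) v $ i $ j + t * row_scale (\<lambda>_. c) w $ i $ j)
      = row_scale (\<lambda>_. c) (\<chi> i j. v $ i $ j + t * w $ i $ j)"
      by (simp add: vec_eq_iff algebra_simps)
    then show "F (\<chi> i j. row_scale (\<lambda>_. c) v $ i $ j + t * row_scale (\<lambda>_. c) w $ i $ j) = poly (smult (c ^ e) q) t"
      by (simp add: form1_scale[OF F] q(1))
  qed
  moreover have "dird F (row_scale (\<lambda>_. c) v) (row_scale (\<lambda>_. c) w) = c * dird F (row_scale (\<lambda>_. c) v) w"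
    by (simp add: dird_def sum_distrib_left mult_ac)
  ultimately show ?thesis using q(2) by (simp add: pderiv_smult)
qed

context blowup_line begin

lemma hat_X: "hat p (v1 (ev X t)) = row_scale (\<lambda>i. case i of None \<Rightarrow> 1 | Some c \<Rightarrow> poly (M c) t) (cev Yc t)"
proof -
  have "crs (p c) (ev X t) = poly (M c) t *s ev (L c) t" for c
    using arg_cong[OF M[of c], of "\<lambda>A. ev A t"] by simp
  then have "hat p (v1 (ev X t)) $ i = row_scale (\<lambda>i. case i of None \<Rightarrow> 1 | Some c \<Rightarrow> poly (M c) t) (cev Yc t) $ i" for i
    by (cases i) (simp_all add: hat_def cev_rows)
  then show ?thesis by (simp add: vec_eq_iff)
qed

lemma vanish_hat_X: "form d P \<Longrightarrow> P (cev Yc t) = 0 \<Longrightarrow> P (hat p (v1 (ev X t))) = 0"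
  unfolding hat_X by (simp add: form_scale)

text \<open>
Along the curve, \<open>hat\<close> of the point \<open>L a \<times> L b = R * X\<close> is the chart vector with its rows \<open>a\<close> and \<open>b\<close>
scaled; \<open>E\<close> collects the scale factors.
\<close>

lemma pull_back_line:
  assumes P: "form d P" and R: "crs (L a) (L b) = R *s X" and ab: "a \<noteq> b"
    and D: "D = (\<Sum>j\<in>UNIV. d j)"
    and E: "E = dot (kc (p a)) (L b) ^ d (Some a) * (- dot (kc (p b)) (L a)) ^ d (Some b)"
  shows "E * plift P (vt a b) = R ^ D * plift (\<lambda>z. P (hat p z)) Xc"
proof (rule poly_eqI_all)
  fix t
  let ?la = "ev (L a) t" and ?lb = "ev (L b) t"
  have "crs ?la ?lb = poly R t *s ev X t" using arg_cong[OF R, of "\<lambda>A. ev A t"] by simp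
  then have "v1 (crs ?la ?lb) = row_scale (\<lambda>_. poly R t) (v1 (ev X t))" by (simp add: vec_eq_iff)
  then have "P (hat p (v1 (crs ?la ?lb))) = poly R t ^ D * P (hat p (v1 (ev X t)))"
    unfolding D using form1_scale[OF form_Ph[OF P], of p "poly R t" "v1 (ev X t)"] by simp
  moreover have "P (hat p (v1 (crs ?la ?lb))) = poly E t * P (cev (vt a b) t)"
    using form_hat_chart[OF P L_dot(1)[of a t] L_dot(1)[of b t] ab] by (simp add: E cev_vt)
  ultimately show "poly (E * plift P (vt a b)) t = poly (R ^ D * plift (\<lambda>z. P (hat p z)) Xc) t"
    by (simp add: poly_plift[OF form_poly_fun[OF P]] poly_plift[OF form_poly_fun[OF form_Ph[OF P]]] cev_Xc)
qed

text \<open>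
The derivative of \<open>pull_back_line\<close> across the curve. The derivatives of the factors do not
contribute, since \<open>P\<close> vanishes on the curve.
\<close>

lemma pull_back_derivative:
  assumes ch: "chart p a b (cev Yc t0)"
    and P: "form d P" and P0: "\<And>t. P (cev Yc t) = 0" and R: "crs (L a) (L b) = R *s X"
    and m: "dot m (p a) = 0" and D: "D = (\<Sum>j\<in>UNIV. d j)"
    and E: "E = dot (kc (p a)) (L b) ^ d (Some a) * (- dot (kc (p b)) (L a)) ^ d (Some b)"
  shows "R * (E * dirp P a b m) = R ^ D * dot (Nv P) (crs (kc m) (L b))"
proof (rule poly_eqI_cofinite)
  have ab: "a \<noteq> b" using ch by (simp add: chart_def)
  let ?F = "\<lambda>z. P (hat p z)"
  note fF = form_Ph[OF P, of p]
  show "\<forall>\<^sub>\<infinity>t. poly (R * (E * dirp P a b m)) t = poly (R ^ D * dot (Nv P) (crs (kc m) (L b))) t"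
    using chart_cofinite[OF ch]
  proof eventually_elim
    case (elim t)
    let ?la = "ev (L a) t" and ?lb = "ev (L b) t"
    let ?v = "cev (vt a b) t" and ?w = "Zv p a b m ?lb"
    have "proj_class ?v = proj_class (cev Yc t)" using gam_vt[OF elim] gam_Yc[of t] by simp
    then have Pv: "P ?v = 0" using P0[of t] form_rep_eq_0[OF P] by metis
    obtain q where q: "\<And>e. P (\<chi> i j. ?v $ i $ j + e * ?w $ i $ j) = poly q e"
      "poly (pderiv q) 0 = dird P ?v ?w" "poly q 0 = P ?v" by (rule dird_ex[OF form_poly_fun[OF P], of ?v ?w]) blast
    define G where "G = smult (dot (p a) ?lb ^ d (Some a)) ([:- dot (p b) ?la, - dot (p b) m:] ^ d (Some b))"
    have G0: "poly G 0 = poly E t" by (simp add: G_def E)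
    have "?F (\<chi> i j. v1 (crs ?la ?lb) $ i $ j + e * v1 (crs m ?lb) $ i $ j) = poly (G * q) e" for e
    proof -
      have line: "(\<chi> i j. v1 (crs ?la ?lb) $ i $ j + e * v1 (crs m ?lb) $ i $ j) = v1 (crs (?la + e *s m) ?lb)"
        by (simp add: vec_eq_iff crs_add)
      have d0: "dot (?la + e *s m) (p a) = 0" by (simp add: dot_add L_dot m)
      have Pq: "P (Phi p a b (?la + e *s m) ?lb) = poly q e"
        unfolding Phi_line q(1)[symmetric] cev_vt ..
      show ?thesis unfolding line form_hat_chart[OF P d0 L_dot(1)[of b t] ab] Pq
        by (simp add: G_def dot_add algebra_simps)
    qed
    then have "dird ?F (v1 (crs ?la ?lb)) (v1 (crs m ?lb)) = poly (pderiv (G * q)) 0"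
      by (intro dird_eqI[OF form_poly_fun[OF fF]]) simp
    also have "\<dots> = poly E t * poly (dirp P a b m) t"
      unfolding pderiv_mult poly_dirp[OF form_poly_fun[OF P]] using q(2,3) G0 Pv by simp
    finally have 1: "dird ?F (v1 (crs ?la ?lb)) (v1 (crs m ?lb)) = poly E t * poly (dirp P a b m) t" .
    have "crs ?la ?lb = poly R t *s ev X t" using arg_cong[OF R, of "\<lambda>A. ev A t"] by simp
    then have "v1 (crs ?la ?lb) = row_scale (\<lambda>_. poly R t) (v1 (ev X t))" by (simp add: vec_eq_iff)
    with 1 have "poly R t * (poly E t * poly (dirp P a b m) t) = poly R t ^ D * dird ?F (v1 (ev X t)) (v1 (crs m ?lb))"
      using dird_scale[OF fF, of "poly R t" "v1 (ev X t)" "v1 (crs m ?lb)"] by (simp add: D)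
    then show ?case by (simp add: dot_Nv[OF P])
  qed
qed

text \<open>
The line through \<open>p b\<close> turns with speed \<open>W\<close>, that through \<open>p a\<close> is turned by \<open>m\<close> with speed \<open>w\<close>. Their
product differs from the determinant of the point, its velocity, and the transversal direction by
the factors \<open>M a\<close> and \<open>M b\<close>: these are what the blow-up adds to the plane.
\<close>

lemma triple_product:
  assumes ab: "a \<noteq> b" and R: "crs (L a) (L b) = R *s X" "R \<noteq> 0" and m: "dot m (p a) = 0"
  obtains W w where "crs (L b) (dv (L b)) = W *s kc (p b)" "crs (L a) (kc m) = w *s kc (p a)"
    "dot K (crs (kc m) (L b)) = - (W * w) * (M a * M b)"
proof -
  have pne: "ev (kc (p i)) t \<noteq> 0" for i t using gp_nonzero[OF gp] by simp
  have dv0: "dot (dv (L b)) (kc (p b)) = 0"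
    using pderiv_dot_kc[of "L b" "p b"] L_dot_poly(1)[of b] by simp
  have "crs (kc (p b)) (crs (L b) (dv (L b))) = 0"
    unfolding crs_crs using dv0 L_dot_poly(1)[of b] by (simp add: dot_commute)
  then have "crs (crs (L b) (dv (L b))) (kc (p b)) = 0" using crs_swap[of "crs (L b) (dv (L b))" "kc (p b)"] by simp
  then obtain W where W: "crs (L b) (dv (L b)) = W *s kc (p b)" using multiple_of_coprime[OF pne] by metis
  have "dot (kc (p a)) (kc m) = [:dot m (p a):]" by (simp add: dot_def mult.commute)
  then have "crs (kc (p a)) (crs (L a) (kc m)) = 0"
    unfolding crs_crs using m L_dot_poly(1)[of a] by (simp add: dot_commute)
  then have "crs (crs (L a) (kc m)) (kc (p a)) = 0" using crs_swap[of "crs (L a) (kc m)" "kc (p a)"] by simp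
  then obtain w where w: "crs (L a) (kc m) = w *s kc (p a)" using multiple_of_coprime[OF pne] by metis
  have "R *s (M a *s L a) = crs (kc (p a)) (crs (L a) (L b))" unfolding R(1) by (simp add: M)
  also have "\<dots> = dot (kc (p a)) (L b) *s L a"
    unfolding crs_crs using L_dot_poly(1)[of a] by (simp add: dot_commute)
  finally have Ma: "R * M a = dot (kc (p a)) (L b)" by (intro smult_cancel_L[of _ a]) (simp add: vector_smult_assoc)
  have "R *s (M b *s L b) = crs (kc (p b)) (crs (L a) (L b))" unfolding R(1) by (simp add: M)
  also have "\<dots> = (- dot (kc (p b)) (L a)) *s L b"
    unfolding crs_crs using L_dot_poly(1)[of b] by (simp add: dot_commute vec_eq_iff)
  finally have Mb: "R * M b = - dot (kc (p b)) (L a)" by (intro smult_cancel_L[of _ b]) (simp add: vector_smult_assoc)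
  have "(R * R) *s K = crs (R *s X) (dv (R *s X))"
    by (simp add: K_def dv_smult crs_add vector_smult_assoc)
  also have "\<dots> = crs (crs (L a) (L b)) (crs (dv (L a)) (L b) + crs (L a) (dv (L b)))"
    unfolding R(1)[symmetric] dv_crs ..
  finally have "dot ((R * R) *s K) (crs (kc m) (L b)) = dot (L a) (crs (L b) (dv (L b))) * dot (crs (L a) (kc m)) (L b)"
    by (simp only: triple_identity)
  also have "\<dots> = (W * dot (L a) (kc (p b))) * (w * dot (kc (p a)) (L b))" unfolding W w by simp
  also have "\<dots> = - (W * w) * ((- dot (kc (p b)) (L a)) * dot (kc (p a)) (L b))"
    by (simp add: dot_commute[of "L a"])
  also have "\<dots> = (R * R) * (- (W * w) * (M a * M b))" unfolding Ma[symmetric] Mb[symmetric] by (simp add: mult_ac)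
  finally have "(R * R) * dot K (crs (kc m) (L b)) = (R * R) * (- (W * w) * (M a * M b))" by simp
  moreover have "R * R \<noteq> 0" using R(2) by simp
  ultimately have "dot K (crs (kc m) (L b)) = - (W * w) * (M a * M b)"
    using mult_left_cancel[of "R * R"] by blast
  with W w show thesis by (rule that)
qed

text \<open>
The order of the section is that of \<open>dP / Q\<close> by \<open>conormal_identity\<close>; \<open>pull_back_derivative\<close> and
\<open>pull_back_line\<close> move \<open>dP\<close> and \<open>Q\<close> to the plane, \<open>Nv_cross\<close> replaces the transversal direction by
\<open>K\<close>, and \<open>triple_product\<close> produces \<open>M a * M b\<close>. The other two \<open>M i\<close> have no zero at \<open>t0\<close>, as
the chart avoids their points.
\<close>

lemma local_order_chart:
  assumes nE: "\<And>i. crs (kc (p i)) X \<noteq> 0"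
    and ch: "chart p a b (cev Yc t0)" and W0: "crs (ev (L b) t0) (ev (dv (L b)) t0) \<noteq> 0"
    and P: "form d P" "form d Q" and P0: "\<And>t. P (cev Yc t) = 0"
    and QX: "plift (\<lambda>z. Q (hat p z)) Xc \<noteq> 0"
    and co: "conormal_order (blowup4 p) C P Q (gam t0) n" and Kj: "K $ j \<noteq> 0"
  shows "Nv P $ j \<noteq> 0 \<and> n = int (order t0 (Nv P $ j)) + (\<Sum>i\<in>UNIV. int (order t0 (M i)))
    - int (order t0 (K $ j)) - int (order t0 (plift (\<lambda>z. Q (hat p z)) Xc))"
proof -
  let ?V = "blowup4 p" and ?x = "gam t0" and ?QX = "plift (\<lambda>z. Q (hat p z)) Xc"
  have ab: "a \<noteq> b" using ch by (simp add: chart_def)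
  obtain f A B where co': "local_equation ?V C ?x f"
    "A \<in> local_ring ?V ?x - curve_ideal ?V C ?x" "B \<in> local_ring ?V ?x - curve_ideal ?V C ?x"
    "near ?V ?x (\<lambda>y. Q (rep y) \<noteq> 0 \<longrightarrow> ratio P Q y * B y = f y * A y)"
    "n = int (order_on_curve ?V C ?x A) - int (order_on_curve ?V C ?x B)"
    using co unfolding conormal_order_def by blast
  have "f \<in> local_ring ?V ?x" using co'(1) unfolding local_equation_def curve_ideal_def by blast
  then obtain dd Pf Qf where F: "form dd Pf" "form dd Qf" "Qf (rep ?x) \<noteq> 0"
    "\<And>y. y \<in> ?V \<Longrightarrow> Qf (rep y) \<noteq> 0 \<Longrightarrow> f y = ratio Pf Qf y" by (rule local_ringE) blast
  obtain q where q: "dot (ev (L a) t0) q \<noteq> 0" using exists_nonzero_dot[OF L_nonzero] by blast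
  define m where "m = crs (p a) q"
  have m: "dot m (p a) = 0" by (simp add: m_def)
  have "crs (ev (L a) t0) m = dot (ev (L a) t0) q *s p a"
    unfolding m_def crs_crs L_dot by simp
  then have "crs (ev (L a) t0) m \<noteq> 0" using q gp_nonzero[OF gp] by simp
  then have m': "crs m (ev (L a) t0) \<noteq> 0" using crs_swap[of m "ev (L a) t0"] by simp
  have F1: "poly (dirp Pf a b m) t0 \<noteq> 0" by (rule local_equation_derivative[OF ch m m' W0 co'(1) F])
  obtain R where R: "crs (L a) (L b) = R *s X" using Xlines[OF ab] by blast
  have R0: "poly R t0 \<noteq> 0"
  proof
    assume "poly R t0 = 0"
    then have "crs (ev (L a) t0) (ev (L b) t0) = 0" using arg_cong[OF R, of "\<lambda>A. ev A t0"] by simp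
    then show False using ch by (simp add: chart_def cev_rows)
  qed
  have Rn: "R \<noteq> 0" using R0 by auto
  have RD: "poly (R ^ k) t0 \<noteq> 0" "R ^ k \<noteq> 0" for k using R0 Rn by simp_all
  define D where "D = (\<Sum>j\<in>UNIV. d j)"
  define E where "E = dot (kc (p a)) (L b) ^ d (Some a) * (- dot (kc (p b)) (L a)) ^ d (Some b)"
  have I2: "E * plift Q (vt a b) = R ^ D * ?QX" by (rule pull_back_line[OF P(2) R ab D_def E_def])
  have I2n: "E * plift Q (vt a b) \<noteq> 0" unfolding I2 using RD QX by simp
  then have QV: "plift Q (vt a b) \<noteq> 0" and En: "E \<noteq> 0" by auto
  note ci = conormal_identity[OF ch m P QV P0 co'(1-4) F F1]
  let ?z = "crs (kc m) (L b)"
  have I3: "R * (E * dirp P a b m) = R ^ D * dot (Nv P) ?z"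
    by (rule pull_back_derivative[OF ch P(1) P0 R m D_def E_def])
  have EP: "E * dirp P a b m \<noteq> 0" using En ci(1) by simp
  then have Nz: "dot (Nv P) ?z \<noteq> 0" using I3 Rn by auto
  have o1: "order t0 E + order t0 (plift Q (vt a b)) = order t0 ?QX"
  proof -
    have "order t0 E + order t0 (plift Q (vt a b)) = order t0 (?QX * R ^ D)"
      using Polynomial.order_mult[OF I2n, of t0] I2 by (simp add: mult.commute)
    then show ?thesis using order_mult_nonzero_left[OF RD(1) QX] by simp
  qed
  have o2: "order t0 E + order t0 (dirp P a b m) = order t0 (dot (Nv P) ?z)"
  proof -
    have "order t0 E + order t0 (dirp P a b m) = order t0 (E * dirp P a b m)"
      by (rule Polynomial.order_mult[OF EP, symmetric])
    also have "\<dots> = order t0 (E * dirp P a b m * R)" by (rule order_mult_nonzero_left[OF R0 EP, symmetric])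
    also have "\<dots> = order t0 (dot (Nv P) ?z * R ^ D)" using I3 by (simp add: mult.commute)
    also have "\<dots> = order t0 (dot (Nv P) ?z)" by (rule order_mult_nonzero_left[OF RD(1) Nz])
    finally show ?thesis .
  qed
  have I4: "dot (Nv P) ?z * K $ j = Nv P $ j * dot K ?z"
    by (rule Nv_cross[OF P(1) vanish_hat_X[OF P(1) P0]])
  have I4n: "Nv P $ j * dot K ?z \<noteq> 0" unfolding I4[symmetric] using Nz Kj by simp
  then have Nj: "Nv P $ j \<noteq> 0" and Kz: "dot K ?z \<noteq> 0" by auto
  have o3: "order t0 (dot (Nv P) ?z) + order t0 (K $ j) = order t0 (Nv P $ j) + order t0 (dot K ?z)"
    using Polynomial.order_mult[OF I4n, of t0] Polynomial.order_mult[of "dot (Nv P) ?z" "K $ j" t0] I4 I4n by simp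
  obtain W w where Ww: "crs (L b) (dv (L b)) = W *s kc (p b)" "crs (L a) (kc m) = w *s kc (p a)"
    "dot K ?z = - (W * w) * (M a * M b)" using triple_product[OF ab R Rn m] by blast
  have W0': "poly W t0 \<noteq> 0"
  proof
    assume "poly W t0 = 0"
    then have "crs (ev (L b) t0) (ev (dv (L b)) t0) = 0" using arg_cong[OF Ww(1), of "\<lambda>A. ev A t0"] by simp
    with W0 show False by simp
  qed
  have w0: "poly w t0 \<noteq> 0"
  proof
    assume "poly w t0 = 0"
    then have "crs (ev (L a) t0) m = 0" using arg_cong[OF Ww(2), of "\<lambda>A. ev A t0"] by simp
    with \<open>crs (ev (L a) t0) m \<noteq> 0\<close> show False by simp
  qed
  have Mn: "M i \<noteq> 0" for i using nE[of i] M[of i] by auto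
  have o4: "order t0 (dot K ?z) = order t0 (M a) + order t0 (M b)"
  proof -
    have "M a * M b \<noteq> 0" using Mn by simp
    then have "order t0 (dot K ?z) = order t0 (M a * M b)"
      using order_mult_nonzero_left[of "- (W * w)" t0 "M a * M b"] W0' w0 unfolding Ww(3) by (simp add: mult.commute)
    then show ?thesis using Polynomial.order_mult[OF \<open>M a * M b \<noteq> 0\<close>, of t0] by simp
  qed
  have "(\<Sum>i\<in>UNIV. int (order t0 (M i))) = (\<Sum>i\<in>{a, b}. int (order t0 (M i)))"
  proof (rule sum.mono_neutral_right)
    show "\<forall>i\<in>UNIV - {a, b}. int (order t0 (M i)) = 0"
    proof
      fix i assume i: "i \<in> UNIV - {a, b}"
      have "poly (M i) t0 \<noteq> 0"
      proof
        assume "poly (M i) t0 = 0"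
        then have "crs (p i) (ev X t0) = 0" using arg_cong[OF M[of i], of "\<lambda>A. ev A t0"] by simp
        then show False using ch i by (auto simp: chart_def cev_rows)
      qed
      then show "int (order t0 (M i)) = 0" by (simp add: order_0I)
    qed
  qed auto
  also have "\<dots> = int (order t0 (M a)) + int (order t0 (M b))" using ab by simp
  finally have o5: "(\<Sum>i\<in>UNIV. int (order t0 (M i))) = int (order t0 (M a)) + int (order t0 (M b))" .
  have "n = int (order t0 (dirp P a b m)) - int (order t0 (plift Q (vt a b)))"
    using co'(5) ci(2) by simp
  then show ?thesis using Nj o1 o2 o3 o4 o5 by linarith
qed

text \<open>
By \<open>chart_derivative\<close> one of the two lines of a chart moves, and the roles of the two are symmetric.
\<close>

lemma local_order:
  assumes nE: "\<And>i. crs (kc (p i)) X \<noteq> 0"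
    and P: "form d P" "form d Q" and P0: "\<And>t. P (cev Yc t) = 0"
    and QX: "plift (\<lambda>z. Q (hat p z)) Xc \<noteq> 0"
    and co: "conormal_order (blowup4 p) C P Q (gam t0) n" and Kj: "K $ j \<noteq> 0"
  shows "Nv P $ j \<noteq> 0" "n = int (order t0 (Nv P $ j)) + (\<Sum>i\<in>UNIV. int (order t0 (M i)))
    - int (order t0 (K $ j)) - int (order t0 (plift (\<lambda>z. Q (hat p z)) Xc))"
proof -
  obtain a b where ch: "chart p a b (cev Yc t0)" using chart_exists[OF gp cone_Yc] .
  have "Nv P $ j \<noteq> 0 \<and> n = int (order t0 (Nv P $ j)) + (\<Sum>i\<in>UNIV. int (order t0 (M i)))
    - int (order t0 (K $ j)) - int (order t0 (plift (\<lambda>z. Q (hat p z)) Xc))"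
    using chart_derivative[OF ch]
  proof
    assume "crs (ev (L b) t0) (ev (dv (L b)) t0) \<noteq> 0"
    then show ?thesis by (rule local_order_chart[OF nE ch _ P P0 QX co Kj])
  next
    assume "crs (ev (L a) t0) (ev (dv (L a)) t0) \<noteq> 0"
    moreover have "chart p b a (cev Yc t0)" using ch chart_swap by blast
    ultimately show ?thesis by (intro local_order_chart[OF nE _ _ P P0 QX co Kj])
  qed
  then show "Nv P $ j \<noteq> 0" "n = int (order t0 (Nv P $ j)) + (\<Sum>i\<in>UNIV. int (order t0 (M i)))
    - int (order t0 (K $ j)) - int (order t0 (plift (\<lambda>z. Q (hat p z)) Xc))" by blast+
qed

text \<open>
Off the exceptional curves over the four points the blow-down is an isomorphism, so the plane curve
is immersed there too.
\<close>

lemma K_nonzero: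
  assumes "\<And>i. crs (p i) (ev X t0) \<noteq> 0"
  shows "ev K t0 \<noteq> 0"
proof
  assume "ev K t0 = 0"
  then have "crs (ev X t0) (ev (dv X) t0) = 0" by (simp add: K_def)
  then obtain k where k: "ev (dv X) t0 = k *s ev X t0" using crs_eq_0 X_nonzero by blast
  define H where "H = (\<chi> i. case i of None \<Rightarrow> X | Some c \<Rightarrow> crs (kc (p c)) X :: 'k poly^3)"
  have evH: "ev (H $ i) t = hat p (v1 (ev X t)) $ i" for i t
    by (cases i) (simp_all add: H_def hat_def)
  have cevH: "cev H t = hat p (v1 (ev X t))" for t
    by (simp add: vec_eq_iff evH[symmetric])
  have dvH: "ev (dv (H $ i)) t0 = k *s ev (H $ i) t0" for i
    by (cases i) (simp_all add: H_def dv_crs k)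
  define c where "c = (\<chi> i j. pcompose (H $ i $ j) [:t0, 1:])"
  have c: "cev c e = hat p (v1 (ev X (t0 + e)))" for e
    unfolding cevH[symmetric] by (simp add: c_def vec_eq_iff poly_pcompose add.commute)
  have M0: "poly (M i) t0 \<noteq> 0" for i
    using assms[of i] arg_cong[OF M[of i], of "\<lambda>A. ev A t0"] by auto
  have cl: "gam t = proj_class (hat p (v1 (ev X t)))" if "\<And>i. poly (M i) t \<noteq> 0" for t
    unfolding hat_X gam_Yc by (rule proj_class_row_scale[symmetric]) (use that in \<open>auto split: option.split\<close>)
  show False
  proof (rule embedding_derivative[of t0 c "\<lambda>_. k"])
    show "gam t0 = proj_class (cev c 0)" by (simp add: c cl M0)
    have "\<forall>\<^sub>\<infinity>t. \<forall>i\<in>UNIV. poly (M i) t \<noteq> 0"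
    proof (rule eventually_ball_finite, simp, rule ballI)
      fix i
      have "M i \<noteq> 0" using M0[of i] by auto
      then show "\<forall>\<^sub>\<infinity>t. poly (M i) t \<noteq> 0" by (rule poly_nonzero_cofinite)
    qed
    then have "\<forall>\<^sub>\<infinity>t. gam t = proj_class (hat p (v1 (ev X t)))"
      by (rule eventually_mono) (simp add: cl)
    from cofinite_shift[OF this, of t0] show "\<forall>\<^sub>\<infinity>e. gam (t0 + e) = proj_class (cev c e)" by (simp add: c)
    show "poly (pderiv (c $ i $ j)) 0 = k * poly (c $ i $ j) 0" for i j
      using arg_cong[OF dvH[of i], of "\<lambda>v. v $ j"]
      by (simp add: c_def pderiv_pcompose poly_pcompose pderiv_pCons)
  qed
qed

end

section \<open>Global degrees\<close>

text \<open>
The number of roots with multiplicity is the degree. The finite set \<open>T\<close> may be larger than the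
set of roots, so that several polynomials can share one.
\<close>

lemma sum_order_roots:
  fixes q :: "'k::alg_closed_field poly"
  assumes "q \<noteq> 0" "finite T" "{t. poly q t = 0} \<subseteq> T"
  shows "(\<Sum>t\<in>T. order t q) = degree q"
  using assms
proof (induction "degree q" arbitrary: q rule: less_induct)
  case less
  show ?case
  proof (cases "degree q = 0")
    case True
    then obtain c where c: "q = [:c:]" by (rule degree_eq_zeroE)
    then have "c \<noteq> 0" using less.prems(1) by simp
    then have "order t q = 0" for t unfolding c by (intro order_0I) simp
    then show ?thesis using True by simp
  next
    case False
    then obtain r where r: "poly q r = 0" using alg_closed_imp_poly_has_root[of q] by blast
    then obtain s where s: "q = [:- r, 1:] * s" by (auto simp: poly_eq_0_iff_dvd elim: dvdE)
    have sn: "s \<noteq> 0" using less.prems(1) s by auto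
    have deg: "degree q = 1 + degree s"
    proof -
      have "degree q = degree [:- r, 1:] + degree s" unfolding s by (rule degree_mult_eq) (use sn in auto)
      then show ?thesis by simp
    qed
    have "{t. poly s t = 0} \<subseteq> T" using less.prems(3) unfolding s by auto
    then have IH: "(\<Sum>t\<in>T. order t s) = degree s" by (intro less.hyps) (use deg sn less.prems in auto)
    have lin: "order t [:- r, 1:] = (if t = r then 1 else 0)" for t
    proof (cases "t = r")
      case True
      then show ?thesis using order_power_n_n[of r 1] by simp
    qed (simp add: order_0I)
    have "order t q = (if t = r then 1 else 0) + order t s" for t
    proof -
      have "[:- r, 1:] * s \<noteq> 0" using s less.prems(1) by simp
      then show ?thesis unfolding s using Polynomial.order_mult[of "[:- r, 1:]" s t] lin by simp
    qed
    then have "(\<Sum>t\<in>T. order t q) = (\<Sum>t\<in>T. if t = r then 1 else 0) + (\<Sum>t\<in>T. order t s)"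
      by (simp add: sum.distrib)
    moreover have "r \<in> T" using r less.prems(3) by blast
    ultimately show ?thesis using IH deg less.prems(2) by simp
  qed
qed

lemma coeff_mult_pderiv_top:
  fixes A B :: "'k::alg_closed_field poly"
  assumes d: "degree A \<le> d" "degree B \<le> d" "d \<ge> 1"
  shows "coeff (A * pderiv B) (2 * d - 2) =
    of_nat d * (coeff A (d - 1) * coeff B d) + of_nat (d - 1) * (coeff A d * coeff B (d - 1))"
proof -
  have z: "coeff A i = 0" "coeff B i = 0" if "i > d" for i using that d by (auto intro: coeff_eq_0)
  have "coeff (A * pderiv B) (2 * d - 2) =
    (\<Sum>i\<le>2 * d - 2. coeff A i * (of_nat (Suc (2 * d - 2 - i)) * coeff B (Suc (2 * d - 2 - i))))"
    by (simp add: coeff_mult coeff_pderiv)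
  also have "\<dots> = (\<Sum>i\<le>2 * d - 2. (if i = d - 1 then of_nat d * (coeff A (d - 1) * coeff B d) else 0)
     + (if i = d then of_nat (d - 1) * (coeff A d * coeff B (d - 1)) else 0))"
  proof (rule sum.cong[OF refl])
    fix i assume i: "i \<in> {..2 * d - 2}"
    consider "i < d - 1" | "i = d - 1" | "i = d" | "i > d" by linarith
    then show "coeff A i * (of_nat (Suc (2 * d - 2 - i)) * coeff B (Suc (2 * d - 2 - i))) =
      (if i = d - 1 then of_nat d * (coeff A (d - 1) * coeff B d) else 0)
     + (if i = d then of_nat (d - 1) * (coeff A d * coeff B (d - 1)) else 0)"
    proof cases
      case 1
      then have "Suc (2 * d - 2 - i) > d" by linarith
      then show ?thesis using 1 z(2)[of "Suc (2 * d - 2 - i)"] by simp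
    next
      case 2
      then have "Suc (2 * d - 2 - i) = d" using d(3) by linarith
      moreover have "i \<noteq> d" using 2 d(3) by linarith
      ultimately show ?thesis using 2 by simp
    next
      case 3
      then have "Suc (2 * d - 2 - i) = d - 1" using i d(3) by simp
      moreover have "i \<noteq> d - 1" using 3 d(3) by linarith
      ultimately show ?thesis using 3 by simp
    next
      case 4
      then show ?thesis using z(1)[of i] by simp
    qed
  qed
  also have "\<dots> = of_nat d * (coeff A (d - 1) * coeff B d)
    + (if d \<le> 2 * d - 2 then of_nat (d - 1) * (coeff A d * coeff B (d - 1)) else 0)"
    using d(3) by (simp add: sum.distrib)
  also have "\<dots> = of_nat d * (coeff A (d - 1) * coeff B d) + of_nat (d - 1) * (coeff A d * coeff B (d - 1))"
  proof (cases "d \<le> 2 * d - 2")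
    case False
    then have "d = 1" using d(3) by linarith
    then show ?thesis by simp
  qed simp
  finally show ?thesis .
qed

text \<open>
The factors \<open>d\<close> and \<open>d - 1\<close> coming from the two derivatives combine to \<open>1\<close>. So this coefficient is nonzero
in every characteristic as soon as the top coefficients are independent.
\<close>

lemma coeff_wronskian_top:
  fixes A B :: "'k::alg_closed_field poly"
  assumes d: "degree A \<le> d" "degree B \<le> d" "d \<ge> 1"
  shows "coeff (A * pderiv B - B * pderiv A) (2 * d - 2) = coeff A (d - 1) * coeff B d - coeff A d * coeff B (d - 1)"
proof -
  obtain e where e: "d = Suc e" using d(3) by (cases d) auto
  show ?thesis
    unfolding coeff_diff coeff_mult_pderiv_top[OF d] coeff_mult_pderiv_top[OF d(2,1,3)]
    by (simp add: e algebra_simps)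
qed

lemma form_grad:
  fixes F :: "'k::alg_closed_field^'n::finite^1 \<Rightarrow> 'k"
  assumes F: "form (\<lambda>_. Suc e) F"
  shows "form (\<lambda>_. e) (grad F 1 j)"
  unfolding form_def
proof (intro conjI allI)
  show pg: "poly_fun (grad F 1 j)" by (rule grad_poly_fun[OF form_poly_fun[OF F]])
  fix c :: "1 \<Rightarrow> 'k" and v :: "'k^'n^1"
  define w :: "'k^'n^1" where "w = (\<chi> i k. if k = j then 1 else 0)"
  have dw: "dird F v w = grad F 1 j v" for v
    by (simp add: dird_def w_def UNIV_1 if_distrib cong: if_cong)
  have eq: "s * grad F 1 j (row_scale (\<lambda>_. s) v) = s * (s ^ e * grad F 1 j v)" for s
    using dird_scale[OF F, of s v w] by (simp add: dw mult.assoc)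
  define cc where "cc = (\<chi> i k. [:0, v $ i $ k:])"
  have cc: "cev cc s = row_scale (\<lambda>_. s) v" for s by (simp add: cc_def vec_eq_iff)
  have "plift (grad F 1 j) cc = smult (grad F 1 j v) (monom 1 e)"
  proof (rule plift_eqI[OF pg], rule eventually_mono[OF MOST_neq(1)[of 0]])
    fix s :: 'k assume "s \<noteq> 0"
    then show "grad F 1 j (cev cc s) = poly (smult (grad F 1 j v) (monom 1 e)) s"
      using eq[of s] by (simp add: cc poly_monom)
  qed
  then have "grad F 1 j (row_scale (\<lambda>_. c 1) v) = c 1 ^ e * grad F 1 j v"
    using poly_plift[OF pg, of cc "c 1"] by (simp add: cc poly_monom mult.commute)
  moreover have "(\<lambda>_. c 1) = c" by (rule fun_num1_eqI) simp
  ultimately show "grad F 1 j (row_scale c v) = (\<Prod>i\<in>UNIV. c i ^ e) * grad F 1 j v"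
    by (simp add: UNIV_1)
qed

lemma grad_degree_0:
  fixes F :: "'k::alg_closed_field^'n::finite^1 \<Rightarrow> 'k"
  assumes F: "form (\<lambda>_. 0) F"
  shows "grad F 1 j v = 0"
proof -
  define w :: "'k^'n^1" where "w = (\<chi> i k. if k = j then 1 else 0)"
  have dw: "dird F v w = grad F 1 j v" for v
    by (simp add: dird_def w_def UNIV_1 if_distrib cong: if_cong)
  show ?thesis using dird_scale[OF F, of 0 v w] by (simp add: dw)
qed

context blowup_line begin

abbreviation "d0 \<equiv> \<delta> None"

lemma X_nth: "X $ j = plift (\<lambda>z. Y z $ None $ j) (lin al be)"
  by (simp add: X_def Yc_def)

lemma X_degree: "degree (X $ j) \<le> d0"
  unfolding X_nth by (rule form_line_degree(1)[OF formY])

lemma form_YX: "form (\<lambda>_. e) F \<Longrightarrow> form (\<lambda>_. e * d0) (\<lambda>z. F (v1 (Y z $ None)))"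
  using form_compose[where F = "\<lambda>z. v1 (Y z $ None)" and D = "\<lambda>_ _. d0" and d = "\<lambda>_. e" and P = F] formY
  by (simp add: UNIV_1)

lemma plift_Xc:
  assumes F: "form (\<lambda>_. e) F"
  shows "plift F Xc = plift (\<lambda>z. F (v1 (Y z $ None))) (lin al be)"
  by (rule plift_eqI[OF form_poly_fun[OF F]])
    (simp add: poly_plift[OF form_poly_fun[OF form_YX[OF F]]] cev_Xc cev_rows[symmetric] cev_Yc)

lemma Xc_degree:
  assumes F: "form (\<lambda>_. e) F"
  shows "degree (plift F Xc) \<le> e * d0" "coeff (plift F Xc) (e * d0) = F (v1 (Y be $ None))"
  unfolding plift_Xc[OF F] by (rule form_line_degree[OF form_YX[OF F]])+

text \<open>
The gradient of a form of degree \<open>D\<close> has degree \<open>D - 1\<close>, and the plane curve has degree \<open>d0\<close>.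
\<close>

lemma Nv_degree:
  assumes P: "form d P" and n: "Nv P $ j \<noteq> 0"
  shows "degree (Nv P $ j) + d0 \<le> (\<Sum>i\<in>UNIV. d i) * d0"
proof -
  let ?F = "\<lambda>z. P (hat p z)"
  have F: "form (\<lambda>_. \<Sum>i\<in>UNIV. d i) ?F" by (rule form_Ph[OF P])
  have N: "Nv P $ j = plift (grad ?F 1 j) Xc" by (simp add: Nv_def)
  have pg: "poly_fun (grad ?F 1 j)" by (rule grad_poly_fun[OF form_poly_fun[OF F]])
  show ?thesis
  proof (cases "\<Sum>i\<in>UNIV. d i")
    case 0
    have "form (\<lambda>_. 0) ?F" using F unfolding 0 .
    then have "plift (grad ?F 1 j) Xc = 0" by (intro plift_eqI[OF pg]) (simp add: grad_degree_0)
    then show ?thesis using n N by simp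
  next
    case (Suc e)
    have "form (\<lambda>_. Suc e) ?F" using F unfolding Suc .
    from form_grad[OF this] have "form (\<lambda>_. e) (grad ?F 1 j)" .
    from Xc_degree(1)[OF this] show ?thesis unfolding N Suc by simp
  qed
qed

lemma swapped: "blowup_line p C \<phi> \<psi> Y \<delta> be al"
proof unfold_locales
  show "det2 be al \<noteq> 0" using ind by (simp add: det2_swap[of be al])
qed (use V CV mor1 mor2 inv1 inv2 lift gp in auto)

text \<open>
The point at infinity, moved to the origin by exchanging \<open>al\<close> and \<open>be\<close>, is immersed by
\<open>K_nonzero\<close>. The point and the velocity there are the two top coefficients of \<open>X\<close>,
so \<open>coeff_wronskian_top\<close> gives \<open>K\<close> its full degree.
\<close>

lemma K_degree:
  assumes off: "\<And>i. crs (p i) (Y be $ None) \<noteq> 0"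
  obtains j where "K $ j \<noteq> 0" "2 * d0 \<le> degree (K $ j) + 2" "d0 \<ge> 1"
proof -
  interpret S: blowup_line p C \<phi> \<psi> Y \<delta> be al by (rule swapped)
  have SX0: "ev S.X 0 = Y be $ None"
    using S.cev_rows(1)[of 0] by (simp add: S.cev_Yc)
  have K0: "ev S.K 0 \<noteq> 0" by (rule S.K_nonzero) (simp add: SX0 off)
  have c0: "poly (S.X $ j) 0 = coeff (X $ j) d0" for j
    using form_line_reverse[OF formY, of None j be al 0] by (simp add: S.X_nth X_nth poly_0_coeff_0)
  have c1: "poly (pderiv (S.X $ j)) 0 = (if 1 \<le> d0 then coeff (X $ j) (d0 - 1) else 0)" for j
    using form_line_reverse[OF formY, of None j be al 1] by (simp add: S.X_nth X_nth poly_0_coeff_0 coeff_pderiv)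
  have d1: "d0 \<ge> 1"
  proof (rule ccontr)
    assume "\<not> d0 \<ge> 1"
    then have "ev (dv S.X) 0 = 0" by (simp add: vec_eq_iff c1)
    then show False using K0 by (simp add: S.K_def)
  qed
  define xd where "xd = (\<chi> j. coeff (X $ j) d0)"
  define xe where "xe = (\<chi> j. coeff (X $ j) (d0 - 1))"
  have "ev S.X 0 = xd" "ev (dv S.X) 0 = xe" using d1 by (simp_all add: vec_eq_iff xd_def xe_def c0 c1)
  then have "crs xd xe \<noteq> 0" using K0 by (simp add: S.K_def)
  then obtain j where j: "crs xd xe $ j \<noteq> 0" by (auto simp: vec_eq_iff)
  have cK: "coeff (K $ j) (2 * d0 - 2) = - crs xd xe $ j"
  proof -
    have w: "coeff (X $ i * dv X $ k - X $ k * dv X $ i) (2 * d0 - 2) = - (xd $ i * xe $ k - xd $ k * xe $ i)" for i k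
      using coeff_wronskian_top[OF X_degree[of i] X_degree[of k] d1] by (simp add: dv_def xd_def xe_def)
    show ?thesis using exhaust_3[of j] w[of 2 3] w[of 3 1] w[of 1 2] unfolding K_def by (elim disjE) (simp_all only: crs_nth)
  qed
  then have ne: "coeff (K $ j) (2 * d0 - 2) \<noteq> 0" using j by simp
  then have "K $ j \<noteq> 0" by auto
  moreover have "2 * d0 \<le> degree (K $ j) + 2" using le_degree[OF ne] by linarith
  ultimately show thesis using that d1 by blast
qed

text \<open>
The formula of \<open>local_order\<close> is summed over all parameters. By assumption the point at infinity is
neither on an exceptional curve over the \<open>p i\<close> nor a zero of \<open>Q\<close>, and the section has order zero
there, so no contribution is missed and \<open>Q\<close> attains its full degree.
\<close>

lemma degree_inequality:
  assumes nE: "\<And>i. crs (kc (p i)) X \<noteq> 0" and off: "\<And>i. crs (p i) (Y be $ None) \<noteq> 0"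
    and P: "form d P" "form d Q" and P0: "\<And>t. P (cev Yc t) = 0" and Qbe: "Q (Y be) \<noteq> 0"
    and n: "\<And>x. x \<in> C \<Longrightarrow> conormal_order (blowup4 p) C P Q x (n x)"
    and fin: "finite {x \<in> C. n x \<noteq> 0}" and sum: "(\<Sum>x | x \<in> C \<and> n x \<noteq> 0. n x) = 1"
    and nbe: "n (\<phi> (proj_class be)) = 0"
  shows "3 * d0 \<le> 1 + (\<Sum>i\<in>UNIV. degree (M i))" "d0 \<ge> 1"
proof -
  interpret S: blowup_line p C \<phi> \<psi> Y \<delta> be al by (rule swapped)
  let ?QX = "plift (\<lambda>z. Q (hat p z)) Xc" and ?D = "\<Sum>i\<in>UNIV. d i"
  obtain j where j: "K $ j \<noteq> 0" "2 * d0 \<le> degree (K $ j) + 2" and d1: "d0 \<ge> 1" using K_degree[OF off] .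
  show "d0 \<ge> 1" by (rule d1)
  have SX0: "ev S.X 0 = Y be $ None"
    using S.cev_rows(1)[of 0] by (simp add: S.cev_Yc)
  have SM0: "poly (S.M i) 0 \<noteq> 0" for i
    using off[of i] arg_cong[OF S.M[of i], of "\<lambda>A. ev A 0"] by (auto simp: SX0)
  have hatbe: "Q (hat p (v1 (Y be $ None))) \<noteq> 0"
  proof -
    have "hat p (v1 (Y be $ None)) = row_scale (\<lambda>i. case i of None \<Rightarrow> 1 | Some c \<Rightarrow> poly (S.M c) 0) (Y be)"
      using S.hat_X[of 0] by (simp add: SX0 S.cev_Yc)
    moreover have "\<forall>i. (case i of None \<Rightarrow> 1 | Some c \<Rightarrow> poly (S.M c) 0) \<noteq> 0"
      using SM0 by (auto split: option.split)
    ultimately show ?thesis using form_scale_eq_0[OF P(2)] Qbe by metis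
  qed
  note QXd = Xc_degree[OF form_Ph[OF P(2), of p]]
  have QX: "?QX \<noteq> 0" using QXd(2) hatbe by auto
  have QXdeg: "degree ?QX = ?D * d0"
    using QXd(1) le_degree[of ?QX "?D * d0"] QXd(2) hatbe by simp
  note lo = local_order[OF nE P P0 QX n[OF gam_in] j(1)]
  have Nj: "Nv P $ j \<noteq> 0" by (rule lo(1))
  have Mn: "M i \<noteq> 0" for i using nE[of i] M[of i] by auto
  define T1 where "T1 = {t. n (gam t) \<noteq> 0}"
  have img: "{x \<in> C. n x \<noteq> 0} = gam ` T1"
    using C_gam nbe gam_in by (auto simp: T1_def)
  have inj: "inj_on gam T1" using gam_inj by (auto simp: inj_on_def)
  have fT1: "finite T1" using fin unfolding img by (rule finite_imageD[OF _ inj])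
  define T where "T = T1 \<union> {t. poly (Nv P $ j) t = 0} \<union> {t. poly (K $ j) t = 0} \<union> {t. poly ?QX t = 0}
    \<union> (\<Union>i. {t. poly (M i) t = 0})"
  have fT: "finite T" unfolding T_def using fT1 poly_roots_finite[OF Nj] poly_roots_finite[OF j(1)]
      poly_roots_finite[OF QX] poly_roots_finite[OF Mn] by simp
  have so: "(\<Sum>t\<in>T. int (order t q)) = int (degree q)" if "q \<noteq> 0" "{t. poly q t = 0} \<subseteq> T" for q
    unfolding of_nat_sum[symmetric] by (simp only: sum_order_roots[OF that(1) fT that(2)])
  have sN: "(\<Sum>t\<in>T. int (order t (Nv P $ j))) = int (degree (Nv P $ j))"
    by (rule so[OF Nj]) (unfold T_def, blast)
  have sK: "(\<Sum>t\<in>T. int (order t (K $ j))) = int (degree (K $ j))"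
    by (rule so[OF j(1)]) (unfold T_def, blast)
  have sQ: "(\<Sum>t\<in>T. int (order t ?QX)) = int (degree ?QX)"
    by (rule so[OF QX]) (unfold T_def, blast)
  have sM: "(\<Sum>t\<in>T. int (order t (M i))) = int (degree (M i))" for i
    by (rule so[OF Mn]) (unfold T_def, blast)
  have "1 = (\<Sum>x\<in>gam ` T1. n x)" using sum unfolding img[symmetric] by simp
  also have "\<dots> = (\<Sum>t\<in>T1. n (gam t))" by (simp add: sum.reindex[OF inj])
  also have "\<dots> = (\<Sum>t\<in>T. n (gam t))"
    by (rule sum.mono_neutral_left[OF fT]) (auto simp: T_def T1_def)
  also have "\<dots> = (\<Sum>t\<in>T. int (order t (Nv P $ j)) + (\<Sum>i\<in>UNIV. int (order t (M i)))
    - int (order t (K $ j)) - int (order t ?QX))"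
    by (rule sum.cong[OF refl]) (rule lo(2))
  also have "\<dots> = int (degree (Nv P $ j)) + (\<Sum>i\<in>UNIV. int (degree (M i))) - int (degree (K $ j)) - int (degree ?QX)"
  proof -
    have "(\<Sum>t\<in>T. \<Sum>i\<in>UNIV. int (order t (M i))) = (\<Sum>i\<in>UNIV. int (degree (M i)))"
      by (subst sum.swap) (simp add: sM)
    then show ?thesis by (simp add: sum.distrib sum_subtractf sN sK sQ)
  qed
  finally have 1: "1 = int (degree (Nv P $ j)) + (\<Sum>i\<in>UNIV. int (degree (M i))) - int (degree (K $ j)) - int (degree ?QX)" .
  have "int (degree (Nv P $ j)) + int d0 \<le> int (?D * d0)" using Nv_degree[OF P(1) Nj] by linarith
  moreover have "(\<Sum>i\<in>UNIV. int (degree (M i))) = int (\<Sum>i\<in>UNIV. degree (M i))" by simp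
  ultimately show "3 * d0 \<le> 1 + (\<Sum>i\<in>UNIV. degree (M i))"
    using 1 j(2) unfolding QXdeg by linarith
qed

lemma in_Ecurve_if: "crs (kc (p i)) X = 0 \<Longrightarrow> C \<subseteq> Ecurve p i"
proof
  fix y assume z: "crs (kc (p i)) X = 0" and y: "y \<in> C"
  have "crs (p i) (ev X t) = 0" for t using arg_cong[OF z, of "\<lambda>A. ev A t"] by simp
  then have "crs (p i) (rep y $ None) $ j = 0" for j
    by (intro vanishing_on_C[OF form_crs_const _ y]) (simp add: cev_rows)
  then show "y \<in> Ecurve p i" using y CV by (auto simp: Ecurve_def vec_eq_iff)
qed

lemma in_Lcurve_if:
  assumes "dot (L a) (kc (p b)) = 0" "dot (L b) (kc (p a)) = 0"
  shows "C \<subseteq> Lcurve p a b"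
proof
  fix y assume y: "y \<in> C"
  have "dot (ev (L a) t) (p b) = 0" "dot (ev (L b) t) (p a) = 0" for t
    using arg_cong[OF assms(1), of "\<lambda>q. poly q t"] arg_cong[OF assms(2), of "\<lambda>q. poly q t"] by simp_all
  then have "dot (rep y $ Some a) (p b) = 0" "dot (rep y $ Some b) (p a) = 0"
    by (intro vanishing_on_C[OF form_dot _ y]; simp add: cev_rows)+
  then show "y \<in> Lcurve p a b" using y CV by (auto simp: Lcurve_def)
qed

text \<open>
Bezout for the line joining \<open>p a\<close> and \<open>p b\<close>: evaluated along the plane curve, its equation has degree
at most \<open>d0\<close> and is divisible by \<open>M a\<close> and by \<open>M b\<close>, which have no common zero.
\<close>

lemma pair_inequality:
  assumes nE: "\<And>i. crs (kc (p i)) X \<noteq> 0" and nL: "\<not> C \<subseteq> Lcurve p a b" and ab: "a \<noteq> b"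
  shows "degree (M a) + degree (M b) \<le> d0"
proof -
  have Mn: "M i \<noteq> 0" for i using nE[of i] M[of i] by auto
  define \<Lambda> where "\<Lambda> = dot (crs (kc (p a)) X) (kc (p b))"
  have La: "\<Lambda> = M a * dot (L a) (kc (p b))" by (simp add: \<Lambda>_def M)
  have "\<Lambda> = - dot (crs (kc (p b)) X) (kc (p a))"
    unfolding \<Lambda>_def dot_crs_det by (simp add: det3_def dot_def crs_nth algebra_simps)
  then have Lb: "\<Lambda> = M b * (- dot (L b) (kc (p a)))" by (simp add: M)
  have Ln: "\<Lambda> \<noteq> 0"
  proof
    assume "\<Lambda> = 0"
    then have "dot (L a) (kc (p b)) = 0" "dot (L b) (kc (p a)) = 0" using La Lb Mn[of a] Mn[of b] by simp_all
    with in_Lcurve_if nL show False by blast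
  qed
  have "degree \<Lambda> \<le> d0"
  proof -
    have "\<Lambda> = dot (crs (kc (p b)) (kc (p a))) X"
      
    proof -
      have "det3 (kc (p a)) X (kc (p b)) = - det3 (kc (p a)) (kc (p b)) X" by (rule det3_perm(2))
      moreover have "det3 (kc (p b)) (kc (p a)) X = - det3 (kc (p a)) (kc (p b)) X" by (rule det3_perm(1))
      ultimately show ?thesis unfolding \<Lambda>_def dot_crs_det by simp
    qed
    also have "crs (kc (p b)) (kc (p a)) = kc (crs (p b) (p a))"
      by (rule ev_eqI) simp
    finally have "\<Lambda> = smult (crs (p b) (p a) $ 1) (X $ 1) + smult (crs (p b) (p a) $ 2) (X $ 2) + smult (crs (p b) (p a) $ 3) (X $ 3)"
      by (simp add: dot_def)
    then show ?thesis
      using X_degree degree_smult_le by (auto intro!: degree_add_le intro: order_trans)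
  qed
  define T where "T = {t. poly \<Lambda> t = 0} \<union> {t. poly (M a) t = 0} \<union> {t. poly (M b) t = 0}"
  have fT: "finite T" unfolding T_def using poly_roots_finite[OF Ln] poly_roots_finite[OF Mn] by simp
  have "degree (M a) + degree (M b) = (\<Sum>t\<in>T. order t (M a)) + (\<Sum>t\<in>T. order t (M b))"
  proof -
    have "(\<Sum>t\<in>T. order t (M a)) = degree (M a)" by (rule sum_order_roots[OF Mn fT]) (unfold T_def, blast)
    moreover have "(\<Sum>t\<in>T. order t (M b)) = degree (M b)" by (rule sum_order_roots[OF Mn fT]) (unfold T_def, blast)
    ultimately show ?thesis by simp
  qed
  also have "\<dots> = (\<Sum>t\<in>T. order t (M a) + order t (M b))" by (simp add: sum.distrib)
  also have "\<dots> \<le> (\<Sum>t\<in>T. order t \<Lambda>)"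
  proof (rule sum_mono)
    fix t
    have oa: "order t (M a) \<le> order t \<Lambda>"
      unfolding La using Polynomial.order_mult[of "M a" "dot (L a) (kc (p b))" t] Ln La by simp
    have ob: "order t (M b) \<le> order t \<Lambda>"
      unfolding Lb using Polynomial.order_mult[of "M b" "- dot (L b) (kc (p a))" t] Ln Lb by simp
    show "order t (M a) + order t (M b) \<le> order t \<Lambda>"
    proof (cases "poly (M a) t = 0")
      case False
      then show ?thesis using ob by (simp add: order_0I)
    next
      case True
      then have "crs (p a) (ev X t) = 0" using arg_cong[OF M[of a], of "\<lambda>A. ev A t"] by simp
      then obtain k where k: "k \<noteq> 0" "ev X t = k *s p a" using crs_gp_eq_0[OF gp _ X_nonzero] by blast
      have "poly (M b) t \<noteq> 0"
      proof
        assume "poly (M b) t = 0"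
        then have "crs (p b) (ev X t) = 0" using arg_cong[OF M[of b], of "\<lambda>A. ev A t"] by simp
        then show False using k gp_crs[OF gp, of b a] ab by simp
      qed
      then show ?thesis using oa by (simp add: order_0I)
    qed
  qed
  also have "\<dots> = degree \<Lambda>" by (rule sum_order_roots[OF Ln fT]) (auto simp: T_def)
  finally show ?thesis using \<open>degree \<Lambda> \<le> d0\<close> by linarith
qed

text \<open>
The numerator vanishes on the curve near one point, hence on all of it.
\<close>

lemma conormal_section_vanishes:
  assumes "conormal_section (blowup4 p) C P Q"
  obtains d where "form d P" "form d Q" "\<And>t. P (cev Yc t) = 0" "plift Q Yc \<noteq> 0"
proof -
  obtain d x where d: "form d P" "form d Q" and x: "x \<in> C" "Q (rep x) \<noteq> 0" "local_equation (blowup4 p) C x (ratio P Q)"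
    using assms unfolding conormal_section_def by blast
  have "near (blowup4 p) x (\<lambda>y. y \<in> C \<longrightarrow> ratio P Q y = 0)"
    using x(3) unfolding local_equation_def curve_ideal_def by blast
  then obtain e S where S: "form e S" "S (rep x) \<noteq> 0"
    "\<forall>y\<in>blowup4 p. S (rep y) \<noteq> 0 \<longrightarrow> y \<in> C \<longrightarrow> ratio P Q y = 0" unfolding near_def by blast
  note pf = form_poly_fun[OF d(1)] form_poly_fun[OF d(2)] form_poly_fun[OF S(1)]
  have nz: "plift F Yc \<noteq> 0" if F: "form f F" "F (rep x) \<noteq> 0" for F f
  proof
    assume "plift F Yc = 0"
    then have "F (cev Yc t) = 0" for t using poly_plift[OF form_poly_fun[OF F(1)], of Yc t] by simp
    then have "F (rep x) = 0" by (intro vanishing_on_C[OF F(1) _ x(1)]) simp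
    with F(2) show False by simp
  qed
  have "plift S Yc * (plift Q Yc * plift P Yc) = 0"
  proof (rule poly_eqI_all)
    fix t
    have "S (cev Yc t) \<noteq> 0 \<Longrightarrow> Q (cev Yc t) \<noteq> 0 \<Longrightarrow> P (cev Yc t) = 0"
    proof -
      assume a: "S (cev Yc t) \<noteq> 0" "Q (cev Yc t) \<noteq> 0"
      have "ratio P Q (gam t) = 0"
        using S(3) gam_in[of t] gam_inV[of t] a(1) by (auto simp: gam_Yc form_rep_eq_0[OF S(1)])
      then show "P (cev Yc t) = 0" using a(2) by (simp add: gam_Yc ratio_proj_class[OF d])
    qed
    then show "poly (plift S Yc * (plift Q Yc * plift P Yc)) t = poly 0 t"
      by (auto simp: poly_plift[OF pf(1)] poly_plift[OF pf(2)] poly_plift[OF pf(3)])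
  qed
  then have "plift P Yc = 0" using nz[OF S(1,2)] nz[OF d(2) x(2)] by simp
  then have "P (cev Yc t) = 0" for t using poly_plift[OF pf(1), of Yc t] by simp
  with d nz[OF d(2) x(2)] show thesis using that by blast
qed

end

lemma curve_on_subset:
  assumes "curve_on V C" "curve_on V D" "C \<subseteq> D"
  shows "C = D"
proof (rule ccontr)
  assume "C \<noteq> D"
  then have "C \<subset> D" using assms(3) by blast
  moreover obtain Z where "irreducible_closed V Z" "Z \<subset> C" using assms(1) unfolding curve_on_def by blast
  moreover have "irreducible_closed V C" using assms(1) unfolding curve_on_def by blast
  ultimately show False using assms(2) unfolding curve_on_def by blast
qed

text \<open>
Summing over two complementary pairs, \<open>3 * d \<le> 1 + 2 * d\<close>, so \<open>d = 1\<close> and all pairs have the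
sum \<open>1\<close>, which is impossible for three integers.
\<close>

lemma numerical_contradiction:
  fixes m :: "4 \<Rightarrow> nat"
  assumes "\<And>a b. a \<noteq> b \<Longrightarrow> m a + m b \<le> d" "3 * d \<le> 1 + (\<Sum>i\<in>UNIV. m i)" "d \<ge> 1"
  shows False
proof -
  have s: "(\<Sum>i\<in>UNIV. m i) = m 1 + m 2 + m 3 + m 4" by (simp add: sum_4)
  have "m 1 + m 2 \<le> d" "m 3 + m 4 \<le> d" "m 1 + m 3 \<le> d" "m 1 + m 4 \<le> d" "m 2 + m 3 \<le> d" "m 2 + m 4 \<le> d"
    by (intro assms(1); simp)+
  note pairs = this
  have "m 1 + m 2 + m 3 + m 4 \<le> 2 * d" using pairs by linarith
  moreover have "3 * d \<le> 1 + (m 1 + m 2 + m 3 + m 4)" using assms(2) unfolding s .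
  ultimately have d: "d = 1" "m 1 + m 2 + m 3 + m 4 \<ge> 2" using assms(3) by linarith+
  then have "m 1 + m 2 = 1" "m 3 + m 4 = 1" "m 1 + m 3 = 1" "m 1 + m 4 = 1" "m 2 + m 3 = 1" using pairs by linarith+
  then have "2 * m 1 = 1" by linarith
  then show False by presburger
qed

section \<open>Classification of the exceptional curves\<close>

text \<open>
A curve that is none of the ten is contained in none of them, since curves contain no smaller curves.
This is what \<open>degree_inequality\<close> and \<open>pair_inequality\<close> assume.
\<close>

theorem exceptional_curve_cases:
  fixes p :: "4 \<Rightarrow> 'k::alg_closed_field^3"
  assumes gp: "general_points p" and C: "C \<in> exceptional_curves (blowup4 p)"
  shows "(\<exists>i. C = Ecurve p i) \<or> (\<exists>a b. a \<noteq> b \<and> C = Lcurve p a b)"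
proof (rule ccontr)
  assume not: "\<not> ?thesis"
  have curve: "curve_on (blowup4 p) C" and iso: "isomorphic_varieties projective_line C"
    and self: "has_self_intersection (blowup4 p) C (- 1)"
    using C unfolding exceptional_curves_def mem_Collect_eq by simp_all
  have n1: "C \<noteq> Ecurve p i" for i
  proof
    assume "C = Ecurve p i"
    then have "\<exists>i. C = Ecurve p i" by (rule exI)
    from not disjI1[OF this] show False by (rule notE)
  qed
  have n2: "C \<noteq> Lcurve p a b" if "a \<noteq> b" for a b
  proof
    assume "C = Lcurve p a b"
    with that have "\<exists>a b. a \<noteq> b \<and> C = Lcurve p a b" by (intro exI conjI)
    from not disjI2[OF this] show False by (rule notE)
  qed
  have nE: "\<not> C \<subseteq> Ecurve p i" for i
  proof
    assume "C \<subseteq> Ecurve p i"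
    from n1 curve_on_subset[OF curve Ecurve_rational(1)[OF gp] this] show False by (rule notE)
  qed
  have nL: "\<not> C \<subseteq> Lcurve p a b" if "a \<noteq> b" for a b
  proof
    assume "C \<subseteq> Lcurve p a b"
    from n2[OF that] curve_on_subset[OF curve Lcurve_rational(1)[OF gp that] this] show False by (rule notE)
  qed
  have CV: "C \<subseteq> blowup4 p"
  proof -
    have "zclosed (blowup4 p) C" using curve unfolding curve_on_def irreducible_closed_def by (elim conjE)
    then show ?thesis by (rule zclosed_subset)
  qed
  obtain \<phi> \<psi> where iso': "morphism projective_line C \<phi> \<and> morphism C projective_line \<psi> \<and>
      (\<forall>x\<in>projective_line. \<psi> (\<phi> x) = x) \<and> (\<forall>y\<in>C. \<phi> (\<psi> y) = y)"
    using iso unfolding isomorphic_varieties_def by (elim exE) (rule that)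
  have mor: "morphism projective_line C \<phi>" "morphism C projective_line \<psi>"
    using iso'[THEN conjunct1] iso'[THEN conjunct2, THEN conjunct1] .
  have inv: "\<psi> (\<phi> x) = x" if "x \<in> projective_line" for x using iso'[THEN conjunct2, THEN conjunct2, THEN conjunct1] that by (rule bspec)
  have inv': "\<phi> (\<psi> y) = y" if "y \<in> C" for y using iso'[THEN conjunct2, THEN conjunct2, THEN conjunct2] that by (rule bspec)
  have VM: "C \<subseteq> multiproj" using CV blowup4_multiproj by (rule order_trans)
  obtain Y \<delta> where lift: "lift_of \<phi> Y \<delta>" using lift_ex[OF mor(1) VM] by (elim exE) (rule that)
  have loc: "blowup_line p C \<phi> \<psi> Y \<delta> al be" if "det2 al be \<noteq> 0" for al be
    by (unfold_locales; (rule blowup4_multiproj CV mor inv inv' lift that gp; assumption?))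
  obtain P Q n where sec: "conormal_section (blowup4 p) C P Q"
    and n: "\<And>x. x \<in> C \<Longrightarrow> conormal_order (blowup4 p) C P Q x (n x)"
    and fin: "finite {x \<in> C. n x \<noteq> 0}" and sum: "(\<Sum>x | x \<in> C \<and> n x \<noteq> 0. n x) = 1"
  proof -
    from self obtain P Q n where "conormal_section (blowup4 p) C P Q \<and> (\<forall>x\<in>C. conormal_order (blowup4 p) C P Q x (n x)) \<and>
        finite {x \<in> C. n x \<noteq> 0} \<and> - 1 = - (\<Sum>x | x \<in> C \<and> n x \<noteq> 0. n x)"
      unfolding has_self_intersection_def by (elim exE) (rule that)
    then show thesis by (intro that[of P Q n]) simp_all
  qed
  \<comment> \<open>the point at infinity must avoid every zero counted below, so that all of them have a finite parameter\<close>
  define e1 :: "'k^2^1" where "e1 = (\<chi> i j. if j = 1 then 1 else 0)"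
  define e2 :: "'k^2^1" where "e2 = (\<chi> i j. if j = 2 then 1 else 0)"
  have ind: "det2 e1 e2 \<noteq> 0" by (simp add: det2_def e1_def e2_def)
  obtain be where be: "be $ 1 \<noteq> 0" "\<And>i. crs (p i) (Y be $ None) \<noteq> 0" "Q (Y be) \<noteq> 0" "n (\<phi> (proj_class be)) = 0"
  proof -
    interpret A: blowup_line p C \<phi> \<psi> Y \<delta> e1 e2 by (rule loc[OF ind])
    obtain d where d: "form d Q" "plift Q A.Yc \<noteq> 0" using A.conormal_section_vanishes[OF sec] by blast
    have "finite (A.gam ` {t. n (A.gam t) \<noteq> 0})"
      by (rule finite_subset[OF _ fin]) (use A.gam_in in auto)
    moreover have "inj_on A.gam {t. n (A.gam t) \<noteq> 0}" using A.gam_inj by (auto simp: inj_on_def)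
    ultimately have "finite {t. n (A.gam t) \<noteq> 0}" by (rule finite_imageD)
    then have c1: "\<forall>\<^sub>\<infinity>t. n (A.gam t) = 0" by (simp add: eventually_cofinite)
    have c2: "\<forall>\<^sub>\<infinity>t. poly (plift Q A.Yc) t \<noteq> 0" by (rule poly_nonzero_cofinite[OF d(2)])
    have c3: "\<forall>\<^sub>\<infinity>t. \<forall>i\<in>UNIV. crs (p i) (ev A.X t) \<noteq> 0"
    proof (rule eventually_ball_finite, simp, rule ballI)
      fix i
      have "crs (kc (p i)) A.X \<noteq> 0" using A.in_Ecurve_if nE by blast
      then obtain j where "crs (kc (p i)) A.X $ j \<noteq> 0" by (auto simp: vec_eq_iff)
      from poly_nonzero_cofinite[OF this] show "\<forall>\<^sub>\<infinity>t. crs (p i) (ev A.X t) \<noteq> 0"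
      proof (rule eventually_mono)
        fix t assume "poly (crs (kc (p i)) A.X $ j) t \<noteq> 0"
        then have "ev (crs (kc (p i)) A.X) t \<noteq> 0" by (auto simp: vec_eq_iff simp del: ev_crs)
        then show "crs (p i) (ev A.X t) \<noteq> 0" by simp
      qed
    qed
    have "\<exists>t. n (A.gam t) = 0 \<and> poly (plift Q A.Yc) t \<noteq> 0 \<and> (\<forall>i\<in>UNIV. crs (p i) (ev A.X t) \<noteq> 0)"
      using c1 c2 c3 by (intro cofinite_ex eventually_conj)
    then obtain t where t: "n (A.gam t) = 0" "poly (plift Q A.Yc) t \<noteq> 0" "\<And>i. crs (p i) (ev A.X t) \<noteq> 0" by blast
    show thesis
    proof (rule that[of "pl e1 e2 t"])
      show "pl e1 e2 t $ 1 \<noteq> 0" by (rule pl_nonzero[OF ind])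
      show "crs (p i) (Y (pl e1 e2 t) $ None) \<noteq> 0" for i
        using t(3) A.cev_rows(1)[of t] by (simp add: A.cev_Yc)
      show "Q (Y (pl e1 e2 t)) \<noteq> 0" using t(2) by (simp add: poly_plift[OF form_poly_fun[OF d(1)]] A.cev_Yc)
      show "n (\<phi> (proj_class (pl e1 e2 t))) = 0" using t(1) by (simp add: A.gam_def)
    qed
  qed
  obtain al where al: "det2 al be \<noteq> 0" using ex_independent[OF be(1)] .
  interpret A: blowup_line p C \<phi> \<psi> Y \<delta> al be by (rule loc[OF al])
  obtain d where d: "form d P" "form d Q" "\<And>t. P (cev A.Yc t) = 0" using A.conormal_section_vanishes[OF sec] by blast
  have nE': "crs (kc (p i)) A.X \<noteq> 0" for i using A.in_Ecurve_if nE by blast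
  note ineq = A.degree_inequality[OF nE' be(2) d be(3) n fin sum be(4)]
  show False
    by (rule numerical_contradiction[OF _ ineq]) (rule A.pair_inequality[OF nE' nL])
qed

section \<open>The intersection graph and its maximum cut\<close>

lemma Lcurve_meets_Ecurve:
  fixes p :: "4 \<Rightarrow> 'k::alg_closed_field^3"
  assumes "general_points p" "a \<noteq> c"
  shows "Ecurve p c \<inter> Lcurve p a c \<noteq> {}"
  using ELpoint_in[OF assms] by blast

text \<open>
  A curve of the configuration is recognized by the set of those \<open>Ecurve p e\<close> that it meets: this
  is \<open>{c}\<close> for \<open>Ecurve p c\<close> and \<open>{a, b}\<close> for \<open>Lcurve p a b\<close>.
\<close>

lemma Ecurve_neq:
  fixes p :: "4 \<Rightarrow> 'k::alg_closed_field^3"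
  assumes gp: "general_points p" and "c \<noteq> e"
  shows "Ecurve p c \<noteq> Ecurve p e"
  using Ecurve_disjoint[OF gp \<open>c \<noteq> e\<close>] Lcurve_meets_Ecurve[OF gp \<open>c \<noteq> e\<close>[symmetric]] by auto

lemma Lcurve_neq:
  fixes p :: "4 \<Rightarrow> 'k::alg_closed_field^3"
  assumes gp: "general_points p" and "a \<noteq> b" "c \<noteq> d" "b \<noteq> c" "b \<noteq> d"
  shows "Lcurve p a b \<noteq> Lcurve p c d"
  using Lcurve_meets_Ecurve[OF gp \<open>a \<noteq> b\<close>] Ecurve_Lcurve_disjoint[OF gp \<open>c \<noteq> d\<close>, of b] assms by auto

lemma Ecurve_neq_Lcurve:
  fixes p :: "4 \<Rightarrow> 'k::alg_closed_field^3"
  assumes gp: "general_points p" and "a \<noteq> b"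
  shows "Ecurve p c \<noteq> Lcurve p a b"
proof (cases "b = c")
  case False
  then show ?thesis using Lcurve_meets_Ecurve[OF gp \<open>a \<noteq> b\<close>] Ecurve_disjoint[OF gp False] by auto
next
  case True
  then have "a \<noteq> c" using \<open>a \<noteq> b\<close> by simp
  then show ?thesis
    using Lcurve_meets_Ecurve[OF gp \<open>a \<noteq> b\<close>[symmetric]] Ecurve_disjoint[OF gp \<open>a \<noteq> c\<close>] Lcurve_commute[of p a b] by auto
qed

definition curve_list :: "(4 \<Rightarrow> 'k::field^3) \<Rightarrow> ('k, 3, 4 option) mpoint set list" where
  "curve_list p = [Ecurve p 1, Ecurve p 2, Ecurve p 3, Ecurve p 4,
     Lcurve p 1 2, Lcurve p 1 3, Lcurve p 1 4, Lcurve p 2 3, Lcurve p 2 4, Lcurve p 3 4]"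

lemma exceptional_curves_eq:
  fixes p :: "4 \<Rightarrow> 'k::alg_closed_field^3"
  assumes gp: "general_points p"
  shows "exceptional_curves (blowup4 p) = set (curve_list p)"
proof
  have "Ecurve p i \<in> set (curve_list p)" for i
    using exhaust_4[of i] by (auto simp: curve_list_def)
  moreover have "Lcurve p a b \<in> set (curve_list p)" if "a \<noteq> b" for a b
    using exhaust_4[of a] exhaust_4[of b] that Lcurve_commute[of p 2 1] Lcurve_commute[of p 3 1]
      Lcurve_commute[of p 4 1] Lcurve_commute[of p 3 2] Lcurve_commute[of p 4 2] Lcurve_commute[of p 4 3]
    unfolding curve_list_def by (elim disjE) simp_all
  ultimately show "exceptional_curves (blowup4 p) \<subseteq> set (curve_list p)"
    using exceptional_curve_cases[OF gp] by blast
  show "set (curve_list p) \<subseteq> exceptional_curves (blowup4 p)"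
    by (simp add: curve_list_def Ecurve_exceptional[OF gp] Lcurve_exceptional[OF gp])
qed

lemma distinct_curve_list:
  fixes p :: "4 \<Rightarrow> 'k::alg_closed_field^3"
  assumes gp: "general_points p"
  shows "distinct (curve_list p)"
proof -
  have "Lcurve p a b \<noteq> Lcurve p c d" if "a \<noteq> b" "c \<noteq> d" "a \<noteq> c" "a \<noteq> d" for a b c d
    using Lcurve_neq[OF gp, of b a c d] that Lcurve_commute[of p a b] by auto
  then show ?thesis
    by (simp add: curve_list_def Ecurve_neq[OF gp] Ecurve_neq_Lcurve[OF gp] Lcurve_neq[OF gp])
qed

lemma intersection_table:
  fixes p :: "4 \<Rightarrow> 'k::alg_closed_field^3"
  assumes gp: "general_points p"
  defines "I \<equiv> intersection_number (blowup4 p)"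
  shows "c \<noteq> e \<Longrightarrow> I (Ecurve p c) (Ecurve p e) = 0"
    "a \<noteq> b \<Longrightarrow> I (Ecurve p c) (Lcurve p a b) = (if c = a \<or> c = b then 1 else 0)"
    "a \<noteq> b \<Longrightarrow> I (Lcurve p a b) (Ecurve p c) = (if c = a \<or> c = b then 1 else 0)"
    "a \<noteq> b \<Longrightarrow> c \<noteq> d \<Longrightarrow> {a, b} \<noteq> {c, d} \<Longrightarrow>
       I (Lcurve p a b) (Lcurve p c d) = (if a = c \<or> a = d \<or> b = c \<or> b = d then 0 else 1)"
proof -
  show "I (Ecurve p c) (Ecurve p e) = 0" if "c \<noteq> e"
    unfolding I_def using intersection_number_disjoint[OF Ecurve_disjoint[OF gp that]] .
  show EL: "I (Ecurve p c) (Lcurve p a b) = (if c = a \<or> c = b then 1 else 0)" if "a \<noteq> b"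
  proof -
    consider "c = a" | "c = b" | "c \<noteq> a" "c \<noteq> b" by blast
    then show ?thesis
    proof cases
      case 1
      then show ?thesis using intersection_number_EL[OF gp, of b a] that Lcurve_commute[of p a b] by (simp add: I_def)
    next
      case 2
      then show ?thesis using intersection_number_EL[OF gp, of a b] that by (simp add: I_def)
    next
      case 3
      then show ?thesis using intersection_number_disjoint[OF Ecurve_Lcurve_disjoint[OF gp that, of c]] by (simp add: I_def)
    qed
  qed
  show "I (Lcurve p a b) (Ecurve p c) = (if c = a \<or> c = b then 1 else 0)" if "a \<noteq> b"
    unfolding I_def intersection_number_commute[of _ "Lcurve p a b"] using EL[OF that] by (simp add: I_def)
  have share: "I (Lcurve p a b) (Lcurve p a c) = 0" if "a \<noteq> b" "a \<noteq> c" "b \<noteq> c" for a b c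
    unfolding I_def using intersection_number_disjoint[OF Lcurve_disjoint[OF gp that]] .
  assume ab: "a \<noteq> b" and cd: "c \<noteq> d" and ne: "{a, b} \<noteq> {c, d}"
  consider "a = c" | "a = d" | "b = c" | "b = d" | "a \<noteq> c" "a \<noteq> d" "b \<noteq> c" "b \<noteq> d" by blast
  then show "I (Lcurve p a b) (Lcurve p c d) = (if a = c \<or> a = d \<or> b = c \<or> b = d then 0 else 1)"
  proof cases
    case 1
    then have "b \<noteq> d" using ne by blast
    then show ?thesis using share[of a b d] 1 ab cd by simp
  next
    case 2
    then have "b \<noteq> c" using ne by blast
    then show ?thesis using share[of a b c] 2 ab cd Lcurve_commute[of p a c] by simp
  next
    case 3
    then have "a \<noteq> d" using ne by blast
    then show ?thesis using share[of b a d] 3 ab cd Lcurve_commute[of p a b] by simp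
  next
    case 4
    then have "a \<noteq> c" using ne by blast
    then show ?thesis using share[of b a c] 4 ab cd Lcurve_commute[of p a b] Lcurve_commute[of p c b] by simp
  next
    case 5
    then show ?thesis using intersection_number_LL[OF gp ab 5(1,2) 5(3,4) cd] by (simp add: I_def)
  qed
qed

definition separated :: "'a set \<Rightarrow> 'a \<Rightarrow> 'a \<Rightarrow> nat" where
  "separated S U V = (if U \<in> S \<longleftrightarrow> V \<in> S then 0 else 1)"

text \<open>The boundary of a set of vertices of a cycle has even size.\<close>

lemma five_cycle:
  "separated S a b + separated S b c + separated S c d + separated S d e + separated S e a \<le> 4"
  by (simp add: separated_def)

lemma cut_value_eq:
  fixes p :: "4 \<Rightarrow> 'k::alg_closed_field^3"
  assumes gp: "general_points p" and S: "S \<subseteq> set (curve_list p)"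
  shows "cut_value (blowup4 p) S =
    separated S (Ecurve p 1) (Lcurve p 1 2) + separated S (Ecurve p 1) (Lcurve p 1 3) + separated S (Ecurve p 1) (Lcurve p 1 4)
  + separated S (Ecurve p 2) (Lcurve p 1 2) + separated S (Ecurve p 2) (Lcurve p 2 3) + separated S (Ecurve p 2) (Lcurve p 2 4)
  + separated S (Ecurve p 3) (Lcurve p 1 3) + separated S (Ecurve p 3) (Lcurve p 2 3) + separated S (Ecurve p 3) (Lcurve p 3 4)
  + separated S (Ecurve p 4) (Lcurve p 1 4) + separated S (Ecurve p 4) (Lcurve p 2 4) + separated S (Ecurve p 4) (Lcurve p 3 4)
  + separated S (Lcurve p 1 2) (Lcurve p 3 4) + separated S (Lcurve p 1 3) (Lcurve p 2 4) + separated S (Lcurve p 1 4) (Lcurve p 2 3)"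
proof -
  let ?A = "set (curve_list p)" and ?I = "intersection_number (blowup4 p)"
  define t :: "('k, 3, 4 option) mpoint set \<Rightarrow> ('k, 3, 4 option) mpoint set \<Rightarrow> nat"
    where "t U V = (if U \<in> S \<and> V \<notin> S then 1 else 0)" for U V
  have inner: "(\<Sum>V\<in>?A - S. ?I U V) = (\<Sum>V\<in>?A. if V \<notin> S then ?I U V else 0)" for U
    by (rule sum.mono_neutral_cong_left) auto
  have outer: "(\<Sum>U\<in>S. h U) = (\<Sum>U\<in>?A. if U \<in> S then h U else 0)" for h :: "_ \<Rightarrow> nat"
    by (rule sum.mono_neutral_cong_left) (use S in auto)
  have "cut_value (blowup4 p) S = (\<Sum>U\<in>?A. \<Sum>V\<in>?A. t U V * ?I U V)"
    unfolding cut_value_def exceptional_curves_eq[OF gp] inner outer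
    by (intro sum.cong refl) (auto simp: t_def intro!: sum.cong)
  also have "\<dots> = sum_list (map (\<lambda>U. sum_list (map (\<lambda>V. t U V * ?I U V) (curve_list p))) (curve_list p))"
    by (simp only: sum.distinct_set_conv_list[OF distinct_curve_list[OF gp]])
  finally have c: "cut_value (blowup4 p) S = \<dots>" .
  have t0: "t U U = 0" for U by (simp add: t_def)
  have st: "separated S U V = t U V + t V U" for U V by (auto simp: t_def separated_def)
  show ?thesis
    unfolding c st by (simp add: curve_list_def intersection_table[OF gp] t0 doubleton_eq_iff)
qed

theorem mainTheorem1:
  fixes p :: "4 \<Rightarrow> 'k::alg_closed_field^3"
  assumes "general_points p"
  shows "card (exceptional_curves (blowup4 p)) = 10 \<and>
    Max (cut_value (blowup4 p) ` {S. S \<subseteq> exceptional_curves (blowup4 p)}) = 12"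
proof
  note gp = assms
  show "card (exceptional_curves (blowup4 p)) = 10"
    unfolding exceptional_curves_eq[OF gp] distinct_card[OF distinct_curve_list[OF gp]] by (simp add: curve_list_def)
  show "Max (cut_value (blowup4 p) ` {S. S \<subseteq> exceptional_curves (blowup4 p)}) = 12"
    unfolding exceptional_curves_eq[OF gp]
  proof (rule Max_eqI)
    show "finite (cut_value (blowup4 p) ` {S. S \<subseteq> set (curve_list p)})" by simp
    fix n assume "n \<in> cut_value (blowup4 p) ` {S. S \<subseteq> set (curve_list p)}"
    then obtain S where S: "S \<subseteq> set (curve_list p)" and n: "n = cut_value (blowup4 p) S" by blast
    have comm: "separated S U V = separated S V U" for U V by (auto simp: separated_def)
    let ?E = "Ecurve p" and ?L = "Lcurve p"
    \<comment> \<open>these six cycles of the Petersen graph contain each of its 15 edges twice\<close>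
    show "n \<le> 12"
      using five_cycle[of S "?E 2" "?L 1 2" "?E 1" "?L 1 3" "?L 2 4"]
        five_cycle[of S "?L 1 2" "?L 3 4" "?E 4" "?L 1 4" "?E 1"]
        five_cycle[of S "?L 2 4" "?E 4" "?L 1 4" "?L 2 3" "?E 2"]
        five_cycle[of S "?E 1" "?L 1 4" "?L 2 3" "?E 3" "?L 1 3"]
        five_cycle[of S "?L 1 2" "?L 3 4" "?E 3" "?L 2 3" "?E 2"]
        five_cycle[of S "?L 2 4" "?E 4" "?L 3 4" "?E 3" "?L 1 3"]
      unfolding n cut_value_eq[OF gp S] comm[of "Lcurve p _ _" "Ecurve p _"] comm[of "?L 2 4" "?L 1 3"] comm[of "?L 2 3" "?L 1 4"]
      by linarith
  next
    let ?S = "{Ecurve p 1, Ecurve p 2, Ecurve p 3, Ecurve p 4}"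
    have S: "?S \<subseteq> set (curve_list p)" by (simp add: curve_list_def)
    have "Ecurve p c \<in> ?S" for c using exhaust_4[of c] by auto
    moreover have "Lcurve p a b \<notin> ?S" if "a \<noteq> b" for a b
      using Ecurve_neq_Lcurve[OF gp that] by auto
    ultimately have "cut_value (blowup4 p) ?S = 12"
      unfolding cut_value_eq[OF gp S] separated_def by simp
    then show "12 \<in> cut_value (blowup4 p) ` {S. S \<subseteq> set (curve_list p)}" using S by (metis (mono_tags, lifting) image_eqI mem_Collect_eq)
  qed
qed

end
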